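(* Let $n\ge 4$ and let $T$ be a triangulation of an $n$-gon with $d$ inner triangles, whose $n-3$ diagonals (with assigned lengths) define, after fixing for each diagonal one of the three interpretations (dual, neighboring, intersecting), tropical cross-ratios $C_1,\dots,C_{n-3}$ in general position. Let $k$ be the number of inner triangles of $T$ for which all three cross-ratios given by its three sides are interpreted in the neighboring way and which fulfill the triangle inequalities. Then $\pi_{\mathcal U(T)}^{-1}(C_1,\dots,C_{n-3})$ consists of exactly $2^{d-k}$ tropical curves, they are of pairwise different combinatorial types, and each has multiplicity $2^k$. In particular $d_{\mathcal U(T)}=2^d$.
   Context: Tropical curves. For a finite set $A$ with $|A|\ge 3$, an $A$-marked (abstract rational) tropical curve is a finite tree without two-valent vertices having exactly $|A|$ one-valent vertices; the edges at one-valent vertices are called ends, have length $\infty$ and are marked bijectively by $A$; all other edges (bounded edges) have a length in $\mathbb R_{>0}$. The vertices that are not one-valent are called inner vertices. Curves are taken up to isomorphism preserving lengths and markings; $M_{0,A}^{\mathrm{trop}}$ is the space of isomorphism classes. The combinatorial type is obtained by forgetting lengths; curves of a fixed type with $r$ bounded edges form an open cone $\mathbb R_{>0}^r$, and cones are glued by letting edge lengths go to $0$. Maximal cones correspond to types with all inner vertices three-valent ($|A|-3$ bounded edges). For $S\subseteq A$, $|S|\ge 3$, the forgetful map $ft_{A\setminus S}:M_{0,A}^{\mathrm{trop}}\to M_{0,S}^{\mathrm{trop}}$ removes the ends not marked by $S$ and stabilizes (two edges meeting in a two-valent vertex are merged, adding lengths, the merged edge being an end if one of the two is an end). Cross-ratios.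 A tropical cross-ratio $C=(\lambda,(ab|cd))$ consists of $\lambda\in\mathbb R_{\ge 0}$ and a splitting of four distinct markings into two unordered pairs $\{a,b\},\{c,d\}$ (the order of the pairs is irrelevant); it uses the markings $S=\{a,b,c,d\}$. A curve $\Gamma$ fulfills $C$ if $ft_{A\setminus S}(\Gamma)$ is the $4$-marked curve whose bounded edge has length $\lambda$ and in which $a,b$ share a vertex and $c,d$ share a vertex (for $\lambda=0$: the curve with one four-valent vertex). A bounded edge of such $\Gamma$ contributes to $C$ if it lies both on the path from end $a$ to end $c$ and on the path from end $b$ to end $d$. Thus $C$ is a point of $M_{0,S}^{\mathrm{trop}}$. Degree. For a set $\mathcal U=\{S_1,\dots,S_{m}\}$ of four-element subsets of $A$, let $\pi_{\mathcal U}=\prod_i ft_{A\setminus S_i}:M_{0,A}^{\mathrm{trop}}\to\prod_{i}M_{0,S_i}^{\mathrm{trop}}$; so $\pi_{\mathcal U}^{-1}(C_1,\dots,C_m)$ is the set of $A$-marked curves fulfilling all $C_i$, where $C_i$ uses the markings $S_i$. Let $m=|A|-3$. The cross-ratios $C_1,\dots,C_m$ are in general position if every curve in $\pi_{\mathcal U}^{-1}(C_1,\dots,C_m)$ lies in the interior of a maximal cone. In this case the multiplicity of such a curve is $|\det|$ of the $m\times m$ matrix with rows indexed by the $C_i$, columns by the bounded edges $e_j$, and entry $1$ if $e_j$ contributes to $C_i$, $0$ otherwise. The degree $d_{\mathcal U}$ is the sum of the multiplicities of all curves in $\pi_{\mathcal U}^{-1}(C_1,\dots,C_m)$ for cross-ratios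 in general position (independent of the choice), and $d_{\mathcal U}=0$ if $\pi_{\mathcal U}$ is not injective on any maximal cone. Triangulations. Consider a regular $n$-gon, $n\ge 4$, with edges marked clockwise $1,\dots,n$ (indices mod $n$), and a triangulation $T$ by $n-3$ non-crossing diagonals, each with an assigned length $\lambda\in\mathbb R_{\ge 0}$. A triangle of $T$ is inner, outer or border if it contains $0$, $1$ or $2$ edges of the $n$-gon, respectively. A diagonal joining the vertex between edges $k,k+1$ to the vertex between edges $l,l+1$ gives the four-element set $\{k,k+1,l,l+1\}$; $\mathcal U(T)$ is the set of these. It defines a cross-ratio in one of three interpretations: dual $(\lambda,(k\,(l+1)\,|\,(k+1)\,l))$; neighboring $(\lambda,(k\,(k+1)\,|\,l\,(l+1)))$; intersecting $(\lambda,(k\,l\,|\,(k+1)\,(l+1)))$. An inner triangle with side lengths $\lambda_i,\lambda_j,\lambda_k$ fulfills the triangle inequalities if $\lambda_i+\lambda_j>\lambda_k$, $\lambda_i+\lambda_k>\lambda_j$ and $\lambda_j+\lambda_k>\lambda_i$. *)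

theory Defs
  imports Complex_Main "HOL-Library.FuncSet" "Jordan_Normal_Form.Determinant"
begin

section \<open>Marked trees\<close>

text \<open>
  Underlying graphs are finite simple graphs on vertices of type \<^typ>\<open>nat\<close>, edges being two-element
  sets of vertices. \<open>leaf\<close> sends a marking to the one-valent vertex of the end it marks. The values of
  \<open>leaf\<close> outside the set of markings, and of \<open>len\<close> outside the bounded edges, are irrelevant;
  in particular the length \<open>\<infinity>\<close> of an end is not stored.
\<close>

record 'a tcurve =
  verts :: "nat set"
  edges :: "nat set set"
  leaf :: "'a \<Rightarrow> nat"
  len :: "nat set \<Rightarrow> real"

definition valence :: "'a tcurve \<Rightarrow> nat \<Rightarrow> nat" where
  "valence \<Gamma> v = card {e \<in> edges \<Gamma>. v \<in> e}"

definition inner_verts :: "'a tcurve \<Rightarrow> nat set" where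
  "inner_verts \<Gamma> = {v \<in> verts \<Gamma>. valence \<Gamma> v \<noteq> 1}"

definition bounded_edges :: "'a tcurve \<Rightarrow> nat set set" where
  "bounded_edges \<Gamma> = {e \<in> edges \<Gamma>. \<forall>v\<in>e. valence \<Gamma> v \<noteq> 1}"

definition tree_path :: "'a tcurve \<Rightarrow> nat \<Rightarrow> nat list \<Rightarrow> nat \<Rightarrow> bool" where
  "tree_path \<Gamma> u p v \<longleftrightarrow> p \<noteq> [] \<and> hd p = u \<and> last p = v \<and> distinct p \<and> set p \<subseteq> verts \<Gamma> \<and>
     successively (\<lambda>x y. {x, y} \<in> edges \<Gamma>) p"

definition path_edges :: "nat list \<Rightarrow> nat set set" where
  "path_edges p = {{p ! i, p ! Suc i} | i. Suc i < length p}"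

definition is_tree :: "'a tcurve \<Rightarrow> bool" where
  "is_tree \<Gamma> \<longleftrightarrow> finite (verts \<Gamma>) \<and> verts \<Gamma> \<noteq> {} \<and>
     edges \<Gamma> \<subseteq> {e. e \<subseteq> verts \<Gamma> \<and> card e = 2} \<and>
     (\<forall>u\<in>verts \<Gamma>. \<forall>v\<in>verts \<Gamma>. \<exists>!p. tree_path \<Gamma> u p v)"

definition tropical_curve :: "'a set \<Rightarrow> 'a tcurve \<Rightarrow> bool" where
  "tropical_curve A \<Gamma> \<longleftrightarrow> finite A \<and> card A \<ge> 3 \<and> is_tree \<Gamma> \<and>
     (\<forall>v\<in>verts \<Gamma>. valence \<Gamma> v \<noteq> 2) \<and>
     bij_betw (leaf \<Gamma>) A {v \<in> verts \<Gamma>. valence \<Gamma> v = 1} \<and>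
     (\<forall>e\<in>bounded_edges \<Gamma>. len \<Gamma> e > 0)"


section \<open>The moduli space and its cones\<close>

definition marked_tree_iso :: "'a set \<Rightarrow> (nat \<Rightarrow> nat) \<Rightarrow> 'a tcurve \<Rightarrow> 'a tcurve \<Rightarrow> bool" where
  "marked_tree_iso A f \<Gamma> \<Delta> \<longleftrightarrow> bij_betw f (verts \<Gamma>) (verts \<Delta>) \<and>
     (\<lambda>e. f ` e) ` edges \<Gamma> = edges \<Delta> \<and> (\<forall>a\<in>A. f (leaf \<Gamma> a) = leaf \<Delta> a)"

definition type_rel :: "'a set \<Rightarrow> ('a tcurve \<times> 'a tcurve) set" where
  "type_rel A = {(\<Gamma>, \<Delta>). tropical_curve A \<Gamma> \<and> tropical_curve A \<Delta> \<and>
     (\<exists>f. marked_tree_iso A f \<Gamma> \<Delta>)}"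

definition iso_rel :: "'a set \<Rightarrow> ('a tcurve \<times> 'a tcurve) set" where
  "iso_rel A = {(\<Gamma>, \<Delta>). tropical_curve A \<Gamma> \<and> tropical_curve A \<Delta> \<and>
     (\<exists>f. marked_tree_iso A f \<Gamma> \<Delta> \<and> (\<forall>e\<in>bounded_edges \<Gamma>. len \<Delta> (f ` e) = len \<Gamma> e))}"

definition M0_trop :: "'a set \<Rightarrow> 'a tcurve set set" where
  "M0_trop A = {\<Gamma>. tropical_curve A \<Gamma>} // iso_rel A"

definition comb_type :: "'a set \<Rightarrow> 'a tcurve set \<Rightarrow> 'a tcurve set" where
  "comb_type A X = (\<Union>\<Gamma>\<in>X. type_rel A `` {\<Gamma>})"

definition trivalent :: "'a tcurve set \<Rightarrow> bool" where
  "trivalent X \<longleftrightarrow> (\<forall>\<Gamma>\<in>X. \<forall>v\<in>inner_verts \<Gamma>. valence \<Gamma> v = 3)"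

text \<open>
  Cones are the open cones of curves of a fixed combinatorial type, so the interiors of the maximal
  cones consist exactly of the trivalent curves.
\<close>

definition maximal_cones :: "'a set \<Rightarrow> 'a tcurve set set set" where
  "maximal_cones A = {{Y \<in> M0_trop A. comb_type A Y = comb_type A X} | X.
     X \<in> M0_trop A \<and> trivalent X}"


section \<open>Forgetful maps\<close>

text \<open>
  Removing the ends not marked by \<open>S\<close>, together with the unmarked dead branches this leaves behind,
  yields the subtree spanned by the ends marked by \<open>S\<close>.
\<close>

definition remove_ends :: "'a set \<Rightarrow> 'a tcurve \<Rightarrow> 'a tcurve" where
  "remove_ends S \<Gamma> = \<Gamma>\<lparr>
     verts := \<Union> {set p | p. \<exists>s\<in>S. \<exists>t\<in>S. tree_path \<Gamma> (leaf \<Gamma> s) p (leaf \<Gamma> t)},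
     edges := \<Union> {path_edges p | p. \<exists>s\<in>S. \<exists>t\<in>S. tree_path \<Gamma> (leaf \<Gamma> s) p (leaf \<Gamma> t)}\<rparr>"

text \<open>
  Merging at all two-valent vertices simultaneously: the new edges are the paths between vertices
  that are not two-valent all of whose intermediate vertices are two-valent.
\<close>

definition stabilize :: "'a tcurve \<Rightarrow> 'a tcurve" where
  "stabilize \<Gamma> = (let W = {v \<in> verts \<Gamma>. valence \<Gamma> v \<noteq> 2} in \<Gamma>\<lparr>
     verts := W,
     edges := {{u, v} | u v. u \<in> W \<and> v \<in> W \<and> u \<noteq> v \<and> (\<exists>p. tree_path \<Gamma> u p v \<and> set p \<inter> W = {u, v})},
     len := (\<lambda>e. \<Sum>f \<in> \<Union> {path_edges p | p u v. e = {u, v} \<and> tree_path \<Gamma> u p v}. len \<Gamma> f)\<rparr>)"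

definition ft :: "'a set \<Rightarrow> 'a tcurve \<Rightarrow> 'a tcurve" where
  "ft S \<Gamma> = stabilize (remove_ends S \<Gamma>)"

text \<open>The map on isomorphism classes; \<open>S\<close> is the set of markings that are kept.\<close>

definition ft_map :: "'a set \<Rightarrow> 'a tcurve set \<Rightarrow> 'a tcurve set" where
  "ft_map S X = (\<Union>\<Gamma>\<in>X. iso_rel S `` {ft S \<Gamma>})"

definition pi_map :: "'a set set \<Rightarrow> 'a tcurve set \<Rightarrow> 'a set \<Rightarrow> 'a tcurve set" where
  "pi_map U X = (\<lambda>S\<in>U. ft_map S X)"


section \<open>Cross-ratios\<close>

text \<open>The second component is the splitting as an unordered pair of unordered pairs.\<close>

type_synonym 'a cross_ratio = "real \<times> 'a set set"

definition CR :: "real \<Rightarrow> 'a \<Rightarrow> 'a \<Rightarrow> 'a \<Rightarrow> 'a \<Rightarrow> 'a cross_ratio" where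
  "CR l a b c d = (l, {{a, b}, {c, d}})"

definition is_cross_ratio :: "'a set \<Rightarrow> 'a cross_ratio \<Rightarrow> bool" where
  "is_cross_ratio A C \<longleftrightarrow> (\<exists>l a b c d. C = CR l a b c d \<and> l \<ge> 0 \<and>
     distinct [a, b, c, d] \<and> {a, b, c, d} \<subseteq> A)"

definition cr_marks :: "'a cross_ratio \<Rightarrow> 'a set" where
  "cr_marks C = \<Union> (snd C)"

text \<open>The cross-ratio \<open>C\<close> as a point, i.e. as an isomorphism class, of \<open>M0_trop (cr_marks C)\<close>.\<close>

definition cr_point :: "'a cross_ratio \<Rightarrow> 'a tcurve set" where
  "cr_point C = {\<Delta>. tropical_curve (cr_marks C) \<Delta> \<and>
     (if fst C = 0 then \<exists>v\<in>verts \<Delta>. valence \<Delta> v = 4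
      else (\<exists>e. bounded_edges \<Delta> = {e} \<and> len \<Delta> e = fst C) \<and>
        (\<forall>P\<in>snd C. \<exists>v\<in>verts \<Delta>. \<forall>a\<in>P. {leaf \<Delta> a, v} \<in> edges \<Delta>))}"

definition fulfills :: "'a tcurve set \<Rightarrow> 'a cross_ratio \<Rightarrow> bool" where
  "fulfills X C \<longleftrightarrow> ft_map (cr_marks C) X = cr_point C"

text \<open>
  For a curve fulfilling \<open>C\<close> this does not depend on how the elements of the splitting are named
  \<open>a, b, c, d\<close>.
\<close>

definition contributes :: "'a tcurve \<Rightarrow> nat set \<Rightarrow> 'a cross_ratio \<Rightarrow> bool" where
  "contributes \<Gamma> e C \<longleftrightarrow> e \<in> bounded_edges \<Gamma> \<and> (\<exists>a b c d. snd C = {{a, b}, {c, d}} \<and>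
     (\<exists>p. tree_path \<Gamma> (leaf \<Gamma> a) p (leaf \<Gamma> c) \<and> e \<in> path_edges p) \<and>
     (\<exists>p. tree_path \<Gamma> (leaf \<Gamma> b) p (leaf \<Gamma> d) \<and> e \<in> path_edges p))"

definition fibre :: "'a set \<Rightarrow> 'a cross_ratio list \<Rightarrow> 'a tcurve set set" where
  "fibre A Cs = {X \<in> M0_trop A. \<forall>C\<in>set Cs. fulfills X C}"

definition general_position :: "'a set \<Rightarrow> 'a cross_ratio list \<Rightarrow> bool" where
  "general_position A Cs \<longleftrightarrow> (\<forall>X\<in>fibre A Cs. trivalent X)"


section \<open>Multiplicities and degree\<close>

text \<open>
  The absolute value makes the choice of an enumeration of the bounded edges irrelevant, and
  isomorphic curves have the same value, so that the image in \<open>tropical_multiplicity\<close> is a singleton.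
\<close>

definition curve_mult :: "'a cross_ratio list \<Rightarrow> 'a tcurve \<Rightarrow> int" where
  "curve_mult Cs \<Gamma> = (let es = (SOME es. distinct es \<and> set es = bounded_edges \<Gamma>) in
     \<bar>det (mat (length Cs) (length es)
        (\<lambda>(i, j). if contributes \<Gamma> (es ! j) (Cs ! i) then 1 else 0))\<bar>)"

definition tropical_multiplicity :: "'a cross_ratio list \<Rightarrow> 'a tcurve set \<Rightarrow> int" where
  "tropical_multiplicity Cs X = the_elem (curve_mult Cs ` X)"

definition uses_markings :: "'a set \<Rightarrow> 'a set set \<Rightarrow> 'a cross_ratio list \<Rightarrow> bool" where
  "uses_markings A U Cs \<longleftrightarrow> (\<forall>C\<in>set Cs. is_cross_ratio A C) \<and>
     distinct (map cr_marks Cs) \<and> set (map cr_marks Cs) = U"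

text \<open>
  The definite description expresses that the sum is the same for all cross-ratios in general
  position.
\<close>

definition tropical_degree :: "'a set \<Rightarrow> 'a set set \<Rightarrow> int" where
  "tropical_degree A U = (if \<exists>K\<in>maximal_cones A. inj_on (pi_map U) K
     then (THE D. \<forall>Cs. uses_markings A U Cs \<and> general_position A Cs \<longrightarrow>
             (\<Sum>X\<in>fibre A Cs. tropical_multiplicity Cs X) = D)
     else 0)"


section \<open>Triangulations of a polygon\<close>

text \<open>
  The edges of the \<open>n\<close>-gon are \<open>1, \<dots>, n\<close> in cyclic order, and its vertex \<open>k\<close> is the one between the
  edges \<open>k\<close> and \<open>nxt n k\<close>. A segment joining vertices \<open>k < l\<close> is the pair \<open>(k, l)\<close>.
\<close>

definition nxt :: "nat \<Rightarrow> nat \<Rightarrow> nat" where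
  "nxt n k = k mod n + 1"

definition segments :: "nat \<Rightarrow> (nat \<times> nat) set" where
  "segments n = {(k, l). 1 \<le> k \<and> k < l \<and> l \<le> n}"

definition polygon_edges :: "nat \<Rightarrow> (nat \<times> nat) set" where
  "polygon_edges n = {(k, l) \<in> segments n. l = nxt n k \<or> k = nxt n l}"

definition diagonals :: "nat \<Rightarrow> (nat \<times> nat) set" where
  "diagonals n = segments n - polygon_edges n"

fun crossing :: "nat \<times> nat \<Rightarrow> nat \<times> nat \<Rightarrow> bool" where
  "crossing (a, b) (c, d) \<longleftrightarrow> (a < c \<and> c < b \<and> b < d) \<or> (c < a \<and> a < d \<and> d < b)"

definition triangulation :: "nat \<Rightarrow> (nat \<times> nat) set \<Rightarrow> bool" where
  "triangulation n T \<longleftrightarrow> T \<subseteq> diagonals n \<and> card T = n - 3 \<and>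
     (\<forall>e\<in>T. \<forall>f\<in>T. \<not> crossing e f)"

fun sides :: "nat \<times> nat \<times> nat \<Rightarrow> (nat \<times> nat) set" where
  "sides (i, j, k) = {(i, j), (j, k), (i, k)}"

definition triangles :: "nat \<Rightarrow> (nat \<times> nat) set \<Rightarrow> (nat \<times> nat \<times> nat) set" where
  "triangles n T = {(i, j, k). i < j \<and> j < k \<and> sides (i, j, k) \<subseteq> T \<union> polygon_edges n}"

definition inner_triangles :: "nat \<Rightarrow> (nat \<times> nat) set \<Rightarrow> (nat \<times> nat \<times> nat) set" where
  "inner_triangles n T = {t \<in> triangles n T. sides t \<inter> polygon_edges n = {}}"

fun triangle_ineqs :: "(nat \<times> nat \<Rightarrow> real) \<Rightarrow> nat \<times> nat \<times> nat \<Rightarrow> bool" where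
  "triangle_ineqs lam (i, j, k) \<longleftrightarrow>
     lam (i, j) + lam (j, k) > lam (i, k) \<and>
     lam (i, j) + lam (i, k) > lam (j, k) \<and>
     lam (j, k) + lam (i, k) > lam (i, j)"

datatype interpretation_kind = Dual | Neighboring | Intersecting

fun diagonal_marks :: "nat \<Rightarrow> nat \<times> nat \<Rightarrow> nat set" where
  "diagonal_marks n (k, l) = {k, nxt n k, l, nxt n l}"

fun diagonal_cr :: "nat \<Rightarrow> interpretation_kind \<Rightarrow> real \<Rightarrow> nat \<times> nat \<Rightarrow> nat cross_ratio" where
  "diagonal_cr n Dual x (k, l) = CR x k (nxt n l) (nxt n k) l"
| "diagonal_cr n Neighboring x (k, l) = CR x k (nxt n k) l (nxt n l)"
| "diagonal_cr n Intersecting x (k, l) = CR x k l (nxt n k) (nxt n l)"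

end

theory Submission
  imports Defs
begin

text \<open>
  A curve is encoded by its half distances \<open>H a b\<close>, half the total length of the bounded edges between
  the ends \<open>a\<close> and \<open>b\<close>, through the quartets \<open>H a c + H b d - H a b - H c d\<close>: isomorphism classes of
  curves are tree metrics on the markings up to equality of quartets, and trivalence, cross-ratio
  conditions and contributing edges are linear (in)equalities in \<open>H\<close>.

  The triangulation is built up triangle by triangle. An outer triangle adds one marking and one
  condition, an inner triangle adds two of each, and a solution of the enlarged problem is an amalgam
  of a solution of the old problem and one for the markings of the new triangle, glued along the markings
  of the common side; in general position it is unique, so the numbers of solutions multiply. The
  six markings of an inner triangle admit two solutions of multiplicity one, except in the neighboring case
  with triangle inequalities, where there is one solution, at which one of the three conditions is twice an
  integral functional up to the other two. The remaining factor of the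
  determinant is one because all edge lengths are integral combinations of integral quartets.
\<close>

section \<open>Trees and tree orders\<close>

text \<open>An amalgam along a common side need not be unique: the position of a new marking
  relative to an old one can stay open when, seen from the common side, both attach at the same
  place. In that case an unresolved amalgam exists as well, so general position of the whole problem
  excludes it, and also passes to both parts. Otherwise everything is forced by one fact: in an
  ultrametric triple with two different values the third is the larger of the two. The same fact
  carries integrality across the gluing; there the edge lengths may be arbitrary reals, hence
  \<open>tlike\<close>, which keeps only the linear equalities of a combinatorial type. Determinants
  are never expanded: a square integral matrix is unimodular if integral values force integral
  arguments, and this is a statement about quartets that can be glued. The factor 2 comes from the
  tree with three cherries joined at one vertex: its edge lengths solve u + v = l1, v + w = l2, u +
  w = l3, and the triangle inequalities say that the solution is positive.\<close>

lemma path_edges_simps [simp]: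
  "path_edges [] = {}" "path_edges [x] = {}"
  "path_edges (x # y # p) = insert {x, y} (path_edges (y # p))"
proof -
  show "path_edges (x # y # p) = insert {x, y} (path_edges (y # p))" (is "?L = ?R")
  proof (rule Set.set_eqI)
    fix e
    show "e \<in> ?L \<longleftrightarrow> e \<in> ?R"
    proof
      assume "e \<in> ?L"
      then obtain i where "e = {(x#y#p) ! i, (x#y#p) ! Suc i}" "Suc i < length (x#y#p)"
        by (auto simp: path_edges_def)
      thus "e \<in> ?R" by (cases i) (auto simp: path_edges_def)
    next
      assume "e \<in> ?R"
      then consider "e = {x, y}" | i where "e = {(y#p) ! i, (y#p) ! Suc i}" "Suc i < length (y#p)"
        by (auto simp: path_edges_def)
      thus "e \<in> ?L"
      proof cases
        case 1 thus ?thesis unfolding path_edges_def by (intro CollectI exI[of _ 0]) simp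
      next
        case (2 i) thus ?thesis unfolding path_edges_def by (intro CollectI exI[of _ "Suc i"]) simp
      qed
    qed
  qed
qed (auto simp: path_edges_def)

lemma path_edges_subset: "e \<in> path_edges p \<Longrightarrow> e \<subseteq> set p"
  by (auto simp: path_edges_def)

text \<open>The first vertex of a simple path lies on only one of its edges, which therefore
  determines the second vertex; removing the first vertex gives the induction.\<close>

lemma path_eq_if_path_edges_eq:
  assumes "distinct p" "distinct q" "p \<noteq> []" "q \<noteq> []" "hd p = hd q" "last p = last q"
    and "path_edges p = path_edges q"
  shows "p = q"
  using assms
proof (induction p arbitrary: q)
  case (Cons x p)
  obtain q' where q: "q = x # q'" using Cons.prems by (cases q) auto
  show ?case
  proof (cases p)
    case Nil
    thus ?thesis using Cons.prems q by (cases q') auto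
  next
    case p: (Cons y p')
    show ?thesis
    proof (cases q')
      case Nil
      thus ?thesis using Cons.prems p q by auto
    next
      case q': (Cons z q'')
      have x: "x \<notin> set p" "x \<notin> set q'" using Cons.prems(1,2) q by auto
      have nx: "e \<in> path_edges p \<Longrightarrow> x \<notin> e" "e \<in> path_edges q' \<Longrightarrow> x \<notin> e" for e
        using x path_edges_subset by blast+
      have eq: "insert {x, y} (path_edges p) = insert {x, z} (path_edges q')"
        using Cons.prems(7) p q q' by simp
      have "{x, y} \<in> insert {x, z} (path_edges q')" using eq by (metis insertI1)
      hence "{x, y} = {x, z}" using nx(2)[of "{x, y}"] by auto
      hence yz: "y = z" by (auto simp: doubleton_eq_iff)
      have "{x, y} \<notin> path_edges p" "{x, y} \<notin> path_edges q'"
        using nx(1)[of "{x, y}"] nx(2)[of "{x, y}"] by auto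
      hence "path_edges p = path_edges q'" using eq yz by (metis insert_ident)
      hence "p = q'" using Cons.prems p q q' yz by (intro Cons.IH) auto
      thus ?thesis using q by simp
    qed
  qed
qed simp

section \<open>Rooted trees as finite orders\<close>

definition covers :: "'v set \<Rightarrow> ('v \<Rightarrow> 'v \<Rightarrow> bool) \<Rightarrow> 'v \<Rightarrow> 'v \<Rightarrow> bool" where
  "covers V leq u v \<longleftrightarrow> u \<in> V \<and> v \<in> V \<and> u \<noteq> v \<and> leq u v \<and> (\<forall>w\<in>V. leq u w \<longrightarrow> leq w v \<longrightarrow> w = u \<or> w = v)"

definition cover_edges :: "'v set \<Rightarrow> ('v \<Rightarrow> 'v \<Rightarrow> bool) \<Rightarrow> 'v set set" where
  "cover_edges V leq = {{u, v} | u v. covers V leq u v}"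

text \<open>A finite order with least element in which everything below a vertex is a chain; the
  tree is its Hasse diagram \<open>cover_edges\<close>. The advantage over graphs is that the axioms
  pass to every subset containing \<open>r\<close>, so that deleting branches and merging edges
  become a mere change of the vertex set.\<close>

locale tree_order =
  fixes V :: "'v set" and r :: 'v and leq :: "'v \<Rightarrow> 'v \<Rightarrow> bool"
  assumes fin: "finite V" and root: "r \<in> V"
    and bot: "v \<in> V \<Longrightarrow> leq r v" and refl: "v \<in> V \<Longrightarrow> leq v v"
    and trans: "u \<in> V \<Longrightarrow> v \<in> V \<Longrightarrow> w \<in> V \<Longrightarrow> leq u v \<Longrightarrow> leq v w \<Longrightarrow> leq u w"
    and antisym: "u \<in> V \<Longrightarrow> v \<in> V \<Longrightarrow> leq u v \<Longrightarrow> leq v u \<Longrightarrow> u = v"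
    and chain: "u \<in> V \<Longrightarrow> v \<in> V \<Longrightarrow> w \<in> V \<Longrightarrow> leq u w \<Longrightarrow> leq v w \<Longrightarrow> leq u v \<or> leq v u"
begin

abbreviation "cov \<equiv> covers V leq"

definition rank :: "'v \<Rightarrow> nat" where "rank v = card {w \<in> V. leq w v}"

lemma rank_less:
  assumes "u \<in> V" "v \<in> V" "leq u v" "u \<noteq> v"
  shows "rank u < rank v"
  unfolding rank_def
proof (rule psubset_card_mono)
  show "finite {w \<in> V. leq w v}" using fin by simp
  have "v \<notin> {w \<in> V. leq w u}" using antisym assms by blast
  moreover have "v \<in> {w \<in> V. leq w v}" using assms refl by simp
  ultimately show "{w \<in> V. leq w u} \<subset> {w \<in> V. leq w v}" using assms trans by blast
qed

lemma covD: assumes "cov u v" shows "u \<in> V" "v \<in> V" "u \<noteq> v" "leq u v"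
  using assms by (auto simp: covers_def)

lemma cov_between: "cov u v \<Longrightarrow> w \<in> V \<Longrightarrow> leq u w \<Longrightarrow> leq w v \<Longrightarrow> w = u \<or> w = v"
  by (auto simp: covers_def)

lemma cov_le: "cov u v \<Longrightarrow> w \<in> V \<Longrightarrow> leq w v \<Longrightarrow> w \<noteq> v \<Longrightarrow> leq w u"
  using chain[of w u v] covD cov_between refl by blast

lemma cov_unique: "cov u v \<Longrightarrow> cov u' v \<Longrightarrow> u = u'"
  using cov_le covD antisym by meson

lemma cov_root: "\<not> cov u r"
  using covD bot antisym root by metis

lemma ex_cov_below:
  assumes "v \<in> V" "u \<in> V" "leq u v" "u \<noteq> v"
  shows "\<exists>w. cov w v \<and> leq u w"
proof -
  let ?D = "{w \<in> V. leq w v \<and> w \<noteq> v}"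
  have D: "finite ?D" "?D \<noteq> {}" using fin assms by auto
  obtain w where w: "w \<in> ?D" "\<And>x. x \<in> ?D \<Longrightarrow> rank x \<le> rank w"
    using finite_imageI[OF D(1), of rank] D Max_in[of "rank ` ?D"] Max_ge[of "rank ` ?D"]
    by (smt (verit) image_iff image_is_empty)
  have "cov w v" unfolding covers_def
  proof (intro conjI ballI impI)
    fix x assume x: "x \<in> V" "leq w x" "leq x v"
    show "x = w \<or> x = v"
    proof (rule ccontr)
      assume n: "\<not> ?thesis"
      hence "rank w < rank x" using x w rank_less by auto
      thus False using w(2)[of x] x n by auto
    qed
  qed (use w assms in auto)
  moreover have "leq u w"
    using cov_le[OF \<open>cov w v\<close>] assms by blast
  ultimately show ?thesis by blast
qed

lemma ex_parent: "v \<in> V \<Longrightarrow> v \<noteq> r \<Longrightarrow> \<exists>u. cov u v"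
  using ex_cov_below[of v r] root bot by blast

lemma ex_cov_above:
  assumes "v \<in> V" "u \<in> V" "leq u v" "u \<noteq> v"
  shows "\<exists>w. cov u w \<and> leq w v"
  using assms
proof (induction "rank v" arbitrary: v rule: less_induct)
  case less
  obtain w where w: "cov w v" "leq u w" using ex_cov_below less.prems by blast
  show ?case
  proof (cases "u = w")
    case True thus ?thesis using w less.prems refl by blast
  next
    case False
    have "rank w < rank v" using rank_less covD[OF w(1)] by blast
    then obtain x where x: "cov u x" "leq x w" using less.hyps[of w] w False covD[OF w(1)] less.prems by blast
    thus ?thesis using trans[of x w v] covD[OF w(1)] covD[OF x(1)] by blast
  qed
qed

lemma ex_maximal_above:
  assumes "v \<in> V"
  shows "\<exists>m\<in>V. leq v m \<and> (\<forall>w. \<not> cov m w)"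
  using assms
proof (induction "card V - rank v" arbitrary: v rule: less_induct)
  case less
  have rk: "rank w \<le> card V" for w unfolding rank_def using fin by (intro card_mono) auto
  show ?case
  proof (cases "\<exists>w. cov v w")
    case True
    then obtain w where w: "cov v w" by blast
    have "rank v < rank w" using rank_less covD[OF w] by blast
    hence "card V - rank w < card V - rank v" using rk[of w] by linarith
    then obtain m where "m \<in> V" "leq w m" "\<forall>w. \<not> cov m w"
      using less.hyps[of w] covD[OF w] by blast
    thus ?thesis using trans[of v w m] covD[OF w] by blast
  next
    case False thus ?thesis using less.prems refl by blast
  qed
qed

lemma disjoint_children:
  assumes "cov u v" "cov u v'" "v \<noteq> v'" "w \<in> V" "leq v w"
  shows "\<not> leq v' w"
proof
  assume "leq v' w"
  hence "leq v v' \<or> leq v' v" using chain assms covD by metis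
  thus False using cov_between assms covD by metis
qed

lemma cov_inj: "cov u v \<Longrightarrow> cov u' v' \<Longrightarrow> {u, v} = {u', v'} \<Longrightarrow> u = u' \<and> v = v'"
  using antisym covD by (metis doubleton_eq_iff)

lemma le_cov_iff:
  assumes "cov s t" "v \<in> V" "v \<noteq> t"
  shows "leq v t \<longleftrightarrow> leq v s"
  using assms cov_le trans covD by metis

end

locale tree_order_graph = tree_order "verts \<Gamma>" r leq
  for \<Gamma> :: "'a tcurve" and r leq +
  assumes edges_eq: "edges \<Gamma> = cover_edges (verts \<Gamma>) leq"
begin

text \<open>The vertices above \<open>v\<close> form one side of the edge from \<open>u\<close> to
  \<open>v\<close>, and every other covering pair lies on one side by \<open>le_cov_iff\<close>. A
  distinct path uses the edge at most once, so its ends lie on different sides precisely if it uses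
  the edge.\<close>

lemma path_cross_aux:
  assumes "successively (\<lambda>x y. {x, y} \<in> cover_edges (verts \<Gamma>) leq) p" "distinct p" "p \<noteq> []" "cov u v"
  shows "{u, v} \<in> path_edges p \<longleftrightarrow> (leq v (hd p) \<noteq> leq v (last p))"
  using assms
proof (induction p)
  case (Cons x p)
  show ?case
  proof (cases p)
    case Nil thus ?thesis by simp
  next
    case p: (Cons y p')
    have IH: "{u, v} \<in> path_edges p \<longleftrightarrow> (leq v y \<noteq> leq v (last p))"
      using Cons p by simp
    have "{x, y} \<in> cover_edges (verts \<Gamma>) leq" using Cons.prems p by simp
    then obtain s t where st: "cov s t" "{x, y} = {s, t}" by (auto simp: cover_edges_def)
    have v: "v \<in> verts \<Gamma>" using Cons.prems(4) covD by blast
    show ?thesis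
    proof (cases "{x, y} = {u, v}")
      case True
      hence "{u, v} \<notin> path_edges p" using path_edges_subset[of "{u,v}" p] Cons.prems(2) by auto
      moreover have "leq v x \<noteq> leq v y"
        using True Cons.prems(4) covD antisym refl by (metis doubleton_eq_iff)
      ultimately show ?thesis using IH p True by auto
    next
      case False
      hence "t \<noteq> v" using st cov_unique Cons.prems(4) by metis
      hence "leq v t \<longleftrightarrow> leq v s" using le_cov_iff[OF st(1) v] by blast
      hence "leq v x \<longleftrightarrow> leq v y" using st(2) by (metis doubleton_eq_iff)
      thus ?thesis using IH p False by auto
    qed
  qed
qed simp

lemma path_cross:
  assumes "tree_path \<Gamma> a p b" "cov u v"
  shows "{u, v} \<in> path_edges p \<longleftrightarrow> (leq v a \<noteq> leq v b)"
  using path_cross_aux[of p u v] assms by (auto simp: tree_path_def edges_eq)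

lemma successively_path_edges:
  "successively (\<lambda>x y. {x, y} \<in> E) p \<longleftrightarrow> path_edges p \<subseteq> E"
  by (induction p rule: induct_list012) auto

lemma tree_path_edges: "tree_path \<Gamma> a p b \<Longrightarrow> path_edges p \<subseteq> edges \<Gamma>"
  by (simp add: tree_path_def successively_path_edges)

lemma edge_cov: "e \<in> edges \<Gamma> \<Longrightarrow> \<exists>u v. cov u v \<and> e = {u, v}"
  by (auto simp: edges_eq cover_edges_def)

text \<open>By \<open>path_cross\<close> the ends of a path alone decide which edges it
  uses.\<close>

lemma path_unique:
  assumes p: "tree_path \<Gamma> a p b" and q: "tree_path \<Gamma> a q b"
  shows "p = q"
proof -
  have "path_edges p \<subseteq> path_edges q" if t: "tree_path \<Gamma> a p b" "tree_path \<Gamma> a q b" for p q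
  proof
    fix e assume e: "e \<in> path_edges p"
    then obtain u v where "cov u v" "e = {u, v}" using tree_path_edges[OF t(1)] edge_cov by blast
    thus "e \<in> path_edges q" using path_cross t e by metis
  qed
  hence "path_edges p = path_edges q" using p q by blast
  thus ?thesis using p q path_eq_if_path_edges_eq by (auto simp: tree_path_def)
qed

text \<open>An end that is not below the other one is replaced by its parent. The bound on the
  vertices of the path is carried through the induction because it keeps the replaced end off the
  shorter path.\<close>

lemma path_exists:
  assumes "a \<in> verts \<Gamma>" "b \<in> verts \<Gamma>"
  shows "\<exists>p. tree_path \<Gamma> a p b \<and> set p \<subseteq> {w \<in> verts \<Gamma>. leq w a \<or> leq w b}"
  using assms
proof (induction "rank a + rank b" arbitrary: a b rule: less_induct)
  case less
  consider "a = b" | "\<not> leq a b" | "a \<noteq> b" "leq a b" by blast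
  thus ?case
  proof cases
    case 1
    thus ?thesis using less.prems refl by (intro exI[of _ "[a]"]) (auto simp: tree_path_def)
  next
    case 2
    then obtain u where u: "cov u a" using ex_parent less.prems bot by metis
    have "rank u < rank a" using rank_less covD[OF u] by blast
    then obtain p where p: "tree_path \<Gamma> u p b" "set p \<subseteq> {w \<in> verts \<Gamma>. leq w u \<or> leq w b}"
      using less.hyps[of u b] covD[OF u] less.prems by auto
    have "\<not> leq a u" using antisym covD[OF u] by blast
    hence "a \<notin> set p" using p 2 by auto
    moreover have "{a, u} \<in> edges \<Gamma>" using u by (auto simp: edges_eq cover_edges_def insert_commute)
    ultimately have "tree_path \<Gamma> a (a # p) b"
      using p(1) less.prems by (auto simp: tree_path_def successively_Cons)
    moreover have "leq w a" if "w \<in> verts \<Gamma>" "leq w u" for w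
      using trans[of w u a] that covD[OF u] by blast
    hence "set (a # p) \<subseteq> {w \<in> verts \<Gamma>. leq w a \<or> leq w b}"
      using p(2) less.prems refl by auto
    ultimately show ?thesis by blast
  next
    case 3
    hence "b \<noteq> r" using bot antisym less.prems by metis
    then obtain u where u: "cov u b" using ex_parent less.prems by metis
    have "rank u < rank b" using rank_less covD[OF u] by blast
    then obtain p where p: "tree_path \<Gamma> a p u" "set p \<subseteq> {w \<in> verts \<Gamma>. leq w a \<or> leq w u}"
      using less.hyps[of a u] covD[OF u] less.prems by auto
    have "\<not> leq b u" "\<not> leq b a" using antisym covD[OF u] 3 less.prems by blast+
    hence "b \<notin> set p" using p by auto
    moreover have "{u, b} \<in> edges \<Gamma>" using u by (auto simp: edges_eq cover_edges_def)
    ultimately have "tree_path \<Gamma> a (p @ [b]) b"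
      using p(1) less.prems by (auto simp: tree_path_def successively_append_iff)
    moreover have "leq w b" if "w \<in> verts \<Gamma>" "leq w u" for w
      using trans[of w u b] that covD[OF u] by blast
    hence "set (p @ [b]) \<subseteq> {w \<in> verts \<Gamma>. leq w a \<or> leq w b}"
      using p(2) less.prems refl by auto
    ultimately show ?thesis by blast
  qed
qed

lemma is_tree: "is_tree \<Gamma>"
  unfolding is_tree_def
proof (intro conjI ballI)
  show "edges \<Gamma> \<subseteq> {e. e \<subseteq> verts \<Gamma> \<and> card e = 2}"
  proof
    fix e assume "e \<in> edges \<Gamma>"
    then obtain u v where uv: "cov u v" "e = {u, v}" using edge_cov by blast
    show "e \<in> {e. e \<subseteq> verts \<Gamma> \<and> card e = 2}" using covD[OF uv(1)] uv(2) by auto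
  qed
  fix u v assume "u \<in> verts \<Gamma>" "v \<in> verts \<Gamma>"
  thus "\<exists>!p. tree_path \<Gamma> u p v" using path_exists path_unique by metis
qed (use fin root in auto)

text \<open>The order can be read off from the graph: being below \<open>v\<close> means lying on
  the path from the root to \<open>v\<close>. This identifies a given order with the ancestor order
  \<open>tle\<close>, see \<open>tle_eq\<close>.\<close>

lemma root_path:
  assumes "v \<in> verts \<Gamma>" "tree_path \<Gamma> r p v"
  shows "set p = {w \<in> verts \<Gamma>. leq w v}"
  using assms
proof (induction "rank v" arbitrary: v p rule: less_induct)
  case less
  show ?case
  proof (cases "v = r")
    case True
    have "tree_path \<Gamma> r [r] r" using root by (auto simp: tree_path_def)
    hence "p = [r]" using path_unique less.prems True by blast
    thus ?thesis using True root refl bot antisym by auto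
  next
    case False
    then obtain u where u: "cov u v" using ex_parent less.prems by metis
    obtain q where q: "tree_path \<Gamma> r q u" using path_exists root covD[OF u] by metis
    have "rank u < rank v" using rank_less covD[OF u] by blast
    hence sq: "set q = {w \<in> verts \<Gamma>. leq w u}" using less.hyps[OF _ _ q] covD[OF u] by blast
    have "v \<notin> set q" using sq antisym covD[OF u] by blast
    moreover have "{u, v} \<in> edges \<Gamma>" using u by (auto simp: edges_eq cover_edges_def)
    ultimately have "tree_path \<Gamma> r (q @ [v]) v"
      using q less.prems by (auto simp: tree_path_def successively_append_iff)
    hence "p = q @ [v]" using path_unique less.prems by blast
    hence "set p = insert v {w \<in> verts \<Gamma>. leq w u}" using sq by simp
    also have "\<dots> = {w \<in> verts \<Gamma>. leq w v}"
      using u covD[OF u] le_cov_iff[OF u] refl by auto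
    finally show ?thesis .
  qed
qed

end

section \<open>The ancestor order of a rooted tree\<close>

definition tpath :: "'a tcurve \<Rightarrow> nat \<Rightarrow> nat \<Rightarrow> nat list" where
  "tpath \<Gamma> u v = (THE p. tree_path \<Gamma> u p v)"

definition tle :: "'a tcurve \<Rightarrow> nat \<Rightarrow> nat \<Rightarrow> nat \<Rightarrow> bool" where
  "tle \<Gamma> r u v \<longleftrightarrow> u \<in> set (tpath \<Gamma> r v)"

locale rooted_tree =
  fixes \<Gamma> :: "'a tcurve" and r :: nat
  assumes tree: "is_tree \<Gamma>" and root_in: "r \<in> verts \<Gamma>"
begin

lemma tpath_unique: "tree_path \<Gamma> u p v \<Longrightarrow> tpath \<Gamma> u v = p"
proof -
  assume p: "tree_path \<Gamma> u p v"
  hence "hd p \<in> set p" "last p \<in> set p" by (auto simp: tree_path_def)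
  hence "u \<in> verts \<Gamma>" "v \<in> verts \<Gamma>" using p by (auto simp: tree_path_def)
  hence "\<exists>!p. tree_path \<Gamma> u p v" using tree by (simp add: is_tree_def)
  thus ?thesis unfolding tpath_def using p by (rule the1_equality)
qed

lemma tpath: "u \<in> verts \<Gamma> \<Longrightarrow> v \<in> verts \<Gamma> \<Longrightarrow> tree_path \<Gamma> u (tpath \<Gamma> u v) v"
  using tree tpath_unique unfolding is_tree_def by metis

lemma tpath_prefix:
  assumes "v \<in> verts \<Gamma>" "tpath \<Gamma> r v = p @ u # q"
  shows "tpath \<Gamma> r u = p @ [u]"
proof (rule tpath_unique)
  have t: "tree_path \<Gamma> r ((p @ [u]) @ q) v" using tpath[OF root_in assms(1)] assms(2) by simp
  have "successively (\<lambda>x y. {x, y} \<in> edges \<Gamma>) (p @ [u])"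
    using t unfolding tree_path_def successively_append_iff[of _ "p @ [u]" q] by blast
  moreover have "hd (p @ [u]) = r" using t by (cases p) (auto simp: tree_path_def)
  ultimately show "tree_path \<Gamma> r (p @ [u]) u"
    using t by (auto simp: tree_path_def)
qed

lemma tle_prefix:
  assumes "v \<in> verts \<Gamma>" "tle \<Gamma> r u v"
  obtains q where "tpath \<Gamma> r v = tpath \<Gamma> r u @ q"
proof -
  obtain p q where "tpath \<Gamma> r v = p @ u # q" using assms(2) by (auto simp: tle_def dest: split_list)
  thus ?thesis using tpath_prefix[OF assms(1)] that[of q] by simp
qed

lemma tle_verts: "v \<in> verts \<Gamma> \<Longrightarrow> tle \<Gamma> r u v \<Longrightarrow> u \<in> verts \<Gamma>"
  using tpath[OF root_in] by (auto simp: tle_def tree_path_def)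

lemma last_tpath: "v \<in> verts \<Gamma> \<Longrightarrow> last (tpath \<Gamma> r v) = v" "v \<in> verts \<Gamma> \<Longrightarrow> tpath \<Gamma> r v \<noteq> []"
  "v \<in> verts \<Gamma> \<Longrightarrow> hd (tpath \<Gamma> r v) = r" "v \<in> verts \<Gamma> \<Longrightarrow> distinct (tpath \<Gamma> r v)"
  using tpath[OF root_in] by (auto simp: tree_path_def)

lemma tle_antisym:
  assumes "u \<in> verts \<Gamma>" "v \<in> verts \<Gamma>" "tle \<Gamma> r u v" "tle \<Gamma> r v u" shows "u = v"
proof -
  obtain q where "tpath \<Gamma> r v = tpath \<Gamma> r u @ q" using tle_prefix assms by blast
  moreover obtain q' where "tpath \<Gamma> r u = tpath \<Gamma> r v @ q'" using tle_prefix assms by blast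
  ultimately have "tpath \<Gamma> r u = tpath \<Gamma> r v" by simp
  thus ?thesis using last_tpath(1) assms by metis
qed

text \<open>Root paths to ancestors are prefixes of the root path (\<open>tle_prefix\<close>); two
  prefixes of one list are comparable, which is the chain axiom.\<close>

sublocale tree_order "verts \<Gamma>" r "tle \<Gamma> r"
proof
  show "finite (verts \<Gamma>)" using tree by (simp add: is_tree_def)
  show "r \<in> verts \<Gamma>" by (rule root_in)
  fix v assume v: "v \<in> verts \<Gamma>"
  show "tle \<Gamma> r r v" "tle \<Gamma> r v v"
    unfolding tle_def using last_tpath[OF v] hd_in_set last_in_set by metis+
next
  fix u v w assume a: "u \<in> verts \<Gamma>" "v \<in> verts \<Gamma>" "w \<in> verts \<Gamma>" "tle \<Gamma> r u v" "tle \<Gamma> r v w"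
  obtain q where "tpath \<Gamma> r w = tpath \<Gamma> r v @ q" using tle_prefix a by blast
  thus "tle \<Gamma> r u w" using a(4) by (simp add: tle_def)
next
  fix u v w assume a: "u \<in> verts \<Gamma>" "v \<in> verts \<Gamma>" "w \<in> verts \<Gamma>" "tle \<Gamma> r u w" "tle \<Gamma> r v w"
  obtain q where q: "tpath \<Gamma> r w = tpath \<Gamma> r u @ q" using tle_prefix a by blast
  obtain q' where q': "tpath \<Gamma> r w = tpath \<Gamma> r v @ q'" using tle_prefix a by blast
  have "u \<in> set (tpath \<Gamma> r u)" "v \<in> set (tpath \<Gamma> r v)"
    using last_tpath a last_in_set by metis+
  moreover have "(\<exists>us. tpath \<Gamma> r u @ us = tpath \<Gamma> r v) \<or> (\<exists>us. tpath \<Gamma> r u = tpath \<Gamma> r v @ us)"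
    using q q' by (metis append_eq_append_conv2)
  ultimately show "tle \<Gamma> r u v \<or> tle \<Gamma> r v u"
    unfolding tle_def by (metis Un_iff set_append)
qed (rule tle_antisym)

lemma edge_subset: "e \<in> edges \<Gamma> \<Longrightarrow> e \<subseteq> verts \<Gamma> \<and> card e = 2"
proof -
  have "edges \<Gamma> \<subseteq> {e. e \<subseteq> verts \<Gamma> \<and> card e = 2}" using tree unfolding is_tree_def by (elim conjE)
  thus "e \<in> edges \<Gamma> \<Longrightarrow> e \<subseteq> verts \<Gamma> \<and> card e = 2" by blast
qed

lemma tpath_snoc:
  assumes "{u, v} \<in> edges \<Gamma>" "\<not> tle \<Gamma> r v u"
  shows "tpath \<Gamma> r v = tpath \<Gamma> r u @ [v]"
proof (rule tpath_unique)
  have V: "u \<in> verts \<Gamma>" "v \<in> verts \<Gamma>" using edge_subset[OF assms(1)] by auto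
  thus "tree_path \<Gamma> r (tpath \<Gamma> r u @ [v]) v"
    using tpath[OF root_in V(1)] assms by (simp add: tree_path_def tle_def successively_append_iff)
qed

lemma snoc_covers:
  assumes "u \<in> verts \<Gamma>" "v \<in> verts \<Gamma>" "tpath \<Gamma> r v = tpath \<Gamma> r u @ [v]"
  shows "cov u v"
  unfolding covers_def
proof (intro conjI ballI impI)
  show "u \<noteq> v" using assms(3) by (metis append_self_conv list.distinct(1))
  have "u \<in> set (tpath \<Gamma> r u)" using last_tpath[OF assms(1)] last_in_set by metis
  thus "tle \<Gamma> r u v" by (simp add: tle_def assms(3))
  fix w assume w: "w \<in> verts \<Gamma>" "tle \<Gamma> r u w" "tle \<Gamma> r w v"
  obtain q where q: "tpath \<Gamma> r v = tpath \<Gamma> r w @ q" using tle_prefix w assms by blast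
  obtain q' where q': "tpath \<Gamma> r w = tpath \<Gamma> r u @ q'" using tle_prefix w assms by blast
  have "q' @ q = [v]" using q q' assms(3) by simp
  hence "q' = [] \<or> q = []" by (auto simp: append_eq_Cons_conv)
  hence "tpath \<Gamma> r w = tpath \<Gamma> r u \<or> tpath \<Gamma> r w = tpath \<Gamma> r v" using q q' by auto
  thus "w = u \<or> w = v" using last_tpath(1) w assms by metis
qed (use assms in auto)

text \<open>An edge extends the root path of one of its ends by a single vertex, so nothing fits in
  between. Conversely, if \<open>v\<close> covers \<open>u\<close>, the vertex following
  \<open>u\<close> on the root path to \<open>v\<close> lies between them and must be
  \<open>v\<close>.\<close>

lemma edges_covers: "edges \<Gamma> = cover_edges (verts \<Gamma>) (tle \<Gamma> r)"
proof (intro Set.set_eqI iffI)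
  fix e assume e: "e \<in> edges \<Gamma>"
  then obtain u v where uv: "e = {u, v}" "u \<noteq> v" "u \<in> verts \<Gamma>" "v \<in> verts \<Gamma>"
    using edge_subset[OF e] by (auto simp: card_2_iff)
  show "e \<in> cover_edges (verts \<Gamma>) (tle \<Gamma> r)"
  proof (cases "tle \<Gamma> r v u")
    case True
    hence "\<not> tle \<Gamma> r u v" using tle_antisym uv by blast
    hence "cov v u" using snoc_covers tpath_snoc[of v u] e uv by (metis insert_commute)
    thus ?thesis using uv by (auto simp: cover_edges_def)
  next
    case False
    hence "cov u v" using snoc_covers tpath_snoc[of u v] e uv by metis
    thus ?thesis using uv by (auto simp: cover_edges_def)
  qed
next
  fix e assume "e \<in> cover_edges (verts \<Gamma>) (tle \<Gamma> r)"
  then obtain u v where uv: "cov u v" "e = {u, v}" by (auto simp: cover_edges_def)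
  have V: "u \<in> verts \<Gamma>" "v \<in> verts \<Gamma>" and leq: "tle \<Gamma> r u v" and ne: "u \<noteq> v" using covD[OF uv(1)] by auto
  obtain q where q: "tpath \<Gamma> r v = tpath \<Gamma> r u @ q" using tle_prefix V leq by blast
  have "q \<noteq> []"
  proof
    assume "q = []"
    hence "tpath \<Gamma> r v = tpath \<Gamma> r u" using q by simp
    thus False using last_tpath(1)[OF V(1)] last_tpath(1)[OF V(2)] ne by simp
  qed
  then obtain x q' where x: "q = x # q'" by (cases q) auto
  have px: "tpath \<Gamma> r x = tpath \<Gamma> r u @ [x]" using tpath_prefix[OF V(2), of "tpath \<Gamma> r u" x q'] q x by simp
  have xV: "x \<in> verts \<Gamma>" "tle \<Gamma> r x v" using q x tle_verts V by (auto simp: tle_def)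
  moreover have "u \<in> set (tpath \<Gamma> r u)" using last_tpath[OF V(1)] last_in_set by metis
  hence "tle \<Gamma> r u x" by (simp add: tle_def px)
  ultimately have "x = u \<or> x = v" using cov_between uv by blast
  moreover have "x \<noteq> u" using px by (metis append_self_conv list.distinct(1))
  ultimately have "x = v" by simp
  hence "tree_path \<Gamma> r (tpath \<Gamma> r u @ [v]) v" using tpath[OF root_in V(2)] px by simp
  hence "{last (tpath \<Gamma> r u), v} \<in> edges \<Gamma>"
    using last_tpath(2)[OF V(1)] by (simp add: tree_path_def successively_append_iff)
  thus "e \<in> edges \<Gamma>" using uv last_tpath[OF V(1)] by simp
qed

sublocale tree_order_graph \<Gamma> r "tle \<Gamma> r"
  by unfold_locales (rule edges_covers)

end

section \<open>Tropical curves rooted at a marking\<close>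

definition sep :: "'a tcurve \<Rightarrow> nat set \<Rightarrow> 'a \<Rightarrow> 'a \<Rightarrow> bool" where
  "sep \<Gamma> e a b \<longleftrightarrow> e \<in> path_edges (tpath \<Gamma> (leaf \<Gamma> a) (leaf \<Gamma> b))"

text \<open>Separation means lying on different sides of \<open>e\<close>, so once \<open>a\<close>,
  \<open>b\<close> are on one side and \<open>c\<close>, \<open>d\<close> on one side, separating
  \<open>a\<close> from \<open>c\<close> separates the two pairs.\<close>

definition seps :: "'a tcurve \<Rightarrow> nat set \<Rightarrow> 'a \<Rightarrow> 'a \<Rightarrow> 'a \<Rightarrow> 'a \<Rightarrow> bool" where
  "seps \<Gamma> e a b c d \<longleftrightarrow> \<not> sep \<Gamma> e a b \<and> \<not> sep \<Gamma> e c d \<and> sep \<Gamma> e a c"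

text \<open>If the curve splits the four markings as \<open>ab|cd\<close>, this is the length of the
  bounded edge left after forgetting all other ends. The lengths are a separate argument because the
  same tree is later given arbitrary real lengths.\<close>

definition lamf :: "'a tcurve \<Rightarrow> (nat set \<Rightarrow> real) \<Rightarrow> 'a \<Rightarrow> 'a \<Rightarrow> 'a \<Rightarrow> 'a \<Rightarrow> real" where
  "lamf \<Gamma> l a b c d = (\<Sum>e\<in>{e \<in> bounded_edges \<Gamma>. seps \<Gamma> e a b c d}. l e)"

context rooted_tree begin

definition ch :: "nat \<Rightarrow> nat set" where "ch v = {c. cov v c}"

lemma ch_subset: "ch v \<subseteq> verts \<Gamma>" using covD by (auto simp: ch_def)

lemma finite_ch: "finite (ch v)" using ch_subset fin finite_subset by blast

lemma valence_ch:
  assumes v: "v \<in> verts \<Gamma>"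
  shows "valence \<Gamma> v = card (ch v) + (if v = r then 0 else 1)"
proof -
  let ?up = "{e. \<exists>u. cov u v \<and> e = {u, v}}"
  have eq: "{e \<in> edges \<Gamma>. v \<in> e} = (\<lambda>c. {v, c}) ` ch v \<union> ?up"
    unfolding edges_eq cover_edges_def ch_def by auto
  have inj: "inj_on (\<lambda>c. {v, c}) (ch v)" by (auto simp: inj_on_def doubleton_eq_iff)
  have disj: "(\<lambda>c. {v, c}) ` ch v \<inter> ?up = {}"
  proof -
    have "{v, c} \<noteq> {u, v}" if "cov v c" "cov u v" for c u
      using cov_inj[OF that] covD[OF that(1)] by auto
    thus ?thesis by (auto simp: ch_def)
  qed
  have up: "finite ?up \<and> card ?up = (if v = r then 0 else 1)"
  proof (cases "v = r")
    case True thus ?thesis using cov_root by simp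
  next
    case False
    then obtain u where u: "cov u v" using ex_parent v by blast
    have "?up = {{u, v}}" using u cov_unique by auto
    thus ?thesis using False by simp
  qed
  show ?thesis unfolding valence_def eq
    using card_Un_disjoint[OF _ _ disj] up finite_ch card_image[OF inj] by simp
qed

end

section \<open>Clusters: the markings above a vertex\<close>

locale marked_tree =
  fixes A :: "'a set" and \<Gamma> :: "'a tcurve" and \<rho> :: 'a
  assumes trop: "tropical_curve A \<Gamma>" and rho: "\<rho> \<in> A"
begin

abbreviation "r \<equiv> leaf \<Gamma> \<rho>"

lemma finA: "finite A" and cardA: "card A \<ge> 3" and tree': "is_tree \<Gamma>"
  and val2: "v \<in> verts \<Gamma> \<Longrightarrow> valence \<Gamma> v \<noteq> 2"
  and leaf_bij: "bij_betw (leaf \<Gamma>) A {v \<in> verts \<Gamma>. valence \<Gamma> v = 1}"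
  and len_pos: "e \<in> bounded_edges \<Gamma> \<Longrightarrow> len \<Gamma> e > 0"
  using trop by (simp_all add: tropical_curve_def)

lemma leaf_in: "a \<in> A \<Longrightarrow> leaf \<Gamma> a \<in> verts \<Gamma>" and leaf_val: "a \<in> A \<Longrightarrow> valence \<Gamma> (leaf \<Gamma> a) = 1"
  using bij_betwE[OF leaf_bij] by blast+

lemma leaf_inj: "a \<in> A \<Longrightarrow> b \<in> A \<Longrightarrow> leaf \<Gamma> a = leaf \<Gamma> b \<Longrightarrow> a = b"
  using leaf_bij by (meson bij_betw_imp_inj_on inj_onD)

sublocale rooted_tree \<Gamma> "leaf \<Gamma> \<rho>"
  using tree' leaf_in rho by unfold_locales auto

abbreviation tl :: "nat \<Rightarrow> nat \<Rightarrow> bool" (infix "\<preceq>" 50) where "u \<preceq> v \<equiv> tle \<Gamma> r u v"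

lemma ch_leaf: "a \<in> A \<Longrightarrow> a \<noteq> \<rho> \<Longrightarrow> ch (leaf \<Gamma> a) = {}"
  using valence_ch[OF leaf_in] leaf_val leaf_inj rho finite_ch by fastforce

lemma card_ch_root: "card (ch r) = 1"
  using valence_ch[OF leaf_in[OF rho]] leaf_val[OF rho] by simp

lemma leaf_if_val1: "v \<in> verts \<Gamma> \<Longrightarrow> valence \<Gamma> v = 1 \<Longrightarrow> \<exists>a\<in>A. v = leaf \<Gamma> a"
  using leaf_bij unfolding bij_betw_def by blast

lemma leaf_if_no_ch: "v \<in> verts \<Gamma> \<Longrightarrow> ch v = {} \<Longrightarrow> \<exists>a\<in>A. a \<noteq> \<rho> \<and> v = leaf \<Gamma> a"
proof -
  assume v: "v \<in> verts \<Gamma>" "ch v = {}"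
  hence "v \<noteq> r" using card_ch_root by auto
  moreover from this have "valence \<Gamma> v = 1" using valence_ch[OF v(1)] v(2) by simp
  ultimately show "\<exists>a\<in>A. a \<noteq> \<rho> \<and> v = leaf \<Gamma> a" using leaf_if_val1[OF v(1)] by auto
qed

lemma card_ch_inner:
  assumes "v \<in> verts \<Gamma>" "valence \<Gamma> v \<noteq> 1" shows "card (ch v) \<ge> 2" "v \<noteq> r"
proof -
  show n: "v \<noteq> r" using leaf_val[OF rho] assms by auto
  have "card (ch v) \<noteq> 0" using valence_ch[OF assms(1)] n assms(2) by simp
  moreover have "card (ch v) \<noteq> 1" using valence_ch[OF assms(1)] n val2[OF assms(1)] by simp
  ultimately show "card (ch v) \<ge> 2" by simp
qed

text \<open>Clusters form a laminar family that determines the tree. Only the root has a cluster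
  containing \<rho>, so the cluster of any other vertex names one side of the edge below it, the
  side away from \<rho>.\<close>

definition cl :: "nat \<Rightarrow> 'a set" where "cl v = {a \<in> A. v \<preceq> leaf \<Gamma> a}"

lemma cl_subset: "cl v \<subseteq> A" by (auto simp: cl_def)

lemma finite_cl: "finite (cl v)" using cl_subset finA finite_subset by blast

lemma cl_nonempty: assumes "v \<in> verts \<Gamma>" shows "cl v \<noteq> {}"
proof -
  obtain m where m: "m \<in> verts \<Gamma>" "v \<preceq> m" "\<forall>w. \<not> cov m w" using ex_maximal_above[OF assms] by blast
  hence "ch m = {}" by (auto simp: ch_def)
  then obtain a where "a \<in> A" "m = leaf \<Gamma> a" using leaf_if_no_ch m by blast
  thus ?thesis using m by (auto simp: cl_def)
qed

lemma cl_mono: assumes "v \<in> verts \<Gamma>" "w \<in> verts \<Gamma>" "v \<preceq> w" shows "cl w \<subseteq> cl v"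
  using trans[OF assms(1,2) leaf_in assms(3)] by (auto simp: cl_def)

lemma cl_root: "cl r = A" using bot leaf_in by (auto simp: cl_def)

lemma rho_notin_cl: "v \<in> verts \<Gamma> \<Longrightarrow> v \<noteq> r \<Longrightarrow> \<rho> \<notin> cl v"
  using antisym bot root_in by (auto simp: cl_def)

lemma leaf_maximal:
  assumes "a \<in> A" "a \<noteq> \<rho>" "w \<in> verts \<Gamma>" "leaf \<Gamma> a \<preceq> w" shows "w = leaf \<Gamma> a"
  using ex_cov_above[OF assms(3) leaf_in[OF assms(1)] assms(4)] ch_leaf[OF assms(1,2)]
  by (auto simp: ch_def)

lemma cl_leaf: "a \<in> A \<Longrightarrow> a \<noteq> \<rho> \<Longrightarrow> cl (leaf \<Gamma> a) = {a}"
  using leaf_maximal leaf_inj leaf_in refl by (auto simp: cl_def)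

lemma cl_disjoint: "cov v c \<Longrightarrow> cov v c' \<Longrightarrow> c \<noteq> c' \<Longrightarrow> cl c \<inter> cl c' = {}"
  using disjoint_children leaf_in unfolding cl_def by blast

lemma ch_cases:
  assumes "v \<in> verts \<Gamma>" "a \<in> cl v" "v \<noteq> leaf \<Gamma> a"
  shows "\<exists>c. cov v c \<and> a \<in> cl c"
proof -
  have "a \<in> A" "v \<preceq> leaf \<Gamma> a" using assms(2) by (auto simp: cl_def)
  then obtain c where "cov v c" "c \<preceq> leaf \<Gamma> a" using ex_cov_above[OF leaf_in assms(1)] assms(3) by blast
  thus ?thesis using \<open>a \<in> A\<close> by (auto simp: cl_def)
qed

lemma inner_two:
  assumes "v \<in> verts \<Gamma>" "valence \<Gamma> v \<noteq> 1"
  obtains c c' a b where "cov v c" "cov v c'" "c \<noteq> c'" "a \<in> cl c" "b \<in> cl c'" "a \<noteq> b" "a \<in> cl v" "b \<in> cl v"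
proof -
  obtain c c' where c: "c \<in> ch v" "c' \<in> ch v" "c \<noteq> c'"
    using card_ch_inner[OF assms] by (metis One_nat_def Suc_1 card_le_Suc0_iff_eq finite_ch not_less_eq_eq)
  hence cv: "cov v c" "cov v c'" by (auto simp: ch_def)
  obtain a where a: "a \<in> cl c" using cl_nonempty covD[OF cv(1)] by blast
  obtain b where b: "b \<in> cl c'" using cl_nonempty covD[OF cv(2)] by blast
  have "a \<noteq> b" using a b cl_disjoint[OF cv c(3)] by blast
  moreover have "a \<in> cl v" using a cl_mono covD[OF cv(1)] by blast
  moreover have "b \<in> cl v" using b cl_mono covD[OF cv(2)] by blast
  ultimately show thesis using that cv c a b by blast
qed

lemma laminar:
  assumes "v \<in> verts \<Gamma>" "w \<in> verts \<Gamma>" "a \<in> cl v" "a \<in> cl w"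
  shows "v \<preceq> w \<or> w \<preceq> v"
  using chain[OF assms(1,2) leaf_in] assms(3,4) by (auto simp: cl_def)

text \<open>The absence of two-valent vertices enters here. An inner vertex has two children with
  disjoint nonempty clusters, so its cluster is not contained in that of a single child; at the root
  the same follows since its cluster contains \<rho>. Hence clusters shrink strictly on the way
  up.\<close>

lemma le_if_cl_subset:
  assumes v: "v \<in> verts \<Gamma>" and w: "w \<in> verts \<Gamma>" and sub: "cl w \<subseteq> cl v"
  shows "v \<preceq> w"
proof (rule ccontr)
  assume n: "\<not> v \<preceq> w"
  obtain a where a: "a \<in> cl w" using cl_nonempty w by blast
  hence "w \<preceq> v" using laminar[OF v w] sub n by blast
  hence "w \<noteq> v" using n refl v by blast
  then obtain c where c: "cov w c" "c \<preceq> v" using ex_cov_above[OF v w \<open>w \<preceq> v\<close>] by blast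
  have sub': "cl w \<subseteq> cl c" using sub cl_mono[OF covD(2)[OF c(1)] v c(2)] by blast
  show False
  proof (cases "w = r")
    case True
    hence "\<rho> \<in> cl v" using sub cl_root rho by auto
    hence "v = r" using rho_notin_cl v by blast
    thus False using True \<open>w \<noteq> v\<close> by simp
  next
    case False
    hence "valence \<Gamma> w \<noteq> 1" using c(1) valence_ch[OF w] finite_ch by (auto simp: ch_def card_eq_0_iff)
    then obtain c1 c2 a b where "cov w c1" "cov w c2" "c1 \<noteq> c2" "a \<in> cl c1" "b \<in> cl c2" "a \<in> cl w" "b \<in> cl w"
      using inner_two[OF w] by metis
    moreover have "c = c1 \<or> cl c \<inter> cl c1 = {}" "c = c2 \<or> cl c \<inter> cl c2 = {}"
      using cl_disjoint calculation c by blast+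
    ultimately show False using sub' by blast
  qed
qed

lemma cl_inj: "v \<in> verts \<Gamma> \<Longrightarrow> w \<in> verts \<Gamma> \<Longrightarrow> cl v = cl w \<Longrightarrow> v = w"
  using le_if_cl_subset antisym by (metis subset_refl)

lemma le_iff: "v \<in> verts \<Gamma> \<Longrightarrow> w \<in> verts \<Gamma> \<Longrightarrow> v \<preceq> w \<longleftrightarrow> cl w \<subseteq> cl v"
  using le_if_cl_subset cl_mono by blast

section \<open>Bounded edges and the splits they induce\<close>

definition apex :: nat where "apex = (THE c. cov r c)"

lemma apex: "cov r apex" "cov r c \<Longrightarrow> c = apex"
proof -
  obtain x where x: "ch r = {x}" using card_ch_root by (metis card_1_singletonE)
  have c: "cov r x" "\<And>c. cov r c \<Longrightarrow> c = x" using x unfolding ch_def by blast+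
  have "apex = x" unfolding apex_def using c by (rule the_equality)
  thus "cov r apex" "cov r c \<Longrightarrow> c = apex" using c by blast+
qed

lemma cl_apex: "cl apex = A - {\<rho>}"
proof
  show "cl apex \<subseteq> A - {\<rho>}"
    using rho_notin_cl[OF covD(2)[OF apex(1)] not_sym[OF covD(3)[OF apex(1)]]] cl_subset by blast
  show "A - {\<rho>} \<subseteq> cl apex"
  proof
    fix a assume a: "a \<in> A - {\<rho>}"
    hence "r \<noteq> leaf \<Gamma> a" using leaf_inj rho by blast
    then obtain c where "cov r c" "a \<in> cl c" using ch_cases[OF root_in, of a] a cl_root by auto
    thus "a \<in> cl apex" using apex(2) by simp
  qed
qed

text \<open>A bounded edge is represented by its vertex farther from the root. Excluded are the
  upper vertices of the ends: \<open>apex\<close> for the end at the root, one-valent vertices for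
  the others.\<close>

definition bv :: "nat set" where
  "bv = {v \<in> verts \<Gamma>. v \<noteq> r \<and> v \<noteq> apex \<and> valence \<Gamma> v \<noteq> 1}"

definition par :: "nat \<Rightarrow> nat" where "par v = (THE u. cov u v)"

lemma par: assumes "v \<in> verts \<Gamma>" "v \<noteq> r" shows "cov (par v) v"
proof -
  obtain u where "cov u v" using ex_parent assms by blast
  hence "\<exists>!u. cov u v" using cov_unique by blast
  thus ?thesis unfolding par_def by (rule theI')
qed

lemma par_eq: "cov u v \<Longrightarrow> par v = u"
  using cov_unique unfolding par_def by blast

definition eb :: "nat \<Rightarrow> nat set" where "eb v = {par v, v}"

lemma par_inner:
  assumes "v \<in> verts \<Gamma>" "v \<noteq> r" "v \<noteq> apex"
  shows "valence \<Gamma> (par v) \<noteq> 1" "par v \<noteq> r" "par v \<in> verts \<Gamma>"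
proof -
  note c = par[OF assms(1,2)]
  show n: "par v \<noteq> r" using apex(2) c assms by metis
  show p: "par v \<in> verts \<Gamma>" using covD[OF c] by blast
  have "v \<in> ch (par v)" using c by (simp add: ch_def)
  hence "card (ch (par v)) \<noteq> 0" using finite_ch by auto
  thus "valence \<Gamma> (par v) \<noteq> 1" using valence_ch[OF p] n by simp
qed

lemma bounded_eq: "bounded_edges \<Gamma> = eb ` bv"
proof (intro Set.set_eqI iffI)
  fix e assume "e \<in> bounded_edges \<Gamma>"
  hence e: "e \<in> edges \<Gamma>" "\<forall>v\<in>e. valence \<Gamma> v \<noteq> 1" by (auto simp: bounded_edges_def)
  then obtain u v where uv: "cov u v" "e = {u, v}" using edge_cov by blast
  have "u \<noteq> r" using e(2) uv leaf_val[OF rho] by auto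
  hence "v \<noteq> apex" using cov_unique[OF uv(1)] apex(1) by blast
  moreover have "v \<noteq> r" using cov_root uv by blast
  ultimately have "v \<in> bv" using uv e covD by (auto simp: bv_def)
  moreover have "e = eb v" using uv par_eq by (simp add: eb_def)
  ultimately show "e \<in> eb ` bv" by blast
next
  fix e assume "e \<in> eb ` bv"
  then obtain v where v: "v \<in> bv" "e = eb v" by blast
  hence v': "v \<in> verts \<Gamma>" "v \<noteq> r" "v \<noteq> apex" "valence \<Gamma> v \<noteq> 1" by (auto simp: bv_def)
  show "e \<in> bounded_edges \<Gamma>"
    using par[OF v'(1,2)] par_inner[OF v'(1-3)] v' v
    by (auto simp: bounded_edges_def edges_eq cover_edges_def eb_def)
qed

lemma bvD: assumes "v \<in> bv" shows "v \<in> verts \<Gamma>" "v \<noteq> r" "v \<noteq> apex" "valence \<Gamma> v \<noteq> 1" "cov (par v) v"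
  using assms par by (auto simp: bv_def)

lemma eb_inj: "inj_on eb bv"
proof (rule inj_onI)
  fix v w assume "v \<in> bv" "w \<in> bv" "eb v = eb w"
  thus "v = w" using cov_inj[OF bvD(5) bvD(5)] unfolding eb_def by blast
qed

lemma finite_bv: "finite bv" using fin by (simp add: bv_def)

lemma finite_bounded: "finite (bounded_edges \<Gamma>)" using finite_bv bounded_eq by simp

lemma sep_cov:
  assumes "cov u v" "a \<in> A" "b \<in> A"
  shows "sep \<Gamma> {u, v} a b \<longleftrightarrow> ((a \<in> cl v) \<noteq> (b \<in> cl v))"
  using path_cross[OF tpath[OF leaf_in leaf_in] assms(1), OF assms(2,3)] assms(2,3)
  by (simp add: sep_def cl_def)

lemma sep_eb: "v \<in> bv \<Longrightarrow> a \<in> A \<Longrightarrow> b \<in> A \<Longrightarrow> sep \<Gamma> (eb v) a b \<longleftrightarrow> ((a \<in> cl v) \<noteq> (b \<in> cl v))"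
  using sep_cov[OF bvD(5)] by (simp add: eb_def)

lemma seps_eb: "v \<in> bv \<Longrightarrow> a \<in> A \<Longrightarrow> b \<in> A \<Longrightarrow> c \<in> A \<Longrightarrow> d \<in> A \<Longrightarrow>
   seps \<Gamma> (eb v) a b c d \<longleftrightarrow> (a \<in> cl v \<longleftrightarrow> b \<in> cl v) \<and> (c \<in> cl v \<longleftrightarrow> d \<in> cl v) \<and> (a \<in> cl v) \<noteq> (c \<in> cl v)"
  by (auto simp: seps_def sep_eb)

text \<open>A cluster containing exactly one of the pairs \<open>ab\<close>, \<open>cd\<close> and a
  cluster containing exactly one of the pairs \<open>ac\<close>, \<open>bd\<close> share one of the
  four markings, yet neither contains the other; clusters are laminar.\<close>

lemma seps_compat:
  assumes "e \<in> bounded_edges \<Gamma>" "e' \<in> bounded_edges \<Gamma>" "a \<in> A" "b \<in> A" "c \<in> A" "d \<in> A"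
    and "seps \<Gamma> e a b c d" "seps \<Gamma> e' a c b d"
  shows False
proof -
  obtain v w where vw: "v \<in> bv" "w \<in> bv" "e = eb v" "e' = eb w" using assms(1,2) by (auto simp: bounded_eq)
  have 1: "(a \<in> cl v \<longleftrightarrow> b \<in> cl v) \<and> (c \<in> cl v \<longleftrightarrow> d \<in> cl v) \<and> (a \<in> cl v) \<noteq> (c \<in> cl v)"
    using assms(7) unfolding vw(3) seps_eb[OF vw(1) assms(3-6)] .
  have 2: "(a \<in> cl w \<longleftrightarrow> c \<in> cl w) \<and> (b \<in> cl w \<longleftrightarrow> d \<in> cl w) \<and> (a \<in> cl w) \<noteq> (b \<in> cl w)"
    using assms(8) unfolding vw(4) seps_eb[OF vw(2) assms(3,5,4,6)] .
  obtain x where x: "x \<in> cl v" "x \<in> cl w" using 1 2 by blast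
  hence "cl w \<subseteq> cl v \<or> cl v \<subseteq> cl w"
    using laminar[OF bvD(1)[OF vw(1)] bvD(1)[OF vw(2)]] cl_mono bvD(1) vw(1,2) by meson
  thus False using 1 2 by blast
qed

text \<open>The markings \<open>a\<close> and \<open>b\<close> come from two children of
  \<open>v\<close>, and \<open>c\<close> from a sibling of \<open>v\<close>. A cluster containing
  \<open>a\<close> and \<open>b\<close> belongs to a vertex not above a child of \<open>v\<close>,
  and one missing \<open>c\<close> to a vertex not below the parent of \<open>v\<close>.\<close>

lemma bv_witness:
  assumes v: "v \<in> bv"
  obtains a b c where "a \<in> cl v" "b \<in> cl v" "a \<noteq> b" "c \<in> A" "c \<noteq> \<rho>" "c \<notin> cl v"
    "\<forall>w\<in>verts \<Gamma>. a \<in> cl w \<and> b \<in> cl w \<and> c \<notin> cl w \<longrightarrow> w = v"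
proof -
  note vD = bvD[OF v]
  obtain c1 c2 a b where ab: "cov v c1" "cov v c2" "c1 \<noteq> c2" "a \<in> cl c1" "b \<in> cl c2" "a \<noteq> b" "a \<in> cl v" "b \<in> cl v"
    using inner_two[OF vD(1,4)] by blast
  note pD = par_inner[OF vD(1-3)]
  obtain x where x: "x \<in> ch (par v)" "x \<noteq> v"
    using card_ch_inner[OF pD(3,1)] by (metis One_nat_def Suc_1 card_le_Suc0_iff_eq finite_ch not_less_eq_eq)
  hence cx: "cov (par v) x" by (simp add: ch_def)
  obtain c where c: "c \<in> cl x" using cl_nonempty covD[OF cx] by blast
  have "c \<notin> cl v" using c cl_disjoint[OF cx vD(5) x(2)] by blast
  moreover have cp: "c \<in> cl (par v)" using c cl_mono covD[OF cx] by blast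
  moreover have "c \<in> A" "c \<noteq> \<rho>" using cp cl_subset rho_notin_cl pD by blast+
  moreover have "w = v" if w: "w \<in> verts \<Gamma>" "a \<in> cl w" "b \<in> cl w" "c \<notin> cl w" for w
  proof -
    have "w \<preceq> v"
    proof (rule ccontr)
      assume n: "\<not> w \<preceq> v"
      hence vw: "v \<preceq> w" using laminar[OF vD(1) w(1) ab(7) w(2)] by blast
      have "v \<noteq> w" using n refl w by blast
      then obtain z where z: "cov v z" "z \<preceq> w" using ex_cov_above[OF w(1) vD(1) vw] by blast
      hence "a \<in> cl z" "b \<in> cl z" using w cl_mono covD[OF z(1)] by blast+
      thus False using cl_disjoint[OF z(1) ab(1)] cl_disjoint[OF z(1) ab(2)] ab by blast
    qed
    moreover have "\<not> w \<preceq> par v" using cl_mono[OF w(1) pD(3)] cp w(4) by blast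
    ultimately show ?thesis using cov_le[OF vD(5) w(1)] by blast
  qed
  ultimately show thesis using that ab by blast
qed

text \<open>Together with the root marking the three markings of \<open>bv_witness\<close> isolate a
  single edge, so each edge length is itself a quartet value.\<close>

lemma edge_witness:
  assumes "e \<in> bounded_edges \<Gamma>"
  obtains a b c d where "distinct [a, b, c, d]" "{a, b, c, d} \<subseteq> A"
    "\<forall>e'\<in>bounded_edges \<Gamma>. seps \<Gamma> e' a b c d \<longleftrightarrow> e' = e"
proof -
  obtain v where v: "v \<in> bv" "e = eb v" using assms unfolding bounded_eq by blast
  obtain a b c where abc: "a \<in> cl v" "b \<in> cl v" "a \<noteq> b" "c \<in> A" "c \<noteq> \<rho>" "c \<notin> cl v"
    and u: "\<forall>w\<in>verts \<Gamma>. a \<in> cl w \<and> b \<in> cl w \<and> c \<notin> cl w \<longrightarrow> w = v"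
    by (rule bv_witness[OF v(1)])
  have r: "w \<in> bv \<Longrightarrow> \<rho> \<notin> cl w" for w using rho_notin_cl bvD by blast
  have A: "a \<in> A" "b \<in> A" using abc cl_subset by blast+
  show thesis
  proof (rule that[of a b c \<rho>])
    show "distinct [a, b, c, \<rho>]" using abc r[OF v(1)] by auto
    show "{a, b, c, \<rho>} \<subseteq> A" using A abc rho by auto
    show "\<forall>e'\<in>bounded_edges \<Gamma>. seps \<Gamma> e' a b c \<rho> \<longleftrightarrow> e' = e"
    proof
    fix e' assume "e' \<in> bounded_edges \<Gamma>"
    then obtain w where w: "w \<in> bv" "e' = eb w" unfolding bounded_eq by blast
    have "seps \<Gamma> e' a b c \<rho> \<longleftrightarrow> a \<in> cl w \<and> b \<in> cl w \<and> c \<notin> cl w"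
      using seps_eb[OF w(1) A abc(4) rho] r[OF w(1)] w(2) by auto
    also have "\<dots> \<longleftrightarrow> w = v" using u bvD(1)[OF w(1)] abc by blast
    also have "\<dots> \<longleftrightarrow> e' = e" using eb_inj v w by (auto simp: inj_on_def)
    finally show "seps \<Gamma> e' a b c \<rho> \<longleftrightarrow> e' = e" .
    qed
  qed
qed

lemma lamf_rho:
  assumes "a \<in> A" "b \<in> A" "c \<in> A"
  shows "lamf \<Gamma> l a b c \<rho> = (\<Sum>v\<in>{v \<in> bv. a \<in> cl v \<and> b \<in> cl v \<and> c \<notin> cl v}. l (eb v))"
proof -
  have r: "w \<in> bv \<Longrightarrow> \<rho> \<notin> cl w" for w using rho_notin_cl bvD by blast
  have "{e \<in> bounded_edges \<Gamma>. seps \<Gamma> e a b c \<rho>} = eb ` {v \<in> bv. a \<in> cl v \<and> b \<in> cl v \<and> c \<notin> cl v}"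
    unfolding bounded_eq using seps_eb[OF _ assms rho] r by auto
  moreover have "inj_on eb {v \<in> bv. a \<in> cl v \<and> b \<in> cl v \<and> c \<notin> cl v}"
    using eb_inj by (rule inj_on_subset) auto
  ultimately show ?thesis unfolding lamf_def by (simp add: sum.reindex)
qed

text \<open>Makes clusters a matter of quartet values alone. Conversely to the obvious direction,
  let \<open>v\<close> be a highest vertex whose cluster contains \<open>S\<close>. If
  \<open>c\<close> in its cluster were missing from \<open>S\<close>, choose \<open>a\<close>,
  \<open>b\<close> in \<open>S\<close> not above a common child of \<open>v\<close>; an edge
  separating \<open>a\<close>, \<open>b\<close> from \<open>c\<close>, \<rho> would have to lie
  above \<open>v\<close>, hence above one child, and could not be below both \<open>a\<close> and
  \<open>b\<close>.\<close>

lemma cluster_iff: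
  assumes S: "S \<subseteq> A - {\<rho>}" "card S \<ge> 2" "S \<noteq> A - {\<rho>}"
  shows "S \<in> cl ` verts \<Gamma> \<longleftrightarrow> (\<forall>a\<in>S. \<forall>b\<in>S. \<forall>c\<in>A - {\<rho>} - S. a \<noteq> b \<longrightarrow> lamf \<Gamma> (len \<Gamma>) a b c \<rho> > 0)"
    (is "_ \<longleftrightarrow> ?R")
proof
  assume "S \<in> cl ` verts \<Gamma>"
  then obtain v where v: "v \<in> verts \<Gamma>" "S = cl v" by blast
  have "v \<noteq> r" using v S cl_root rho by auto
  moreover have "v \<noteq> apex" using v S cl_apex by auto
  moreover have "valence \<Gamma> v \<noteq> 1"
  proof
    assume "valence \<Gamma> v = 1"
    then obtain a where "a \<in> A" "v = leaf \<Gamma> a" using leaf_if_val1 v by blast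
    thus False using cl_leaf[of a] v S(2) \<open>v \<noteq> r\<close> by (cases "a = \<rho>") auto
  qed
  ultimately have vb: "v \<in> bv" using v by (simp add: bv_def)
  show ?R
  proof (intro ballI impI)
    fix a b c assume abc: "a \<in> S" "b \<in> S" "c \<in> A - {\<rho>} - S" "a \<noteq> b"
    hence A: "a \<in> A" "b \<in> A" "c \<in> A" using S by auto
    have "0 < (\<Sum>v\<in>{v \<in> bv. a \<in> cl v \<and> b \<in> cl v \<and> c \<notin> cl v}. len \<Gamma> (eb v))"
      using vb abc v finite_bv len_pos by (intro sum_pos2[where i=v]) (auto simp: bounded_eq intro: less_imp_le)
    thus "lamf \<Gamma> (len \<Gamma>) a b c \<rho> > 0" using lamf_rho[OF A] by simp
  qed
next
  assume R: ?R
  let ?U = "{v \<in> verts \<Gamma>. S \<subseteq> cl v}"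
  have U: "finite ?U" "r \<in> ?U" using fin S cl_root root_in by auto
  obtain v where v: "v \<in> ?U" "\<And>x. x \<in> ?U \<Longrightarrow> rank x \<le> rank v"
  proof -
    have "Max (rank ` ?U) \<in> rank ` ?U" using U by (intro Max_in) auto
    then obtain v where "v \<in> ?U" "rank v = Max (rank ` ?U)" by auto
    thus thesis using that[of v] U Max_ge[of "rank ` ?U"] by auto
  qed
  have vV: "v \<in> verts \<Gamma>" "S \<subseteq> cl v" using v(1) by auto
  have notin: "\<not> S \<subseteq> cl c" if "cov v c" for c
  proof
    assume "S \<subseteq> cl c"
    hence "rank c \<le> rank v" using v(2)[of c] covD(2)[OF that] by blast
    moreover have "rank v < rank c"
      using covD[OF that] by (intro rank_less)
    ultimately show False by simp
  qed
  have "v \<noteq> r"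
  proof
    assume "v = r"
    hence "cov v apex" using apex(1) by simp
    from notin[OF this] show False using cl_apex S(1) by simp
  qed
  have nl: "v \<noteq> leaf \<Gamma> a" if "a \<in> S" for a
  proof
    assume "v = leaf \<Gamma> a"
    hence "S \<subseteq> {a}" using vV cl_leaf[of a] that S \<open>v \<noteq> r\<close> by auto
    thus False using S(2) by (metis card.empty card.insert card_mono empty_iff finite.emptyI finite.insertI le_trans
       not_less_eq_eq numeral_2_eq_2)
  qed
  have "cl v \<subseteq> S"
  proof
    fix c assume c: "c \<in> cl v"
    show "c \<in> S"
    proof (rule ccontr)
      assume cS: "c \<notin> S"
      have cA: "c \<in> A - {\<rho>} - S" using c cS cl_subset rho_notin_cl[OF vV(1) \<open>v \<noteq> r\<close>] by blast
      obtain a where a: "a \<in> S" using S(2) by fastforce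
      then obtain x where x: "cov v x" "a \<in> cl x" using ch_cases[OF vV(1), of a] nl vV by blast
      obtain b where b: "b \<in> S" "b \<notin> cl x" using notin[OF x(1)] by blast
      have A: "a \<in> A" "b \<in> A" "c \<in> A" "a \<noteq> b" using a b S cA x by auto
      have "lamf \<Gamma> (len \<Gamma>) a b c \<rho> > 0" using R a b cA A by blast
      hence "{v \<in> bv. a \<in> cl v \<and> b \<in> cl v \<and> c \<notin> cl v} \<noteq> {}"
        using lamf_rho[OF A(1-3)] by (metis less_irrefl sum.empty)
      then obtain w where w: "w \<in> bv" "a \<in> cl w" "b \<in> cl w" "c \<notin> cl w" by blast
      have nwv: "\<not> w \<preceq> v" using w c cl_mono[OF bvD(1)[OF w(1)] vV(1)] by blast
      hence vw: "v \<preceq> w" using laminar[OF vV(1) bvD(1)[OF w(1)]] w(2) a vV by blast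
      moreover have "v \<noteq> w" using nwv refl vV by blast
      ultimately obtain z where z: "cov v z" "z \<preceq> w" using ex_cov_above[OF bvD(1)[OF w(1)] vV(1)] by blast
      have "a \<in> cl z" "b \<in> cl z" using w z cl_mono covD[OF z(1)] bvD(1)[OF w(1)] by blast+
      hence "z = x" using cl_disjoint[OF z(1) x(1)] x by blast
      thus False using \<open>b \<in> cl z\<close> b by blast
    qed
  qed
  thus "S \<in> cl ` verts \<Gamma>" using vV by blast
qed

lemma clusters_eq:
  "cl ` verts \<Gamma> = {A, A - {\<rho>}} \<union> (\<lambda>a. {a}) ` (A - {\<rho>}) \<union>
    {S. S \<subseteq> A - {\<rho>} \<and> card S \<ge> 2 \<and> S \<noteq> A - {\<rho>} \<and>
      (\<forall>a\<in>S. \<forall>b\<in>S. \<forall>c\<in>A - {\<rho>} - S. a \<noteq> b \<longrightarrow> lamf \<Gamma> (len \<Gamma>) a b c \<rho> > 0)}" (is "?L = ?R")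
proof (rule subset_antisym)
  show "?L \<subseteq> ?R"
  proof
    fix S assume S: "S \<in> ?L"
    then obtain v where v: "v \<in> verts \<Gamma>" "S = cl v" by blast
    show "S \<in> ?R"
    proof (cases "v = r")
      case True thus ?thesis using v cl_root by simp
    next
      case False
      have sub: "S \<subseteq> A - {\<rho>}" using v False rho_notin_cl cl_subset by blast
      have "finite S" "S \<noteq> {}" using v finite_cl cl_nonempty by auto
      hence "card S \<ge> 1" by (simp add: Suc_leI card_gt_0_iff)
      then consider "card S = 1" | "card S \<ge> 2" by linarith
      thus ?thesis
      proof cases
        case 1
        then obtain a where "S = {a}" by (metis card_1_singletonE)
        thus ?thesis using sub by auto
      next
        case 2
        show ?thesis
        proof (cases "S = A - {\<rho>}")
          case F: False
          show ?thesis using cluster_iff[OF sub 2 F] S sub 2 F by blast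
        qed simp
      qed
    qed
  qed
  show "?R \<subseteq> ?L"
  proof
    fix S assume "S \<in> ?R"
    then consider "S = A" | "S = A - {\<rho>}" | a where "S = {a}" "a \<in> A - {\<rho>}" |
      "S \<subseteq> A - {\<rho>}" "card S \<ge> 2" "S \<noteq> A - {\<rho>}" "\<forall>a\<in>S. \<forall>b\<in>S. \<forall>c\<in>A - {\<rho>} - S. a \<noteq> b \<longrightarrow> lamf \<Gamma> (len \<Gamma>) a b c \<rho> > 0"
      by blast
    thus "S \<in> ?L"
    proof cases
      case 1 thus ?thesis using cl_root root_in by (intro image_eqI[of _ _ r]) auto
    next
      case 2 thus ?thesis using cl_apex covD[OF apex(1)] by (intro image_eqI[of _ _ apex]) auto
    next
      case (3 a) thus ?thesis using cl_leaf leaf_in by (intro image_eqI[of _ _ "leaf \<Gamma> a"]) auto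
    next
      case 4 thus ?thesis using cluster_iff[OF 4(1-3)] by blast
    qed
  qed
qed

lemma apex_in: "apex \<in> verts \<Gamma>" "valence \<Gamma> apex \<noteq> 1" "apex \<noteq> r"
proof -
  show t: "apex \<in> verts \<Gamma>" "apex \<noteq> r" using covD[OF apex(1)] by auto
  show "valence \<Gamma> apex \<noteq> 1"
  proof
    assume "valence \<Gamma> apex = 1"
    then obtain a where "a \<in> A" "apex = leaf \<Gamma> a" using leaf_if_val1 t by blast
    hence "A - {\<rho>} = {a}" using cl_leaf[of a] cl_apex t by auto
    hence "card (A - {\<rho>}) = 1" by simp
    thus False using cardA rho finA by simp
  qed
qed

text \<open>Every vertex but the root is a child of exactly one vertex; counting children in two ways
  determines the number of inner vertices of a trivalent curve.\<close>

lemma card_bounded_trivalent: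
  assumes t: "\<forall>v\<in>inner_verts \<Gamma>. valence \<Gamma> v = 3"
  shows "card (bounded_edges \<Gamma>) = card A - 3"
proof -
  let ?I = "inner_verts \<Gamma>" let ?L = "leaf \<Gamma> ` A"
  have V: "verts \<Gamma> = ?I \<union> ?L" "?I \<inter> ?L = {}"
    using leaf_if_val1 leaf_in leaf_val by (auto simp: inner_verts_def)
  have fI: "finite ?I" using fin by (simp add: inner_verts_def)
  have cL: "card ?L = card A" using leaf_inj by (intro card_image inj_onI)
  have "verts \<Gamma> - {r} = (\<Union>v\<in>verts \<Gamma>. ch v)"
  proof (intro Set.set_eqI iffI)
    fix x assume "x \<in> verts \<Gamma> - {r}"
    thus "x \<in> (\<Union>v\<in>verts \<Gamma>. ch v)" using par covD(1) unfolding ch_def by blast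
  next
    fix x assume "x \<in> (\<Union>v\<in>verts \<Gamma>. ch v)"
    thus "x \<in> verts \<Gamma> - {r}" using cov_root covD(2) unfolding ch_def by blast
  qed
  hence "card (verts \<Gamma>) - 1 = card (\<Union>v\<in>verts \<Gamma>. ch v)" using root_in fin by (metis card_Diff_singleton)
  also have "\<dots> = (\<Sum>v\<in>verts \<Gamma>. card (ch v))"
    using fin finite_ch cov_unique by (intro card_UN_disjoint) (auto simp: ch_def)
  also have "\<dots> = (\<Sum>v\<in>?I. card (ch v)) + (\<Sum>v\<in>?L. card (ch v))"
    using V fI finA sum.union_disjoint[of ?I ?L] by simp
  also have "(\<Sum>v\<in>?I. card (ch v)) = (\<Sum>v\<in>?I. 2)"
  proof (rule sum.cong)
    fix v assume v: "v \<in> ?I"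
    hence v': "v \<in> verts \<Gamma>" "valence \<Gamma> v \<noteq> 1" by (simp_all add: inner_verts_def)
    have "valence \<Gamma> v = 3" using t v by blast
    thus "card (ch v) = 2" using valence_ch[OF v'(1)] card_ch_inner(2)[OF v'(1,2)] by simp
  qed simp
  also have "(\<Sum>v\<in>?L. card (ch v)) = (\<Sum>v\<in>{r}. card (ch v))"
  proof (intro sum.mono_neutral_right ballI)
    fix v assume "v \<in> ?L - {r}"
    then obtain a where "a \<in> A" "a \<noteq> \<rho>" "v = leaf \<Gamma> a" by auto
    thus "card (ch v) = 0" using ch_leaf by simp
  qed (use finA rho in auto)
  finally have "card (verts \<Gamma>) - 1 = 2 * card ?I + 1" using card_ch_root by simp
  moreover have "card (verts \<Gamma>) = card ?I + card A" using V fI finA cL card_Un_disjoint[of ?I ?L] by simp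
  ultimately have "card ?I + 2 = card A" by linarith
  moreover have "?I = insert apex bv"
    using apex_in card_ch_inner(2) by (auto simp: inner_verts_def bv_def)
  hence "card ?I = card bv + 1" using finite_bv by (simp add: bv_def)
  moreover have "card (bounded_edges \<Gamma>) = card bv" unfolding bounded_eq by (rule card_image[OF eb_inj])
  ultimately show ?thesis by simp
qed

end

section \<open>Half distances\<close>

text \<open>Changing the lengths of the ends adds \<open>f a + f b\<close> to \<open>H a b\<close>,
  which cancels here. As the ends are infinite, only such combinations are meaningful.\<close>

definition qd :: "('a \<Rightarrow> 'a \<Rightarrow> real) \<Rightarrow> 'a \<Rightarrow> 'a \<Rightarrow> 'a \<Rightarrow> 'a \<Rightarrow> real" where
  "qd H a b c d = H a c + H b d - H a b - H c d"

text \<open>The four-point condition, imposed on distinct markings only: triangle inequalities and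
  diagonal values would again involve the lengths of the ends.\<close>

definition tm :: "'a set \<Rightarrow> ('a \<Rightarrow> 'a \<Rightarrow> real) \<Rightarrow> bool" where
  "tm A H \<longleftrightarrow> (\<forall>a\<in>A. \<forall>b\<in>A. H a b = H b a) \<and>
     (\<forall>a\<in>A. \<forall>b\<in>A. \<forall>c\<in>A. \<forall>d\<in>A. distinct [a, b, c, d] \<longrightarrow>
        H a b + H c d \<le> max (H a c + H b d) (H a d + H b c))"

text \<open>The value zero off the quadruples of distinct markings in \<open>A\<close> turns
  agreement of all quartets into equality of functions, which makes these functions usable as points
  of the moduli space; see \<open>iso_rel_iff\<close>.\<close>

definition quart :: "'a set \<Rightarrow> ('a \<Rightarrow> 'a \<Rightarrow> real) \<Rightarrow> 'a \<times> 'a \<times> 'a \<times> 'a \<Rightarrow> real" where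
  "quart A H = (\<lambda>(a, b, c, d). if distinct [a, b, c, d] \<and> {a, b, c, d} \<subseteq> A then qd H a b c d else 0)"

text \<open>No four markings form a star; for curves this is trivalence, see
  \<open>resolved_iff_trivalent\<close>.\<close>

definition resolved :: "'a set \<Rightarrow> ('a \<Rightarrow> 'a \<Rightarrow> real) \<Rightarrow> bool" where
  "resolved A H \<longleftrightarrow> (\<forall>a\<in>A. \<forall>b\<in>A. \<forall>c\<in>A. \<forall>d\<in>A. distinct [a, b, c, d] \<longrightarrow>
     \<not> (H a b + H c d = H a c + H b d \<and> H a c + H b d = H a d + H b c))"

text \<open>Halved because an edge separating \<open>a\<close>, \<open>b\<close> from
  \<open>c\<close>, \<open>d\<close> lies both on the path from \<open>a\<close> to \<open>c\<close>
  and on the one from \<open>b\<close> to \<open>d\<close>, while \<open>qd\<close> has to count it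
  once.\<close>

definition hd_len :: "'a tcurve \<Rightarrow> (nat set \<Rightarrow> real) \<Rightarrow> 'a \<Rightarrow> 'a \<Rightarrow> real" where
  "hd_len \<Gamma> l a b = (\<Sum>e\<in>bounded_edges \<Gamma>. if sep \<Gamma> e a b then l e else 0) / 2"

abbreviation hdist :: "'a tcurve \<Rightarrow> 'a \<Rightarrow> 'a \<Rightarrow> real" where
  "hdist \<Gamma> \<equiv> hd_len \<Gamma> (len \<Gamma>)"

lemma quartD: "quart A H = quart A H' \<Longrightarrow> distinct [a, b, c, d] \<Longrightarrow> {a, b, c, d} \<subseteq> A \<Longrightarrow> qd H a b c d = qd H' a b c d"
  by (drule fun_cong[of _ _ "(a, b, c, d)"]) (simp add: quart_def)

lemma quartI: "(\<And>a b c d. distinct [a, b, c, d] \<Longrightarrow> {a, b, c, d} \<subseteq> A \<Longrightarrow> qd H a b c d = qd H' a b c d) \<Longrightarrow> quart A H = quart A H'"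
  by (rule ext) (auto simp: quart_def)

context marked_tree begin

text \<open>Hides the root: an edge is just a bipartition of the markings, so symmetric statements
  about separation reduce to deciding sides.\<close>

lemma sep_side:
  assumes "e \<in> bounded_edges \<Gamma>"
  obtains S where "\<And>a b. a \<in> A \<Longrightarrow> b \<in> A \<Longrightarrow> sep \<Gamma> e a b \<longleftrightarrow> ((a \<in> S) \<noteq> (b \<in> S))"
proof -
  obtain v where "v \<in> bv" "e = eb v" using assms unfolding bounded_eq by blast
  thus thesis using that[of "cl v"] sep_eb by blast
qed

lemma seps_sym:
  assumes "e \<in> bounded_edges \<Gamma>" "{a, b, c, d} \<subseteq> A"
  shows "seps \<Gamma> e a b d c \<longleftrightarrow> seps \<Gamma> e a b c d" "seps \<Gamma> e b a c d \<longleftrightarrow> seps \<Gamma> e a b c d"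
    "seps \<Gamma> e c d a b \<longleftrightarrow> seps \<Gamma> e a b c d"
proof -
  obtain S where S: "\<And>a b. a \<in> A \<Longrightarrow> b \<in> A \<Longrightarrow> sep \<Gamma> e a b \<longleftrightarrow> ((a \<in> S) \<noteq> (b \<in> S))"
    using sep_side[OF assms(1)] by metis
  show "seps \<Gamma> e a b d c \<longleftrightarrow> seps \<Gamma> e a b c d" "seps \<Gamma> e b a c d \<longleftrightarrow> seps \<Gamma> e a b c d"
    "seps \<Gamma> e c d a b \<longleftrightarrow> seps \<Gamma> e a b c d"
    using assms(2) S unfolding seps_def by auto
qed

lemma lamf_sym:
  assumes "{a, b, c, d} \<subseteq> A"
  shows "lamf \<Gamma> l a b d c = lamf \<Gamma> l a b c d" "lamf \<Gamma> l b a c d = lamf \<Gamma> l a b c d"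
    "lamf \<Gamma> l c d a b = lamf \<Gamma> l a b c d"
  unfolding lamf_def using seps_sym[OF _ assms] by (intro sum.cong; blast)+

text \<open>The contribution of an edge depends only on the sides of the four markings: it counts
  positively for \<open>ab|cd\<close>, negatively for \<open>ac|bd\<close>, and cancels for every
  other distribution.\<close>

lemma qd_hd_len:
  assumes A: "{a, b, c, d} \<subseteq> A"
  shows "qd (hd_len \<Gamma> l) a b c d = lamf \<Gamma> l a b c d - lamf \<Gamma> l a c b d"
proof -
  let ?s = "\<lambda>e x y. if sep \<Gamma> e x y then l e else 0"
  have *: "(?s e a c + ?s e b d - ?s e a b - ?s e c d) / 2 =
     (if seps \<Gamma> e a b c d then l e else 0) - (if seps \<Gamma> e a c b d then l e else 0)"
    if e: "e \<in> bounded_edges \<Gamma>" for e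
  proof -
    obtain S where S: "\<And>a b. a \<in> A \<Longrightarrow> b \<in> A \<Longrightarrow> sep \<Gamma> e a b \<longleftrightarrow> ((a \<in> S) \<noteq> (b \<in> S))"
      using sep_side[OF e] by metis
    have s: "sep \<Gamma> e a b \<longleftrightarrow> ((a \<in> S) \<noteq> (b \<in> S))" "sep \<Gamma> e a c \<longleftrightarrow> ((a \<in> S) \<noteq> (c \<in> S))"
      "sep \<Gamma> e b d \<longleftrightarrow> ((b \<in> S) \<noteq> (d \<in> S))" "sep \<Gamma> e c d \<longleftrightarrow> ((c \<in> S) \<noteq> (d \<in> S))"
      using S A by auto
    show ?thesis unfolding seps_def s by (cases "a \<in> S"; cases "b \<in> S"; cases "c \<in> S"; cases "d \<in> S") auto
  qed
  have "qd (hd_len \<Gamma> l) a b c d = (\<Sum>e\<in>bounded_edges \<Gamma>. (?s e a c + ?s e b d - ?s e a b - ?s e c d) / 2)"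
    unfolding qd_def hd_len_def by (simp add: sum_divide_distrib[symmetric] sum.distrib sum_subtractf diff_divide_distrib add_divide_distrib)
  also have "\<dots> = (\<Sum>e\<in>bounded_edges \<Gamma>. (if seps \<Gamma> e a b c d then l e else 0) - (if seps \<Gamma> e a c b d then l e else 0))"
    using * by (rule sum.cong[OF HOL.refl])
  also have "\<dots> = lamf \<Gamma> l a b c d - lamf \<Gamma> l a c b d"
    unfolding lamf_def sum_subtractf using finite_bounded by (simp add: sum.inter_filter)
  finally show ?thesis .
qed

lemma lamf_pos_iff:
  assumes "\<And>e. e \<in> bounded_edges \<Gamma> \<Longrightarrow> l e > 0"
  shows "lamf \<Gamma> l a b c d \<ge> 0" "lamf \<Gamma> l a b c d > 0 \<longleftrightarrow> (\<exists>e\<in>bounded_edges \<Gamma>. seps \<Gamma> e a b c d)"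
proof -
  let ?E = "{e \<in> bounded_edges \<Gamma>. seps \<Gamma> e a b c d}"
  show 0: "lamf \<Gamma> l a b c d \<ge> 0" unfolding lamf_def using assms by (intro sum_nonneg) (auto intro: less_imp_le)
  show "lamf \<Gamma> l a b c d > 0 \<longleftrightarrow> (\<exists>e\<in>bounded_edges \<Gamma>. seps \<Gamma> e a b c d)"
  proof
    assume "lamf \<Gamma> l a b c d > 0"
    hence "?E \<noteq> {}" unfolding lamf_def by (metis less_irrefl sum.empty)
    thus "\<exists>e\<in>bounded_edges \<Gamma>. seps \<Gamma> e a b c d" by blast
  next
    assume "\<exists>e\<in>bounded_edges \<Gamma>. seps \<Gamma> e a b c d"
    then obtain e where "e \<in> ?E" by blast
    thus "lamf \<Gamma> l a b c d > 0" unfolding lamf_def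
      using assms finite_bounded by (intro sum_pos2[of _ e]) (auto intro: less_imp_le)
  qed
qed

lemma lamf_zero: "\<not> (\<exists>e\<in>bounded_edges \<Gamma>. seps \<Gamma> e a b c d) \<Longrightarrow> lamf \<Gamma> l a b c d = 0"
  unfolding lamf_def by (metis (no_types, lifting) empty_Collect_eq sum.empty)

lemma lamf_compat:
  assumes A: "{a, b, c, d} \<subseteq> A" and e: "\<exists>e\<in>bounded_edges \<Gamma>. seps \<Gamma> e a b c d"
  shows "lamf \<Gamma> l a c b d = 0" "lamf \<Gamma> l a d b c = 0"
proof -
  show "lamf \<Gamma> l a c b d = 0" using e A seps_compat by (intro lamf_zero) auto
  have "\<exists>e\<in>bounded_edges \<Gamma>. seps \<Gamma> e a b d c" using e seps_sym(1)[OF _ A] by blast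
  hence "lamf \<Gamma> l a d b c = 0" using A seps_compat[of _ _ a b d c] by (intro lamf_zero) auto
  thus "lamf \<Gamma> l a d b c = 0" .
qed

text \<open>At most one of the three splittings is realised by edges. If it is \<open>ab|cd\<close>,
  both quartets equal the wanted length; otherwise one of them is not positive.\<close>

lemma lamf_eq:
  assumes l: "\<And>e. e \<in> bounded_edges \<Gamma> \<Longrightarrow> l e > 0" and A: "{a, b, c, d} \<subseteq> A"
  shows "lamf \<Gamma> l a b c d = max 0 (min (qd (hd_len \<Gamma> l) a b c d) (qd (hd_len \<Gamma> l) a b d c))"
proof -
  have A': "{a, b, d, c} \<subseteq> A" "{a, c, b, d} \<subseteq> A" "{a, d, b, c} \<subseteq> A" using A by auto
  have q1: "qd (hd_len \<Gamma> l) a b c d = lamf \<Gamma> l a b c d - lamf \<Gamma> l a c b d" using qd_hd_len A by blast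
  have q2: "qd (hd_len \<Gamma> l) a b d c = lamf \<Gamma> l a b c d - lamf \<Gamma> l a d b c"
    using qd_hd_len[OF A'(1)] lamf_sym(1)[OF A] by simp
  note nn = lamf_pos_iff(1)[of l, OF l]
  show ?thesis
  proof (cases "\<exists>e\<in>bounded_edges \<Gamma>. seps \<Gamma> e a b c d")
    case True
    hence "lamf \<Gamma> l a c b d = 0" "lamf \<Gamma> l a d b c = 0" using lamf_compat[OF A] by blast+
    thus ?thesis using q1 q2 nn[of a b c d] by simp
  next
    case False
    hence "lamf \<Gamma> l a b c d = 0" by (rule lamf_zero)
    thus ?thesis using q1 q2 nn[of a c b d] by simp
  qed
qed

lemma sep_sym: "e \<in> bounded_edges \<Gamma> \<Longrightarrow> a \<in> A \<Longrightarrow> b \<in> A \<Longrightarrow> sep \<Gamma> e a b \<longleftrightarrow> sep \<Gamma> e b a"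
  using sep_side by metis

lemma hd_len_sym:
  assumes "a \<in> A" "b \<in> A" shows "hd_len \<Gamma> l a b = hd_len \<Gamma> l b a"
proof -
  have "(\<Sum>e\<in>bounded_edges \<Gamma>. if sep \<Gamma> e a b then l e else 0) = (\<Sum>e\<in>bounded_edges \<Gamma>. if sep \<Gamma> e b a then l e else 0)"
    using sep_sym[OF _ assms] by (intro sum.cong) simp_all
  thus ?thesis by (simp add: hd_len_def)
qed

lemma tm_hd_len:
  assumes l: "\<And>e. e \<in> bounded_edges \<Gamma> \<Longrightarrow> l e > 0"
  shows "tm A (hd_len \<Gamma> l)"
  unfolding tm_def
proof (intro conjI ballI impI)
  fix a b assume "a \<in> A" "b \<in> A"
  thus "hd_len \<Gamma> l a b = hd_len \<Gamma> l b a" by (rule hd_len_sym)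
next
  fix a b c d assume abcd: "a \<in> A" "b \<in> A" "c \<in> A" "d \<in> A" "distinct [a, b, c, d]"
  hence A: "{a, b, c, d} \<subseteq> A" "{a, b, d, c} \<subseteq> A" "{a, c, b, d} \<subseteq> A" "{a, d, b, c} \<subseteq> A" "{a, c, d, b} \<subseteq> A" by auto
  have sym: "hd_len \<Gamma> l c d = hd_len \<Gamma> l d c" using hd_len_sym abcd by blast
  note nn = lamf_pos_iff(1)[of l, OF l]
  have q1: "qd (hd_len \<Gamma> l) a b c d = lamf \<Gamma> l a b c d - lamf \<Gamma> l a c b d" using qd_hd_len A by blast
  have q2: "qd (hd_len \<Gamma> l) a b d c = lamf \<Gamma> l a b c d - lamf \<Gamma> l a d b c"
    using qd_hd_len[OF A(2)] lamf_sym(1)[OF A(1)] by simp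
  have "lamf \<Gamma> l a c b d = 0 \<or> lamf \<Gamma> l a d b c = 0"
  proof (cases "\<exists>e\<in>bounded_edges \<Gamma>. seps \<Gamma> e a c b d")
    case True
    hence "lamf \<Gamma> l a d c b = 0" using lamf_compat[OF A(3)] by blast
    thus ?thesis using lamf_sym(1)[OF A(4), of l] by simp
  qed (use lamf_zero in blast)
  thus "hd_len \<Gamma> l a b + hd_len \<Gamma> l c d \<le> max (hd_len \<Gamma> l a c + hd_len \<Gamma> l b d) (hd_len \<Gamma> l a d + hd_len \<Gamma> l b c)"
    using q1 q2 nn[of a b c d] sym unfolding qd_def by linarith
qed

lemma tm_hdist: "tm A (hdist \<Gamma>)" using tm_hd_len len_pos by blast

text \<open>The half distances of a trivalent curve with changed, possibly negative, lengths still satisfy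
  the equalities coming from the combinatorial type.\<close>

definition (in -) tlike :: "'a set \<Rightarrow> ('a \<Rightarrow> 'a \<Rightarrow> real) \<Rightarrow> ('a \<Rightarrow> 'a \<Rightarrow> real) \<Rightarrow> bool" where
  "tlike A H K \<longleftrightarrow> (\<forall>a\<in>A. \<forall>b\<in>A. K a b = K b a) \<and>
     (\<forall>a\<in>A. \<forall>b\<in>A. \<forall>c\<in>A. \<forall>d\<in>A. distinct [a, b, c, d] \<longrightarrow> H a b + H c d < H a c + H b d \<longrightarrow>
        K a c + K b d = K a d + K b c)"

lemma tlike_hd_len: "tlike A (hdist \<Gamma>) (hd_len \<Gamma> l)"
  unfolding tlike_def
proof (intro conjI ballI impI)
  show sym: "hd_len \<Gamma> l a b = hd_len \<Gamma> l b a" if "a \<in> A" "b \<in> A" for a b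
    using that by (rule hd_len_sym)
  fix a b c d assume abcd: "a \<in> A" "b \<in> A" "c \<in> A" "d \<in> A" "distinct [a, b, c, d]"
    and less: "hdist \<Gamma> a b + hdist \<Gamma> c d < hdist \<Gamma> a c + hdist \<Gamma> b d"
  hence A: "{a, b, c, d} \<subseteq> A" "{a, b, d, c} \<subseteq> A" by auto
  have "qd (hdist \<Gamma>) a b c d > 0" using less by (simp add: qd_def)
  hence "lamf \<Gamma> (len \<Gamma>) a b c d > 0"
    using qd_hd_len[OF A(1)] lamf_pos_iff(1)[of "len \<Gamma>", OF len_pos] by (smt (verit))
  hence e: "\<exists>e\<in>bounded_edges \<Gamma>. seps \<Gamma> e a b c d"
    using lamf_pos_iff(2)[of "len \<Gamma>", OF len_pos] by blast
  hence "lamf \<Gamma> l a c b d = 0" "lamf \<Gamma> l a d b c = 0" using lamf_compat[OF A(1)] by blast+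
  hence "qd (hd_len \<Gamma> l) a b c d = qd (hd_len \<Gamma> l) a b d c"
    using qd_hd_len[OF A(1)] qd_hd_len[OF A(2)] lamf_sym(1)[OF A(1)] by simp
  thus "hd_len \<Gamma> l a c + hd_len \<Gamma> l b d = hd_len \<Gamma> l a d + hd_len \<Gamma> l b c"
    using sym[OF abcd(3,4)] unfolding qd_def by simp
qed

text \<open>A highest vertex whose cluster contains all three markings has only two children, so one
  child has exactly two of the markings above it and is the upper vertex of a bounded edge.\<close>

lemma resolved_if_trivalent_aux:
  assumes t: "\<forall>v\<in>inner_verts \<Gamma>. valence \<Gamma> v = 3"
    and b: "{x, y, z} \<subseteq> A - {\<rho>}" "distinct [x, y, z]"
  shows "\<exists>v\<in>bv. (x \<in> cl v \<and> y \<in> cl v \<and> z \<notin> cl v) \<or> (x \<in> cl v \<and> z \<in> cl v \<and> y \<notin> cl v) \<or> (y \<in> cl v \<and> z \<in> cl v \<and> x \<notin> cl v)"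
proof -
  let ?S = "{x, y, z}" let ?U = "{v \<in> verts \<Gamma>. ?S \<subseteq> cl v}"
  have U: "finite ?U" "apex \<in> ?U" using fin b cl_apex apex_in by auto
  obtain v where v: "v \<in> ?U" "\<And>x. x \<in> ?U \<Longrightarrow> rank x \<le> rank v"
  proof -
    have "Max (rank ` ?U) \<in> rank ` ?U" using U by (intro Max_in) auto
    then obtain v where "v \<in> ?U" "rank v = Max (rank ` ?U)" by auto
    thus thesis using that[of v] U Max_ge[of "rank ` ?U"] by auto
  qed
  have vV: "v \<in> verts \<Gamma>" "?S \<subseteq> cl v" using v(1) by auto
  have notin: "\<not> ?S \<subseteq> cl c" if "cov v c" for c
  proof
    assume "?S \<subseteq> cl c"
    hence "rank c \<le> rank v" using v(2)[of c] covD(2)[OF that] by blast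
    moreover have "rank v < rank c" using covD[OF that] by (intro rank_less)
    ultimately show False by simp
  qed
  have vr: "v \<noteq> r"
  proof
    assume "v = r"
    hence "cov v apex" using apex(1) by simp
    from notin[OF this] show False using cl_apex b(1) by simp
  qed
  have v1: "valence \<Gamma> v \<noteq> 1"
  proof
    assume "valence \<Gamma> v = 1"
    then obtain a where "a \<in> A" "v = leaf \<Gamma> a" using leaf_if_val1 vV by blast
    thus False using cl_leaf[of a] vV(2) vr b by (cases "a = \<rho>") auto
  qed
  hence "v \<in> inner_verts \<Gamma>" using vV by (simp add: inner_verts_def)
  hence "valence \<Gamma> v = 3" using t by blast
  hence "card (ch v) = 2" using valence_ch[OF vV(1)] vr by simp
  then obtain c1 c2 where c: "ch v = {c1, c2}" by (metis card_2_iff)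
  hence cov: "cov v c1" "cov v c2" "\<And>c. cov v c \<Longrightarrow> c = c1 \<or> c = c2" unfolding ch_def by blast+
  have nl: "v \<noteq> leaf \<Gamma> a" if "a \<in> A" for a using v1 leaf_val[OF that] by auto
  have in12: "a \<in> cl c1 \<or> a \<in> cl c2" if "a \<in> ?S" for a
  proof -
    have aA: "a \<in> A" using that b by auto
    have "a \<in> cl v" using that vV(2) by (rule rev_subsetD)
    from ch_cases[OF vV(1) this nl[OF aA]] obtain c where "cov v c" "a \<in> cl c" by blast
    thus ?thesis using cov(3) by blast
  qed
  have bvc: "c \<in> bv" if h: "cov v c" "s \<in> cl c" "s' \<in> cl c" "s \<noteq> s'" "s \<in> A" for c s s'
  proof -
    have "c \<noteq> r" using cov_root h(1) by blast
    moreover have "c \<noteq> apex" using cov_unique[OF apex(1)] h(1) vr by blast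
    moreover have "valence \<Gamma> c \<noteq> 1"
    proof
      assume "valence \<Gamma> c = 1"
      then obtain a where a: "a \<in> A" "c = leaf \<Gamma> a" using leaf_if_val1 covD(2)[OF h(1)] by blast
      hence "cl c = {a}" using cl_leaf[of a] \<open>c \<noteq> r\<close> by (cases "a = \<rho>") auto
      thus False using h by auto
    qed
    ultimately show ?thesis using covD(2)[OF h(1)] by (simp add: bv_def)
  qed
  have A: "x \<in> A" "y \<in> A" "z \<in> A" "x \<noteq> y" "x \<noteq> z" "y \<noteq> z" using b by auto
  have b1: "s \<in> cl c1 \<Longrightarrow> s' \<in> cl c1 \<Longrightarrow> s \<noteq> s' \<Longrightarrow> s \<in> A \<Longrightarrow> c1 \<in> bv"
    and b2: "s \<in> cl c2 \<Longrightarrow> s' \<in> cl c2 \<Longrightarrow> s \<noteq> s' \<Longrightarrow> s \<in> A \<Longrightarrow> c2 \<in> bv" for s s'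
    using bvc cov by blast+
  have n1: "\<not> (x \<in> cl c1 \<and> y \<in> cl c1 \<and> z \<in> cl c1)" and n2: "\<not> (x \<in> cl c2 \<and> y \<in> cl c2 \<and> z \<in> cl c2)"
    using notin[OF cov(1)] notin[OF cov(2)] by auto
  have i: "x \<in> cl c1 \<or> x \<in> cl c2" "y \<in> cl c1 \<or> y \<in> cl c2" "z \<in> cl c1 \<or> z \<in> cl c2" using in12 by auto
  show ?thesis
    using n1 n2 i b1[of x y] b1[of x z] b1[of y z] b2[of x y] b2[of x z] b2[of y z] A by metis
qed

text \<open>A vertex of valence at least four has three children. One marking above each of them and
  \<rho> form a star: no edge separates two of these four from the other two.\<close>

lemma not_resolvedI:
  assumes v: "v \<in> verts \<Gamma>" "valence \<Gamma> v \<noteq> 1" "valence \<Gamma> v \<noteq> 3"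
  shows "\<not> resolved A (hdist \<Gamma>)"
proof -
  have vr: "v \<noteq> r" using card_ch_inner[OF v(1,2)] by blast
  have "card (ch v) \<ge> 2" using card_ch_inner[OF v(1,2)] by blast
  hence "card (ch v) \<ge> 3" using v(3) valence_ch[OF v(1)] vr by simp
  then obtain T where T: "T \<subseteq> ch v" "card T = 3" by (meson obtain_subset_with_card_n)
  then obtain c1 c2 c3 where "T = {c1, c2, c3}" and ne: "c1 \<noteq> c2" "c2 \<noteq> c3" "c1 \<noteq> c3" by (metis card_3_iff)
  hence cov: "cov v c1" "cov v c2" "cov v c3" using T unfolding ch_def by blast+
  obtain x y z where x: "x \<in> cl c1" "y \<in> cl c2" "z \<in> cl c3" using cl_nonempty covD(2) cov by (metis all_not_in_conv)
  note dj = cl_disjoint[OF cov(1,2) ne(1)] cl_disjoint[OF cov(2,3) ne(2)] cl_disjoint[OF cov(1,3) ne(3)]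
  have xv: "x \<in> cl v" "y \<in> cl v" "z \<in> cl v" using x cov cl_mono covD by blast+
  have rho': "\<rho> \<notin> cl v" using rho_notin_cl v vr by blast
  have D: "distinct [x, y, z, \<rho>]" using x dj xv rho' by auto
  have A: "x \<in> A" "y \<in> A" "z \<in> A" using xv cl_subset by blast+
  have zero: "lamf \<Gamma> l s s' s'' \<rho> = 0"
    if hh: "cov v c" "cov v c'" "c \<noteq> c'" "s \<in> cl c" "s' \<in> cl c'" "s \<in> cl v" "s'' \<in> cl v" "s \<in> A" "s' \<in> A" "s'' \<in> A" for s s' s'' c c' l
  proof -
    have "\<not> (s \<in> cl w \<and> s' \<in> cl w \<and> s'' \<notin> cl w)" if w: "w \<in> bv" for w
    proof
      assume h: "s \<in> cl w \<and> s' \<in> cl w \<and> s'' \<notin> cl w"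
      have "\<not> w \<preceq> v" using cl_mono[OF bvD(1)[OF w] v(1)] h \<open>s'' \<in> cl v\<close> by blast
      hence "v \<preceq> w" "v \<noteq> w" using laminar[OF v(1) bvD(1)[OF w] \<open>s \<in> cl v\<close>] h refl v(1) by blast+
      then obtain z where z: "cov v z" "z \<preceq> w" using ex_cov_above[OF bvD(1)[OF w] v(1)] by blast
      hence "s \<in> cl z" "s' \<in> cl z" using h cl_mono[OF covD(2)[OF z(1)] bvD(1)[OF w] z(2)] by blast+
      thus False using cl_disjoint[OF z(1) hh(1)] cl_disjoint[OF z(1) hh(2)] hh(3-5) by blast
    qed
    hence e: "{v \<in> bv. s \<in> cl v \<and> s' \<in> cl v \<and> s'' \<notin> cl v} = {}" by blast
    show ?thesis unfolding lamf_rho[OF hh(8-10)] e by simp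
  qed
  have "lamf \<Gamma> (len \<Gamma>) x y z \<rho> = 0" "lamf \<Gamma> (len \<Gamma>) x z y \<rho> = 0" "lamf \<Gamma> (len \<Gamma>) y z x \<rho> = 0"
    using zero[OF cov(1,2) ne(1) x(1,2) xv(1,3) A(1,2,3)] zero[OF cov(1,3) ne(3) x(1,3) xv(1,2) A(1,3,2)]
      zero[OF cov(2,3) ne(2) x(2,3) xv(2,1) A(2,3,1)] by auto
  moreover have "{x, y, z, \<rho>} \<subseteq> A" "{y, x, z, \<rho>} \<subseteq> A" "{x, z, y, \<rho>} \<subseteq> A" "{y, z, x, \<rho>} \<subseteq> A" "{x, \<rho>, y, z} \<subseteq> A" "{x, y, \<rho>, z} \<subseteq> A" using A rho by auto
  ultimately have "qd (hdist \<Gamma>) x y z \<rho> = 0" "qd (hdist \<Gamma>) x y \<rho> z = 0"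
    using qd_hd_len[of x y z \<rho>] qd_hd_len[of x y \<rho> z] lamf_sym by auto
  moreover have "hdist \<Gamma> z \<rho> = hdist \<Gamma> \<rho> z" using tm_hdist A rho by (simp add: tm_def)
  ultimately have "hdist \<Gamma> x y + hdist \<Gamma> z \<rho> = hdist \<Gamma> x z + hdist \<Gamma> y \<rho>" "hdist \<Gamma> x z + hdist \<Gamma> y \<rho> = hdist \<Gamma> x \<rho> + hdist \<Gamma> y z"
    by (auto simp: qd_def)
  thus ?thesis using D A rho unfolding resolved_def by blast
qed

end

lemma resolved_iff_trivalent:
  assumes trop: "tropical_curve A \<Gamma>"
  shows "resolved A (hdist \<Gamma>) \<longleftrightarrow> (\<forall>v\<in>inner_verts \<Gamma>. valence \<Gamma> v = 3)"
proof
  assume t: "\<forall>v\<in>inner_verts \<Gamma>. valence \<Gamma> v = 3"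
  show "resolved A (hdist \<Gamma>)" unfolding resolved_def
  proof (intro ballI impI notI)
    fix a b c d assume abcd: "a \<in> A" "b \<in> A" "c \<in> A" "d \<in> A" "distinct [a, b, c, d]"
      and eq: "hdist \<Gamma> a b + hdist \<Gamma> c d = hdist \<Gamma> a c + hdist \<Gamma> b d \<and> hdist \<Gamma> a c + hdist \<Gamma> b d = hdist \<Gamma> a d + hdist \<Gamma> b c"
    \<comment> \<open>Rooting at the fourth marking reduces the claim to the three others.\<close>
    interpret marked_tree A \<Gamma> d using trop abcd by unfold_locales
    have A: "{a, b, c, d} \<subseteq> A" "{a, b, d, c} \<subseteq> A" "{a, c, b, d} \<subseteq> A" "{b, c, a, d} \<subseteq> A" "{a, c, d, b} \<subseteq> A" "{a, d, b, c} \<subseteq> A" using abcd by auto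
    have "hdist \<Gamma> c d = hdist \<Gamma> d c" using tm_hdist abcd by (simp add: tm_def)
    hence q: "qd (hdist \<Gamma>) a b c d = 0" "qd (hdist \<Gamma>) a b d c = 0" using eq by (auto simp: qd_def)
    obtain v where v: "v \<in> bv" "(a \<in> cl v \<and> b \<in> cl v \<and> c \<notin> cl v) \<or> (a \<in> cl v \<and> c \<in> cl v \<and> b \<notin> cl v) \<or> (b \<in> cl v \<and> c \<in> cl v \<and> a \<notin> cl v)"
      using resolved_if_trivalent_aux[OF t, of a b c] abcd by auto
    have e: "eb v \<in> bounded_edges \<Gamma>" using v by (simp add: bounded_eq)
    have dn: "d \<notin> cl v" using rho_notin_cl bvD[OF v(1)] by blast
    have "seps \<Gamma> (eb v) a b c d \<or> seps \<Gamma> (eb v) a c b d \<or> seps \<Gamma> (eb v) a d b c"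
      using v(2) dn seps_eb[OF v(1)] abcd by auto
    hence pos: "lamf \<Gamma> (len \<Gamma>) a b c d > 0 \<or> lamf \<Gamma> (len \<Gamma>) a c b d > 0 \<or> lamf \<Gamma> (len \<Gamma>) a d b c > 0"
      using e lamf_pos_iff(2)[of "len \<Gamma>", OF len_pos] by blast
    have q1: "lamf \<Gamma> (len \<Gamma>) a b c d = lamf \<Gamma> (len \<Gamma>) a c b d" using q(1) qd_hd_len[OF A(1)] by simp
    have q2: "lamf \<Gamma> (len \<Gamma>) a b c d = lamf \<Gamma> (len \<Gamma>) a d b c" using q(2) qd_hd_len[OF A(2)] lamf_sym(1)[OF A(1)] by simp
    have "lamf \<Gamma> (len \<Gamma>) a b c d > 0" using pos q1 q2 by auto
    hence "\<exists>e\<in>bounded_edges \<Gamma>. seps \<Gamma> e a b c d" using lamf_pos_iff(2)[of "len \<Gamma>", OF len_pos] by blast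
    hence "lamf \<Gamma> (len \<Gamma>) a c b d = 0" using lamf_compat[OF A(1)] by blast
    thus False using q1 \<open>lamf \<Gamma> (len \<Gamma>) a b c d > 0\<close> by simp
  qed
next
  assume res: "resolved A (hdist \<Gamma>)"
  have "A \<noteq> {}" using trop by (auto simp: tropical_curve_def)
  then obtain \<rho> where "\<rho> \<in> A" by blast
  then interpret marked_tree A \<Gamma> \<rho> using trop by unfold_locales
  show "\<forall>v\<in>inner_verts \<Gamma>. valence \<Gamma> v = 3"
    using not_resolvedI res by (auto simp: inner_verts_def)
qed

section \<open>Isomorphisms\<close>

lemma covers_iso:
  assumes f: "bij_betw f V W" and le: "\<And>u v. u \<in> V \<Longrightarrow> v \<in> V \<Longrightarrow> leq' (f u) (f v) \<longleftrightarrow> leq u v"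
    and uv: "u \<in> V" "v \<in> V"
  shows "covers W leq' (f u) (f v) \<longleftrightarrow> covers V leq u v"
proof -
  have W: "W = f ` V" using f by (simp add: bij_betw_def)
  have inj: "x \<in> V \<Longrightarrow> y \<in> V \<Longrightarrow> f x = f y \<longleftrightarrow> x = y" for x y
    using f by (meson bij_betw_imp_inj_on inj_on_eq_iff)
  show ?thesis unfolding covers_def W using uv le inj by (simp add: ball_simps)
qed

lemma cover_edges_iso:
  assumes f: "bij_betw f V W" and le: "\<And>u v. u \<in> V \<Longrightarrow> v \<in> V \<Longrightarrow> leq' (f u) (f v) \<longleftrightarrow> leq u v"
  shows "cover_edges W leq' = (`) f ` cover_edges V leq"
proof (intro Set.set_eqI iffI)
  fix e assume "e \<in> cover_edges W leq'"
  then obtain x y where xy: "covers W leq' x y" "e = {x, y}" by (auto simp: cover_edges_def)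
  hence "x \<in> f ` V" "y \<in> f ` V" using f by (auto simp: covers_def bij_betw_def)
  then obtain u v where uv: "u \<in> V" "v \<in> V" "x = f u" "y = f v" by blast
  hence "covers V leq u v" using covers_iso[where leq=leq and leq'=leq', OF f le uv(1,2)] xy by simp
  moreover have "e = f ` {u, v}" using xy uv by simp
  ultimately show "e \<in> (`) f ` cover_edges V leq" unfolding cover_edges_def by blast
next
  fix e assume "e \<in> (`) f ` cover_edges V leq"
  then obtain u v where uv: "covers V leq u v" "e = f ` {u, v}" by (auto simp: cover_edges_def)
  hence "u \<in> V" "v \<in> V" by (auto simp: covers_def)
  hence "covers W leq' (f u) (f v)" using covers_iso[where leq=leq and leq'=leq', OF f le] uv by simp
  thus "e \<in> cover_edges W leq'" using uv(2) unfolding cover_edges_def by auto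
qed

text \<open>Quartets determine \<open>lamf\<close> by \<open>lamf_eq\<close> and thereby the
  clusters by \<open>clusters_eq\<close>. Since the order is reverse inclusion of clusters, matching
  equal clusters is an isomorphism of trees, and a quartet isolating one edge gives its
  length.\<close>

lemma iso_if_quart_eq:
  assumes tG: "tropical_curve A \<Gamma>" and tD: "tropical_curve A \<Delta>"
    and q: "quart A (hdist \<Gamma>) = quart A (hdist \<Delta>)"
  shows "(\<Gamma>, \<Delta>) \<in> iso_rel A"
proof -
  have "A \<noteq> {}" using tG by (auto simp: tropical_curve_def)
  then obtain \<rho> where rho: "\<rho> \<in> A" by blast
  interpret G: marked_tree A \<Gamma> \<rho> using tG rho by unfold_locales
  interpret D: marked_tree A \<Delta> \<rho> using tD rho by unfold_locales
  have lam: "lamf \<Gamma> (len \<Gamma>) a b c d = lamf \<Delta> (len \<Delta>) a b c d"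
    if A: "distinct [a, b, c, d]" "{a, b, c, d} \<subseteq> A" for a b c d
  proof -
    have A': "distinct [a, b, d, c]" "{a, b, d, c} \<subseteq> A" using A by auto
    show ?thesis
      using G.lamf_eq[of "len \<Gamma>", OF G.len_pos A(2)] D.lamf_eq[of "len \<Delta>", OF D.len_pos A(2)]
        quartD[OF q A] quartD[OF q A'] by simp
  qed
  have "{S. S \<subseteq> A - {\<rho>} \<and> card S \<ge> 2 \<and> S \<noteq> A - {\<rho>} \<and>
      (\<forall>a\<in>S. \<forall>b\<in>S. \<forall>c\<in>A - {\<rho>} - S. a \<noteq> b \<longrightarrow> lamf \<Gamma> (len \<Gamma>) a b c \<rho> > 0)} =
    {S. S \<subseteq> A - {\<rho>} \<and> card S \<ge> 2 \<and> S \<noteq> A - {\<rho>} \<and>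
      (\<forall>a\<in>S. \<forall>b\<in>S. \<forall>c\<in>A - {\<rho>} - S. a \<noteq> b \<longrightarrow> lamf \<Delta> (len \<Delta>) a b c \<rho> > 0)}"
  proof (intro Collect_cong conj_cong HOL.refl ball_cong imp_cong)
    fix S a b c assume "S \<subseteq> A - {\<rho>}" "a \<in> S" "b \<in> S" "c \<in> A - {\<rho>} - S" "a \<noteq> b"
    hence "distinct [a, b, c, \<rho>]" "{a, b, c, \<rho>} \<subseteq> A" using rho by auto
    thus "lamf \<Gamma> (len \<Gamma>) a b c \<rho> > 0 \<longleftrightarrow> lamf \<Delta> (len \<Delta>) a b c \<rho> > 0" using lam by simp
  qed
  hence cleq: "G.cl ` verts \<Gamma> = D.cl ` verts \<Delta>" unfolding G.clusters_eq D.clusters_eq by simp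
  \<comment> \<open>The vertex of \<Delta> with the same cluster.\<close>
  define f where "f v = inv_into (verts \<Delta>) D.cl (G.cl v)" for v
  have f: "f v \<in> verts \<Delta>" "D.cl (f v) = G.cl v" if "v \<in> verts \<Gamma>" for v
  proof -
    have "G.cl v \<in> D.cl ` verts \<Delta>" using cleq that by blast
    thus "f v \<in> verts \<Delta>" "D.cl (f v) = G.cl v" unfolding f_def by (rule inv_into_into, rule f_inv_into_f)
  qed
  have fI: "f v = w" if "v \<in> verts \<Gamma>" "w \<in> verts \<Delta>" "G.cl v = D.cl w" for v w
    using D.cl_inj[OF f(1)[OF that(1)] that(2)] f(2)[OF that(1)] that(3) by simp
  have ex: "\<exists>v\<in>verts \<Gamma>. G.cl v = D.cl w" if "w \<in> verts \<Delta>" for w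
  proof -
    have "D.cl w \<in> G.cl ` verts \<Gamma>" using cleq that by blast
    thus ?thesis by auto
  qed
  have bij: "bij_betw f (verts \<Gamma>) (verts \<Delta>)"
  proof (rule bij_betw_imageI)
    show "inj_on f (verts \<Gamma>)"
    proof (rule inj_onI)
      fix v w assume vw: "v \<in> verts \<Gamma>" "w \<in> verts \<Gamma>" "f v = f w"
      hence "G.cl v = G.cl w" using f(2) by metis
      thus "v = w" using G.cl_inj vw by blast
    qed
    show "f ` verts \<Gamma> = verts \<Delta>"
    proof (intro Set.set_eqI iffI)
      fix w assume "w \<in> verts \<Delta>"
      then obtain v where "v \<in> verts \<Gamma>" "G.cl v = D.cl w" using ex by blast
      thus "w \<in> f ` verts \<Gamma>" using fI \<open>w \<in> verts \<Delta>\<close> by blast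
    qed (use f in blast)
  qed
  have le: "tle \<Delta> (leaf \<Delta> \<rho>) (f u) (f v) \<longleftrightarrow> tle \<Gamma> (leaf \<Gamma> \<rho>) u v" if "u \<in> verts \<Gamma>" "v \<in> verts \<Gamma>" for u v
    using G.le_iff[OF that] D.le_iff[OF f(1)[OF that(1)] f(1)[OF that(2)]] f(2) that by simp
  have edges: "(`) f ` edges \<Gamma> = edges \<Delta>"
    unfolding G.edges_eq D.edges_eq using cover_edges_iso[where leq="tle \<Gamma> (leaf \<Gamma> \<rho>)" and leq'="tle \<Delta> (leaf \<Delta> \<rho>)", OF bij le] by simp
  have leaf: "f (leaf \<Gamma> a) = leaf \<Delta> a" if a: "a \<in> A" for a
  proof (rule fI[OF G.leaf_in[OF a] D.leaf_in[OF a]])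
    show "G.cl (leaf \<Gamma> a) = D.cl (leaf \<Delta> a)"
      using G.cl_root D.cl_root G.cl_leaf[OF a] D.cl_leaf[OF a] by (cases "a = \<rho>") auto
  qed
  have len: "len \<Delta> (f ` e) = len \<Gamma> e" if e: "e \<in> bounded_edges \<Gamma>" for e
  proof -
    obtain v where v: "v \<in> G.bv" "e = G.eb v" using e unfolding G.bounded_eq by blast
    note vD = G.bvD[OF v(1)]
    obtain a b c where abc: "a \<in> G.cl v" "b \<in> G.cl v" "a \<noteq> b" "c \<in> A" "c \<noteq> \<rho>" "c \<notin> G.cl v"
      and u: "\<forall>w\<in>verts \<Gamma>. a \<in> G.cl w \<and> b \<in> G.cl w \<and> c \<notin> G.cl w \<longrightarrow> w = v"
      by (rule G.bv_witness[OF v(1)])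
    have rv: "\<rho> \<notin> G.cl v" using G.rho_notin_cl vD by blast
    have A: "a \<in> A" "b \<in> A" using abc G.cl_subset by blast+
    have dist: "distinct [a, b, c, \<rho>]" "{a, b, c, \<rho>} \<subseteq> A" using abc A rv rho by auto
    have "{v \<in> G.bv. a \<in> G.cl v \<and> b \<in> G.cl v \<and> c \<notin> G.cl v} = {v}" using u abc v G.bvD(1) by blast
    hence lG: "lamf \<Gamma> (len \<Gamma>) a b c \<rho> = len \<Gamma> e" using G.lamf_rho[OF A abc(4)] v by simp
    \<comment> \<open>The markings isolating \<open>v\<close> isolate \<open>f v\<close> in
      \<Delta>, since uniqueness of the vertex was stated in terms of clusters. That the set is not
      empty follows from the positive quartet value.\<close>
    have sub: "{w \<in> D.bv. a \<in> D.cl w \<and> b \<in> D.cl w \<and> c \<notin> D.cl w} \<subseteq> {f v}"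
    proof
      fix w assume "w \<in> {w \<in> D.bv. a \<in> D.cl w \<and> b \<in> D.cl w \<and> c \<notin> D.cl w}"
      hence w: "w \<in> verts \<Delta>" "a \<in> D.cl w" "b \<in> D.cl w" "c \<notin> D.cl w" using D.bvD(1) by blast+
      then obtain w0 where w0: "w0 \<in> verts \<Gamma>" "G.cl w0 = D.cl w" using ex by blast
      hence "w0 = v" using u w by simp
      thus "w \<in> {f v}" using fI[OF w0(1) w(1) w0(2)] by simp
    qed
    have "lamf \<Delta> (len \<Delta>) a b c \<rho> > 0" using lG lam[OF dist] G.len_pos[OF e] by simp
    hence "{w \<in> D.bv. a \<in> D.cl w \<and> b \<in> D.cl w \<and> c \<notin> D.cl w} \<noteq> {}"
      unfolding D.lamf_rho[OF A abc(4)] by (metis less_irrefl sum.empty)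
    hence eq: "{w \<in> D.bv. a \<in> D.cl w \<and> b \<in> D.cl w \<and> c \<notin> D.cl w} = {f v}" using sub by blast
    hence lD: "lamf \<Delta> (len \<Delta>) a b c \<rho> = len \<Delta> (D.eb (f v))" unfolding D.lamf_rho[OF A abc(4)] by simp
    have "covers (verts \<Delta>) (tle \<Delta> (leaf \<Delta> \<rho>)) (f (G.par v)) (f v)"
      using covers_iso[where leq="tle \<Gamma> (leaf \<Gamma> \<rho>)" and leq'="tle \<Delta> (leaf \<Delta> \<rho>)", OF bij le G.covD(1,2)[OF vD(5)]] vD(5) by simp
    hence "D.par (f v) = f (G.par v)" by (rule D.par_eq)
    hence "D.eb (f v) = f ` e" using v by (simp add: D.eb_def G.eb_def)
    thus ?thesis using lD lG lam[OF dist] by simp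
  qed
  have "marked_tree_iso A f \<Gamma> \<Delta>" unfolding marked_tree_iso_def using bij edges leaf by blast
  thus ?thesis unfolding iso_rel_def using tG tD len by blast
qed

lemma marked_tree_iso_tree_path:
  assumes f: "marked_tree_iso A f \<Gamma> \<Delta>" and p: "tree_path \<Gamma> u p v"
  shows "tree_path \<Delta> (f u) (map f p) (f v)"
proof -
  have inj: "inj_on f (verts \<Gamma>)" and im: "f ` verts \<Gamma> = verts \<Delta>" and ed: "(`) f ` edges \<Gamma> = edges \<Delta>"
    using f by (auto simp: marked_tree_iso_def bij_betw_def)
  have "{f x, f y} \<in> edges \<Delta>" if "{x, y} \<in> edges \<Gamma>" for x y
  proof -
    have "f ` {x, y} \<in> edges \<Delta>" using that ed by blast
    thus ?thesis by simp
  qed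
  hence "successively (\<lambda>x y. {x, y} \<in> edges \<Delta>) (map f p)"
    using p unfolding tree_path_def successively_map by (meson successively_mono)
  moreover have "inj_on f (set p)" using inj p by (auto simp: tree_path_def intro: inj_on_subset)
  ultimately show ?thesis using p im by (auto simp: tree_path_def distinct_map hd_map last_map)
qed

lemma path_edges_map: "path_edges (map f p) = (`) f ` path_edges p"
  by (induction p rule: induct_list012) auto

lemma marked_tree_iso_facts:
  assumes f: "marked_tree_iso A f \<Gamma> \<Delta>" and tG: "tropical_curve A \<Gamma>" and tD: "tropical_curve A \<Delta>"
  shows "bij_betw ((`) f) (bounded_edges \<Gamma>) (bounded_edges \<Delta>)"
    "\<And>e a b. e \<in> bounded_edges \<Gamma> \<Longrightarrow> a \<in> A \<Longrightarrow> b \<in> A \<Longrightarrow> sep \<Delta> (f ` e) a b \<longleftrightarrow> sep \<Gamma> e a b"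
proof -
  have "A \<noteq> {}" using tG by (auto simp: tropical_curve_def)
  then obtain \<rho> where rho: "\<rho> \<in> A" by blast
  interpret G: marked_tree A \<Gamma> \<rho> using tG rho by unfold_locales
  interpret D: marked_tree A \<Delta> \<rho> using tD rho by unfold_locales
  have inj: "inj_on f (verts \<Gamma>)" and im: "f ` verts \<Gamma> = verts \<Delta>" and ed: "(`) f ` edges \<Gamma> = edges \<Delta>"
    and leaf: "\<And>a. a \<in> A \<Longrightarrow> f (leaf \<Gamma> a) = leaf \<Delta> a"
    using f by (auto simp: marked_tree_iso_def bij_betw_def)
  have sub: "e \<subseteq> verts \<Gamma>" if "e \<in> edges \<Gamma>" for e using G.edge_subset[OF that] by blast
  have inje: "inj_on ((`) f) (edges \<Gamma>)"
    using inj sub by (meson inj_onI inj_on_image_eq_iff)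
  have val: "valence \<Delta> (f v) = valence \<Gamma> v" if v: "v \<in> verts \<Gamma>" for v
  proof -
    have "{e \<in> edges \<Delta>. f v \<in> e} = (`) f ` {e \<in> edges \<Gamma>. v \<in> e}"
    proof (intro Set.set_eqI iffI)
      fix e assume "e \<in> {e \<in> edges \<Delta>. f v \<in> e}"
      hence "e \<in> (`) f ` edges \<Gamma>" and fv: "f v \<in> e" using ed by auto
      then obtain e0 where e0: "e0 \<in> edges \<Gamma>" "e = f ` e0" by blast
      hence "v \<in> e0" using fv inj_on_image_mem_iff[OF inj v sub[OF e0(1)]] by simp
      thus "e \<in> (`) f ` {e \<in> edges \<Gamma>. v \<in> e}" using e0 by blast
    next
      fix e assume "e \<in> (`) f ` {e \<in> edges \<Gamma>. v \<in> e}"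
      thus "e \<in> {e \<in> edges \<Delta>. f v \<in> e}" using ed by blast
    qed
    moreover have "inj_on ((`) f) {e \<in> edges \<Gamma>. v \<in> e}" using inje by (rule inj_on_subset) auto
    ultimately show ?thesis unfolding valence_def by (simp add: card_image)
  qed
  have bsub: "bounded_edges \<Gamma> \<subseteq> edges \<Gamma>" by (auto simp: bounded_edges_def)
  have bd: "f ` e \<in> bounded_edges \<Delta> \<longleftrightarrow> e \<in> bounded_edges \<Gamma>" if e: "e \<in> edges \<Gamma>" for e
  proof -
    have "f ` e \<in> edges \<Delta>" using ed e by blast
    moreover have "(\<forall>v\<in>f ` e. valence \<Delta> v \<noteq> 1) \<longleftrightarrow> (\<forall>v\<in>e. valence \<Gamma> v \<noteq> 1)"
      using val sub[OF e] by (metis (no_types, lifting) ball_imageD image_iff subsetD)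
    ultimately show ?thesis using e by (simp add: bounded_edges_def)
  qed
  show "bij_betw ((`) f) (bounded_edges \<Gamma>) (bounded_edges \<Delta>)"
  proof (rule bij_betw_imageI)
    show "inj_on ((`) f) (bounded_edges \<Gamma>)" using inje bsub by (rule inj_on_subset)
    show "(`) f ` bounded_edges \<Gamma> = bounded_edges \<Delta>"
    proof (intro Set.set_eqI iffI)
      fix e assume e: "e \<in> bounded_edges \<Delta>"
      hence "e \<in> (`) f ` edges \<Gamma>" using ed by (auto simp: bounded_edges_def)
      then obtain e0 where "e0 \<in> edges \<Gamma>" "e = f ` e0" by blast
      thus "e \<in> (`) f ` bounded_edges \<Gamma>" using bd e by blast
    qed (use bd bsub in blast)
  qed
  show "sep \<Delta> (f ` e) a b \<longleftrightarrow> sep \<Gamma> e a b" if e: "e \<in> bounded_edges \<Gamma>" and ab: "a \<in> A" "b \<in> A" for e a b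
  proof -
    let ?p = "tpath \<Gamma> (leaf \<Gamma> a) (leaf \<Gamma> b)"
    have p: "tree_path \<Gamma> (leaf \<Gamma> a) ?p (leaf \<Gamma> b)" using G.tpath[OF G.leaf_in G.leaf_in] ab by blast
    have "tree_path \<Delta> (leaf \<Delta> a) (map f ?p) (leaf \<Delta> b)"
      using marked_tree_iso_tree_path[OF f p] leaf ab by simp
    hence "tpath \<Delta> (leaf \<Delta> a) (leaf \<Delta> b) = map f ?p" by (rule D.tpath_unique)
    hence "sep \<Delta> (f ` e) a b \<longleftrightarrow> f ` e \<in> (`) f ` path_edges ?p" by (simp add: sep_def path_edges_map)
    also have "\<dots> \<longleftrightarrow> e \<in> path_edges ?p"
      using inj_on_image_mem_iff[OF inje] e bsub G.tree_path_edges[OF p] by blast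
    finally show ?thesis by (simp add: sep_def)
  qed
qed

lemma marked_tree_iso_hd_len:
  assumes f: "marked_tree_iso A f \<Gamma> \<Delta>" and tG: "tropical_curve A \<Gamma>" and tD: "tropical_curve A \<Delta>"
    and ab: "a \<in> A" "b \<in> A"
  shows "hd_len \<Delta> l a b = hd_len \<Gamma> (\<lambda>e. l (f ` e)) a b"
proof -
  note F = marked_tree_iso_facts[OF f tG tD]
  have "(\<Sum>e\<in>bounded_edges \<Delta>. if sep \<Delta> e a b then l e else 0) =
    (\<Sum>e\<in>bounded_edges \<Gamma>. if sep \<Delta> (f ` e) a b then l (f ` e) else 0)"
    using sum.reindex_bij_betw[OF F(1), of "\<lambda>e. if sep \<Delta> e a b then l e else 0"] by simp
  also have "\<dots> = (\<Sum>e\<in>bounded_edges \<Gamma>. if sep \<Gamma> e a b then l (f ` e) else 0)"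
    using F(2)[OF _ ab] by (intro sum.cong) simp_all
  finally show ?thesis by (simp add: hd_len_def)
qed

lemma hd_len_cong:
  assumes "\<And>e. e \<in> bounded_edges \<Gamma> \<Longrightarrow> l e = l' e"
  shows "hd_len \<Gamma> l a b = hd_len \<Gamma> l' a b"
proof -
  have "(\<Sum>e\<in>bounded_edges \<Gamma>. if sep \<Gamma> e a b then l e else 0) = (\<Sum>e\<in>bounded_edges \<Gamma>. if sep \<Gamma> e a b then l' e else 0)"
    using assms by (intro sum.cong) simp_all
  thus ?thesis by (simp add: hd_len_def)
qed

lemma quart_cong: "(\<And>a b. a \<in> A \<Longrightarrow> b \<in> A \<Longrightarrow> H a b = K a b) \<Longrightarrow> quart A H = quart A K"
  by (rule quartI) (simp add: qd_def)

lemma iso_rel_iff: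
  "(\<Gamma>, \<Delta>) \<in> iso_rel A \<longleftrightarrow> tropical_curve A \<Gamma> \<and> tropical_curve A \<Delta> \<and> quart A (hdist \<Gamma>) = quart A (hdist \<Delta>)"
proof
  assume "(\<Gamma>, \<Delta>) \<in> iso_rel A"
  then obtain f where f: "tropical_curve A \<Gamma>" "tropical_curve A \<Delta>" "marked_tree_iso A f \<Gamma> \<Delta>"
    "\<forall>e\<in>bounded_edges \<Gamma>. len \<Delta> (f ` e) = len \<Gamma> e"
    unfolding iso_rel_def by blast
  have "quart A (hdist \<Delta>) = quart A (hdist \<Gamma>)"
  proof (rule quart_cong)
    fix a b assume "a \<in> A" "b \<in> A"
    hence "hdist \<Delta> a b = hd_len \<Gamma> (\<lambda>e. len \<Delta> (f ` e)) a b" by (rule marked_tree_iso_hd_len[OF f(3,1,2)])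
    also have "\<dots> = hdist \<Gamma> a b" using f(4) by (intro hd_len_cong) simp
    finally show "hdist \<Delta> a b = hdist \<Gamma> a b" .
  qed
  thus "tropical_curve A \<Gamma> \<and> tropical_curve A \<Delta> \<and> quart A (hdist \<Gamma>) = quart A (hdist \<Delta>)" using f by simp
qed (use iso_if_quart_eq in blast)

text \<open>All curves of one cone live on a single tree: the lengths of \<Gamma> are transported
  along the isomorphism of types. Differences of half distances of such curves are then half
  distances of that tree with real lengths.\<close>

lemma type_rel_lengths:
  assumes "(\<Gamma>, \<Delta>) \<in> type_rel A"
  obtains l where "\<And>a b. a \<in> A \<Longrightarrow> b \<in> A \<Longrightarrow> hdist \<Gamma> a b = hd_len \<Delta> l a b"
proof -
  obtain f where f: "tropical_curve A \<Gamma>" "tropical_curve A \<Delta>" "marked_tree_iso A f \<Gamma> \<Delta>"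
    using assms unfolding type_rel_def by blast
  note F = marked_tree_iso_facts[OF f(3,1,2)]
  define l where "l e = len \<Gamma> (inv_into (bounded_edges \<Gamma>) ((`) f) e)" for e
  have "l (f ` e) = len \<Gamma> e" if "e \<in> bounded_edges \<Gamma>" for e
    unfolding l_def using inv_into_f_f[OF bij_betw_imp_inj_on[OF F(1)] that] by simp
  hence "hd_len \<Gamma> (\<lambda>e. l (f ` e)) a b = hdist \<Gamma> a b" for a b by (rule hd_len_cong)
  hence "hdist \<Gamma> a b = hd_len \<Delta> l a b" if "a \<in> A" "b \<in> A" for a b
    using marked_tree_iso_hd_len[OF f(3,1,2) that] by simp
  thus thesis by (rule that)
qed

lemma type_rel_refl: "tropical_curve A \<Gamma> \<Longrightarrow> (\<Gamma>, \<Gamma>) \<in> type_rel A"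
  unfolding type_rel_def marked_tree_iso_def by (auto intro!: exI[of _ id])

section \<open>Curves from tree orders\<close>

lemma covers_cong:
  "(\<And>u v. u \<in> V \<Longrightarrow> v \<in> V \<Longrightarrow> leq u v \<longleftrightarrow> leq' u v) \<Longrightarrow> covers V leq u v \<longleftrightarrow> covers V leq' u v"
  unfolding covers_def by blast

lemma (in tree_order_graph) tle_eq:
  assumes "u \<in> verts \<Gamma>" "v \<in> verts \<Gamma>"
  shows "tle \<Gamma> r u v \<longleftrightarrow> leq u v"
proof -
  interpret R: rooted_tree \<Gamma> r using is_tree root by unfold_locales
  show ?thesis unfolding tle_def root_path[OF assms(2) R.tpath[OF root assms(2)]] using assms(1) by simp
qed

text \<open>The common criterion for both constructions of curves, from the clusters of a tree
  metric and from stabilisation. Positivity is demanded for covering pairs that neither start at the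
  root nor end at a maximal vertex, which are the bounded edges.\<close>

lemma tropical_curve_if_tree_order:
  fixes \<Gamma> :: "'a tcurve" and \<rho> :: 'a
  defines "r \<equiv> leaf \<Gamma> \<rho>"
  assumes tog: "tree_order_graph \<Gamma> r leq" and S: "finite S" "card S \<ge> 3" "\<rho> \<in> S"
    and inj: "inj_on (leaf \<Gamma>) S"
    and leaves: "leaf \<Gamma> ` (S - {\<rho>}) = {v \<in> verts \<Gamma>. v \<noteq> r \<and> (\<forall>w. \<not> covers (verts \<Gamma>) leq v w)}"
    and one: "\<exists>!c. covers (verts \<Gamma>) leq r c"
    and two: "\<And>v w. v \<noteq> r \<Longrightarrow> covers (verts \<Gamma>) leq v w \<Longrightarrow> \<exists>w'. covers (verts \<Gamma>) leq v w' \<and> w' \<noteq> w"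
    and pos: "\<And>u v w. covers (verts \<Gamma>) leq u v \<Longrightarrow> u \<noteq> r \<Longrightarrow> covers (verts \<Gamma>) leq v w \<Longrightarrow> len \<Gamma> {u, v} > 0"
  shows "tropical_curve S \<Gamma>"
proof -
  interpret T: tree_order_graph \<Gamma> r leq by (rule tog)
  interpret R: rooted_tree \<Gamma> r using T.is_tree T.root by unfold_locales
  have cov: "covers (verts \<Gamma>) (tle \<Gamma> r) u v \<longleftrightarrow> covers (verts \<Gamma>) leq u v" for u v
    using T.tle_eq by (rule covers_cong)
  have ch: "R.ch v = {c. covers (verts \<Gamma>) leq v c}" for v unfolding R.ch_def cov ..
  have val_r: "valence \<Gamma> r = 1"
  proof -
    obtain c where "covers (verts \<Gamma>) leq r c" "\<And>c'. covers (verts \<Gamma>) leq r c' \<Longrightarrow> c' = c" using one by blast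
    hence "R.ch r = {c}" unfolding ch by blast
    thus ?thesis using R.valence_ch[OF R.root_in] by simp
  qed
  have val_leaf: "valence \<Gamma> v = 1" if "v \<in> verts \<Gamma>" "v \<noteq> r" "\<forall>w. \<not> covers (verts \<Gamma>) leq v w" for v
  proof -
    have "R.ch v = {}" unfolding ch using that(3) by blast
    thus ?thesis using R.valence_ch[OF that(1)] that(2) by simp
  qed
  have val_inner: "valence \<Gamma> v \<ge> 3" if v: "v \<in> verts \<Gamma>" "v \<noteq> r" and w: "covers (verts \<Gamma>) leq v w" for v w
  proof -
    obtain w' where "covers (verts \<Gamma>) leq v w'" "w' \<noteq> w" using two[OF v(2) w] by blast
    hence "{w, w'} \<subseteq> R.ch v" "card {w, w'} = 2" using w unfolding ch by auto
    hence "card (R.ch v) \<ge> 2" using card_mono[OF R.finite_ch] by metis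
    thus ?thesis using R.valence_ch[OF v(1)] v(2) by simp
  qed
  have cases: "v = r \<or> (\<forall>w. \<not> covers (verts \<Gamma>) leq v w) \<or> valence \<Gamma> v \<ge> 3" if "v \<in> verts \<Gamma>" for v
    using val_inner[OF that] by blast
  have Sr: "leaf \<Gamma> ` S = insert r (leaf \<Gamma> ` (S - {\<rho>}))" using S(3) r_def by blast
  have img: "leaf \<Gamma> ` S = {v \<in> verts \<Gamma>. valence \<Gamma> v = 1}"
  proof (intro Set.set_eqI iffI)
    fix v assume "v \<in> leaf \<Gamma> ` S"
    thus "v \<in> {v \<in> verts \<Gamma>. valence \<Gamma> v = 1}" unfolding Sr leaves using val_r val_leaf R.root_in by blast
  next
    fix v assume "v \<in> {v \<in> verts \<Gamma>. valence \<Gamma> v = 1}"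
    hence v: "v \<in> verts \<Gamma>" "valence \<Gamma> v = 1" by auto
    show "v \<in> leaf \<Gamma> ` S" unfolding Sr leaves using cases[OF v(1)] v by auto
  qed
  show ?thesis unfolding tropical_curve_def
  proof (intro conjI ballI)
    show "is_tree \<Gamma>" by (rule T.is_tree)
    show "bij_betw (leaf \<Gamma>) S {v \<in> verts \<Gamma>. valence \<Gamma> v = 1}" using inj img by (rule bij_betw_imageI)
    fix v assume v: "v \<in> verts \<Gamma>"
    show "valence \<Gamma> v \<noteq> 2"
    proof (cases "valence \<Gamma> v \<ge> 3")
      case False
      hence "valence \<Gamma> v = 1" using cases[OF v] val_r val_leaf[OF v] by blast
      thus ?thesis by simp
    qed simp
  next
    fix e assume "e \<in> bounded_edges \<Gamma>"
    hence e: "e \<in> edges \<Gamma>" "\<forall>v\<in>e. valence \<Gamma> v \<noteq> 1" by (auto simp: bounded_edges_def)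
    then obtain u v where uv: "covers (verts \<Gamma>) leq u v" "e = {u, v}" using T.edge_cov by blast
    have "u \<noteq> r" using e(2) uv(2) val_r by auto
    moreover have "\<exists>w. covers (verts \<Gamma>) leq v w"
    proof (rule ccontr)
      assume "\<not> ?thesis"
      hence "valence \<Gamma> v = 1" using val_leaf[of v] T.covD[OF uv(1)] T.cov_root uv(1) by blast
      thus False using e(2) uv(2) by simp
    qed
    ultimately show "len \<Gamma> e > 0" using pos[OF uv(1)] uv(2) by blast
  qed (use S in auto)
qed

section \<open>Edge lengths as differences of a function on vertices\<close>

context marked_tree begin

text \<open>Telescoping along the path from \<open>apex\<close> to \<open>m\<close>. The function
  \<open>dep\<close> is arbitrary so that it can be the depth in a given curve as well as minus the
  diameter of a cluster.\<close>

lemma sum_dep: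
  assumes dep: "\<And>v. v \<in> bv \<Longrightarrow> l (eb v) = dep v - dep (par v)"
    and "m \<in> verts \<Gamma>" "m \<noteq> r" "valence \<Gamma> m \<noteq> 1"
  shows "(\<Sum>v\<in>{v \<in> bv. v \<preceq> m}. l (eb v)) = dep m - (dep apex :: real)"
  using assms(2-)
proof (induction "rank m" arbitrary: m rule: less_induct)
  case less
  show ?case
  proof (cases "m = apex")
    case True
    have e: "{v \<in> bv. v \<preceq> m} = {}"
    proof -
      have "\<not> v \<preceq> apex" if v: "v \<in> bv" for v
      proof
        assume "v \<preceq> apex"
        hence "v \<preceq> r" using cov_le[OF apex(1) bvD(1)[OF v]] bvD(3)[OF v] by blast
        thus False using antisym[OF bvD(1)[OF v] root_in] bot[OF bvD(1)[OF v]] bvD(2)[OF v] by blast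
      qed
      thus ?thesis using True by blast
    qed
    show ?thesis unfolding e using True by simp
  next
    case False
    hence m: "m \<in> bv" using less.prems by (simp add: bv_def)
    note P = par_inner[OF less.prems(1,2) False]
    have eq: "{v \<in> bv. v \<preceq> m} = insert m {v \<in> bv. v \<preceq> par m}"
    proof (intro Set.set_eqI iffI)
      fix v assume "v \<in> {v \<in> bv. v \<preceq> m}"
      thus "v \<in> insert m {v \<in> bv. v \<preceq> par m}" using cov_le[OF bvD(5)[OF m]] bvD(1) by blast
    next
      fix v assume "v \<in> insert m {v \<in> bv. v \<preceq> par m}"
      thus "v \<in> {v \<in> bv. v \<preceq> m}"
        using m refl[OF bvD(1)[OF m]] trans[OF bvD(1) P(3) bvD(1)[OF m]] covD(4)[OF bvD(5)[OF m]] by blast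
    qed
    have "\<not> m \<preceq> par m" using antisym[OF bvD(1)[OF m] P(3)] covD(3,4)[OF bvD(5)[OF m]] by metis
    hence "(\<Sum>v\<in>{v \<in> bv. v \<preceq> m}. l (eb v)) = l (eb m) + (\<Sum>v\<in>{v \<in> bv. v \<preceq> par m}. l (eb v))"
      unfolding eq using finite_bv by (subst sum.insert) auto
    also have "(\<Sum>v\<in>{v \<in> bv. v \<preceq> par m}. l (eb v)) = dep (par m) - dep apex"
      using less.hyps[of "par m"] rank_less covD[OF bvD(5)[OF m]] P by blast
    finally show ?thesis using dep[OF m] by simp
  qed
qed

definition is_meet :: "nat \<Rightarrow> 'a \<Rightarrow> 'a \<Rightarrow> bool" where
  "is_meet m a b \<longleftrightarrow> m \<in> verts \<Gamma> \<and> a \<in> cl m \<and> b \<in> cl m \<and> (\<forall>w\<in>verts \<Gamma>. a \<in> cl w \<longrightarrow> b \<in> cl w \<longrightarrow> w \<preceq> m)"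

lemma meet_inner:
  assumes "is_meet m a b" "{a, b} \<subseteq> A - {\<rho>}" "a \<noteq> b"
  shows "m \<in> verts \<Gamma>" "m \<noteq> r" "valence \<Gamma> m \<noteq> 1"
proof -
  show m: "m \<in> verts \<Gamma>" using assms by (simp add: is_meet_def)
  have "apex \<preceq> m" using assms cl_apex apex_in by (simp add: is_meet_def)
  thus mr: "m \<noteq> r" using antisym[OF apex_in(1) root_in] bot[OF apex_in(1)] apex_in(3) by blast
  show "valence \<Gamma> m \<noteq> 1"
  proof
    assume "valence \<Gamma> m = 1"
    then obtain x where x: "x \<in> A" "m = leaf \<Gamma> x" using leaf_if_val1 m by blast
    hence "cl m = {x}" using cl_leaf[of x] mr by (cases "x = \<rho>") auto
    thus False using assms by (auto simp: is_meet_def)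
  qed
qed

lemma sum_meet:
  assumes dep: "\<And>v. v \<in> bv \<Longrightarrow> l (eb v) = dep v - (dep (par v) :: real)"
    and m: "is_meet m a b" "{a, b} \<subseteq> A - {\<rho>}" "a \<noteq> b"
  shows "(\<Sum>v\<in>{v \<in> bv. a \<in> cl v \<and> b \<in> cl v}. l (eb v)) = dep m - dep apex"
proof -
  note M = meet_inner[OF m]
  have "{v \<in> bv. a \<in> cl v \<and> b \<in> cl v} = {v \<in> bv. v \<preceq> m}"
  proof (intro Set.set_eqI iffI)
    fix v assume "v \<in> {v \<in> bv. a \<in> cl v \<and> b \<in> cl v}"
    thus "v \<in> {v \<in> bv. v \<preceq> m}" using m(1) bvD(1) unfolding is_meet_def by blast
  next
    fix v assume v: "v \<in> {v \<in> bv. v \<preceq> m}"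
    hence "cl m \<subseteq> cl v" using cl_mono[OF bvD(1) M(1)] by blast
    thus "v \<in> {v \<in> bv. a \<in> cl v \<and> b \<in> cl v}" using m(1) v unfolding is_meet_def by blast
  qed
  thus ?thesis using sum_dep[where l=l and dep=dep, OF dep M] by simp
qed

text \<open>Edges having \<open>a\<close> and \<open>b\<close> above them are those below the last
  common ancestor of the two. In the difference of the two sums the edges below all of
  \<open>a\<close>, \<open>b\<close>, \<open>c\<close> cancel, so a quartet with the root marking
  compares the depths of two last common ancestors.\<close>

lemma qd_meet:
  assumes dep: "\<And>v. v \<in> bv \<Longrightarrow> l (eb v) = dep v - (dep (par v) :: real)"
    and m: "is_meet m a b" "is_meet m' a c" and abc: "{a, b, c} \<subseteq> A - {\<rho>}" "distinct [a, b, c]"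
  shows "qd (hd_len \<Gamma> l) a b c \<rho> = dep m - dep m'"
proof -
  let ?f = "\<lambda>P. (\<Sum>v\<in>{v \<in> bv. P v}. l (eb v))"
  have split: "?f P = ?f (\<lambda>v. P v \<and> Q v) + ?f (\<lambda>v. P v \<and> \<not> Q v)" for P Q
  proof -
    have "{v \<in> bv. P v} = {v \<in> bv. P v \<and> Q v} \<union> {v \<in> bv. P v \<and> \<not> Q v}" by blast
    thus ?thesis using finite_bv by (subst sum.union_disjoint[symmetric]) auto
  qed
  have A: "a \<in> A" "b \<in> A" "c \<in> A" "{a, b, c, \<rho>} \<subseteq> A" using abc rho by auto
  have 1: "?f (\<lambda>v. a \<in> cl v \<and> b \<in> cl v) = ?f (\<lambda>v. a \<in> cl v \<and> b \<in> cl v \<and> c \<in> cl v) + ?f (\<lambda>v. a \<in> cl v \<and> b \<in> cl v \<and> c \<notin> cl v)"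
    using split[of "\<lambda>v. a \<in> cl v \<and> b \<in> cl v" "\<lambda>v. c \<in> cl v"] by (simp add: conj_assoc)
  have 2: "?f (\<lambda>v. a \<in> cl v \<and> c \<in> cl v) = ?f (\<lambda>v. a \<in> cl v \<and> b \<in> cl v \<and> c \<in> cl v) + ?f (\<lambda>v. a \<in> cl v \<and> c \<in> cl v \<and> b \<notin> cl v)"
    using split[of "\<lambda>v. a \<in> cl v \<and> c \<in> cl v" "\<lambda>v. b \<in> cl v"] by (simp add: conj_ac)
  have "qd (hd_len \<Gamma> l) a b c \<rho> = lamf \<Gamma> l a b c \<rho> - lamf \<Gamma> l a c b \<rho>" by (rule qd_hd_len[OF A(4)])
  also have "\<dots> = ?f (\<lambda>v. a \<in> cl v \<and> b \<in> cl v \<and> c \<notin> cl v) - ?f (\<lambda>v. a \<in> cl v \<and> c \<in> cl v \<and> b \<notin> cl v)"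
    unfolding lamf_rho[OF A(1,2,3)] lamf_rho[OF A(1,3,2)] ..
  also have "\<dots> = ?f (\<lambda>v. a \<in> cl v \<and> b \<in> cl v) - ?f (\<lambda>v. a \<in> cl v \<and> c \<in> cl v)" using 1 2 by simp
  also have "\<dots> = dep m - dep m'"
    using sum_meet[where l=l and dep=dep, OF dep m(1)] sum_meet[where l=l and dep=dep, OF dep m(2)] abc by auto
  finally show ?thesis .
qed

end

text \<open>Quartets containing \<rho> generate all others, because
  \<open>qd H a b c d = qd H a b c \<rho> + qd H d c b \<rho>\<close> for symmetric
  \<open>H\<close>.\<close>

lemma quart_eqI_root:
  assumes H: "\<And>a b. a \<in> A \<Longrightarrow> b \<in> A \<Longrightarrow> H a b = H b a" and K: "\<And>a b. a \<in> A \<Longrightarrow> b \<in> A \<Longrightarrow> K a b = K b a"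
    and rho: "\<rho> \<in> A"
    and eq: "\<And>a b c. {a, b, c} \<subseteq> A - {\<rho>} \<Longrightarrow> distinct [a, b, c] \<Longrightarrow> qd H a b c \<rho> = qd K a b c \<rho>"
  shows "quart A H = quart A K"
proof (rule quartI)
  fix a b c d assume D: "distinct [a, b, c, d]" and A: "{a, b, c, d} \<subseteq> A"
  have s: "qd H a b c d = qd H b a d c" "qd H a b c d = qd H c d a b" "qd H a b c d = qd H d c b a"
       "qd K a b c d = qd K b a d c" "qd K a b c d = qd K c d a b" "qd K a b c d = qd K d c b a"
    using A H[of a b] H[of c d] H[of a c] H[of b d] K[of a b] K[of c d] K[of a c] K[of b d] by (auto simp: qd_def)
  consider "d = \<rho>" | "c = \<rho>" | "b = \<rho>" | "a = \<rho>" | "\<rho> \<notin> {a, b, c, d}" by blast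
  thus "qd H a b c d = qd K a b c d"
  proof cases
    case 1 thus ?thesis using eq[of a b c] D A by auto
  next
    case 2 thus ?thesis using eq[of b a d] D A s by auto
  next
    case 3 thus ?thesis using eq[of c d a] D A s by auto
  next
    case 4 thus ?thesis using eq[of d c b] D A s by auto
  next
    case 5
    have "qd H a b c d = qd H a b c \<rho> + qd H d c b \<rho>" "qd K a b c d = qd K a b c \<rho> + qd K d c b \<rho>"
      using A H[of d b] H[of d c] K[of d b] K[of d c] by (auto simp: qd_def)
    moreover have "qd H a b c \<rho> = qd K a b c \<rho>" "qd H d c b \<rho> = qd K d c b \<rho>"
      using eq[of a b c] eq[of d c b] 5 D A by auto
    ultimately show ?thesis by simp
  qed
qed

section \<open>Realising a tree metric by a curve\<close>

lemma tm_sym: "tm A H \<Longrightarrow> a \<in> A \<Longrightarrow> b \<in> A \<Longrightarrow> H a b = H b a"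
  by (simp add: tm_def)

text \<open>Rooted at a marking \<open>\<rho>\<close>, the four-point condition says that the half distances become an
  ultrametric; its balls are the clusters of a curve.\<close>

lemma ex_curve_if_tm:
  assumes tm: "tm A H" and finA: "finite A" and cA: "card A \<ge> 3"
  shows "\<exists>\<Gamma>. tropical_curve A \<Gamma> \<and> quart A (hdist \<Gamma>) = quart A H"
proof -
  have "A \<noteq> {}" using cA by auto
  then obtain \<rho> where rho: "\<rho> \<in> A" by blast
  define B where "B = A - {\<rho>}"
  have finB: "finite B" using finA by (simp add: B_def)
  have cB: "card B \<ge> 2" using cA rho finA by (simp add: B_def)
  have BA: "a \<in> A" "a \<noteq> \<rho>" if "a \<in> B" for a using that by (auto simp: B_def)
  \<comment> \<open>The ultrametric on the markings other than \<rho>; its values may be negative,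
    only comparisons matter.\<close>
  define h where "h a b = H a b - H \<rho> a - H \<rho> b" for a b
  have hsym: "h a b = h b a" if "a \<in> B" "b \<in> B" for a b
    using tm_sym[OF tm] BA that by (simp add: h_def)
  have um: "h a b \<le> max (h a c) (h c b)" if "a \<in> B" "b \<in> B" "c \<in> B" "a \<noteq> b" "b \<noteq> c" "a \<noteq> c" for a b c
  proof -
    have "distinct [a, b, c, \<rho>]" using that BA by auto
    hence "H a b + H c \<rho> \<le> max (H a c + H b \<rho>) (H a \<rho> + H b c)"
      using tm that BA rho unfolding tm_def by blast
    moreover have "H c \<rho> = H \<rho> c" "H b \<rho> = H \<rho> b" "H a \<rho> = H \<rho> a" "H b c = H c b"
      using tm_sym[OF tm] BA that rho by blast+
    ultimately show ?thesis unfolding h_def by linarith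
  qed
  \<comment> \<open>Isolated sets: any two members are closer to each other than to any outsider.
    Singletons and \<open>B\<close> qualify vacuously.\<close>
  define iso where "iso S \<longleftrightarrow> (\<forall>a\<in>S. \<forall>b\<in>S. \<forall>c\<in>B - S. a \<noteq> b \<longrightarrow> h a b < h a c)" for S
  have isoD: "h a b < h a c" if "iso S" "a \<in> S" "b \<in> S" "a \<noteq> b" "c \<in> B" "c \<notin> S" for S a b c
    using that unfolding iso_def by simp
  define F where "F = insert A {S. S \<subseteq> B \<and> S \<noteq> {} \<and> iso S}"
  have "F \<subseteq> Pow A" unfolding F_def B_def by blast
  hence finF: "finite F" using finA by (simp add: finite_subset)
  \<comment> \<open>Vertices of curves are natural numbers, so the clusters that serve as vertices
    have to be encoded.\<close>
  then obtain enc :: "'a set \<Rightarrow> nat" where enc: "inj_on enc F" using finite_imp_inj_to_nat_seg by metis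
  define dec where "dec = inv_into F enc"
  have de: "dec (enc S) = S" if "S \<in> F" for S unfolding dec_def using enc that by (rule inv_into_f_f)
  define V where "V = enc ` F"
  have decF: "dec x \<in> F" if "x \<in> V" for x using that de by (auto simp: V_def)
  have ed: "enc (dec x) = x" if "x \<in> V" for x using that de by (auto simp: V_def)
  have encV: "enc S \<in> V" if "S \<in> F" for S using that by (simp add: V_def)
  define leq where "leq x y \<longleftrightarrow> dec y \<subseteq> dec x" for x y
  have AF: "A \<in> F" by (simp add: F_def)
  have BF: "B \<in> F" using cB by (auto simp: F_def iso_def)
  have sF: "{a} \<in> F" if "a \<in> B" for a using that by (auto simp: F_def iso_def)
  have ne: "S \<noteq> {}" if "S \<in> F" for S using that \<open>A \<noteq> {}\<close> by (auto simp: F_def)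
  have nA: "B \<noteq> A" using rho by (auto simp: B_def)
  have FB: "S \<subseteq> B \<and> iso S" if "S \<in> F" "S \<noteq> A" for S using that by (auto simp: F_def)
  have sA: "S \<subseteq> A" if "S \<in> F" for S using that by (auto simp: F_def B_def)
  \<comment> \<open>If neither of two intersecting isolated sets contained the other, a common
    member would be strictly closer to either of two outsiders than to the other one.\<close>
  have lam: "S \<subseteq> T \<or> T \<subseteq> S" if ST: "S \<in> F" "T \<in> F" "x \<in> S" "x \<in> T" for S T x
  proof (rule ccontr)
    assume n: "\<not> ?thesis"
    hence "S \<noteq> A" "T \<noteq> A" using sA ST(1,2) by blast+
    hence S: "S \<subseteq> B" "iso S" "T \<subseteq> B" "iso T" using FB ST by blast+
    obtain y where y: "y \<in> S" "y \<notin> T" using n by blast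
    obtain z where z: "z \<in> T" "z \<notin> S" using n by blast
    have xy: "x \<noteq> y" "x \<noteq> z" "z \<in> B" "y \<in> B" using ST(3,4) y z S(1,3) by blast+
    have "h x y < h x z" by (rule isoD[OF S(2) ST(3) y(1) xy(1,3) z(2)])
    moreover have "h x z < h x y" by (rule isoD[OF S(4) ST(4) z(1) xy(2,4) y(2)])
    ultimately show False by simp
  qed
  define r where "r = enc A"
  have rV: "r \<in> V" "dec r = A" using encV AF de by (auto simp: r_def)
  have to: "tree_order V r leq"
  proof
    show "finite V" using finF by (simp add: V_def)
    show "r \<in> V" by (rule rV)
    fix v assume "v \<in> V"
    thus "leq r v" "leq v v" using sA decF rV by (auto simp: leq_def)
  next
    fix u v assume uv: "u \<in> V" "v \<in> V" "leq u v" "leq v u"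
    hence "dec u = dec v" by (auto simp: leq_def)
    thus "u = v" using ed uv by metis
  next
    fix u v w assume a: "u \<in> V" "v \<in> V" "w \<in> V" "leq u w" "leq v w"
    obtain x where "x \<in> dec w" using ne decF a(3) by blast
    thus "leq u v \<or> leq v u" using lam[OF decF[OF a(1)] decF[OF a(2)], of x] a(4,5) unfolding leq_def by blast
  qed (auto simp: leq_def)
  \<comment> \<open>The diameter of a cluster; an edge gets the difference of the diameters of its
    two clusters. In \<open>\<Gamma>\<close> this is written with \<open>Max\<close> and
    \<open>Min\<close> only because an edge is an unordered pair. At a singleton or at
    \<open>A\<close> the value of \<open>ht\<close> has no meaning, but all edges there are
    ends.\<close>
  define ht where "ht S = Max {h a b | a b. a \<in> S \<and> b \<in> S \<and> a \<noteq> b}" for S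
  define \<Gamma> :: "'a tcurve" where "\<Gamma> = \<lparr>verts = V, edges = cover_edges V leq,
    leaf = (\<lambda>a. if a = \<rho> then r else enc {a}),
    len = (\<lambda>e. Max ((\<lambda>x. ht (dec x)) ` e) - Min ((\<lambda>x. ht (dec x)) ` e))\<rparr>"
  have G: "verts \<Gamma> = V" "edges \<Gamma> = cover_edges V leq" "leaf \<Gamma> \<rho> = r" "\<And>a. a \<noteq> \<rho> \<Longrightarrow> leaf \<Gamma> a = enc {a}"
    "\<And>e. len \<Gamma> e = Max ((\<lambda>x. ht (dec x)) ` e) - Min ((\<lambda>x. ht (dec x)) ` e)"
    by (simp_all add: \<Gamma>_def)
  interpret T: tree_order V r leq by (rule to)
  have tog: "tree_order_graph \<Gamma> (leaf \<Gamma> \<rho>) leq"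
    using to G by (simp add: tree_order_graph_def tree_order_graph_axioms_def)
  have covsub: "dec w \<subset> dec v" "v \<in> V" "w \<in> V" if "covers V leq v w" for v w
    using T.covD[OF that] ed unfolding leq_def by (metis psubsetI)+
  have ht_fin: "finite {h a b | a b. a \<in> S \<and> b \<in> S \<and> a \<noteq> b}" if "S \<subseteq> B" for S
  proof -
    have "{h a b | a b. a \<in> S \<and> b \<in> S \<and> a \<noteq> b} \<subseteq> (\<lambda>(a, b). h a b) ` (B \<times> B)" using that by auto
    thus ?thesis using finB finite_subset by blast
  qed
  have ht_ge: "h a b \<le> ht S" if "S \<subseteq> B" "a \<in> S" "b \<in> S" "a \<noteq> b" for S a b
    unfolding ht_def using ht_fin[OF that(1)] that by (intro Max_ge) auto
  have ht_ex: "\<exists>a b. a \<in> S \<and> b \<in> S \<and> a \<noteq> b \<and> ht S = h a b" if "S \<subseteq> B" "x \<in> S" "y \<in> S" "x \<noteq> y" for S x y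
  proof -
    have "ht S \<in> {h a b | a b. a \<in> S \<and> b \<in> S \<and> a \<noteq> b}"
      unfolding ht_def using ht_fin[OF that(1)] that by (intro Max_in) auto
    thus ?thesis by blast
  qed
  have ht_less: "ht S < ht T" if S: "S \<in> F" "T \<in> F" "S \<subset> T" "T \<noteq> A" "x \<in> S" "y \<in> S" "x \<noteq> y" for S T x y
  proof -
    have "T \<subseteq> B" using FB[OF S(2,4)] by blast
    moreover from this have "S \<noteq> A" using S(3) unfolding B_def by blast
    ultimately have TB: "T \<subseteq> B" "S \<subseteq> B" "iso S" using FB[OF S(1)] by blast+
    obtain a b where ab: "a \<in> S" "b \<in> S" "a \<noteq> b" "ht S = h a b" using ht_ex[OF TB(2) S(5-7)] by blast
    obtain c where c: "c \<in> T" "c \<notin> S" using S(3) by blast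
    have "h a b < h a c" using isoD[OF TB(3) ab(1,2,3) _ c(2)] c(1) TB(1) by blast
    also have "\<dots> \<le> ht T" using ab c S(3) by (intro ht_ge[OF TB(1)]) auto
    finally show ?thesis using ab by simp
  qed
  have len_uv: "len \<Gamma> {u, v} = ht (dec u) - ht (dec v) \<and> ht (dec v) < ht (dec u)"
    if uv: "covers V leq u v" "u \<noteq> r" and xy: "x \<in> dec v" "y \<in> dec v" "x \<noteq> y" for u v x y
  proof -
    note C = covsub[OF uv(1)]
    have "dec u \<noteq> A" using uv(2) ed[OF C(2)] by (auto simp: r_def)
    hence "ht (dec v) < ht (dec u)" using ht_less[OF decF[OF C(3)] decF[OF C(2)] C(1) _ xy] by blast
    thus ?thesis using G(5)[of "{u, v}"] by simp
  qed
  have two_el: "\<exists>x y. x \<in> dec v \<and> y \<in> dec v \<and> x \<noteq> y" if "covers V leq v w" for v w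
    using covsub[OF that] ne[OF decF] by blast
  have decB: "dec v \<subseteq> B" if "v \<in> V" "v \<noteq> r" for v
    using FB[OF decF[OF that(1)]] ed[OF that(1)] that(2) r_def by metis
  have child: "\<exists>w. covers V leq v w \<and> a \<in> dec w" if v: "v \<in> V" "v \<noteq> r" "a \<in> dec v" "dec v \<noteq> {a}" for v a
  proof -
    have aB: "a \<in> B" using decB v by blast
    have "leq v (enc {a})" "v \<noteq> enc {a}" using v de[OF sF[OF aB]] by (auto simp: leq_def)
    then obtain w where "covers V leq v w" "leq w (enc {a})" using T.ex_cov_above[OF encV[OF sF[OF aB]] v(1)] by blast
    thus ?thesis using de[OF sF[OF aB]] by (auto simp: leq_def)
  qed
  have trop: "tropical_curve A \<Gamma>"
  proof (rule tropical_curve_if_tree_order[OF tog finA cA rho])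
    show "inj_on (leaf \<Gamma>) A"
    proof (rule inj_onI)
      fix a b assume ab: "a \<in> A" "b \<in> A" "leaf \<Gamma> a = leaf \<Gamma> b"
      have "dec (leaf \<Gamma> x) = (if x = \<rho> then A else {x})" if "x \<in> A" for x
        using that rV de sF G(3,4) by (auto simp: B_def)
      moreover have "A \<noteq> {x}" for x using cA by auto
      ultimately show "a = b" using ab by (metis singleton_inject)
    qed
    show "leaf \<Gamma> ` (A - {\<rho>}) = {v \<in> verts \<Gamma>. v \<noteq> leaf \<Gamma> \<rho> \<and> (\<forall>w. \<not> covers (verts \<Gamma>) leq v w)}"
    proof (intro Set.set_eqI iffI)
      fix v assume "v \<in> leaf \<Gamma> ` (A - {\<rho>})"
      then obtain a where a: "a \<in> B" "v = enc {a}" using G(4) by (auto simp: B_def)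
      have "v \<in> V" "dec v = {a}" using a encV sF de by auto
      moreover have "\<not> covers V leq v w" for w
      proof
        assume "covers V leq v w"
        hence "dec w = {}" using covsub[of v w] \<open>dec v = {a}\<close> by auto
        thus False using ne[OF decF] covsub(3)[OF \<open>covers V leq v w\<close>] by blast
      qed
      moreover have "v \<noteq> r" using \<open>dec v = {a}\<close> rV BA[OF a(1)] rho by auto
      ultimately show "v \<in> {v \<in> verts \<Gamma>. v \<noteq> leaf \<Gamma> \<rho> \<and> (\<forall>w. \<not> covers (verts \<Gamma>) leq v w)}" using G by simp
    next
      fix v assume "v \<in> {v \<in> verts \<Gamma>. v \<noteq> leaf \<Gamma> \<rho> \<and> (\<forall>w. \<not> covers (verts \<Gamma>) leq v w)}"
      hence v: "v \<in> V" "v \<noteq> r" "\<forall>w. \<not> covers V leq v w" using G by auto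
      obtain a where a: "a \<in> dec v" using ne[OF decF[OF v(1)]] by blast
      hence "dec v = {a}" using child[OF v(1,2) a] v(3) by blast
      moreover have "a \<in> B" using a decB v by blast
      ultimately show "v \<in> leaf \<Gamma> ` (A - {\<rho>})" using ed[OF v(1)] G(4)[of a] BA[of a] by force
    qed
    show "\<exists>!c. covers (verts \<Gamma>) leq (leaf \<Gamma> \<rho>) c"
    proof
      have dB: "dec (enc B) = B" "enc B \<in> V" using de encV BF by auto
      have c: "c = enc B \<or> leq (enc B) c" if "c \<in> V" "c \<noteq> r" for c using decB[OF that] dB by (simp add: leq_def)
      have rB: "leq r (enc B)" using dB(1) rV(2) sA[OF BF] by (simp add: leq_def)
      have rB': "r \<noteq> enc B" using dB(1) rV(2) nA by metis
      have "covers V leq r (enc B)" unfolding covers_def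
      proof (intro conjI ballI impI rV(1) rB rB' dB(2))
        fix w assume w: "w \<in> V" "leq r w" "leq w (enc B)"
        show "w = r \<or> w = enc B" using c[OF w(1)] T.antisym[OF w(1) dB(2) w(3)] by blast
      qed
      thus "covers (verts \<Gamma>) leq (leaf \<Gamma> \<rho>) (enc B)" using G by simp
      fix c' assume "covers (verts \<Gamma>) leq (leaf \<Gamma> \<rho>) c'"
      hence c': "covers V leq r c'" using G by simp
      show "c' = enc B"
        using c[OF T.covD(2)[OF c']] T.covD(3)[OF c'] T.cov_between[OF c' dB(2) rB] rB' by metis
    qed
    show "\<exists>w'. covers (verts \<Gamma>) leq v w' \<and> w' \<noteq> w"
      if v: "v \<noteq> leaf \<Gamma> \<rho>" "covers (verts \<Gamma>) leq v w" for v w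
    proof -
      have v': "v \<noteq> r" "covers V leq v w" using v G by auto
      note C = covsub[OF v'(2)]
      obtain b where b: "b \<in> dec v" "b \<notin> dec w" using C(1) by blast
      have "dec v \<noteq> {b}" using C(1) ne[OF decF[OF C(3)]] b(2) by auto
      then obtain w' where "covers V leq v w'" "b \<in> dec w'" using child[OF C(2) v'(1) b(1)] by blast
      thus ?thesis using b(2) G(1) by auto
    qed
    show "len \<Gamma> {u, v} > 0"
      if uv: "covers (verts \<Gamma>) leq u v" "u \<noteq> leaf \<Gamma> \<rho>" "covers (verts \<Gamma>) leq v w" for u v w
    proof -
      have uv': "covers V leq u v" "u \<noteq> r" "covers V leq v w" using uv G by auto
      obtain x y where "x \<in> dec v" "y \<in> dec v" "x \<noteq> y" using two_el[OF uv'(3)] by blast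
      thus ?thesis using len_uv[OF uv'(1,2)] by fastforce
    qed
  qed
  interpret M: marked_tree A \<Gamma> \<rho> using trop rho by unfold_locales
  interpret TG: tree_order_graph \<Gamma> "leaf \<Gamma> \<rho>" leq by (rule tog)
  have tle: "tle \<Gamma> (leaf \<Gamma> \<rho>) u v \<longleftrightarrow> leq u v" if "u \<in> V" "v \<in> V" for u v
    using TG.tle_eq that G(1) by simp
  have cov: "covers (verts \<Gamma>) (tle \<Gamma> (leaf \<Gamma> \<rho>)) u v \<longleftrightarrow> covers V leq u v" for u v
    unfolding G(1) using tle by (rule covers_cong)
  have cl: "M.cl x = dec x" if x: "x \<in> V" for x
  proof -
    have "tle \<Gamma> (leaf \<Gamma> \<rho>) x (leaf \<Gamma> a) \<longleftrightarrow> a \<in> dec x" if a: "a \<in> A" for a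
    proof (cases "a = \<rho>")
      case True
      have "A \<subseteq> dec x \<longleftrightarrow> \<rho> \<in> dec x"
      proof
        assume "\<rho> \<in> dec x"
        hence "dec x = A" using FB[OF decF[OF x]] BA by blast
        thus "A \<subseteq> dec x" by simp
      qed (use rho in blast)
      thus ?thesis using tle[OF x rV(1)] True G(3) rV(2) by (simp add: leq_def)
    next
      case False
      hence "a \<in> B" using a by (simp add: B_def)
      thus ?thesis using tle[OF x encV[OF sF]] de[OF sF] False G(4) by (simp add: leq_def)
    qed
    thus ?thesis using sA[OF decF[OF x]] unfolding M.cl_def by blast
  qed
  have dep: "len \<Gamma> (M.eb v) = - ht (dec v) - (- ht (dec (M.par v)))" if v: "v \<in> M.bv" for v
  proof -
    note D = M.bvD[OF v]
    have c: "covers V leq (M.par v) v" using D(5) cov by simp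
    obtain x y where "x \<in> M.cl v" "y \<in> M.cl v" "x \<noteq> y" using M.inner_two[OF D(1,4)] by metis
    hence "x \<in> dec v" "y \<in> dec v" "x \<noteq> y" using cl D(1) G(1) by auto
    hence "len \<Gamma> {M.par v, v} = ht (dec (M.par v)) - ht (dec v)"
      using len_uv[OF c] M.par_inner(2)[OF D(1-3)] G(3) by blast
    thus ?thesis by (simp add: M.eb_def)
  qed
  \<comment> \<open>The closed ball around \<open>a\<close> of radius \<open>h a b\<close> is
    isolated, has diameter \<open>h a b\<close>, and lies in every cluster containing
    \<open>a\<close> and \<open>b\<close>; so it is their last common ancestor. With
    \<open>qd_meet\<close> this turns diameters into quartets.\<close>
  have ball: "\<exists>m. M.is_meet m a b \<and> ht (dec m) = h a b" if ab: "a \<in> B" "b \<in> B" "a \<noteq> b" for a b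
  proof -
    define S where "S = {c \<in> B. c = a \<or> h a c \<le> h a b}"
    have SB: "S \<subseteq> B" "a \<in> S" "b \<in> S" using ab by (auto simp: S_def)
    have le: "h x y \<le> h a b" if xy: "x \<in> S" "y \<in> S" "x \<noteq> y" for x y
    proof -
      have "x \<in> B" "y \<in> B" "x = a \<or> h a x \<le> h a b" "y = a \<or> h a y \<le> h a b" using xy by (auto simp: S_def)
      thus ?thesis using um[of x y a] hsym[of x a] xy(3) ab(1) by (cases "x = a"; cases "y = a") auto
    qed
    have "iso S" unfolding iso_def
    proof (intro ballI impI)
      fix x y z assume xyz: "x \<in> S" "y \<in> S" "z \<in> B - S" "x \<noteq> y"
      hence z: "z \<in> B" "z \<noteq> a" "h a z > h a b" by (auto simp: S_def)
      have x: "x \<in> B" "x = a \<or> h a x \<le> h a b" "x \<noteq> z" using xyz by (auto simp: S_def)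
      have "h x z > h a b"
        using um[of a z x] z x ab by (cases "x = a") auto
      thus "h x y < h x z" using le[OF xyz(1,2,4)] by simp
    qed
    hence SF: "S \<in> F" using SB by (auto simp: F_def)
    have m: "enc S \<in> V" "dec (enc S) = S" using encV de SF by auto
    have "ht S = h a b"
    proof (rule antisym)
      show "ht S \<le> h a b" using ht_ex[OF SB ab(3)] le by metis
      show "h a b \<le> ht S" using ht_ge[OF SB ab(3)] .
    qed
    moreover have "M.is_meet (enc S) a b" unfolding M.is_meet_def
    proof (intro conjI ballI impI)
      fix w assume w: "w \<in> verts \<Gamma>" "a \<in> M.cl w" "b \<in> M.cl w"
      hence w': "w \<in> V" "a \<in> dec w" "b \<in> dec w" using cl G(1) by auto
      have "S \<subseteq> dec w"
      proof (cases "dec w = A")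
        case True thus ?thesis using SB(1) BA by auto
      next
        case False
        hence i: "iso (dec w)" using FB[OF decF[OF w'(1)]] by blast
        show ?thesis
        proof (rule subsetI, rule ccontr)
          fix c assume c: "c \<in> S" "c \<notin> dec w"
          hence "h a b < h a c" using isoD[OF i w'(2,3) ab(3) _ c(2)] SB(1) by blast
          moreover have "h a c \<le> h a b" using c w' by (auto simp: S_def)
          ultimately show False by simp
        qed
      qed
      thus "tle \<Gamma> (leaf \<Gamma> \<rho>) w (enc S)" using tle[OF w'(1) m(1)] m(2) by (simp add: leq_def)
    qed (use m SB cl[OF m(1)] G(1) in auto)
    ultimately show ?thesis using m(2) by auto
  qed
  have "quart A (hdist \<Gamma>) = quart A H"
  proof (rule quart_eqI_root[OF _ _ rho])
    fix a b c assume abc: "{a, b, c} \<subseteq> A - {\<rho>}" "distinct [a, b, c]"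
    hence B: "a \<in> B" "b \<in> B" "c \<in> B" by (auto simp: B_def)
    obtain m where m: "M.is_meet m a b" "ht (dec m) = h a b" using ball[OF B(1,2)] abc by auto
    obtain m' where m': "M.is_meet m' a c" "ht (dec m') = h a c" using ball[OF B(1,3)] abc by auto
    have "qd (hdist \<Gamma>) a b c \<rho> = - ht (dec m) - (- ht (dec m'))"
      using M.qd_meet[where l="len \<Gamma>" and dep="\<lambda>v. - ht (dec v)", OF dep m(1) m'(1) abc] .
    also have "\<dots> = qd H a b c \<rho>"
      using m(2) m'(2) tm_sym[OF tm, of b \<rho>] tm_sym[OF tm, of c \<rho>] abc rho by (auto simp: qd_def h_def)
    finally show "qd (hdist \<Gamma>) a b c \<rho> = qd H a b c \<rho>" .
  qed (use tm_sym[OF tm] M.hd_len_sym in blast)+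
  thus ?thesis using trop by blast
qed

section \<open>Forgetful maps\<close>

lemma (in tree_order) restrict: "W \<subseteq> V \<Longrightarrow> r \<in> W \<Longrightarrow> tree_order W r leq"
proof
  assume W: "W \<subseteq> V" "r \<in> W"
  show "finite W" using fin W finite_subset by blast
  show "r \<in> W" by (rule W)
  show "leq r v" "leq v v" if "v \<in> W" for v using that W bot refl by blast+
  show "leq u w" if "u \<in> W" "v \<in> W" "w \<in> W" "leq u v" "leq v w" for u v w
    using that W trans[of u v w] by blast
  show "u = v" if "u \<in> W" "v \<in> W" "leq u v" "leq v u" for u v using that W antisym[of u v] by blast
  show "leq u v \<or> leq v u" if "u \<in> W" "v \<in> W" "w \<in> W" "leq u w" "leq v w" for u v w
    using that W chain[of u v w] by blast
qed

lemma (in tree_order) ex_branch: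
  assumes "u \<in> V" "v \<in> V" "\<not> leq u v" "\<not> leq v u"
  obtains m c1 c2 where "cov m c1" "cov m c2" "c1 \<noteq> c2" "leq c1 u" "leq c2 v"
proof -
  let ?U = "{w \<in> V. leq w u \<and> leq w v}"
  have U: "finite ?U" "r \<in> ?U" using fin root bot assms by auto
  obtain m where m: "m \<in> ?U" "\<And>x. x \<in> ?U \<Longrightarrow> rank x \<le> rank m"
  proof -
    have "Max (rank ` ?U) \<in> rank ` ?U" using U by (intro Max_in) auto
    then obtain v where "v \<in> ?U" "rank v = Max (rank ` ?U)" by auto
    thus thesis using that[of v] U Max_ge[of "rank ` ?U"] by auto
  qed
  have mV: "m \<in> V" "leq m u" "leq m v" using m by auto
  have ne: "m \<noteq> u" "m \<noteq> v" using mV assms by auto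
  obtain c1 where c1: "cov m c1" "leq c1 u" using ex_cov_above[OF assms(1) mV(1,2) ne(1)] by blast
  obtain c2 where c2: "cov m c2" "leq c2 v" using ex_cov_above[OF assms(2) mV(1,3) ne(2)] by blast
  have "c1 \<noteq> c2"
  proof
    assume "c1 = c2"
    hence "c1 \<in> ?U" using c1 c2 covD(2)[OF c1(1)] by simp
    hence "rank c1 \<le> rank m" by (rule m(2))
    moreover have "rank m < rank c1" using covD[OF c1(1)] by (intro rank_less)
    ultimately show False by simp
  qed
  thus thesis using that c1 c2 by blast
qed

lemma tree_path_rev:
  assumes "tree_path \<Gamma> u p v" shows "tree_path \<Gamma> v (rev p) u"
proof -
  have "successively (\<lambda>x y. {y, x} \<in> edges \<Gamma>) p" using assms by (simp add: tree_path_def insert_commute)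
  hence "successively (\<lambda>x y. {x, y} \<in> edges \<Gamma>) (rev p)" by (simp add: successively_rev)
  thus ?thesis using assms by (simp add: tree_path_def hd_rev last_rev)
qed

lemma (in rooted_tree) path_between:
  assumes "u \<in> verts \<Gamma>" "v \<in> verts \<Gamma>" "tle \<Gamma> r u v" "tree_path \<Gamma> u p v"
  shows "set p = {w \<in> verts \<Gamma>. tle \<Gamma> r u w \<and> tle \<Gamma> r w v}"
proof -
  obtain q where q: "tpath \<Gamma> r v = tpath \<Gamma> r u @ q" using tle_prefix[OF assms(2,3)] by blast
  define us where "us = butlast (tpath \<Gamma> r u)"
  have us: "tpath \<Gamma> r u = us @ [u]" using last_tpath[OF assms(1)] unfolding us_def by (metis append_butlast_last_id)
  have v: "tpath \<Gamma> r v = us @ (u # q)" using q us by simp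
  have tv: "tree_path \<Gamma> r (us @ (u # q)) v" using tpath[OF root_in assms(2)] v by simp
  have "successively (\<lambda>x y. {x, y} \<in> edges \<Gamma>) (u # q)"
    using tv unfolding tree_path_def successively_append_iff[of _ us "u # q"] by blast
  hence "tree_path \<Gamma> u (u # q) v" using tv by (auto simp: tree_path_def)
  hence p: "p = u # q" using path_unique assms(4) by blast
  have dist: "distinct (us @ (u # q))" using tv by (simp add: tree_path_def)
  show ?thesis
  proof (intro Set.set_eqI iffI)
    fix w assume w: "w \<in> set p"
    hence wv: "tle \<Gamma> r w v" unfolding tle_def v p by auto
    have wV: "w \<in> verts \<Gamma>" using tle_verts[OF assms(2) wv] .
    have "tle \<Gamma> r u w"
    proof (cases "tle \<Gamma> r w u")
      case True
      hence "w \<in> set (us @ [u])" unfolding tle_def us .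
      hence "w = u" using w dist unfolding p by auto
      thus ?thesis using refl assms(1) by simp
    next
      case False thus ?thesis using chain[OF wV assms(1,2) wv assms(3)] by blast
    qed
    thus "w \<in> {w \<in> verts \<Gamma>. tle \<Gamma> r u w \<and> tle \<Gamma> r w v}" using wv wV by blast
  next
    fix w assume w: "w \<in> {w \<in> verts \<Gamma>. tle \<Gamma> r u w \<and> tle \<Gamma> r w v}"
    hence "w \<in> set (us @ (u # q))" using v by (simp add: tle_def)
    moreover have "w = u" if "w \<in> set us"
    proof -
      have "tle \<Gamma> r w u" using that us by (simp add: tle_def)
      thus ?thesis using antisym[OF _ assms(1)] w by blast
    qed
    ultimately show "w \<in> set p" unfolding p by auto
  qed
qed

section \<open>Last common ancestors and depths in a curve\<close>

context marked_tree begin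

lemma meet_branch:
  assumes "cov m c1" "cov m c2" "c1 \<noteq> c2" "a \<in> cl c1" "b \<in> cl c2"
  shows "is_meet m a b"
  unfolding is_meet_def
proof (intro conjI ballI impI)
  show "m \<in> verts \<Gamma>" using covD[OF assms(1)] by blast
  show "a \<in> cl m" using cl_mono covD[OF assms(1)] assms(4) by blast
  show "b \<in> cl m" using cl_mono covD[OF assms(2)] assms(5) by blast
  fix w assume w: "w \<in> verts \<Gamma>" "a \<in> cl w" "b \<in> cl w"
  have n: "\<not> c1 \<preceq> w"
  proof
    assume "c1 \<preceq> w"
    hence "b \<in> cl c1" using cl_mono[OF covD(2)[OF assms(1)] w(1)] w(3) by blast
    thus False using cl_disjoint[OF assms(1-3)] assms(5) by blast
  qed
  hence "w \<preceq> c1" using laminar[OF w(1) covD(2)[OF assms(1)] w(2) assms(4)] by blast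
  moreover have "w \<noteq> c1" using n refl[OF w(1)] by auto
  ultimately show "w \<preceq> m" using cov_le[OF assms(1) w(1)] by blast
qed

lemma ex_meet:
  assumes "{a, b} \<subseteq> A - {\<rho>}" "a \<noteq> b"
  obtains m c1 c2 where "cov m c1" "cov m c2" "c1 \<noteq> c2" "a \<in> cl c1" "b \<in> cl c2"
proof -
  have A: "a \<in> A" "b \<in> A" "a \<noteq> \<rho>" "b \<noteq> \<rho>" using assms by auto
  have n: "\<not> leaf \<Gamma> a \<preceq> leaf \<Gamma> b" "\<not> leaf \<Gamma> b \<preceq> leaf \<Gamma> a"
    using leaf_maximal[OF A(1,3) leaf_in[OF A(2)]] leaf_maximal[OF A(2,4) leaf_in[OF A(1)]] leaf_inj[OF A(1,2)] assms(2) by auto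
  obtain m c1 c2 where "cov m c1" "cov m c2" "c1 \<noteq> c2" "c1 \<preceq> leaf \<Gamma> a" "c2 \<preceq> leaf \<Gamma> b"
    by (rule ex_branch[OF leaf_in[OF A(1)] leaf_in[OF A(2)] n])
  thus thesis using that A by (simp add: cl_def)
qed

definition dep :: "nat \<Rightarrow> real" where "dep v = (\<Sum>y\<in>{y \<in> bv. y \<preceq> v}. len \<Gamma> (eb y))"

lemma dep_diff:
  assumes "u \<in> verts \<Gamma>" "v \<in> verts \<Gamma>" "u \<preceq> v"
  shows "(\<Sum>y\<in>{y \<in> bv. y \<preceq> v \<and> \<not> y \<preceq> u}. len \<Gamma> (eb y)) = dep v - dep u"
proof -
  have "y \<preceq> v" if "y \<in> bv" "y \<preceq> u" for y using trans[OF bvD(1)[OF that(1)] assms(1,2) that(2) assms(3)] .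
  hence eq: "{y \<in> bv. y \<preceq> v} = {y \<in> bv. y \<preceq> u} \<union> {y \<in> bv. y \<preceq> v \<and> \<not> y \<preceq> u}" by blast
  have "dep v = dep u + (\<Sum>y\<in>{y \<in> bv. y \<preceq> v \<and> \<not> y \<preceq> u}. len \<Gamma> (eb y))"
    unfolding dep_def eq using finite_bv by (subst sum.union_disjoint) auto
  thus ?thesis by simp
qed

lemma dep_eb:
  assumes v: "v \<in> bv" shows "len \<Gamma> (eb v) = dep v - dep (par v)"
proof -
  note D = bvD[OF v] covD[OF bvD(5)[OF v]]
  have "{y \<in> bv. y \<preceq> v \<and> \<not> y \<preceq> par v} = {v}"
  proof (intro Set.set_eqI iffI)
    fix y assume "y \<in> {y \<in> bv. y \<preceq> v \<and> \<not> y \<preceq> par v}"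
    thus "y \<in> {v}" using cov_le[OF D(5)] bvD(1) by blast
  next
    fix y assume "y \<in> {v}"
    moreover have "\<not> v \<preceq> par v" using antisym[OF D(1) D(6)] D(8,9) by metis
    ultimately show "y \<in> {y \<in> bv. y \<preceq> v \<and> \<not> y \<preceq> par v}" using v refl[OF D(1)] by blast
  qed
  thus ?thesis using dep_diff[OF D(6,1,9)] by simp
qed

end

text \<open>The root marking is one of those that are kept. The subtree spanned by the kept ends
  then contains the root, consists of the vertices whose cluster meets \<open>S\<close>, and carries
  the same order.\<close>

locale marked_subtree = marked_tree +
  fixes S :: "'a set"
  assumes SA: "S \<subseteq> A" and rhoS: "\<rho> \<in> S" and cS: "card S \<ge> 3"
begin

abbreviation "\<Gamma>0 \<equiv> remove_ends S \<Gamma>"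

definition hv :: "nat set" where "hv = {v \<in> verts \<Gamma>. cl v \<inter> S \<noteq> {}}"

lemma finS: "finite S" using SA finA finite_subset by blast

lemma hv_down: "v \<in> hv \<Longrightarrow> u \<in> verts \<Gamma> \<Longrightarrow> u \<preceq> v \<Longrightarrow> u \<in> hv"
  using cl_mono[of u v] unfolding hv_def by blast

lemma r_hv: "r \<in> hv" using root_in cl_root rhoS SA by (auto simp: hv_def)

lemma leaf_hv: assumes "s \<in> S" shows "leaf \<Gamma> s \<in> hv"
proof -
  have "s \<in> cl (leaf \<Gamma> s)" using assms SA refl leaf_in by (auto simp: cl_def)
  thus ?thesis using assms SA leaf_in by (auto simp: hv_def)
qed

text \<open>An edge stays if it separates two kept ends. As \<rho> is kept and lies on the lower
  side, this happens precisely if some kept marking lies above the edge.\<close>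

lemma edges0: "edges \<Gamma>0 = {{u, v} | u v. cov u v \<and> v \<in> hv}"
proof (intro Set.set_eqI iffI)
  fix e assume "e \<in> edges \<Gamma>0"
  then obtain p s t where p: "s \<in> S" "t \<in> S" "tree_path \<Gamma> (leaf \<Gamma> s) p (leaf \<Gamma> t)" "e \<in> path_edges p"
    unfolding remove_ends_def by auto
  then obtain u v where uv: "cov u v" "e = {u, v}" using tree_path_edges[OF p(3)] edge_cov by blast
  have "sep \<Gamma> e s t" using p tpath_unique by (simp add: sep_def)
  hence "(s \<in> cl v) \<noteq> (t \<in> cl v)" using sep_cov[OF uv(1), of s t] uv(2) p(1,2) SA by auto
  hence "v \<in> hv" using p(1,2) covD(2)[OF uv(1)] unfolding hv_def by blast
  thus "e \<in> {{u, v} | u v. cov u v \<and> v \<in> hv}" using uv by blast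
next
  fix e assume "e \<in> {{u, v} | u v. cov u v \<and> v \<in> hv}"
  then obtain u v where uv: "cov u v" "v \<in> hv" "e = {u, v}" by blast
  then obtain s where s: "s \<in> cl v" "s \<in> S" by (auto simp: hv_def)
  have "v \<noteq> r" using cov_root uv(1) by blast
  hence "\<rho> \<notin> cl v" using rho_notin_cl covD(2)[OF uv(1)] by blast
  hence "sep \<Gamma> e \<rho> s" using sep_cov[OF uv(1) rho, of s] s SA uv(3) by auto
  moreover have "tree_path \<Gamma> (leaf \<Gamma> \<rho>) (tpath \<Gamma> (leaf \<Gamma> \<rho>) (leaf \<Gamma> s)) (leaf \<Gamma> s)"
    using tpath[OF leaf_in leaf_in] rho s SA by blast
  ultimately show "e \<in> edges \<Gamma>0" using rhoS s(2) unfolding remove_ends_def sep_def by auto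
qed

lemma verts0: "verts \<Gamma>0 = hv"
proof (intro Set.set_eqI iffI)
  fix v assume "v \<in> verts \<Gamma>0"
  then obtain p s t where p: "s \<in> S" "t \<in> S" "tree_path \<Gamma> (leaf \<Gamma> s) p (leaf \<Gamma> t)" "v \<in> set p"
    unfolding remove_ends_def by auto
  have pe: "path_edges p \<subseteq> edges \<Gamma>0" using p unfolding remove_ends_def by auto
  obtain i where i: "i < length p" "v = p ! i" using p(4) by (metis in_set_conv_nth)
  show "v \<in> hv"
  proof (cases "length p = 1")
    case True
    hence "v = leaf \<Gamma> s" using i p(3) by (auto simp: tree_path_def hd_conv_nth)
    thus ?thesis using leaf_hv p by blast
  next
    case False
    have "\<exists>e\<in>path_edges p. v \<in> e"
    proof (cases "Suc i < length p")
      case True thus ?thesis using i unfolding path_edges_def by auto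
    next
      case F: False
      then obtain j where "i = Suc j" using False i by (cases i) auto
      thus ?thesis using i unfolding path_edges_def by auto
    qed
    then obtain u w where uw: "cov u w" "w \<in> hv" "v \<in> {u, w}" using pe unfolding edges0 by blast
    thus ?thesis using hv_down[OF uw(2) covD(1)[OF uw(1)] covD(4)[OF uw(1)]] by blast
  qed
next
  fix v assume v: "v \<in> hv"
  then obtain s where s: "s \<in> S" "v \<preceq> leaf \<Gamma> s" "s \<in> A" by (auto simp: hv_def cl_def)
  have "tree_path \<Gamma> (leaf \<Gamma> \<rho>) (tpath \<Gamma> (leaf \<Gamma> \<rho>) (leaf \<Gamma> s)) (leaf \<Gamma> s)"
    using tpath[OF leaf_in leaf_in] rho s by blast
  thus "v \<in> verts \<Gamma>0" using rhoS s unfolding remove_ends_def tle_def by auto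
qed

lemma covers_hv: "covers hv (tle \<Gamma> r) u v \<longleftrightarrow> cov u v \<and> v \<in> hv"
proof
  assume c: "covers hv (tle \<Gamma> r) u v"
  hence uv: "u \<in> verts \<Gamma>" "v \<in> verts \<Gamma>" "v \<in> hv" by (auto simp: covers_def hv_def)
  have "w = u \<or> w = v" if "w \<in> verts \<Gamma>" "u \<preceq> w" "w \<preceq> v" for w
    using c that hv_down[OF uv(3)] unfolding covers_def by blast
  thus "cov u v \<and> v \<in> hv" using c uv unfolding covers_def by blast
next
  assume "cov u v \<and> v \<in> hv"
  thus "covers hv (tle \<Gamma> r) u v" using hv_down covD unfolding covers_def hv_def by blast
qed

lemma leaf0: "leaf \<Gamma>0 = leaf \<Gamma>" "len \<Gamma>0 = len \<Gamma>" by (simp_all add: remove_ends_def)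

sublocale T0: tree_order_graph \<Gamma>0 r "tle \<Gamma> r"
proof -
  have "tree_order hv r (tle \<Gamma> r)" using restrict r_hv by (auto simp: hv_def)
  moreover have "edges \<Gamma>0 = cover_edges hv (tle \<Gamma> r)" unfolding edges0 cover_edges_def covers_hv ..
  ultimately show "tree_order_graph \<Gamma>0 r (tle \<Gamma> r)"
    by (simp add: tree_order_graph_def tree_order_graph_axioms_def verts0)
qed

lemma hvV: "v \<in> hv \<Longrightarrow> v \<in> verts \<Gamma>" by (simp add: hv_def)

sublocale R0: rooted_tree \<Gamma>0 r
  using T0.is_tree T0.root by unfold_locales

lemma tle0: "u \<in> hv \<Longrightarrow> v \<in> hv \<Longrightarrow> tle \<Gamma>0 r u v \<longleftrightarrow> u \<preceq> v"
  using T0.tle_eq verts0 by simp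

lemma ch0: "R0.ch v = {c. cov v c \<and> c \<in> hv}"
proof -
  have "covers hv (tle \<Gamma>0 r) v c \<longleftrightarrow> covers hv (tle \<Gamma> r) v c" for c using tle0 by (rule covers_cong)
  thus ?thesis unfolding R0.ch_def verts0 covers_hv by blast
qed

section \<open>Stabilisation as restriction of the order\<close>

definition wv :: "nat set" where "wv = {v \<in> hv. valence \<Gamma>0 v \<noteq> 2}"

lemma wvV: "v \<in> wv \<Longrightarrow> v \<in> verts \<Gamma>" "v \<in> wv \<Longrightarrow> v \<in> hv" by (auto simp: wv_def hv_def)

lemma apex_hv: "apex \<in> hv"
proof -
  have "S \<noteq> {\<rho>}" using cS by auto
  then obtain s where "s \<in> S" "s \<noteq> \<rho>" using rhoS by blast
  thus ?thesis using apex_in cl_apex SA by (auto simp: hv_def)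
qed

lemma r_wv: "r \<in> wv"
proof -
  have "R0.ch r = {apex}" unfolding ch0 using apex apex_hv by blast
  hence "valence \<Gamma>0 r = 1" using R0.valence_ch[of r] r_hv verts0 by simp
  thus ?thesis using r_hv by (simp add: wv_def)
qed

lemma leaf_wv: assumes "s \<in> S" shows "leaf \<Gamma> s \<in> wv"
proof (cases "s = \<rho>")
  case True thus ?thesis using r_wv by simp
next
  case False
  have "ch (leaf \<Gamma> s) = {}" using ch_leaf assms SA False by blast
  hence "R0.ch (leaf \<Gamma> s) = {}" unfolding ch0 ch_def by blast
  hence "valence \<Gamma>0 (leaf \<Gamma> s) \<le> 1" using R0.valence_ch[of "leaf \<Gamma> s"] leaf_hv[OF assms] verts0 by simp
  thus ?thesis using leaf_hv[OF assms] by (simp add: wv_def)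
qed

lemma branch_wv:
  assumes "cov m c1" "cov m c2" "c1 \<noteq> c2" "c1 \<in> hv" "c2 \<in> hv"
  shows "m \<in> wv" "m \<noteq> r"
proof -
  show mr: "m \<noteq> r" using apex(2) assms by metis
  have m: "m \<in> hv" using hv_down[OF assms(4)] covD[OF assms(1)] by blast
  have "{c1, c2} \<subseteq> R0.ch m" unfolding ch0 using assms by blast
  hence "card {c1, c2} \<le> card (R0.ch m)" by (rule card_mono[OF R0.finite_ch])
  hence "valence \<Gamma>0 m \<noteq> 2" using R0.valence_ch[of m] m verts0 mr assms(3) by simp
  thus "m \<in> wv" using m by (simp add: wv_def)
qed

sublocale TW: tree_order wv r "tle \<Gamma> r"
  using restrict r_wv wvV by blast

text \<open>The branch vertex of two incomparable vertices has two remaining children besides its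
  parent, so it is not two-valent and survives.\<close>

lemma incomparable_branch:
  assumes "u \<in> wv" "v \<in> wv" "\<not> u \<preceq> v" "\<not> v \<preceq> u"
  obtains m c1 where "m \<in> wv" "m \<noteq> r" "m \<preceq> u" "m \<preceq> v" "m \<noteq> u" "m \<noteq> v" "cov m c1" "c1 \<in> hv" "c1 \<preceq> u" "\<not> c1 \<preceq> v"
proof -
  note V = wvV(1)[OF assms(1)] wvV(1)[OF assms(2)]
  obtain m c1 c2 where m: "cov m c1" "cov m c2" "c1 \<noteq> c2" "c1 \<preceq> u" "c2 \<preceq> v"
    by (rule ex_branch[OF V assms(3,4)])
  note C = covD[OF m(1)] covD[OF m(2)]
  have h: "c1 \<in> hv" "c2 \<in> hv" using hv_down[OF wvV(2)] assms m C by blast+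
  have le: "m \<preceq> u" "m \<preceq> v" using trans[OF C(1,2) V(1) C(4) m(4)] trans[OF C(1,6) V(2) C(8) m(5)] .
  have "\<not> c1 \<preceq> v" using disjoint_children[OF m(2,1) not_sym[OF m(3)] V(2) m(5)] .
  moreover have "m \<noteq> u" "m \<noteq> v" using le assms by auto
  ultimately show thesis using that branch_wv[OF m(1-3) h] le m h by blast
qed

text \<open>If the ends of a path are comparable, its vertices are the interval between them, so
  having no surviving vertex inside means covering. If they are incomparable, the path runs through
  their surviving branch vertex and gives no new edge.\<close>

lemma edges_ft:
  "{{u, v} | u v. u \<in> wv \<and> v \<in> wv \<and> u \<noteq> v \<and> (\<exists>p. tree_path \<Gamma>0 u p v \<and> set p \<inter> wv = {u, v})} =
    cover_edges wv (tle \<Gamma> r)" (is "?L = ?R")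
proof -
  have up: "covers wv (tle \<Gamma> r) u v"
    if uv: "u \<in> wv" "v \<in> wv" "u \<noteq> v" "u \<preceq> v" and p: "tree_path \<Gamma>0 u p v" "set p \<inter> wv = {u, v}" for u v p
  proof -
    have h: "u \<in> hv" "v \<in> hv" using wvV(2) uv by blast+
    have sp: "set p = {w \<in> hv. tle \<Gamma>0 r u w \<and> tle \<Gamma>0 r w v}"
      using R0.path_between[OF _ _ _ p(1)] h tle0[OF h] uv(4) verts0 by simp
    have "w = u \<or> w = v" if w: "w \<in> wv" "u \<preceq> w" "w \<preceq> v" for w
    proof -
      have "w \<in> set p" unfolding sp using w wvV(2)[OF w(1)] tle0 h by simp
      thus ?thesis using p(2) w(1) by blast
    qed
    thus ?thesis using uv unfolding covers_def by blast
  qed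
  show ?thesis
  proof (intro Set.set_eqI iffI)
    fix e assume "e \<in> ?L"
    then obtain u v p where uv: "u \<in> wv" "v \<in> wv" "u \<noteq> v" "e = {u, v}"
      and p: "tree_path \<Gamma>0 u p v" "set p \<inter> wv = {u, v}" by blast
    consider "u \<preceq> v" | "v \<preceq> u" | "\<not> u \<preceq> v" "\<not> v \<preceq> u" by blast
    thus "e \<in> ?R"
    proof cases
      case 1 thus ?thesis using up[OF uv(1-3) 1 p] uv(4) unfolding cover_edges_def by blast
    next
      case 2
      have "set (rev p) \<inter> wv = {v, u}" using p(2) by auto
      hence "covers wv (tle \<Gamma> r) v u" using up[OF uv(2,1) not_sym[OF uv(3)] 2 tree_path_rev[OF p(1)]] by blast
      moreover have "e = {v, u}" using uv(4) by auto
      ultimately show ?thesis unfolding cover_edges_def by blast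
    next
      case 3
      obtain m c1 where m: "m \<in> wv" "m \<noteq> u" "m \<noteq> v" "cov m c1" "c1 \<in> hv" "c1 \<preceq> u" "\<not> c1 \<preceq> v"
        using incomparable_branch[OF uv(1,2) 3] by metis
      have "covers (verts \<Gamma>0) (tle \<Gamma> r) m c1" unfolding verts0 covers_hv using m by blast
      hence "{m, c1} \<in> path_edges p" using T0.path_cross[OF p(1)] m by blast
      hence "m \<in> set p" using path_edges_subset by blast
      thus ?thesis using p(2) m by blast
    qed
  next
    fix e assume "e \<in> ?R"
    then obtain u v where uv: "covers wv (tle \<Gamma> r) u v" "e = {u, v}" unfolding cover_edges_def by blast
    note C = TW.covD[OF uv(1)]
    have h: "u \<in> hv" "v \<in> hv" using wvV(2) C by blast+
    obtain p where p: "tree_path \<Gamma>0 u p v" using T0.path_exists[of u v] h verts0 by auto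
    have sp: "set p = {w \<in> hv. tle \<Gamma>0 r u w \<and> tle \<Gamma>0 r w v}"
      using R0.path_between[OF _ _ _ p] h tle0[OF h] C(4) verts0 by simp
    have "set p \<inter> wv = {u, v}"
    proof (intro Set.set_eqI iffI)
      fix w assume "w \<in> set p \<inter> wv"
      hence "w \<in> wv" "u \<preceq> w" "w \<preceq> v" unfolding sp using tle0 h by auto
      thus "w \<in> {u, v}" using TW.cov_between[OF uv(1)] by blast
    next
      fix w assume "w \<in> {u, v}"
      thus "w \<in> set p \<inter> wv" unfolding sp using tle0 h C refl hvV by auto
    qed
    thus "e \<in> ?L" using C uv(2) p by blast
  qed
qed

lemma ft_simps: "verts (ft S \<Gamma>) = wv" "edges (ft S \<Gamma>) = cover_edges wv (tle \<Gamma> r)" "leaf (ft S \<Gamma>) = leaf \<Gamma>"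
  "len (ft S \<Gamma>) e = (\<Sum>f \<in> \<Union> {path_edges p | p u v. e = {u, v} \<and> tree_path \<Gamma>0 u p v}. len \<Gamma> f)"
proof -
  have w: "{v \<in> verts \<Gamma>0. valence \<Gamma>0 v \<noteq> 2} = wv" by (simp add: verts0 wv_def)
  show "verts (ft S \<Gamma>) = wv" "edges (ft S \<Gamma>) = cover_edges wv (tle \<Gamma> r)" "leaf (ft S \<Gamma>) = leaf \<Gamma>"
    "len (ft S \<Gamma>) e = (\<Sum>f \<in> \<Union> {path_edges p | p u v. e = {u, v} \<and> tree_path \<Gamma>0 u p v}. len \<Gamma> f)"
    unfolding ft_def stabilize_def Let_def w edges_ft by (simp_all add: leaf0)
qed

lemma tog_ft: "tree_order_graph (ft S \<Gamma>) (leaf (ft S \<Gamma>) \<rho>) (tle \<Gamma> r)"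
  using TW.tree_order_axioms by (simp add: tree_order_graph_def tree_order_graph_axioms_def ft_simps)

text \<open>The merged edge is the interval from \<open>u\<close> to \<open>v\<close> of the old
  tree, so its length is a difference of old depths.\<close>

lemma len_ft:
  assumes uv: "covers wv (tle \<Gamma> r) u v" "u \<noteq> r" "covers wv (tle \<Gamma> r) v w"
  shows "len (ft S \<Gamma>) {u, v} = dep v - dep u" "len (ft S \<Gamma>) {u, v} > 0"
proof -
  note C = TW.covD[OF uv(1)] and C' = TW.covD[OF uv(3)]
  have V: "u \<in> verts \<Gamma>" "v \<in> verts \<Gamma>" and h: "u \<in> hv" "v \<in> hv" using C wvV by blast+
  have nvu: "\<not> v \<preceq> u" using antisym[OF V] C(3,4) by blast
  let ?Y = "{y \<in> bv. y \<preceq> v \<and> \<not> y \<preceq> u}"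
  \<comment> \<open>Since \<open>u\<close> is not the root and something survives above
    \<open>v\<close>, every old edge between them is bounded.\<close>
  have Y: "y \<in> ?Y" if y: "y \<in> verts \<Gamma>" "y \<preceq> v" "\<not> y \<preceq> u" for y
  proof -
    have "y \<noteq> r" using y(3) bot[OF V(1)] by auto
    moreover have "y \<noteq> apex"
    proof
      assume "y = apex"
      obtain c where "cov r c" "c \<preceq> u" using ex_cov_above[OF V(1) root_in bot[OF V(1)] not_sym[OF uv(2)]] by blast
      thus False using apex(2) y(3) \<open>y = apex\<close> by blast
    qed
    moreover have "valence \<Gamma> y \<noteq> 1"
    proof
      assume "valence \<Gamma> y = 1"
      then obtain a where a: "a \<in> A" "y = leaf \<Gamma> a" using leaf_if_val1 y(1) by blast
      hence ar: "a \<noteq> \<rho>" using \<open>y \<noteq> r\<close> by auto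
      have "v = y" using leaf_maximal[OF a(1) ar V(2)] y(2) a(2) by blast
      hence "w = y" using leaf_maximal[OF a(1) ar wvV(1)[OF C'(2)]] C'(4) a(2) by blast
      thus False using C'(3) \<open>v = y\<close> by blast
    qed
    ultimately show ?thesis using y by (simp add: bv_def)
  qed
  have pe: "path_edges p = eb ` ?Y" if p: "tree_path \<Gamma>0 a p b" "{u, v} = {a, b}" for p a b
  proof (intro Set.set_eqI iffI)
    fix e assume e: "e \<in> path_edges p"
    then obtain x y where xy: "cov x y" "y \<in> hv" "e = {x, y}" using T0.tree_path_edges[OF p(1)] unfolding edges0 by blast
    have "covers (verts \<Gamma>0) (tle \<Gamma> r) x y" unfolding verts0 covers_hv using xy by blast
    hence "(y \<preceq> a) \<noteq> (y \<preceq> b)" using T0.path_cross[OF p(1)] e xy(3) by blast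
    hence ne: "(y \<preceq> u) \<noteq> (y \<preceq> v)" using p(2) by (metis doubleton_eq_iff)
    have yV: "y \<in> verts \<Gamma>" using covD(2)[OF xy(1)] .
    have "y \<preceq> u \<Longrightarrow> y \<preceq> v" using trans[OF yV V _ C(4)] .
    hence "y \<in> ?Y" using Y[OF yV] ne by blast
    moreover have "e = eb y" unfolding eb_def par_eq[OF xy(1)] xy(3) ..
    ultimately show "e \<in> eb ` ?Y" by blast
  next
    fix e assume "e \<in> eb ` ?Y"
    then obtain y where y: "y \<in> bv" "y \<preceq> v" "\<not> y \<preceq> u" "e = eb y" by blast
    have yh: "y \<in> hv" using hv_down[OF h(2) bvD(1)[OF y(1)] y(2)] .
    have "covers (verts \<Gamma>0) (tle \<Gamma> r) (par y) y" unfolding verts0 covers_hv using bvD(5)[OF y(1)] yh by blast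
    moreover have "(y \<preceq> a) \<noteq> (y \<preceq> b)" using y(2,3) p(2) by (metis doubleton_eq_iff)
    ultimately show "e \<in> path_edges p" using T0.path_cross[OF p(1)] y(4) unfolding eb_def by blast
  qed
  obtain p where p: "tree_path \<Gamma>0 u p v" using T0.path_exists[of u v] h verts0 by auto
  have "\<Union> {path_edges p | p a b. {u, v} = {a, b} \<and> tree_path \<Gamma>0 a p b} = eb ` ?Y"
  proof (intro Set.set_eqI iffI)
    fix e assume "e \<in> \<Union> {path_edges p | p a b. {u, v} = {a, b} \<and> tree_path \<Gamma>0 a p b}"
    then obtain p a b where "{u, v} = {a, b}" "tree_path \<Gamma>0 a p b" "e \<in> path_edges p" by blast
    thus "e \<in> eb ` ?Y" using pe by blast
  next
    fix e assume "e \<in> eb ` ?Y"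
    hence "e \<in> path_edges p" using pe[OF p] by blast
    thus "e \<in> \<Union> {path_edges p | p a b. {u, v} = {a, b} \<and> tree_path \<Gamma>0 a p b}" using p by blast
  qed
  hence "len (ft S \<Gamma>) {u, v} = (\<Sum>f\<in>eb ` ?Y. len \<Gamma> f)" using ft_simps(4) by simp
  also have "\<dots> = (\<Sum>y\<in>?Y. len \<Gamma> (eb y))"
  proof (rule sum.reindex_cong[OF _ HOL.refl HOL.refl])
    show "inj_on eb ?Y" using eb_inj by (rule inj_on_subset) blast
  qed
  finally have l: "len (ft S \<Gamma>) {u, v} = (\<Sum>y\<in>?Y. len \<Gamma> (eb y))" .
  show "len (ft S \<Gamma>) {u, v} = dep v - dep u" using l dep_diff[OF V C(4)] by simp
  have "v \<in> ?Y" using Y[OF V(2) refl[OF V(2)] nvu] .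
  moreover have "len \<Gamma> (eb y) > 0" if "y \<in> bv" for y using len_pos that unfolding bounded_eq by blast
  ultimately show "len (ft S \<Gamma>) {u, v} > 0" unfolding l
    using finite_bv by (intro sum_pos) auto
qed

lemma tropical_ft: "tropical_curve S (ft S \<Gamma>)"
proof (rule tropical_curve_if_tree_order[OF tog_ft finS cS rhoS])
  show "inj_on (leaf (ft S \<Gamma>)) S" using leaf_inj SA unfolding ft_simps by (meson inj_onI subsetD)
  show "leaf (ft S \<Gamma>) ` (S - {\<rho>}) =
    {v \<in> verts (ft S \<Gamma>). v \<noteq> leaf (ft S \<Gamma>) \<rho> \<and> (\<forall>w. \<not> covers (verts (ft S \<Gamma>)) (tle \<Gamma> r) v w)}"
    unfolding ft_simps
  proof (intro Set.set_eqI iffI)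
    fix v assume "v \<in> leaf \<Gamma> ` (S - {\<rho>})"
    then obtain s where s: "s \<in> S" "s \<noteq> \<rho>" "v = leaf \<Gamma> s" by blast
    have sA: "s \<in> A" using s SA by blast
    have "\<not> covers wv (tle \<Gamma> r) v w" for w
    proof
      assume "covers wv (tle \<Gamma> r) v w"
      note C = TW.covD[OF this]
      have "w = v" using leaf_maximal[OF sA s(2) wvV(1)[OF C(2)]] C(4) s(3) by blast
      thus False using C(3) by simp
    qed
    moreover have "v \<noteq> r" using leaf_inj[OF sA rho] s by metis
    ultimately show "v \<in> {v \<in> wv. v \<noteq> r \<and> (\<forall>w. \<not> covers wv (tle \<Gamma> r) v w)}" using leaf_wv s by blast
  next
    fix v assume "v \<in> {v \<in> wv. v \<noteq> r \<and> (\<forall>w. \<not> covers wv (tle \<Gamma> r) v w)}"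
    hence v: "v \<in> wv" "v \<noteq> r" "\<And>w. \<not> covers wv (tle \<Gamma> r) v w" by blast+
    then obtain s where s: "s \<in> cl v" "s \<in> S" using wvV(2) unfolding hv_def by blast
    have "s \<noteq> \<rho>" using rho_notin_cl[OF wvV(1)[OF v(1)] v(2)] s(1) by blast
    have "v \<preceq> leaf \<Gamma> s" using s(1) by (simp add: cl_def)
    hence "v = leaf \<Gamma> s" using TW.ex_cov_above[OF leaf_wv[OF s(2)] v(1)] v(3) by blast
    thus "v \<in> leaf \<Gamma> ` (S - {\<rho>})" using s(2) \<open>s \<noteq> \<rho>\<close> by blast
  qed
  show "\<exists>!c. covers (verts (ft S \<Gamma>)) (tle \<Gamma> r) (leaf (ft S \<Gamma>) \<rho>) c" unfolding ft_simps
  proof -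
    have "S \<noteq> {\<rho>}" using cS by auto
    then obtain s where s: "s \<in> S" "s \<noteq> \<rho>" using rhoS by blast
    have "r \<noteq> leaf \<Gamma> s" using leaf_inj[OF rho, of s] s SA by (metis subsetD)
    then obtain c where c: "covers wv (tle \<Gamma> r) r c"
      using TW.ex_cov_above[OF leaf_wv[OF s(1)] r_wv TW.bot[OF leaf_wv[OF s(1)]]] by blast
    have "c' = c" if c': "covers wv (tle \<Gamma> r) r c'" for c'
    proof (rule ccontr)
      assume ne: "c' \<noteq> c"
      note C = TW.covD[OF c] and C' = TW.covD[OF c']
      have n: "\<not> c \<preceq> c'" "\<not> c' \<preceq> c"
        using TW.cov_between[OF c' C(2,4)] TW.cov_between[OF c C'(2,4)] C(3) C'(3) ne by metis+
      obtain m where "m \<in> wv" "m \<noteq> r" "m \<preceq> c" "m \<noteq> c" using incomparable_branch[OF C(2) C'(2) n] by metis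
      thus False using TW.cov_between[OF c, of m] TW.bot by blast
    qed
    thus "\<exists>!c. covers wv (tle \<Gamma> r) r c" using c by blast
  qed
  show "\<exists>w'. covers (verts (ft S \<Gamma>)) (tle \<Gamma> r) v w' \<and> w' \<noteq> w"
    if "v \<noteq> leaf (ft S \<Gamma>) \<rho>" "covers (verts (ft S \<Gamma>)) (tle \<Gamma> r) v w" for v w
  proof -
    have vr: "v \<noteq> r" and vw: "covers wv (tle \<Gamma> r) v w" using that by (simp_all add: ft_simps)
    note C = TW.covD[OF vw]
    have V: "v \<in> verts \<Gamma>" "w \<in> verts \<Gamma>" using wvV(1) C by blast+
    obtain c1 where c1: "cov v c1" "c1 \<preceq> w" using ex_cov_above[OF V(2,1) C(4,3)] by blast
    have "c1 \<in> hv" using hv_down[OF wvV(2)[OF C(2)] covD(2)[OF c1(1)] c1(2)] .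
    hence c1': "c1 \<in> R0.ch v" unfolding ch0 using c1 by blast
    \<comment> \<open>A vertex other than the root with a single remaining child would be
      two-valent. The second remaining child leads to a kept marking, and below that to another
      surviving child of \<open>v\<close>.\<close>
    have "valence \<Gamma>0 v \<noteq> 2" using C(1) by (simp add: wv_def)
    hence "card (R0.ch v) \<noteq> 1" using R0.valence_ch[of v] wvV(2)[OF C(1)] verts0 vr by simp
    hence "R0.ch v \<noteq> {c1}" by auto
    then obtain c2 where "c2 \<in> R0.ch v" "c2 \<noteq> c1" using c1' by blast
    hence c2: "cov v c2" "c2 \<in> hv" "c2 \<noteq> c1" unfolding ch0 by auto
    then obtain s where s: "s \<in> cl c2" "s \<in> S" unfolding hv_def by blast
    have sA: "s \<in> A" using s SA by blast
    have le: "c2 \<preceq> leaf \<Gamma> s" using s(1) by (simp add: cl_def)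
    have "v \<preceq> leaf \<Gamma> s" using trans[OF V(1) covD(2)[OF c2(1)] leaf_in[OF sA] covD(4)[OF c2(1)] le] .
    moreover have "v \<noteq> leaf \<Gamma> s"
      using antisym[OF V(1) covD(2)[OF c2(1)] covD(4)[OF c2(1)]] le covD(3)[OF c2(1)] by metis
    ultimately obtain w' where w': "covers wv (tle \<Gamma> r) v w'" "w' \<preceq> leaf \<Gamma> s"
      using TW.ex_cov_above[OF leaf_wv[OF s(2)] C(1)] by blast
    have "w' \<noteq> w"
    proof
      assume "w' = w"
      hence "c1 \<preceq> leaf \<Gamma> s" using trans[OF covD(2)[OF c1(1)] V(2) leaf_in[OF sA] c1(2)] w'(2) by blast
      thus False using disjoint_children[OF c2(1) c1(1) c2(3) leaf_in[OF sA] le] by blast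
    qed
    thus ?thesis using w' by (auto simp: ft_simps)
  qed
  show "len (ft S \<Gamma>) {u, v} > 0"
    if "covers (verts (ft S \<Gamma>)) (tle \<Gamma> r) u v" "u \<noteq> leaf (ft S \<Gamma>) \<rho>" "covers (verts (ft S \<Gamma>)) (tle \<Gamma> r) v w" for u v w
    using len_ft(2) that unfolding ft_simps by blast
qed

text \<open>A quartet only sees depths of last common ancestors (\<open>qd_meet\<close>). The last
  common ancestor of two kept markings is a branch vertex, so it survives, and merging leaves the
  depth differences unchanged.\<close>

lemma quart_ft: "quart S (hdist (ft S \<Gamma>)) = quart S (hdist \<Gamma>)"
proof -
  interpret D: marked_tree S "ft S \<Gamma>" \<rho> using tropical_ft rhoS by unfold_locales
  interpret TD: tree_order_graph "ft S \<Gamma>" "leaf (ft S \<Gamma>) \<rho>" "tle \<Gamma> r" by (rule tog_ft)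
  have tle: "tle (ft S \<Gamma>) (leaf (ft S \<Gamma>) \<rho>) u v \<longleftrightarrow> u \<preceq> v" if "u \<in> wv" "v \<in> wv" for u v
    using TD.tle_eq that ft_simps(1) by simp
  have cov: "covers (verts (ft S \<Gamma>)) (tle (ft S \<Gamma>) (leaf (ft S \<Gamma>) \<rho>)) u v \<longleftrightarrow> covers wv (tle \<Gamma> r) u v" for u v
    unfolding ft_simps(1) using tle by (rule covers_cong)
  have cl: "D.cl w = cl w \<inter> S" if w: "w \<in> wv" for w
    using tle[OF w leaf_wv] SA unfolding D.cl_def cl_def ft_simps(3) by auto
  have dep: "len (ft S \<Gamma>) (D.eb w) = dep w - dep (D.par w)" if w: "w \<in> D.bv" for w
  proof -
    note B = D.bvD[OF w]
    have "covers wv (tle \<Gamma> r) (D.par w) w" using B(5) cov by simp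
    moreover have "D.par w \<noteq> r" using D.par_inner(2)[OF B(1-3)] ft_simps(3) by simp
    moreover obtain x where "covers wv (tle \<Gamma> r) w x" using D.inner_two[OF B(1,4)] cov by metis
    ultimately show ?thesis using len_ft(1) unfolding D.eb_def by blast
  qed
  have meet: "\<exists>m. is_meet m a b \<and> D.is_meet m a b" if ab: "{a, b} \<subseteq> S - {\<rho>}" "a \<noteq> b" for a b
  proof -
    have abA: "{a, b} \<subseteq> A - {\<rho>}" using ab SA by blast
    obtain m c1 c2 where m: "cov m c1" "cov m c2" "c1 \<noteq> c2" "a \<in> cl c1" "b \<in> cl c2"
      by (rule ex_meet[OF abA ab(2)])
    have im: "is_meet m a b" by (rule meet_branch[OF m])
    have "c1 \<in> hv" "c2 \<in> hv" using m ab covD(2) unfolding hv_def by blast+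
    hence mw: "m \<in> wv" using branch_wv[OF m(1-3)] by blast
    have "D.is_meet m a b" unfolding D.is_meet_def ft_simps(1)
    proof (intro conjI ballI impI)
      show "m \<in> wv" by (rule mw)
      show "a \<in> D.cl m" "b \<in> D.cl m" using cl[OF mw] im ab unfolding is_meet_def by auto
      fix w assume w: "w \<in> wv" "a \<in> D.cl w" "b \<in> D.cl w"
      hence "w \<preceq> m" using im cl[OF w(1)] wvV(1)[OF w(1)] unfolding is_meet_def by blast
      thus "tle (ft S \<Gamma>) (leaf (ft S \<Gamma>) \<rho>) w m" using tle[OF w(1) mw] by simp
    qed
    thus ?thesis using im by blast
  qed
  show ?thesis
  proof (rule quart_eqI_root[OF _ _ rhoS])
    show "hdist (ft S \<Gamma>) a b = hdist (ft S \<Gamma>) b a" if "a \<in> S" "b \<in> S" for a b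
      using D.hd_len_sym that .
    show "hdist \<Gamma> a b = hdist \<Gamma> b a" if "a \<in> S" "b \<in> S" for a b
      using hd_len_sym that SA by blast
    fix a b c assume abc: "{a, b, c} \<subseteq> S - {\<rho>}" "distinct [a, b, c]"
    hence abcA: "{a, b, c} \<subseteq> A - {\<rho>}" using SA by blast
    obtain m where m: "is_meet m a b" "D.is_meet m a b" using meet[of a b] abc by auto
    obtain m' where m': "is_meet m' a c" "D.is_meet m' a c" using meet[of a c] abc by auto
    show "qd (hdist (ft S \<Gamma>)) a b c \<rho> = qd (hdist \<Gamma>) a b c \<rho>"
      using D.qd_meet[where l="len (ft S \<Gamma>)" and dep=dep, OF dep m(2) m'(2) abc]
        qd_meet[where l="len \<Gamma>" and dep=dep, OF dep_eb m(1) m'(1) abcA abc(2)] by simp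
  qed
qed

end

lemma ft_correct:
  assumes "tropical_curve A \<Gamma>" "S \<subseteq> A" "card S \<ge> 3"
  shows "tropical_curve S (ft S \<Gamma>)" "quart S (hdist (ft S \<Gamma>)) = quart S (hdist \<Gamma>)"
proof -
  have "S \<noteq> {}" using assms(3) by auto
  then obtain \<rho> where "\<rho> \<in> S" by blast
  then interpret marked_subtree A \<Gamma> \<rho> S using assms by unfold_locales auto
  show "tropical_curve S (ft S \<Gamma>)" "quart S (hdist (ft S \<Gamma>)) = quart S (hdist \<Gamma>)"
    by (rule tropical_ft, rule quart_ft)
qed

section \<open>Cross-ratios in terms of half distances\<close>

text \<open>A cross-ratio with named entries: the length and the splitting \<open>ab|cd\<close>.
  Unlike the unordered splitting it can be evaluated directly on half distances.\<close>

type_synonym 'a row = "real \<times> 'a \<times> 'a \<times> 'a \<times> 'a"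

text \<open>The two larger pair sums exceed \<open>H a b + H c d\<close> by \<open>l\<close>. For
  \<open>l = 0\<close> all three coincide, which is the curve with a four-valent vertex.\<close>

fun fulr :: "('a \<Rightarrow> 'a \<Rightarrow> real) \<Rightarrow> 'a row \<Rightarrow> bool" where
  "fulr H (l, a, b, c, d) \<longleftrightarrow> H a c + H b d = H a b + H c d + l \<and> H a d + H b c = H a b + H c d + l"

fun crow :: "'a row \<Rightarrow> 'a cross_ratio" where "crow (l, a, b, c, d) = CR l a b c d"

fun vrow :: "'a set \<Rightarrow> 'a row \<Rightarrow> bool" where
  "vrow A (l, a, b, c, d) \<longleftrightarrow> distinct [a, b, c, d] \<and> {a, b, c, d} \<subseteq> A \<and> 0 \<le> l"

fun rmarks :: "'a row \<Rightarrow> 'a set" where "rmarks (l, a, b, c, d) = {a, b, c, d}"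

text \<open>The fibre in quartet coordinates, where solutions of metric conditions can be restricted
  and glued without constructing trees.\<close>

definition fib :: "'a set \<Rightarrow> 'a row set \<Rightarrow> ('a \<times> 'a \<times> 'a \<times> 'a \<Rightarrow> real) set" where
  "fib A R = {g. \<exists>H. tm A H \<and> (\<forall>C\<in>R. fulr H C) \<and> g = quart A H}"

lemma cr_marks_crow [simp]: "cr_marks (crow C) = rmarks C"
  by (cases C) (auto simp: cr_marks_def CR_def)

lemma fulr_qd:
  assumes "\<And>a b. a \<in> A \<Longrightarrow> b \<in> A \<Longrightarrow> H a b = H b a" "{c, d} \<subseteq> A"
  shows "fulr H (l, a, b, c, d) \<longleftrightarrow> qd H a b c d = l \<and> qd H a b d c = l"
  using assms(1)[of c d] assms(2) by (auto simp: qd_def)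

lemma fulr_quart:
  assumes H: "\<And>a b. a \<in> A \<Longrightarrow> b \<in> A \<Longrightarrow> H a b = H b a" and K: "\<And>a b. a \<in> A \<Longrightarrow> b \<in> A \<Longrightarrow> K a b = K b a"
    and q: "quart A H = quart A K" and C: "vrow A C"
  shows "fulr H C \<longleftrightarrow> fulr K C"
proof -
  obtain l a b c d where C': "C = (l, a, b, c, d)" by (cases C) auto
  have D: "distinct [a, b, c, d]" "{a, b, c, d} \<subseteq> A" "distinct [a, b, d, c]" "{a, b, d, c} \<subseteq> A" "{c, d} \<subseteq> A"
    using C C' by auto
  have "fulr H (l, a, b, c, d) \<longleftrightarrow> qd H a b c d = l \<and> qd H a b d c = l" using H D(5) by (rule fulr_qd)
  moreover have "fulr K (l, a, b, c, d) \<longleftrightarrow> qd K a b c d = l \<and> qd K a b d c = l" using K D(5) by (rule fulr_qd)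
  ultimately show ?thesis unfolding C' using quartD[OF q D(1,2)] quartD[OF q D(3,4)] by (simp only:)
qed

lemma quart_mono: "quart A H = quart A K \<Longrightarrow> M \<subseteq> A \<Longrightarrow> quart M H = quart M K"
  by (rule quartI) (meson quartD subset_trans)

text \<open>A cross-ratio is a point of the moduli space of its four markings, so it fixes every
  quartet on them, not only the one it names.\<close>

lemma quart_eq_if_fulr:
  assumes H: "\<And>a b. a \<in> A \<Longrightarrow> b \<in> A \<Longrightarrow> H a b = H b a" and K: "\<And>a b. a \<in> A \<Longrightarrow> b \<in> A \<Longrightarrow> K a b = K b a"
    and C: "vrow A C" "fulr H C" "fulr K C"
  shows "quart (rmarks C) H = quart (rmarks C) K"
proof -
  obtain l a b c d where C': "C = (l, a, b, c, d)" by (cases C) auto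
  have s: "H b a = H a b" "H c a = H a c" "H d a = H a d" "H c b = H b c" "H d b = H b d" "H d c = H c d"
     "K b a = K a b" "K c a = K a c" "K d a = K a d" "K c b = K b c" "K d b = K b d" "K d c = K c d"
    using C(1) C' by (auto intro!: H K)
  have M: "rmarks C \<subseteq> A" using C(1) C' by simp
  show ?thesis
  proof (rule quart_eqI_root[where \<rho> = d])
    show "H x y = H y x" if "x \<in> rmarks C" "y \<in> rmarks C" for x y using H that M by blast
    show "K x y = K y x" if "x \<in> rmarks C" "y \<in> rmarks C" for x y using K that M by blast
    show "d \<in> rmarks C" using C' by simp
    fix x y z assume xyz: "{x, y, z} \<subseteq> rmarks C - {d}" "distinct [x, y, z]"
    hence "x \<in> {a, b, c}" "y \<in> {a, b, c}" "z \<in> {a, b, c}" using C' by auto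
    thus "qd H x y z d = qd K x y z d"
      using C(2,3) C' s xyz(2) by (elim insertE emptyE) (simp_all add: qd_def)
  qed
qed

lemma resolved_mono: "resolved A H \<Longrightarrow> M \<subseteq> A \<Longrightarrow> resolved M H"
  unfolding resolved_def by blast

lemma resolved_four:
  assumes H: "\<And>x y. x \<in> {a, b, c, d} \<Longrightarrow> y \<in> {a, b, c, d} \<Longrightarrow> H x y = H y x" and D: "distinct [a, b, c, d]"
  shows "resolved {a, b, c, d} H \<longleftrightarrow> \<not> fulr H (0, a, b, c, d)"
proof
  assume "resolved {a, b, c, d} H"
  hence "\<not> (H a b + H c d = H a c + H b d \<and> H a c + H b d = H a d + H b c)"
    using D unfolding resolved_def by blast
  thus "\<not> fulr H (0, a, b, c, d)" by auto
next
  assume n: "\<not> fulr H (0, a, b, c, d)"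
  have s: "H b a = H a b" "H c a = H a c" "H d a = H a d" "H c b = H b c" "H d b = H b d" "H d c = H c d"
    by (auto intro!: H)
  show "resolved {a, b, c, d} H" unfolding resolved_def
  proof (intro ballI impI)
    fix w x y z assume "w \<in> {a, b, c, d}" "x \<in> {a, b, c, d}" "y \<in> {a, b, c, d}" "z \<in> {a, b, c, d}" "distinct [w, x, y, z]"
    thus "\<not> (H w x + H y z = H w y + H x z \<and> H w y + H x z = H w z + H x y)"
      using n s by (elim insertE emptyE) (simp_all, (linarith | argo)+)
  qed
qed

section \<open>Curves with four ends and cross-ratios\<close>

context marked_tree begin

lemma valence_le: assumes "v \<in> verts \<Gamma>" shows "valence \<Gamma> v \<le> card A"
proof (cases "v = r")
  case True thus ?thesis using leaf_val[OF rho] cardA by simp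
next
  case False
  define f where "f c = (SOME a. a \<in> cl c)" for c
  have f: "f c \<in> cl c" if "c \<in> ch v" for c
  proof -
    have "c \<in> verts \<Gamma>" using ch_subset that by blast
    hence "\<exists>a. a \<in> cl c" using cl_nonempty by blast
    thus ?thesis unfolding f_def by (rule someI_ex)
  qed
  have "inj_on f (ch v)"
  proof (rule inj_onI, rule ccontr)
    fix c c' assume "c \<in> ch v" "c' \<in> ch v" "f c = f c'" "c \<noteq> c'"
    thus False using f[of c] f[of c'] cl_disjoint[of v c c'] unfolding ch_def by auto
  qed
  moreover have "f ` ch v \<subseteq> A - {\<rho>}"
  proof
    fix a assume "a \<in> f ` ch v"
    then obtain c where c: "c \<in> ch v" "a \<in> cl c" using f by blast
    hence "cov v c" by (simp add: ch_def)
    hence "c \<in> verts \<Gamma>" "c \<noteq> r" using covD cov_root by blast+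
    thus "a \<in> A - {\<rho>}" using c rho_notin_cl cl_subset by blast
  qed
  ultimately have "card (ch v) \<le> card (A - {\<rho>})" using finA by (intro card_inj_on_le) auto
  also have "\<dots> = card A - 1" using rho finA by simp
  finally show ?thesis using valence_ch[OF assms] False cardA by simp
qed

lemma valence_inner_ge: assumes "v \<in> inner_verts \<Gamma>" shows "valence \<Gamma> v \<ge> 3"
proof -
  have v: "v \<in> verts \<Gamma>" "valence \<Gamma> v \<noteq> 1" using assms by (simp_all add: inner_verts_def)
  show ?thesis using card_ch_inner[OF v] valence_ch[OF v(1)] by simp
qed

text \<open>Rooted at one of the two markings, both ends are adjacent to \<open>apex\<close>: a
  vertex between \<open>apex\<close> and the other end would carry the only bounded edge and
  separate the two.\<close>

lemma adjacent_root:
  assumes e: "bounded_edges \<Gamma> = {e}" and y: "y \<in> A" "y \<noteq> \<rho>" and ns: "\<not> sep \<Gamma> e \<rho> y"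
  shows "\<exists>v\<in>verts \<Gamma>. {leaf \<Gamma> \<rho>, v} \<in> edges \<Gamma> \<and> {leaf \<Gamma> y, v} \<in> edges \<Gamma>"
proof -
  have yr: "leaf \<Gamma> y \<noteq> r" using leaf_inj[OF y(1) rho] y(2) by blast
  define u where "u = par (leaf \<Gamma> y)"
  have u: "cov u (leaf \<Gamma> y)" unfolding u_def by (rule par[OF leaf_in[OF y(1)] yr])
  have "leaf \<Gamma> y \<noteq> apex" using apex_in(2) leaf_val[OF y(1)] by auto
  note P = par_inner[OF leaf_in[OF y(1)] yr this, folded u_def]
  have "u = apex"
  proof (rule ccontr)
    assume "u \<noteq> apex"
    hence ub: "u \<in> bv" using P by (simp add: bv_def)
    hence ue: "eb u = e" using e unfolding bounded_eq by blast
    have "y \<in> cl u" using covD(4)[OF u] y by (simp add: cl_def)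
    moreover have "\<rho> \<notin> cl u" using rho_notin_cl P by blast
    ultimately show False using sep_eb[OF ub rho y(1)] ns ue by simp
  qed
  hence "{apex, leaf \<Gamma> y} \<in> edges \<Gamma>" "{r, apex} \<in> edges \<Gamma>"
    using u apex(1) unfolding edges_eq cover_edges_def by blast+
  moreover from this have "{leaf \<Gamma> y, apex} \<in> edges \<Gamma>" by (simp add: insert_commute)
  ultimately show ?thesis using apex_in(1) by blast
qed

lemma not_sep_if_adjacent:
  assumes ab: "a \<in> A" "b \<in> A" "a \<noteq> b" and v: "{leaf \<Gamma> a, v} \<in> edges \<Gamma>" "{leaf \<Gamma> b, v} \<in> edges \<Gamma>"
    and e: "e \<in> bounded_edges \<Gamma>"
  shows "\<not> sep \<Gamma> e a b"
proof -
  have "v \<in> verts \<Gamma>" "leaf \<Gamma> a \<noteq> v" "leaf \<Gamma> b \<noteq> v" "leaf \<Gamma> a \<noteq> leaf \<Gamma> b"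
    using edge_subset[OF v(1)] edge_subset[OF v(2)] leaf_inj[OF ab(1,2)] ab(3) by (auto simp: card_insert_if split: if_splits)
  hence "tree_path \<Gamma> (leaf \<Gamma> a) [leaf \<Gamma> a, v, leaf \<Gamma> b] (leaf \<Gamma> b)"
    using v leaf_in ab by (simp add: tree_path_def insert_commute)
  hence "tpath \<Gamma> (leaf \<Gamma> a) (leaf \<Gamma> b) = [leaf \<Gamma> a, v, leaf \<Gamma> b]" by (rule tpath_unique)
  moreover have "leaf \<Gamma> a \<notin> e" "leaf \<Gamma> b \<notin> e" using e leaf_val ab unfolding bounded_edges_def by auto
  ultimately show ?thesis unfolding sep_def by auto
qed

lemma fulr_iff_lamf:
  assumes A: "{a, b, c, d} \<subseteq> A" and l: "l > 0"
  shows "fulr (hdist \<Gamma>) (l, a, b, c, d) \<longleftrightarrow> lamf \<Gamma> (len \<Gamma>) a b c d = l"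
proof -
  have A': "{a, b, d, c} \<subseteq> A" "{c, d} \<subseteq> A" using A by auto
  have F: "fulr (hdist \<Gamma>) (l, a, b, c, d) \<longleftrightarrow> qd (hdist \<Gamma>) a b c d = l \<and> qd (hdist \<Gamma>) a b d c = l"
    using hd_len_sym A'(2) by (rule fulr_qd)
  have E: "lamf \<Gamma> (len \<Gamma>) a b c d = max 0 (min (qd (hdist \<Gamma>) a b c d) (qd (hdist \<Gamma>) a b d c))"
    using len_pos A by (rule lamf_eq)
  show ?thesis
  proof
    assume "fulr (hdist \<Gamma>) (l, a, b, c, d)" thus "lamf \<Gamma> (len \<Gamma>) a b c d = l" using E F l by simp
  next
    assume L: "lamf \<Gamma> (len \<Gamma>) a b c d = l"
    hence "\<exists>e\<in>bounded_edges \<Gamma>. seps \<Gamma> e a b c d" using l lamf_pos_iff(2)[of "len \<Gamma>", OF len_pos] by metis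
    hence "lamf \<Gamma> (len \<Gamma>) a c b d = 0" "lamf \<Gamma> (len \<Gamma>) a d b c = 0" using lamf_compat[OF A] by blast+
    thus "fulr (hdist \<Gamma>) (l, a, b, c, d)"
      using F L qd_hd_len[OF A] qd_hd_len[OF A'(1)] lamf_sym(1)[OF A] by simp
  qed
qed

text \<open>The definition allows every naming of the splitting by four letters. A curve fulfilling
  the cross-ratio with positive length has an edge separating \<open>ab\<close> from
  \<open>cd\<close>, so no edge realises another splitting and all namings agree.\<close>

lemma contributes_iff:
  assumes C: "vrow A (l, a, b, c, d)" "fulr (hdist \<Gamma>) (l, a, b, c, d)" "l > 0" and e: "e \<in> bounded_edges \<Gamma>"
  shows "contributes \<Gamma> e (crow (l, a, b, c, d)) \<longleftrightarrow> seps \<Gamma> e a b c d"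
proof -
  have A: "a \<in> A" "b \<in> A" "c \<in> A" "d \<in> A" "{a, b, c, d} \<subseteq> A" "distinct [a, b, c, d]" using C(1) by auto
  have "lamf \<Gamma> (len \<Gamma>) a b c d = l" using fulr_iff_lamf[OF A(5) C(3)] C(2) by blast
  hence ex: "\<exists>e\<in>bounded_edges \<Gamma>. seps \<Gamma> e a b c d" using C(3) lamf_pos_iff(2)[of "len \<Gamma>", OF len_pos] by metis
  have n1: "\<not> seps \<Gamma> e a c b d" using ex seps_compat[OF _ e A(1-4)] by blast
  have "\<exists>e\<in>bounded_edges \<Gamma>. seps \<Gamma> e a b d c" using ex seps_sym(1)[OF _ A(5)] by blast
  hence n2: "\<not> seps \<Gamma> e a d b c" using seps_compat[OF _ e A(1,2,4,3)] by blast
  obtain S where S: "\<And>a b. a \<in> A \<Longrightarrow> b \<in> A \<Longrightarrow> sep \<Gamma> e a b \<longleftrightarrow> ((a \<in> S) \<noteq> (b \<in> S))"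
    using sep_side[OF e] by metis
  have path: "(\<exists>p. tree_path \<Gamma> (leaf \<Gamma> x) p (leaf \<Gamma> y) \<and> e \<in> path_edges p) \<longleftrightarrow> (x \<in> S) \<noteq> (y \<in> S)" if "x \<in> A" "y \<in> A" for x y
    using tpath[OF leaf_in leaf_in, OF that] tpath_unique S[OF that] unfolding sep_def by metis
  have n1': "\<not> ((a \<in> S \<longleftrightarrow> c \<in> S) \<and> (b \<in> S \<longleftrightarrow> d \<in> S) \<and> (a \<in> S) \<noteq> (b \<in> S))"
    using n1 unfolding seps_def S[OF A(1,3)] S[OF A(2,4)] S[OF A(1,2)] by blast
  have n2': "\<not> ((a \<in> S \<longleftrightarrow> d \<in> S) \<and> (b \<in> S \<longleftrightarrow> c \<in> S) \<and> (a \<in> S) \<noteq> (b \<in> S))"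
    using n2 unfolding seps_def S[OF A(1,4)] S[OF A(2,3)] S[OF A(1,2)] by blast
  have s: "seps \<Gamma> e a b c d \<longleftrightarrow> (a \<in> S \<longleftrightarrow> b \<in> S) \<and> (c \<in> S \<longleftrightarrow> d \<in> S) \<and> (a \<in> S) \<noteq> (c \<in> S)"
    unfolding seps_def S[OF A(1,2)] S[OF A(3,4)] S[OF A(1,3)] by blast
  show ?thesis
  proof
    assume "contributes \<Gamma> e (crow (l, a, b, c, d))"
    hence "\<exists>a' b' c' d'. {{a, b}, {c, d}} = {{a', b'}, {c', d'}} \<and>
      (\<exists>p. tree_path \<Gamma> (leaf \<Gamma> a') p (leaf \<Gamma> c') \<and> e \<in> path_edges p) \<and>
      (\<exists>p. tree_path \<Gamma> (leaf \<Gamma> b') p (leaf \<Gamma> d') \<and> e \<in> path_edges p)"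
      unfolding contributes_def crow.simps CR_def snd_conv by (rule conjunct2)
    then obtain a' b' c' d' where eq: "{{a, b}, {c, d}} = {{a', b'}, {c', d'}}"
      and p: "\<exists>p. tree_path \<Gamma> (leaf \<Gamma> a') p (leaf \<Gamma> c') \<and> e \<in> path_edges p"
        "\<exists>p. tree_path \<Gamma> (leaf \<Gamma> b') p (leaf \<Gamma> d') \<and> e \<in> path_edges p"
      by (elim exE conjE) (rule that, assumption, blast, blast)
    have "(a' = a \<and> b' = b \<or> a' = b \<and> b' = a) \<and> (c' = c \<and> d' = d \<or> c' = d \<and> d' = c) \<or>
       (a' = c \<and> b' = d \<or> a' = d \<and> b' = c) \<and> (c' = a \<and> d' = b \<or> c' = b \<and> d' = a)"
      using eq A(6) unfolding doubleton_eq_iff by metis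
    moreover from this have A': "a' \<in> A" "b' \<in> A" "c' \<in> A" "d' \<in> A" using A(1-4) by auto
    ultimately show "seps \<Gamma> e a b c d"
      using p n1' n2' unfolding s path[OF A'(1,3)] path[OF A'(2,4)] by (elim disjE conjE; simp; metis)
  next
    assume "seps \<Gamma> e a b c d"
    hence "(a \<in> S) \<noteq> (c \<in> S)" "(b \<in> S) \<noteq> (d \<in> S)" unfolding s by blast+
    hence p: "\<exists>p. tree_path \<Gamma> (leaf \<Gamma> a) p (leaf \<Gamma> c) \<and> e \<in> path_edges p"
      "\<exists>p. tree_path \<Gamma> (leaf \<Gamma> b) p (leaf \<Gamma> d) \<and> e \<in> path_edges p"
      unfolding path[OF A(1,3)] path[OF A(2,4)] .
    show "contributes \<Gamma> e (crow (l, a, b, c, d))"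
      unfolding contributes_def crow.simps CR_def snd_conv
      by (intro conjI exI[of _ a] exI[of _ b] exI[of _ c] exI[of _ d] HOL.refl e p)
  qed
qed

end

text \<open>With four ends an inner vertex has valence three or four, so a four-valent vertex exists
  precisely if the four markings are not resolved. Otherwise there is one bounded edge, and the
  adjacency conditions say that it separates \<open>ab\<close> from \<open>cd\<close>.\<close>

lemma cr_point_iff:
  assumes C: "vrow A C" and trop: "tropical_curve (rmarks C) \<Delta>"
  shows "\<Delta> \<in> cr_point (crow C) \<longleftrightarrow> fulr (hdist \<Delta>) C"
proof -
  obtain l a b c d where C': "C = (l, a, b, c, d)" by (cases C) auto
  define M where "M = {a, b, c, d}"
  have D: "distinct [a, b, c, d]" and l0: "l \<ge> 0" using C C' by auto
  have M: "a \<in> M" "b \<in> M" "c \<in> M" "d \<in> M" "{a, b, c, d} \<subseteq> M" "card M = 4" using D by (auto simp: M_def)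
  have tM: "tropical_curve M \<Delta>" using trop C' by (simp add: M_def)
  interpret R: marked_tree M \<Delta> d using tM M by unfold_locales
  have sym: "hdist \<Delta> x y = hdist \<Delta> y x" if "x \<in> M" "y \<in> M" for x y using R.hd_len_sym that .
  have res: "resolved M (hdist \<Delta>) \<longleftrightarrow> \<not> fulr (hdist \<Delta>) (0, a, b, c, d)"
    unfolding M_def using sym D unfolding M_def by (rule resolved_four)
  have tri: "resolved M (hdist \<Delta>) \<longleftrightarrow> (\<forall>v\<in>inner_verts \<Delta>. valence \<Delta> v = 3)"
    using tM by (rule resolved_iff_trivalent)
  have pt: "\<Delta> \<in> cr_point (crow C) \<longleftrightarrow> (if l = 0 then \<exists>v\<in>verts \<Delta>. valence \<Delta> v = 4
      else (\<exists>e. bounded_edges \<Delta> = {e} \<and> len \<Delta> e = l) \<and>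
        (\<forall>P\<in>{{a, b}, {c, d}}. \<exists>v\<in>verts \<Delta>. \<forall>a\<in>P. {leaf \<Delta> a, v} \<in> edges \<Delta>))"
    using trop cr_marks_crow[of C] unfolding cr_point_def C' by (simp add: CR_def)
  show ?thesis
  proof (cases "l = 0")
    case True
    have "(\<exists>v\<in>verts \<Delta>. valence \<Delta> v = 4) \<longleftrightarrow> \<not> (\<forall>v\<in>inner_verts \<Delta>. valence \<Delta> v = 3)"
    proof
      assume "\<exists>v\<in>verts \<Delta>. valence \<Delta> v = 4"
      then obtain v where v: "v \<in> verts \<Delta>" "valence \<Delta> v = 4" by blast
      hence "v \<in> inner_verts \<Delta>" by (simp add: inner_verts_def)
      thus "\<not> (\<forall>v\<in>inner_verts \<Delta>. valence \<Delta> v = 3)" using v(2) by (metis numeral_eq_iff semiring_norm(88) num.distinct(5) numeral_eq_iff semiring_norm(87) num.distinct(1) num.distinct(3))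
    next
      assume "\<not> (\<forall>v\<in>inner_verts \<Delta>. valence \<Delta> v = 3)"
      then obtain v where v: "v \<in> inner_verts \<Delta>" "valence \<Delta> v \<noteq> 3" by blast
      have "v \<in> verts \<Delta>" using v(1) by (simp add: inner_verts_def)
      moreover have "valence \<Delta> v = 4" using R.valence_inner_ge[OF v(1)] R.valence_le[OF calculation] M(6) v(2) by linarith
      ultimately show "\<exists>v\<in>verts \<Delta>. valence \<Delta> v = 4" by blast
    qed
    moreover have "\<Delta> \<in> cr_point (crow C) \<longleftrightarrow> (\<exists>v\<in>verts \<Delta>. valence \<Delta> v = 4)" using pt True by simp
    moreover have "fulr (hdist \<Delta>) C \<longleftrightarrow> fulr (hdist \<Delta>) (0, a, b, c, d)" using C' True by simp
    ultimately show ?thesis using res tri by blast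
  next
    case False
    hence l: "l > 0" using l0 by simp
    have F: "fulr (hdist \<Delta>) C \<longleftrightarrow> lamf \<Delta> (len \<Delta>) a b c d = l" unfolding C' by (rule R.fulr_iff_lamf[OF M(5) l])
    have "(\<exists>e. bounded_edges \<Delta> = {e} \<and> len \<Delta> e = l) \<and>
        (\<forall>P\<in>{{a, b}, {c, d}}. \<exists>v\<in>verts \<Delta>. \<forall>a\<in>P. {leaf \<Delta> a, v} \<in> edges \<Delta>) \<longleftrightarrow> lamf \<Delta> (len \<Delta>) a b c d = l" (is "?L \<longleftrightarrow> _")
    proof
      assume ?L
      then obtain e v w where e: "bounded_edges \<Delta> = {e}" "len \<Delta> e = l"
        and v: "{leaf \<Delta> a, v} \<in> edges \<Delta>" "{leaf \<Delta> b, v} \<in> edges \<Delta>"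
        and w: "{leaf \<Delta> c, w} \<in> edges \<Delta>" "{leaf \<Delta> d, w} \<in> edges \<Delta>" by auto
      have eb: "e \<in> bounded_edges \<Delta>" using e by simp
      have ns: "\<not> sep \<Delta> e a b" "\<not> sep \<Delta> e c d"
        using R.not_sep_if_adjacent[OF M(1,2) _ v eb] R.not_sep_if_adjacent[OF M(3,4) _ w eb] D by auto
      obtain S where S: "\<And>a b. a \<in> M \<Longrightarrow> b \<in> M \<Longrightarrow> sep \<Delta> e a b \<longleftrightarrow> ((a \<in> S) \<noteq> (b \<in> S))"
        using R.sep_side[OF eb] by metis
      have S': "a \<in> S \<longleftrightarrow> b \<in> S" "c \<in> S \<longleftrightarrow> d \<in> S" using ns S M(1-4) by blast+
      \<comment> \<open>Some two of the four markings are separated by the edge. It separates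
        neither \<open>a\<close> from \<open>b\<close> nor \<open>c\<close> from \<open>d\<close>,
        so it must separate \<open>a\<close> from \<open>c\<close>.\<close>
      obtain a' b' c' d' where x: "distinct [a', b', c', d']" "{a', b', c', d'} \<subseteq> M"
         "\<forall>e'\<in>bounded_edges \<Delta>. seps \<Delta> e' a' b' c' d' \<longleftrightarrow> e' = e"
        by (rule R.edge_witness[OF eb])
      have "sep \<Delta> e a' c'" using bspec[OF x(3) eb] by (simp add: seps_def)
      hence "(a' \<in> S) \<noteq> (c' \<in> S)" using S x(2) by auto
      moreover have "a' \<in> {a, b, c, d}" "c' \<in> {a, b, c, d}" using x(2) unfolding M_def by auto
      ultimately have "(a \<in> S) \<noteq> (c \<in> S)" using S' by auto
      hence "seps \<Delta> e a b c d" using ns S M unfolding seps_def by blast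
      hence "{e' \<in> bounded_edges \<Delta>. seps \<Delta> e' a b c d} = {e}" unfolding e(1) by blast
      thus "lamf \<Delta> (len \<Delta>) a b c d = l" unfolding lamf_def using e(2) by simp
    next
      assume L: "lamf \<Delta> (len \<Delta>) a b c d = l"
      hence fu: "fulr (hdist \<Delta>) (l, a, b, c, d)" using F C' by simp
      have "\<not> fulr (hdist \<Delta>) (0, a, b, c, d)" using fu l by auto
      hence "\<forall>v\<in>inner_verts \<Delta>. valence \<Delta> v = 3" using res tri by blast
      hence "card (bounded_edges \<Delta>) = 1" using R.card_bounded_trivalent M(6) by simp
      then obtain e where e: "bounded_edges \<Delta> = {e}" by (metis card_1_singletonE)
      have "\<exists>e\<in>bounded_edges \<Delta>. seps \<Delta> e a b c d" using L l R.lamf_pos_iff(2)[of "len \<Delta>", OF R.len_pos] by metis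
      hence se: "seps \<Delta> e a b c d" unfolding e by simp
      hence "{e' \<in> bounded_edges \<Delta>. seps \<Delta> e' a b c d} = {e}" unfolding e by blast
      hence "len \<Delta> e = l" using L unfolding lamf_def by simp
      moreover have "\<exists>v\<in>verts \<Delta>. \<forall>z\<in>{x, y}. {leaf \<Delta> z, v} \<in> edges \<Delta>" if xy: "x \<in> M" "y \<in> M" "x \<noteq> y" "\<not> sep \<Delta> e x y" for x y
      proof -
        interpret Q: marked_tree M \<Delta> x using tM xy by unfold_locales
        show ?thesis using Q.adjacent_root[OF e xy(2) not_sym[OF xy(3)] xy(4)] by blast
      qed
      ultimately have "\<exists>v\<in>verts \<Delta>. \<forall>z\<in>{a, b}. {leaf \<Delta> z, v} \<in> edges \<Delta>"
        "\<exists>v\<in>verts \<Delta>. \<forall>z\<in>{c, d}. {leaf \<Delta> z, v} \<in> edges \<Delta>"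
        using se M(1-4) D unfolding seps_def by auto
      thus ?L using e \<open>len \<Delta> e = l\<close> by simp
    qed
    thus ?thesis using pt F False by simp
  qed
qed

text \<open>\<open>fulfills\<close> is an equality of isomorphism classes. Forgetting ends preserves
  quartets, and fulfilling \<open>C\<close> fixes them on the four markings, so both classes consist
  of the curves with the same quartets.\<close>

lemma fulfills_iff:
  assumes trop: "tropical_curve A \<Gamma>" and C: "vrow A C"
  shows "fulfills (iso_rel A `` {\<Gamma>}) (crow C) \<longleftrightarrow> fulr (hdist \<Gamma>) C"
proof -
  define M where "M = rmarks C"
  have MA: "M \<subseteq> A" and cM: "card M \<ge> 3" using C unfolding M_def by (cases C; auto)+
  have hsym: "hdist \<Delta> a b = hdist \<Delta> b a" if "tropical_curve B \<Delta>" "a \<in> B" "b \<in> B" for \<Delta> :: "'a tcurve" and B a b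
  proof -
    interpret marked_tree B \<Delta> a using that by unfold_locales
    show ?thesis using hd_len_sym that by blast
  qed
  have CM: "vrow M C" using C unfolding M_def by (cases C) auto
  have ftm: "ft_map M (iso_rel A `` {\<Gamma>}) = {\<Delta>. tropical_curve M \<Delta> \<and> quart M (hdist \<Delta>) = quart M (hdist \<Gamma>)}"
  proof (intro Set.set_eqI iffI)
    fix \<Delta> assume "\<Delta> \<in> ft_map M (iso_rel A `` {\<Gamma>})"
    then obtain \<Gamma>' where G': "(\<Gamma>, \<Gamma>') \<in> iso_rel A" "(ft M \<Gamma>', \<Delta>) \<in> iso_rel M" unfolding ft_map_def by blast
    hence G: "tropical_curve A \<Gamma>'" "quart A (hdist \<Gamma>) = quart A (hdist \<Gamma>')"
      "tropical_curve M \<Delta>" "quart M (hdist (ft M \<Gamma>')) = quart M (hdist \<Delta>)" unfolding iso_rel_iff by blast+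
    have "quart M (hdist \<Delta>) = quart M (hdist \<Gamma>)"
      using ft_correct(2)[OF G(1) MA cM] quart_mono[OF G(2) MA] G(4) by simp
    thus "\<Delta> \<in> {\<Delta>. tropical_curve M \<Delta> \<and> quart M (hdist \<Delta>) = quart M (hdist \<Gamma>)}" using G(3) by blast
  next
    fix \<Delta> assume "\<Delta> \<in> {\<Delta>. tropical_curve M \<Delta> \<and> quart M (hdist \<Delta>) = quart M (hdist \<Gamma>)}"
    hence "(ft M \<Gamma>, \<Delta>) \<in> iso_rel M" unfolding iso_rel_iff using ft_correct[OF trop MA cM] by simp
    moreover have "(\<Gamma>, \<Gamma>) \<in> iso_rel A" unfolding iso_rel_iff using trop by simp
    ultimately show "\<Delta> \<in> ft_map M (iso_rel A `` {\<Gamma>})" unfolding ft_map_def by blast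
  qed
  have crp: "cr_point (crow C) = {\<Delta>. tropical_curve M \<Delta> \<and> fulr (hdist \<Delta>) C}"
  proof -
    have "\<Delta> \<in> cr_point (crow C) \<Longrightarrow> tropical_curve M \<Delta>" for \<Delta> unfolding cr_point_def M_def by simp
    thus ?thesis using cr_point_iff[OF C] unfolding M_def by blast
  qed
  have sG: "hdist \<Gamma> a b = hdist \<Gamma> b a" if "a \<in> M" "b \<in> M" for a b using hsym[OF trop] that MA by blast
  have eq: "fulr (hdist \<Delta>) C \<longleftrightarrow> fulr (hdist \<Gamma>) C" if "tropical_curve M \<Delta>" "quart M (hdist \<Delta>) = quart M (hdist \<Gamma>)" for \<Delta>
    using hsym[OF that(1)] sG that(2) CM by (rule fulr_quart)
  show ?thesis
  proof
    assume "fulfills (iso_rel A `` {\<Gamma>}) (crow C)"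
    hence "ft M \<Gamma> \<in> {\<Delta>. tropical_curve M \<Delta> \<and> fulr (hdist \<Delta>) C}"
      using ftm crp ft_correct[OF trop MA cM] unfolding fulfills_def M_def cr_marks_crow by blast
    thus "fulr (hdist \<Gamma>) C" using eq ft_correct[OF trop MA cM] by blast
  next
    assume G: "fulr (hdist \<Gamma>) C"
    have "quart M (hdist \<Delta>) = quart M (hdist \<Gamma>)" if "tropical_curve M \<Delta>" "fulr (hdist \<Delta>) C" for \<Delta>
      using quart_eq_if_fulr[where H="hdist \<Delta>" and K="hdist \<Gamma>", OF hsym[OF that(1)] sG CM that(2) G] unfolding M_def .
    hence "ft_map M (iso_rel A `` {\<Gamma>}) = cr_point (crow C)" unfolding ftm crp using eq G by blast
    thus "fulfills (iso_rel A `` {\<Gamma>}) (crow C)" unfolding fulfills_def M_def by simp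
  qed
qed

section \<open>Amalgamation\<close>

text \<open>Minus the Gromov product with base point \<open>p\<close>. It has the same quartets as
  \<open>H\<close>, vanishes on pairs containing \<open>p\<close>, and is an ultrametric on the rest
  if \<open>H\<close> satisfies the four-point condition.\<close>

definition nrm :: "'a \<Rightarrow> ('a \<Rightarrow> 'a \<Rightarrow> real) \<Rightarrow> 'a \<Rightarrow> 'a \<Rightarrow> real" where
  "nrm p H a b = (if a = p \<or> b = p then 0 else H a b - H p a - H p b)"

definition ultra :: "'a set \<Rightarrow> ('a \<Rightarrow> 'a \<Rightarrow> real) \<Rightarrow> bool" where
  "ultra B u \<longleftrightarrow> (\<forall>a\<in>B. \<forall>b\<in>B. u a b = u b a) \<and>
     (\<forall>a\<in>B. \<forall>b\<in>B. \<forall>c\<in>B. distinct [a, b, c] \<longrightarrow> u a b \<le> max (u a c) (u c b))"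

lemma ultraD: "ultra B u \<Longrightarrow> a \<in> B \<Longrightarrow> b \<in> B \<Longrightarrow> c \<in> B \<Longrightarrow> distinct [a, b, c] \<Longrightarrow> u a b \<le> max (u a c) (u c b)"
  unfolding ultra_def by blast

lemma ultra_sym: "ultra B u \<Longrightarrow> a \<in> B \<Longrightarrow> b \<in> B \<Longrightarrow> u a b = u b a"
  unfolding ultra_def by blast

lemma tm_mono: "tm A H \<Longrightarrow> M \<subseteq> A \<Longrightarrow> tm M H"
  unfolding tm_def by blast

lemma tm_nrm:
  assumes "tm A H" "p \<in> A"
  shows "ultra (A - {p}) (nrm p H)"
  unfolding ultra_def
proof (intro conjI ballI impI)
  fix a b assume "a \<in> A - {p}" "b \<in> A - {p}"
  thus "nrm p H a b = nrm p H b a" using tm_sym[OF assms(1)] by (simp add: nrm_def)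
next
  fix a b c assume abc: "a \<in> A - {p}" "b \<in> A - {p}" "c \<in> A - {p}" "distinct [a, b, c]"
  hence "distinct [a, b, c, p]" "a \<in> A" "b \<in> A" "c \<in> A" by auto
  hence "H a b + H c p \<le> max (H a c + H b p) (H a p + H b c)" using assms unfolding tm_def by blast
  moreover have "H c p = H p c" "H b p = H p b" "H a p = H p a" "H b c = H c b"
    using tm_sym[OF assms(1)] abc assms(2) by blast+
  ultimately show "nrm p H a b \<le> max (nrm p H a c) (nrm p H c b)"
    using abc unfolding nrm_def by auto
qed

lemma quart_nrm:
  assumes "\<And>a b. a \<in> A \<Longrightarrow> b \<in> A \<Longrightarrow> H a b = H b a" "p \<in> A"
  shows "quart A (nrm p H) = quart A H"
proof (rule quartI)
  fix a b c d assume D: "distinct [a, b, c, d]" "{a, b, c, d} \<subseteq> A"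
  thus "qd (nrm p H) a b c d = qd H a b c d"
    using assms(1)[of p a] assms(1)[of p b] assms(1)[of p c] assms(1)[of p d] assms(2)
    by (auto simp: qd_def nrm_def)
qed

lemma ultra_four_point:
  fixes ab ac ad bc bd cd :: real
  assumes "ab \<le> max ac bc" "ab \<le> max ad bd" "cd \<le> max ac ad" "cd \<le> max bc bd"
    "ac \<le> max ab bc" "ac \<le> max ad cd" "bd \<le> max ab ad" "bd \<le> max bc cd"
    "ad \<le> max ab bd" "ad \<le> max ac cd" "bc \<le> max ab ac" "bc \<le> max bd cd"
  shows "ab + cd \<le> max (ac + bd) (ad + bc)"
  using assms by (auto simp: max_def split: if_splits)

lemma tm_if_ultra:
  assumes u: "ultra B u" and p: "p \<notin> B" and H: "\<And>a b. a \<in> B \<Longrightarrow> b \<in> B \<Longrightarrow> H a b = u a b"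
    and Hp: "\<And>a. a \<in> B \<Longrightarrow> H p a = 0 \<and> H a p = 0"
  shows "tm (insert p B) H"
  unfolding tm_def
proof (intro conjI ballI impI)
  fix a b assume "a \<in> insert p B" "b \<in> insert p B"
  thus "H a b = H b a" using ultra_sym[OF u] H Hp by auto
next
  fix a b c d assume m: "a \<in> insert p B" "b \<in> insert p B" "c \<in> insert p B" "d \<in> insert p B" and D: "distinct [a, b, c, d]"
  have U: "u x y \<le> max (u x z) (u y z)" if "x \<in> B" "y \<in> B" "z \<in> B" "x \<noteq> y" "y \<noteq> z" "x \<noteq> z" for x y z
    using ultraD[OF u that(1-3)] that ultra_sym[OF u that(2,3)] by auto
  note S = ultra_sym[OF u]
  consider "a = p" | "b = p" | "c = p" | "d = p" | "p \<notin> {a, b, c, d}" by blast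
  thus "H a b + H c d \<le> max (H a c + H b d) (H a d + H b c)"
  proof cases
    case 1
    hence "b \<in> B" "c \<in> B" "d \<in> B" using m D by auto
    thus ?thesis using U[of c d b] S[of b c] S[of b d] D 1 H Hp by (auto simp: max.commute)
  next
    case 2
    hence "a \<in> B" "c \<in> B" "d \<in> B" using m D by auto
    thus ?thesis using U[of c d a] S[of a c] S[of a d] D 2 H Hp by (auto simp: max.commute)
  next
    case 3
    hence "a \<in> B" "b \<in> B" "d \<in> B" using m D by auto
    thus ?thesis using U[of a b d] D 3 H Hp by (auto simp: max.commute)
  next
    case 4
    hence "a \<in> B" "b \<in> B" "c \<in> B" using m D by auto
    thus ?thesis using U[of a b c] D 4 H Hp by (auto simp: max.commute)
  next
    case 5
    hence B: "a \<in> B" "b \<in> B" "c \<in> B" "d \<in> B" using m by auto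
    have "u a b + u c d \<le> max (u a c + u b d) (u a d + u b c)"
    proof (rule ultra_four_point)
    qed (use U[of a b c] U[of a b d] U[of c d a] U[of c d b] U[of a c b] U[of a c d] U[of b d a] U[of b d c]
        U[of a d b] U[of a d c] U[of b c a] U[of b c d] S[of a b] S[of a c] S[of a d] S[of b c] S[of b d] S[of c d] B D in auto)
    thus ?thesis using H B by simp
  qed
qed

section \<open>Quartets modulo a subgroup of the reals\<close>

lemma card_ge3_obtain:
  assumes "card Q \<ge> 3" "p \<in> Q"
  obtains x y where "x \<in> Q" "y \<in> Q" "x \<noteq> y" "x \<noteq> p" "y \<noteq> p"
proof -
  have f: "finite Q" using assms(1) by (rule_tac card_ge_0_finite) simp
  hence "card (Q - {p}) \<ge> 2" using assms by simp
  then obtain T where "T \<subseteq> Q - {p}" "card T = 2" by (meson obtain_subset_with_card_n)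
  thus thesis using that by (auto simp: card_2_iff)
qed

text \<open>With \<open>G = {0}\<close> and a difference of two metrics this expresses uniqueness,
  with the integers it expresses integrality; one gluing argument serves both.\<close>

definition gen_on :: "real set \<Rightarrow> 'a set \<Rightarrow> ('a \<Rightarrow> 'a \<Rightarrow> real) \<Rightarrow> bool" where
  "gen_on G A K \<longleftrightarrow> (\<forall>a\<in>A. \<forall>b\<in>A. \<forall>c\<in>A. \<forall>d\<in>A. distinct [a, b, c, d] \<longrightarrow> qd K a b c d \<in> G)"

definition subgrp :: "real set \<Rightarrow> bool" where
  "subgrp G \<longleftrightarrow> 0 \<in> G \<and> (\<forall>x\<in>G. \<forall>y\<in>G. x - y \<in> G)"

lemma subgrpD: assumes "subgrp G" shows "0 \<in> G" "x \<in> G \<Longrightarrow> y \<in> G \<Longrightarrow> x - y \<in> G" "x \<in> G \<Longrightarrow> y \<in> G \<Longrightarrow> x + y \<in> G" "x \<in> G \<Longrightarrow> - x \<in> G"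
proof -
  show 0: "0 \<in> G" and d: "\<And>x y. x \<in> G \<Longrightarrow> y \<in> G \<Longrightarrow> x - y \<in> G" using assms by (auto simp: subgrp_def)
  show m: "x \<in> G \<Longrightarrow> - x \<in> G" for x using d[OF 0, of x] by simp
  show "x \<in> G \<Longrightarrow> y \<in> G \<Longrightarrow> x + y \<in> G" using d[of x "- y"] m by simp
qed

lemma gen_onD: "gen_on G A K \<Longrightarrow> {a, b, c, d} \<subseteq> A \<Longrightarrow> distinct [a, b, c, d] \<Longrightarrow> qd K a b c d \<in> G"
  unfolding gen_on_def by blast

text \<open>The difference of the normalised values on two pairs sharing a marking is a quartet with
  \<open>p\<close>, and at most two such steps connect any two pairs. So modulo \<open>G\<close> the
  normalised values are constant.\<close>

lemma gen_on_pairs: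
  assumes G: "subgrp G" and sym: "\<And>a b. a \<in> A \<Longrightarrow> b \<in> A \<Longrightarrow> K a b = K b a" and gen: "gen_on G A K" and p: "p \<in> A"
    and ab: "{a, b, c, d} \<subseteq> A - {p}" "a \<noteq> b" "c \<noteq> d"
  shows "nrm p K a b - nrm p K c d \<in> G"
proof -
  let ?N = "nrm p K"
  have N: "?N x y = ?N y x" if "x \<in> A" "y \<in> A" for x y using sym that by (simp add: nrm_def)
  have step: "?N x y - ?N x z \<in> G" if x: "{x, y, z} \<subseteq> A - {p}" "x \<noteq> y" "x \<noteq> z" for x y z
  proof (cases "y = z")
    case True thus ?thesis using subgrpD(1)[OF G] by simp
  next
    case False
    have "{x, z, y, p} \<subseteq> A" "distinct [x, z, y, p]" using x False p by auto
    hence "qd K x z y p \<in> G" by (rule gen_onD[OF gen])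
    moreover have "qd K x z y p = ?N x y - ?N x z"
      using x p sym[of p z] sym[of p y] by (auto simp: qd_def nrm_def)
    ultimately show ?thesis by simp
  qed
  have A: "a \<in> A" "b \<in> A" "c \<in> A" "d \<in> A" using ab by auto
  show ?thesis
  proof (cases "a = c")
    case True thus ?thesis using step[of a b d] ab by auto
  next
    case ac: False
    show ?thesis
    proof (cases "a = d")
      case True thus ?thesis using step[of a b c] ab N[OF A(3,4)] by auto
    next
      case False
      have "?N a b - ?N a c \<in> G" using step[of a b c] ab ac by auto
      moreover have "?N c a - ?N c d \<in> G" using step[of c a d] ab ac by auto
      ultimately have "(?N a b - ?N a c) + (?N c a - ?N c d) \<in> G" by (rule subgrpD(3)[OF G])
      thus ?thesis using N[OF A(1,3)] by simp
    qed
  qed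
qed

lemma gen_on_if_pairs:
  assumes G: "subgrp G" and sym: "\<And>a b. a \<in> A \<Longrightarrow> b \<in> A \<Longrightarrow> K a b = K b a" and p: "p \<in> A"
    and pairs: "\<And>a b. {a, b} \<subseteq> A - {p} \<Longrightarrow> a \<noteq> b \<Longrightarrow> nrm p K a b - k \<in> G"
  shows "gen_on G A K"
  unfolding gen_on_def
proof (intro ballI impI)
  fix a b c d assume A: "a \<in> A" "b \<in> A" "c \<in> A" "d \<in> A" and D: "distinct [a, b, c, d]"
  let ?N = "nrm p K"
  have q: "qd K a b c d = qd ?N a b c d"
    using quartD[OF quart_nrm[OF sym p] D] A by simp
  have diff: "?N x y - ?N x z \<in> G" if "{x, y, z} \<subseteq> A" "distinct [x, y, z]" "p \<notin> {x, y, z}" for x y z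
    using subgrpD(2)[OF G pairs[of x y] pairs[of x z]] that by auto
  have N0: "?N p x = 0" "?N x p = 0" for x by (auto simp: nrm_def)
  have Ns: "?N x y = ?N y x" if "x \<in> A" "y \<in> A" for x y using sym that by (simp add: nrm_def)
  consider "a = p" | "b = p" | "c = p" | "d = p" | "p \<notin> {a, b, c, d}" by blast
  thus "qd K a b c d \<in> G"
  proof cases
    case 1 thus ?thesis using diff[of d b c] A D N0 Ns[OF A(4,2)] Ns[OF A(4,3)] unfolding q unfolding qd_def by auto
  next
    case 2 thus ?thesis using diff[of c a d] A D N0 Ns[OF A(3,1)] unfolding q unfolding qd_def by auto
  next
    case 3 thus ?thesis using diff[of b d a] A D N0 Ns[OF A(2,1)] unfolding q unfolding qd_def by auto
  next
    case 4 thus ?thesis using diff[of a c b] A D N0 unfolding q unfolding qd_def by auto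
  next
    case 5
    hence "(?N a c - ?N a b) + (?N d b - ?N d c) \<in> G"
      using A D by (intro subgrpD(3)[OF G] diff) auto
    thus ?thesis using Ns[OF A(4,2)] Ns[OF A(4,3)] unfolding q unfolding qd_def by (simp add: algebra_simps)
  qed
qed

text \<open>Modulo \<open>G\<close> the normalised values are constant on \<open>A'\<close> and on
  \<open>insert x Q\<close>, and both constants agree on a pair \<open>y\<close>, \<open>z\<close>
  of \<open>Q\<close> other than \<open>p\<close>; this is why three markings in \<open>Q\<close>
  are required. The remaining pairs of \<open>x\<close> with a marking outside \<open>Q\<close> are
  covered by \<open>ex\<close>, which equates their value with a known one.\<close>

lemma ext_group:
  assumes G: "subgrp G" and sym: "\<And>a b. a \<in> insert x A' \<Longrightarrow> b \<in> insert x A' \<Longrightarrow> K a b = K b a"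
    and Q: "Q \<subseteq> A'" "card Q \<ge> 3" "p \<in> Q" and x: "x \<notin> A'"
    and g1: "gen_on G A' K" and g2: "gen_on G (insert x Q) K"
    and ex: "\<And>a. a \<in> A' - Q \<Longrightarrow> \<exists>b\<in>Q - {p}. nrm p K x a = nrm p K b a \<or> nrm p K x a = nrm p K x b"
  shows "gen_on G (insert x A') K"
proof -
  obtain y z where yz: "y \<in> Q" "z \<in> Q" "y \<noteq> z" "y \<noteq> p" "z \<noteq> p" by (rule card_ge3_obtain[OF Q(2,3)])
  have p: "p \<in> A'" "p \<in> insert x Q" "p \<noteq> x" using Q x by auto
  define k where "k = nrm p K y z"
  have s1: "K a b = K b a" if "a \<in> A'" "b \<in> A'" for a b using sym that by blast
  have s2: "K a b = K b a" if "a \<in> insert x Q" "b \<in> insert x Q" for a b using sym that Q(1) by blast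
  have A1: "nrm p K a b - k \<in> G" if "{a, b} \<subseteq> A' - {p}" "a \<noteq> b" for a b
    unfolding k_def using gen_on_pairs[OF G s1 g1 p(1), of a b y z] that yz Q(1) by blast
  have A2: "nrm p K a b - k \<in> G" if "{a, b} \<subseteq> insert x Q - {p}" "a \<noteq> b" for a b
    unfolding k_def using gen_on_pairs[OF G s2 g2 p(2), of a b y z] that yz by blast
  have A3: "nrm p K x a - k \<in> G" if a: "a \<in> A' - {p}" for a
  proof (cases "a \<in> Q")
    case True thus ?thesis using A2[of x a] a p x by auto
  next
    case False
    then obtain b where b: "b \<in> Q - {p}" "nrm p K x a = nrm p K b a \<or> nrm p K x a = nrm p K x b" using ex a by blast
    moreover have "nrm p K b a - k \<in> G" using A1[of b a] a b(1) False Q(1) by auto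
    moreover have "nrm p K x b - k \<in> G" using A2[of x b] b(1) x Q(1) p by auto
    ultimately show ?thesis by auto
  qed
  have ns: "nrm p K a x = nrm p K x a" if "a \<in> A'" for a using sym[of a x] that by (simp add: nrm_def)
  show ?thesis
  proof (rule gen_on_if_pairs[OF G sym, where p = p and k = k])
    fix a b assume ab: "{a, b} \<subseteq> insert x A' - {p}" "a \<noteq> b"
    consider "a = x" "b \<in> A' - {p}" | "b = x" "a \<in> A' - {p}" | "{a, b} \<subseteq> A' - {p}" using ab by auto
    thus "nrm p K a b - k \<in> G"
    proof cases
      case 1 thus ?thesis using A3 by simp
    next
      case 2 thus ?thesis using A3 ns by simp
    next
      case 3 thus ?thesis using A1 ab(2) by blast
    qed
  qed (use p in auto)
qed

lemma quart_eq_iff_gen: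
  assumes H: "\<And>a b. a \<in> A \<Longrightarrow> b \<in> A \<Longrightarrow> H a b = H b a" and K: "\<And>a b. a \<in> A \<Longrightarrow> b \<in> A \<Longrightarrow> K a b = K b a"
  shows "quart A H = quart A K \<longleftrightarrow> gen_on {0} A (\<lambda>a b. H a b - K a b)"
proof -
  have q: "qd (\<lambda>a b. H a b - K a b) a b c d = qd H a b c d - qd K a b c d" for a b c d by (simp add: qd_def)
  show ?thesis
  proof
    assume "quart A H = quart A K"
    thus "gen_on {0} A (\<lambda>a b. H a b - K a b)" unfolding gen_on_def q using quartD by fastforce
  next
    assume g: "gen_on {0} A (\<lambda>a b. H a b - K a b)"
    show "quart A H = quart A K"
    proof (rule quartI)
      fix a b c d assume "distinct [a, b, c, d]" "{a, b, c, d} \<subseteq> A"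
      thus "qd H a b c d = qd K a b c d" using gen_onD[OF g, of a b c d] unfolding q by simp
    qed
  qed
qed

lemma resolved_quart:
  assumes "quart A H = quart A K" and H: "\<And>a b. a \<in> A \<Longrightarrow> b \<in> A \<Longrightarrow> H a b = H b a" and K: "\<And>a b. a \<in> A \<Longrightarrow> b \<in> A \<Longrightarrow> K a b = K b a"
    and r: "resolved A H"
  shows "resolved A K"
  unfolding resolved_def
proof (intro ballI impI)
  fix a b c d assume A: "a \<in> A" "b \<in> A" "c \<in> A" "d \<in> A" and D: "distinct [a, b, c, d]"
  have n: "\<not> (H a b + H c d = H a c + H b d \<and> H a c + H b d = H a d + H b c)" using r A D unfolding resolved_def by blast
  have "qd H a b c d = qd K a b c d" "qd H a b d c = qd K a b d c"
    using quartD[OF assms(1), of a b c d] quartD[OF assms(1), of a b d c] A D by auto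
  thus "\<not> (K a b + K c d = K a c + K b d \<and> K a c + K b d = K a d + K b c)"
    using n H[OF A(3,4)] K[OF A(3,4)] unfolding qd_def by argo
qed

text \<open>In normalised form \<open>qd H p x a b\<close> is
  \<open>nrm p H x b - nrm p H a b\<close>. If it does not vanish, the ultrametric inequality forces
  \<open>nrm p H x a\<close> to be the larger of these two known values.\<close>

definition generic :: "'a \<Rightarrow> 'a set \<Rightarrow> 'a set \<Rightarrow> ('a \<Rightarrow> 'a \<Rightarrow> real) \<Rightarrow> 'a \<Rightarrow> bool" where
  "generic p Q A' H x \<longleftrightarrow> (\<forall>a\<in>A' - Q. \<exists>b\<in>Q - {p}. qd H p x a b \<noteq> 0)"

text \<open>The new marking \<open>x\<close> is attached next to the marking of \<open>Q\<close> closest to it.\<close>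

lemma ext_exists:
  assumes t1: "tm A' H1" and t2: "tm (insert x Q) H2" and Q: "Q \<subseteq> A'" "card Q \<ge> 3" "p \<in> Q" and x: "x \<notin> A'"
    and q: "quart Q H1 = quart Q H2"
  obtains H where "tm (insert x A') H" "quart A' H = quart A' H1" "quart (insert x Q) H = quart (insert x Q) H2"
    "resolved (insert x A') H \<Longrightarrow> generic p Q A' H x"
proof -
  have finQ: "finite Q" using Q(2) by (rule_tac card_ge_0_finite) simp
  obtain y z where yz: "y \<in> Q" "z \<in> Q" "y \<noteq> z" "y \<noteq> p" "z \<noteq> p" by (rule card_ge3_obtain[OF Q(2,3)])
  define N1 where "N1 = nrm p H1"
  define N2 where "N2 = nrm p H2"
  have p: "p \<in> A'" "p \<in> insert x Q" "p \<noteq> x" using Q x by auto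
  have u1: "ultra (A' - {p}) N1" unfolding N1_def by (rule tm_nrm[OF t1 p(1)])
  have u2: "ultra (insert x Q - {p}) N2" unfolding N2_def by (rule tm_nrm[OF t2 p(2)])
  have s1: "H1 a b = H1 b a" if "a \<in> Q" "b \<in> Q" for a b using tm_sym[OF t1] that Q(1) by blast
  have s2: "H2 a b = H2 b a" if "a \<in> Q" "b \<in> Q" for a b using tm_sym[OF t2] that by blast
  \<comment> \<open>Agreement of quartets on \<open>Q\<close> means that the two normalised metrics
    differ there by a constant, which is read off at \<open>y\<close>, \<open>z\<close>.\<close>
  define k where "k = N1 y z - N2 y z"
  have sg: "subgrp {0}" by (simp add: subgrp_def)
  have k: "N1 a b = N2 a b + k" if ab: "a \<in> Q" "b \<in> Q" "a \<noteq> b" "a \<noteq> p" "b \<noteq> p" for a b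
  proof -
    have g: "gen_on {0} Q (\<lambda>a b. H1 a b - H2 a b)" using q quart_eq_iff_gen[where H=H1 and K=H2 and A=Q, OF s1 s2] by simp
    have "nrm p (\<lambda>a b. H1 a b - H2 a b) a b - nrm p (\<lambda>a b. H1 a b - H2 a b) y z \<in> {0}"
      by (rule gen_on_pairs[OF sg _ g Q(3)]) (use ab yz s1 s2 in auto)
    moreover have "nrm p (\<lambda>a b. H1 a b - H2 a b) c d = N1 c d - N2 c d" for c d
      by (simp add: nrm_def N1_def N2_def)
    ultimately show ?thesis by (simp add: k_def)
  qed
  define B where "B = A' - {p}"
  have QB: "b \<in> B" if "b \<in> Q" "b \<noteq> p" for b using that Q(1) by (auto simp: B_def)
  have xB: "x \<notin> B" "x \<notin> Q" using x Q(1) by (auto simp: B_def)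
  have f: "finite (Q - {p})" "Q - {p} \<noteq> {}" using finQ yz by auto
  \<comment> \<open>The value between \<open>x\<close> and its closest marking \<open>b0\<close> in
    \<open>Q - {p}\<close>, on the scale of \<open>N1\<close>.\<close>
  define t where "t = Min ((\<lambda>b. N2 x b + k) ` (Q - {p}))"
  have "t \<in> (\<lambda>b. N2 x b + k) ` (Q - {p})" unfolding t_def using f by (intro Min_in) auto
  then obtain b0 where b0: "b0 \<in> Q" "b0 \<noteq> p" "t = N2 x b0 + k" by auto
  have tmin: "t \<le> N2 x b + k" if "b \<in> Q" "b \<noteq> p" for b unfolding t_def using f that by (intro Min_le) auto
  \<comment> \<open>The value between \<open>x\<close> and an old marking \<open>c\<close>: as small
    as possible for a leaf attached at height \<open>t\<close> next to \<open>b0\<close>.\<close>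
  define v where "v c = (if c = b0 then t else max t (N1 b0 c))" for c
  define u where "u a b = (if a = x then (if b = x then 0 else v b) else if b = x then v a else N1 a b)" for a b
  define H where "H a b = (if a = p \<or> b = p then 0 else u a b)" for a b
  have b0B: "b0 \<in> B" using QB b0 by blast
  have S1: "N1 a b = N1 b a" if "a \<in> B" "b \<in> B" for a b using ultra_sym[OF u1] that unfolding B_def .
  have U1: "N1 a b \<le> max (N1 a c) (N1 c b)" if "a \<in> B" "b \<in> B" "c \<in> B" "distinct [a, b, c]" for a b c
    using ultraD[OF u1] that unfolding B_def .
  have V: "N1 a b \<le> max (v a) (v b) \<and> v a \<le> max (v b) (N1 a b)" if "a \<in> B" "b \<in> B" "a \<noteq> b" for a b
    using U1[of a b b0] U1[of b0 a b] U1[of b0 b a] S1[of a b] S1[of a b0] S1[of b b0] that b0B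
    by (cases "a = b0"; cases "b = b0") (auto simp: v_def max_def split: if_splits)
  have uB: "u a b = N1 a b" if "a \<in> B" "b \<in> B" for a b using that xB by (auto simp: u_def)
  have ux: "u x b = v b" "u b x = v b" if "b \<in> B" for b using that xB by (auto simp: u_def)
  have ult: "ultra (insert x B) u" unfolding ultra_def
  proof (intro conjI ballI impI)
    fix a b assume "a \<in> insert x B" "b \<in> insert x B"
    thus "u a b = u b a" using S1 by (auto simp: u_def)
  next
    fix a b c assume m: "a \<in> insert x B" "b \<in> insert x B" "c \<in> insert x B" and D: "distinct [a, b, c]"
    consider "a = x" "b \<in> B" "c \<in> B" | "b = x" "a \<in> B" "c \<in> B" | "c = x" "a \<in> B" "b \<in> B" | "a \<in> B" "b \<in> B" "c \<in> B"
      using m D by auto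
    thus "u a b \<le> max (u a c) (u c b)"
    proof cases
      case 1 thus ?thesis using V[of b c] S1[of b c] D by (simp add: uB ux)
    next
      case 2 thus ?thesis using V[of a c] S1[of a c] D by (simp add: uB ux max.commute)
    next
      case 3 thus ?thesis using V[of a b] D by (simp add: uB ux)
    next
      case 4 thus ?thesis using U1[OF 4 D] by (simp add: uB)
    qed
  qed
  have pB: "p \<notin> insert x B" using p by (auto simp: B_def)
  have "tm (insert p (insert x B)) H"
  proof (rule tm_if_ultra[OF ult pB])
    show "H a b = u a b" if "a \<in> insert x B" "b \<in> insert x B" for a b using that pB by (auto simp: H_def)
  qed (simp add: H_def)
  moreover have "insert p (insert x B) = insert x A'" using p by (auto simp: B_def)
  ultimately have T: "tm (insert x A') H" by simp
  have Hsym: "H a b = H b a" if "a \<in> insert x A'" "b \<in> insert x A'" for a b using tm_sym[OF T] that .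
  have "H a b = N1 a b" if "a \<in> A'" "b \<in> A'" for a b
    using that x by (auto simp: H_def u_def N1_def nrm_def)
  hence "quart A' H = quart A' N1" by (rule quart_cong)
  also have "\<dots> = quart A' H1" unfolding N1_def using tm_sym[OF t1] p(1) by (rule quart_nrm)
  finally have q1: "quart A' H = quart A' H1" .
  have S2: "N2 a b = N2 b a" if "a \<in> insert x Q - {p}" "b \<in> insert x Q - {p}" for a b using ultra_sym[OF u2] that .
  have Hx: "v b = N2 x b + k" if b: "b \<in> Q" "b \<noteq> p" for b
  proof (cases "b = b0")
    case True thus ?thesis using b0 by (simp add: v_def)
  next
    case False
    have D: "distinct [x, b, b0]" "distinct [b0, b, x]" using False b b0 xB by auto
    have m: "x \<in> insert x Q - {p}" "b \<in> insert x Q - {p}" "b0 \<in> insert x Q - {p}" using b b0 p by auto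
    have "N2 x b \<le> max (N2 x b0) (N2 b0 b)" by (rule ultraD[OF u2 m D(1)])
    moreover have "N2 b0 b \<le> max (N2 b0 x) (N2 x b)" by (rule ultraD[OF u2 m(3,2,1) D(2)])
    moreover have "N2 b0 x = N2 x b0" using S2 m by blast
    moreover have "N1 b0 b = N2 b0 b + k" using k[OF b0(1) b(1)] False b0 b by blast
    ultimately show ?thesis using tmin[OF b] b0(3) False unfolding v_def by (auto simp: max_def split: if_splits)
  qed
  have HN: "H a b = N2 a b + k" if ab: "a \<in> insert x Q - {p}" "b \<in> insert x Q - {p}" "a \<noteq> b" for a b
  proof -
    consider "a = x" "b \<in> Q" | "b = x" "a \<in> Q" "a \<noteq> x" | "a \<in> Q" "b \<in> Q" "a \<noteq> x" "b \<noteq> x" using ab by blast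
    thus ?thesis
    proof cases
      case 1 thus ?thesis using Hx[of b] ab p by (auto simp: H_def u_def)
    next
      case 2 thus ?thesis using Hx[of a] ab p S2[of a b] by (auto simp: H_def u_def)
    next
      case 3 thus ?thesis using k[of a b] ab by (auto simp: H_def u_def)
    qed
  qed
  have Np: "N2 a p = 0" "N2 p a = 0" "H a p = 0" "H p a = 0" for a by (simp_all add: N2_def nrm_def H_def)
  have "quart (insert x Q) H = quart (insert x Q) N2"
  proof (rule quart_eqI_root[where \<rho> = p])
    show "H a b = H b a" if "a \<in> insert x Q" "b \<in> insert x Q" for a b using Hsym that Q(1) by blast
    show "N2 a b = N2 b a" if "a \<in> insert x Q" "b \<in> insert x Q" for a b
      using S2[of a b] Np that by (cases "a = p"; cases "b = p") auto
    fix a b c assume "{a, b, c} \<subseteq> insert x Q - {p}" "distinct [a, b, c]"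
    thus "qd H a b c p = qd N2 a b c p" using HN[of a c] HN[of a b] Np by (auto simp: qd_def)
  qed (use p in auto)
  also have "\<dots> = quart (insert x Q) H2" unfolding N2_def using tm_sym[OF t2] p(2) by (rule quart_nrm)
  finally have q2: "quart (insert x Q) H = quart (insert x Q) H2" .
  \<comment> \<open>If the position of \<open>a\<close> is not decided by \<open>Q\<close>, then
    \<open>a\<close> has the same value \<open>t\<close> at \<open>b0\<close> as \<open>x\<close>
    does, and by choice of \<open>v\<close> also the value \<open>t\<close> at \<open>x\<close>. So
    \<open>p\<close>, \<open>x\<close>, \<open>a\<close>, \<open>b0\<close> form a star.\<close>
  have gen: "generic p Q A' H x" if res: "resolved (insert x A') H"
  proof (rule ccontr)
    assume "\<not> generic p Q A' H x"
    then obtain a where a: "a \<in> A' - Q" "\<And>b. b \<in> Q - {p} \<Longrightarrow> qd H p x a b = 0" unfolding generic_def by blast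
    have ap: "a \<noteq> p" "a \<noteq> b0" "a \<noteq> x" "a \<in> B" using a Q(3) b0(1) x by (auto simp: B_def)
    have "qd H p x a b0 = 0" using a(2) b0 by blast
    hence e: "H x b0 = H a b0" using Np by (simp add: qd_def)
    have Hxb: "H x b0 = t" using b0 p ap xB by (auto simp: H_def u_def v_def)
    have Hab: "H a b0 = N1 a b0" using ap b0 xB by (auto simp: H_def u_def)
    have "H x a = max t (N1 b0 a)" using ap p by (auto simp: H_def u_def v_def)
    also have "\<dots> = t" using Hab Hxb e S1[OF b0B ap(4)] by simp
    finally have Hxa: "H x a = t" .
    have D: "distinct [p, x, a, b0]" using ap p b0 xB by auto
    have "p \<in> insert x A'" "a \<in> insert x A'" "b0 \<in> insert x A'" using p a b0 Q(1) by auto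
    hence "\<not> (H p x + H a b0 = H p a + H x b0 \<and> H p a + H x b0 = H p b0 + H x a)"
      using res D unfolding resolved_def by blast
    thus False using Hxa Hxb Hab e Np by simp
  qed
  show thesis by (rule that[OF T q1 q2 gen])
qed

lemma tlike_self: assumes "tm A H" shows "tlike A H H"
  unfolding tlike_def
proof (intro conjI ballI impI)
  show "H a b = H b a" if "a \<in> A" "b \<in> A" for a b using tm_sym[OF assms] that .
  fix a b c d assume A: "a \<in> A" "b \<in> A" "c \<in> A" "d \<in> A" and D: "distinct [a, b, c, d]"
    and less: "H a b + H c d < H a c + H b d"
  have D': "distinct [a, c, b, d]" "distinct [a, d, b, c]" using D by auto
  have "H a c + H b d \<le> max (H a b + H c d) (H a d + H c b)" "H a d + H b c \<le> max (H a b + H d c) (H a c + H d b)"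
    using assms A D' unfolding tm_def by blast+
  thus "H a c + H b d = H a d + H b c"
    using less tm_sym[OF assms A(2,3)] tm_sym[OF assms A(3,4)] tm_sym[OF assms A(2,4)] by linarith
qed

lemma tlikeD: "tlike A H K \<Longrightarrow> {a, b, c, d} \<subseteq> A \<Longrightarrow> distinct [a, b, c, d] \<Longrightarrow> H a b + H c d < H a c + H b d \<Longrightarrow>
   K a c + K b d = K a d + K b c"
  unfolding tlike_def by blast

lemma tlike_sym: "tlike A H K \<Longrightarrow> a \<in> A \<Longrightarrow> b \<in> A \<Longrightarrow> K a b = K b a"
  unfolding tlike_def by blast

lemma tlike_mono: "tlike A H K \<Longrightarrow> M \<subseteq> A \<Longrightarrow> tlike M H K"
  unfolding tlike_def by blast

lemma tlike_generic:
  assumes l: "tlike A H K" and A: "{p, x, a, b} \<subseteq> A" "distinct [p, x, a, b]" and q: "qd H p x a b \<noteq> 0"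
    and H: "\<And>a b. a \<in> A \<Longrightarrow> b \<in> A \<Longrightarrow> H a b = H b a"
  shows "if qd H p x a b > 0 then K p a + K x b = K p b + K x a else K p x + K a b = K p b + K a x"
proof (cases "qd H p x a b > 0")
  case True
  hence "H p x + H a b < H p a + H x b" by (simp add: qd_def)
  thus ?thesis using tlikeD[OF l A] True by simp
next
  case False
  hence "H p a + H x b < H p x + H a b" using q by (simp add: qd_def)
  moreover have "{p, a, x, b} \<subseteq> A" "distinct [p, a, x, b]" using A by auto
  ultimately show ?thesis using tlikeD[OF l] False by simp
qed

lemma ext_transfer:
  assumes G: "subgrp G" and Q: "Q \<subseteq> A'" "card Q \<ge> 3" "p \<in> Q" and x: "x \<notin> A'"
    and H: "tm (insert x A') H" and gen: "generic p Q A' H x" and l: "tlike (insert x A') H K"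
    and g: "gen_on G A' K" "gen_on G (insert x Q) K"
  shows "gen_on G (insert x A') K"
proof (rule ext_group[OF G _ Q x g])
  show sym: "K a b = K b a" if "a \<in> insert x A'" "b \<in> insert x A'" for a b using tlike_sym[OF l] that .
  fix a assume a: "a \<in> A' - Q"
  then obtain b where b: "b \<in> Q - {p}" "qd H p x a b \<noteq> 0" using gen unfolding generic_def by blast
  have A: "{p, x, a, b} \<subseteq> insert x A'" "distinct [p, x, a, b]" using a b Q x by auto
  have "if qd H p x a b > 0 then K p a + K x b = K p b + K x a else K p x + K a b = K p b + K a x"
    using l A b(2) tm_sym[OF H] by (rule tlike_generic)
  hence "nrm p K x a = nrm p K b a \<or> nrm p K x a = nrm p K x b"
    using A sym[of a b] sym[of a x] by (auto simp: nrm_def split: if_splits)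
  thus "\<exists>b\<in>Q - {p}. nrm p K x a = nrm p K b a \<or> nrm p K x a = nrm p K x b" using b(1) by blast
qed

text \<open>With a further marking \<open>b'\<close> of \<open>Q\<close> one has
  \<open>qd H p x a b = qd H p x b' b - qd H p a b' b\<close>, where each quartet lies in one of the
  two parts. Hence genericity is a property of the restrictions.\<close>

lemma ext_generic_cong:
  assumes Q: "Q \<subseteq> A'" "card Q \<ge> 3" "p \<in> Q" and x: "x \<notin> A'"
    and q: "quart A' H = quart A' H'" "quart (insert x Q) H = quart (insert x Q) H'"
    and ab: "a \<in> A' - Q" "b \<in> Q - {p}"
  shows "qd H p x a b = qd H' p x a b"
proof -
  obtain y z where "y \<in> Q" "z \<in> Q" "y \<noteq> z" "y \<noteq> p" "z \<noteq> p" by (rule card_ge3_obtain[OF Q(2,3)])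
  then obtain b' where b': "b' \<in> Q" "b' \<noteq> p" "b' \<noteq> b" by metis
  have 1: "qd H p x b' b = qd H' p x b' b" using quartD[OF q(2), of p x b' b] b' ab Q x by auto
  have 2: "qd H p a b' b = qd H' p a b' b" using quartD[OF q(1), of p a b' b] b' ab Q by auto
  show ?thesis using 1 2 unfolding qd_def by linarith
qed

lemma ext_unique:
  assumes Q: "Q \<subseteq> A'" "card Q \<ge> 3" "p \<in> Q" and x: "x \<notin> A'"
    and H: "tm (insert x A') H" and H': "tm (insert x A') H'" and gen: "generic p Q A' H x"
    and q: "quart A' H = quart A' H'" "quart (insert x Q) H = quart (insert x Q) H'"
  shows "quart (insert x A') H = quart (insert x A') H'"
proof -
  define K where "K a b = H a b - H' a b" for a b
  have Kdef: "K = (\<lambda>a b. H a b - H' a b)" by (intro ext) (simp add: K_def)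
  note s = tm_sym[OF H] tm_sym[OF H']
  have iff: "quart M H = quart M H' \<longleftrightarrow> gen_on {0} M K" if M: "M \<subseteq> insert x A'" for M
  proof -
    have "H a b = H b a" "H' a b = H' b a" if "a \<in> M" "b \<in> M" for a b
      using s(1)[of a b] s(2)[of a b] that M by auto
    thus ?thesis unfolding Kdef by (rule quart_eq_iff_gen)
  qed
  have sub: "A' \<subseteq> insert x A'" "insert x Q \<subseteq> insert x A'" using Q by auto
  have "gen_on {0} (insert x A') K"
  proof (rule ext_group[OF _ _ Q x])
    show "subgrp {0}" by (simp add: subgrp_def)
    show sym: "K a b = K b a" if "a \<in> insert x A'" "b \<in> insert x A'" for a b using s that by (simp add: K_def)
    show "gen_on {0} A' K" "gen_on {0} (insert x Q) K" using q iff sub by blast+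
    fix a assume a: "a \<in> A' - Q"
    then obtain b where b: "b \<in> Q - {p}" "qd H p x a b \<noteq> 0" using gen unfolding generic_def by blast
    have A: "{p, x, a, b} \<subseteq> insert x A'" "distinct [p, x, a, b]" using a b Q x by auto
    have e: "qd H p x a b = qd H' p x a b" by (rule ext_generic_cong[OF Q x q a b(1)])
    have "if qd H p x a b > 0 then H p a + H x b = H p b + H x a else H p x + H a b = H p b + H a x"
      using tlike_self[OF H] A b(2) s(1) by (rule tlike_generic)
    moreover have "if qd H' p x a b > 0 then H' p a + H' x b = H' p b + H' x a else H' p x + H' a b = H' p b + H' a x"
      using tlike_self[OF H'] A b(2)[unfolded e] s(2) by (rule tlike_generic)
    ultimately have "if qd H p x a b > 0 then K p a + K x b = K p b + K x a else K p x + K a b = K p b + K a x"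
      unfolding e K_def by (auto split: if_splits)
    hence "nrm p K x a = nrm p K b a \<or> nrm p K x a = nrm p K x b"
      using A sym[of a b] sym[of a x] by (auto simp: nrm_def split: if_splits)
    thus "\<exists>b\<in>Q - {p}. nrm p K x a = nrm p K b a \<or> nrm p K x a = nrm p K x b" using b(1) by blast
  qed
  thus ?thesis using iff by blast
qed

section \<open>Gluing along several markings\<close>

definition amalgam :: "'a set \<Rightarrow> 'a set \<Rightarrow> ('a \<Rightarrow> 'a \<Rightarrow> real) \<Rightarrow> ('a \<Rightarrow> 'a \<Rightarrow> real) \<Rightarrow> ('a \<Rightarrow> 'a \<Rightarrow> real) \<Rightarrow> bool" where
  "amalgam A' M H1 H2 H \<longleftrightarrow> tm (A' \<union> M) H \<and> quart A' H = quart A' H1 \<and> quart M H = quart M H2"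

lemma amalgam_exists:
  assumes "finite X" "X \<inter> A' = {}" and Q: "Q \<subseteq> A'" "card Q \<ge> 3"
    and t1: "tm A' H1" and t2: "tm (Q \<union> X) H2" and q: "quart Q H1 = quart Q H2"
  shows "\<exists>H. amalgam A' (Q \<union> X) H1 H2 H"
  using assms(1,2) t2
proof (induction X rule: finite_induct)
  case empty
  have "A' \<union> (Q \<union> {}) = A'" using Q by blast
  thus ?case using t1 q unfolding amalgam_def by (intro exI[of _ H1]) auto
next
  case (insert x X)
  have t2: "tm (Q \<union> X) H2" using insert.prems(2) by (rule tm_mono) blast
  obtain H0 where H0: "amalgam A' (Q \<union> X) H1 H2 H0" using insert.IH[OF _ t2] insert.prems(1) by blast
  have e: "A' \<union> (Q \<union> X) = A' \<union> X" using Q by blast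
  have tH0: "tm (A' \<union> X) H0" and q0: "quart A' H0 = quart A' H1" "quart (Q \<union> X) H0 = quart (Q \<union> X) H2"
    using H0 unfolding amalgam_def e by blast+
  have t2': "tm (insert x (Q \<union> X)) H2" using insert.prems(2) by simp
  have sub: "Q \<union> X \<subseteq> A' \<union> X" using Q by blast
  have fQX: "finite (Q \<union> X)" using insert.hyps(1) Q(2) by (metis card.infinite finite_UnI not_numeral_le_zero)
  have c: "card (Q \<union> X) \<ge> 3" using card_mono[OF fQX, of Q] Q(2) by simp
  obtain p where p: "p \<in> Q \<union> X" using c by (metis all_not_in_conv card.empty not_numeral_le_zero)
  have x: "x \<notin> A' \<union> X" using insert.hyps(2) insert.prems(1) by blast
  obtain H where H: "tm (insert x (A' \<union> X)) H" "quart (A' \<union> X) H = quart (A' \<union> X) H0"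
     "quart (insert x (Q \<union> X)) H = quart (insert x (Q \<union> X)) H2"
    by (rule ext_exists[OF tH0 t2' sub c p x q0(2)]) blast
  have "quart A' H = quart A' H1" using quart_mono[OF H(2), of A'] q0(1) by simp
  moreover have "A' \<union> (Q \<union> insert x X) = insert x (A' \<union> X)" "Q \<union> insert x X = insert x (Q \<union> X)" using Q by blast+
  ultimately show ?case using H unfolding amalgam_def by metis
qed

text \<open>All amalgams are required to be resolved because genericity is known at first only for
  the amalgam built by \<open>ext_exists\<close>. It depends only on the two restrictions, so it
  passes to every other amalgam with these restrictions, and genericity at each added marking gives
  both uniqueness and the transfer of subgroups.\<close>

lemma amalgam_rigid:
  assumes "finite X" "X \<inter> A' = {}" and Q: "Q \<subseteq> A'" "card Q \<ge> 3"
    and t1: "tm A' H1" and t2: "tm (Q \<union> X) H2" and q: "quart Q H1 = quart Q H2"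
    and res: "\<And>H. amalgam A' (Q \<union> X) H1 H2 H \<Longrightarrow> resolved (A' \<union> X) H"
    and H: "amalgam A' (Q \<union> X) H1 H2 H"
  shows "(\<forall>H'. amalgam A' (Q \<union> X) H1 H2 H' \<longrightarrow> quart (A' \<union> X) H = quart (A' \<union> X) H') \<and>
    (\<forall>G K. subgrp G \<longrightarrow> tlike (A' \<union> X) H K \<longrightarrow> gen_on G A' K \<longrightarrow> gen_on G (Q \<union> X) K \<longrightarrow> gen_on G (A' \<union> X) K)"
  using assms(1,2) t2 res H
proof (induction X rule: finite_induct)
  case empty
  show ?case using empty.prems(4) unfolding amalgam_def by auto
next
  case (insert x X)
  note prems = insert.prems
  have t2: "tm (Q \<union> X) H2" using prems(2) by (rule tm_mono) blast
  have e: "A' \<union> (Q \<union> X) = A' \<union> X" "A' \<union> (Q \<union> insert x X) = insert x (A' \<union> X)" "Q \<union> insert x X = insert x (Q \<union> X)"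
    "A' \<union> insert x X = insert x (A' \<union> X)" "A' \<union> insert x (Q \<union> X) = insert x (A' \<union> X)" using Q by blast+
  have t2': "tm (insert x (Q \<union> X)) H2" using prems(2) by simp
  have sub: "Q \<union> X \<subseteq> A' \<union> X" using Q by blast
  have fQX: "finite (Q \<union> X)" using insert.hyps(1) Q(2) by (metis card.infinite finite_UnI not_numeral_le_zero)
  have c: "card (Q \<union> X) \<ge> 3" using card_mono[OF fQX, of Q] Q(2) by simp
  obtain p where p: "p \<in> Q \<union> X" using c by (metis all_not_in_conv card.empty not_numeral_le_zero)
  have x: "x \<notin> A' \<union> X" using insert.hyps(2) prems(1) by blast
  have restr: "amalgam A' (Q \<union> X) H1 H2 H'" if h: "amalgam A' (Q \<union> insert x X) H1 H2 H'" for H'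
    using h unfolding amalgam_def e
    using tm_mono[of "insert x (A' \<union> X)" H' "A' \<union> X"] quart_mono[of "insert x (Q \<union> X)" H' H2 "Q \<union> X"] by blast
  have am: "amalgam A' (Q \<union> insert x X) H1 H2 H'"
    if h: "amalgam A' (Q \<union> X) H1 H2 H0" "tm (insert x (A' \<union> X)) H'" "quart (A' \<union> X) H' = quart (A' \<union> X) H0"
      "quart (insert x (Q \<union> X)) H' = quart (insert x (Q \<union> X)) H2" for H0 H'
  proof -
    have "quart A' H' = quart A' H0" using h(3) by (rule quart_mono) blast
    thus ?thesis using h(1,2,4) unfolding amalgam_def e by simp
  qed
  \<comment> \<open>The metric constructed by \<open>ext_exists\<close> from the restriction of
    \<open>H0\<close> is again an amalgam, hence resolved, hence generic;
    \<open>ext_generic_cong\<close> returns this to \<open>H0\<close>.\<close>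
  have gen: "generic p (Q \<union> X) (A' \<union> X) H0 x \<and> resolved (insert x (A' \<union> X)) H0" if H0: "amalgam A' (Q \<union> insert x X) H1 H2 H0" for H0
  proof -
    have r0: "resolved (insert x (A' \<union> X)) H0" using prems(3)[OF H0] unfolding e .
    have h0: "tm (A' \<union> X) H0" "quart (Q \<union> X) H0 = quart (Q \<union> X) H2" using restr[OF H0] unfolding amalgam_def e by blast+
    obtain H' where H': "tm (insert x (A' \<union> X)) H'" "quart (A' \<union> X) H' = quart (A' \<union> X) H0"
     "quart (insert x (Q \<union> X)) H' = quart (insert x (Q \<union> X)) H2"
      and g: "resolved (insert x (A' \<union> X)) H' \<Longrightarrow> generic p (Q \<union> X) (A' \<union> X) H' x"
      by (rule ext_exists[OF h0(1) t2' sub c p x h0(2)]) blast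
    have "amalgam A' (Q \<union> insert x X) H1 H2 H'" by (rule am[OF restr[OF H0] H'])
    hence "resolved (insert x (A' \<union> X)) H'" using prems(3) unfolding e by blast
    hence g': "generic p (Q \<union> X) (A' \<union> X) H' x" by (rule g)
    have qq: "quart (insert x (Q \<union> X)) H' = quart (insert x (Q \<union> X)) H0"
      using H'(3) H0 unfolding amalgam_def e by simp
    have "generic p (Q \<union> X) (A' \<union> X) H0 x"
      using g' ext_generic_cong[OF sub c p x H'(2) qq] unfolding generic_def by metis
    thus ?thesis using r0 by blast
  qed
  \<comment> \<open>An amalgam on fewer markings extends to one on all of them, and resolved metrics
    restrict to resolved ones.\<close>
  have res': "resolved (A' \<union> X) H0" if H0: "amalgam A' (Q \<union> X) H1 H2 H0" for H0
  proof -
    have h0: "tm (A' \<union> X) H0" "quart (Q \<union> X) H0 = quart (Q \<union> X) H2" using H0 unfolding amalgam_def e by blast+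
    obtain H' where H': "tm (insert x (A' \<union> X)) H'" "quart (A' \<union> X) H' = quart (A' \<union> X) H0"
     "quart (insert x (Q \<union> X)) H' = quart (insert x (Q \<union> X)) H2"
      by (rule ext_exists[OF h0(1) t2' sub c p x h0(2)]) blast
    have "resolved (insert x (A' \<union> X)) H'" using gen[OF am[OF H0 H']] by blast
    hence r: "resolved (A' \<union> X) H'" by (rule resolved_mono) blast
    show ?thesis
    proof (rule resolved_quart[OF H'(2) _ _ r])
      show "H' a b = H' b a" if "a \<in> A' \<union> X" "b \<in> A' \<union> X" for a b using tm_sym[OF H'(1)] that by blast
      show "H0 a b = H0 b a" if "a \<in> A' \<union> X" "b \<in> A' \<union> X" for a b using tm_sym[OF h0(1)] that by blast
    qed
  qed
  have IH: "(\<forall>H'. amalgam A' (Q \<union> X) H1 H2 H' \<longrightarrow> quart (A' \<union> X) H = quart (A' \<union> X) H') \<and>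
    (\<forall>G K. subgrp G \<longrightarrow> tlike (A' \<union> X) H K \<longrightarrow> gen_on G A' K \<longrightarrow> gen_on G (Q \<union> X) K \<longrightarrow> gen_on G (A' \<union> X) K)"
  proof (rule insert.IH[OF _ t2 res' restr[OF prems(4)]])
    show "X \<inter> A' = {}" using prems(1) by blast
  qed
  have tH: "tm (insert x (A' \<union> X)) H" "quart (insert x (Q \<union> X)) H = quart (insert x (Q \<union> X)) H2"
    using prems(4) unfolding amalgam_def e by blast+
  have gH: "generic p (Q \<union> X) (A' \<union> X) H x" using gen[OF prems(4)] by blast
  show ?case
  proof (intro conjI allI impI)
    fix H' assume H': "amalgam A' (Q \<union> insert x X) H1 H2 H'"
    have t': "tm (insert x (A' \<union> X)) H'" "quart (insert x (Q \<union> X)) H' = quart (insert x (Q \<union> X)) H2"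
      using H' unfolding amalgam_def e by blast+
    have "quart (A' \<union> X) H = quart (A' \<union> X) H'" using IH restr[OF H'] by blast
    thus "quart (A' \<union> insert x X) H = quart (A' \<union> insert x X) H'"
      unfolding e using ext_unique[OF sub c p x tH(1) t'(1) gH] tH(2) t'(2) by simp
  next
    fix G K assume G: "subgrp G" and l: "tlike (A' \<union> insert x X) H K" and g: "gen_on G A' K" "gen_on G (Q \<union> insert x X) K"
    have l': "tlike (insert x (A' \<union> X)) H K" using l unfolding e .
    have "gen_on G (Q \<union> X) K" using g(2) unfolding gen_on_def by blast
    hence "gen_on G (A' \<union> X) K" using IH G tlike_mono[OF l', of "A' \<union> X"] g(1) by blast
    thus "gen_on G (A' \<union> insert x X) K"
      unfolding e using ext_transfer[OF G sub c p x tH(1) gH l'] g(2) unfolding e by blast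
  qed
qed

section \<open>Fibres of an amalgam\<close>

definition gp :: "'a set \<Rightarrow> 'a row set \<Rightarrow> bool" where
  "gp A R \<longleftrightarrow> (\<forall>H. tm A H \<longrightarrow> (\<forall>C\<in>R. fulr H C) \<longrightarrow> resolved A H)"

definition rst :: "'a set \<Rightarrow> ('a \<times> 'a \<times> 'a \<times> 'a \<Rightarrow> real) \<Rightarrow> 'a \<times> 'a \<times> 'a \<times> 'a \<Rightarrow> real" where
  "rst M g = (\<lambda>(a, b, c, d). if {a, b, c, d} \<subseteq> M then g (a, b, c, d) else 0)"

lemma rst_quart: "M \<subseteq> A \<Longrightarrow> rst M (quart A H) = quart M H"
  by (rule ext) (auto simp: rst_def quart_def)

definition sol :: "'a set \<Rightarrow> 'a row set \<Rightarrow> ('a \<Rightarrow> 'a \<Rightarrow> real) \<Rightarrow> bool" where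
  "sol A R H \<longleftrightarrow> tm A H \<and> (\<forall>C\<in>R. fulr H C)"

lemma fib_sol: "fib A R = {quart A H | H. sol A R H}"
  unfolding fib_def sol_def by blast

lemma gp_sol: "gp A R \<longleftrightarrow> (\<forall>H. sol A R H \<longrightarrow> resolved A H)"
  unfolding gp_def sol_def by blast

lemma fulr_cong_tm:
  assumes "tm A H" "tm B K" "M \<subseteq> A" "M \<subseteq> B" "quart M H = quart M K" "vrow M C" "fulr K C"
  shows "fulr H C"
proof -
  have "H a b = H b a" "K a b = K b a" if "a \<in> M" "b \<in> M" for a b
    using tm_sym[OF assms(1)] tm_sym[OF assms(2)] that assms(3,4) by blast+
  thus ?thesis using fulr_quart[where H=H and K=K, OF _ _ assms(5,6)] assms(7) by blast
qed

lemma resolved_cong_tm: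
  assumes "tm A H" "tm B K" "M \<subseteq> A" "M \<subseteq> B" "quart M H = quart M K" "resolved M H"
  shows "resolved M K"
proof -
  have "H a b = H b a" "K a b = K b a" if "a \<in> M" "b \<in> M" for a b
    using tm_sym[OF assms(1)] tm_sym[OF assms(2)] that assms(3,4) by blast+
  thus ?thesis using resolved_quart[where H=H and K=K, OF assms(5) _ _ assms(6)] by blast
qed

text \<open>The assumption \<open>agree\<close> is satisfied in two ways: an overlap of three
  markings has no quartets, and an overlap of four markings carries a cross-ratio belonging to both
  parts.\<close>

locale amalgamation =
  fixes A' M :: "'a set" and R' RM :: "'a row set"
  assumes finM: "finite M" and Q: "card (A' \<inter> M) \<ge> 3"
    and v': "\<And>C. C \<in> R' \<Longrightarrow> vrow A' C" and vM: "\<And>C. C \<in> RM \<Longrightarrow> vrow M C"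
    and agree: "\<And>H1 H2. sol A' R' H1 \<Longrightarrow> sol M RM H2 \<Longrightarrow> quart (A' \<inter> M) H1 = quart (A' \<inter> M) H2"
    and ne': "fib A' R' \<noteq> {}" and neM: "fib M RM \<noteq> {}"
begin

lemma sets: "(A' \<inter> M) \<union> (M - A') = M" "A' \<union> (M - A') = A' \<union> M" "A' \<inter> M \<subseteq> A'" "(M - A') \<inter> A' = {}" "finite (M - A')"
  using finM by auto

lemma sol_amalgam:
  assumes s: "sol A' R' H1" "sol M RM H2" and H: "amalgam A' M H1 H2 H"
  shows "sol (A' \<union> M) (R' \<union> RM) H"
proof -
  have t: "tm (A' \<union> M) H" "quart A' H = quart A' H1" "quart M H = quart M H2" using H unfolding amalgam_def by auto
  have s': "tm A' H1" "tm M H2" using s unfolding sol_def by auto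
  have "fulr H C" if "C \<in> R'" for C
    using fulr_cong_tm[OF t(1) s'(1) _ _ t(2) v'[OF that]] s(1) that unfolding sol_def by blast
  moreover have "fulr H C" if "C \<in> RM" for C
    using fulr_cong_tm[OF t(1) s'(2) _ _ t(3) vM[OF that]] s(2) that unfolding sol_def by blast
  ultimately show ?thesis using t unfolding sol_def by blast
qed

lemma sol_restrict:
  assumes "sol (A' \<union> M) (R' \<union> RM) H" shows "sol A' R' H" "sol M RM H" "amalgam A' M H H H"
  using assms tm_mono[of "A' \<union> M" H] unfolding sol_def amalgam_def by auto

lemma ex_sol: "\<exists>H1. sol A' R' H1" "\<exists>H2. sol M RM H2"
  using ne' neM unfolding fib_sol by auto

lemma ex_amalgam:
  assumes "sol A' R' H1" "sol M RM H2" shows "\<exists>H. amalgam A' M H1 H2 H"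
proof -
  have "tm A' H1" "tm M H2" using assms unfolding sol_def by auto
  thus ?thesis
    using amalgam_exists[OF sets(5,4,3) Q, of H1 H2] agree[OF assms] unfolding sets by blast
qed

lemma fib_nonempty: "fib (A' \<union> M) (R' \<union> RM) \<noteq> {}"
proof -
  obtain H1 H2 where s: "sol A' R' H1" "sol M RM H2" using ex_sol by blast
  then obtain H where "amalgam A' M H1 H2 H" using ex_amalgam by blast
  thus ?thesis using sol_amalgam[OF s] unfolding fib_sol by blast
qed

context assumes gp: "gp (A' \<union> M) (R' \<union> RM)"
begin

text \<open>A solution of one part extends to a solution of the whole, which is resolved. The
  extension needs a solution of the other part, hence the assumption that both fibres are
  nonempty.\<close>

lemma gp_left: "gp A' R'"
  unfolding gp_sol
proof (intro allI impI)
  fix H1 assume s1: "sol A' R' H1"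
  obtain H2 where s2: "sol M RM H2" using ex_sol by blast
  obtain H where H: "amalgam A' M H1 H2 H" using ex_amalgam[OF s1 s2] by blast
  hence "resolved (A' \<union> M) H" using sol_amalgam[OF s1 s2] gp unfolding gp_sol by blast
  hence "resolved A' H" by (rule resolved_mono) blast
  thus "resolved A' H1"
    using resolved_cong_tm[of "A' \<union> M" H A' H1 A'] H s1 unfolding amalgam_def sol_def by blast
qed

lemma gp_right: "gp M RM"
  unfolding gp_sol
proof (intro allI impI)
  fix H2 assume s2: "sol M RM H2"
  obtain H1 where s1: "sol A' R' H1" using ex_sol by blast
  obtain H where H: "amalgam A' M H1 H2 H" using ex_amalgam[OF s1 s2] by blast
  hence "resolved (A' \<union> M) H" using sol_amalgam[OF s1 s2] gp unfolding gp_sol by blast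
  hence "resolved M H" by (rule resolved_mono) blast
  thus "resolved M H2"
    using resolved_cong_tm[of "A' \<union> M" H M H2 M] H s2 unfolding amalgam_def sol_def by blast
qed

lemma rigid:
  assumes s: "sol (A' \<union> M) (R' \<union> RM) H"
  shows "\<And>H'. amalgam A' M H H H' \<Longrightarrow> quart (A' \<union> M) H = quart (A' \<union> M) H'"
    "\<And>G K. subgrp G \<Longrightarrow> tlike (A' \<union> M) H K \<Longrightarrow> gen_on G A' K \<Longrightarrow> gen_on G M K \<Longrightarrow> gen_on G (A' \<union> M) K"
proof -
  note r = sol_restrict[OF s]
  have t: "tm A' H" "tm M H" using r unfolding sol_def by auto
  have res: "resolved (A' \<union> M) H'" if "amalgam A' M H H H'" for H'
    using sol_amalgam[OF r(1,2) that] gp unfolding gp_sol by blast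
  have "(\<forall>H'. amalgam A' M H H H' \<longrightarrow> quart (A' \<union> M) H = quart (A' \<union> M) H') \<and>
    (\<forall>G K. subgrp G \<longrightarrow> tlike (A' \<union> M) H K \<longrightarrow> gen_on G A' K \<longrightarrow> gen_on G M K \<longrightarrow> gen_on G (A' \<union> M) K)"
    using amalgam_rigid[OF sets(5,4,3) Q, of H H H, unfolded sets, OF t HOL.refl res r(3)] .
  thus "\<And>H'. amalgam A' M H H H' \<Longrightarrow> quart (A' \<union> M) H = quart (A' \<union> M) H'"
    "\<And>G K. subgrp G \<Longrightarrow> tlike (A' \<union> M) H K \<Longrightarrow> gen_on G A' K \<Longrightarrow> gen_on G M K \<Longrightarrow> gen_on G (A' \<union> M) K"
    by blast+
qed

text \<open>Restriction to the two parts is injective by rigidity and surjective by gluing.\<close>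

lemma card_fib: "card (fib (A' \<union> M) (R' \<union> RM)) = card (fib A' R') * card (fib M RM)"
proof -
  define f where "f g = (rst A' g, rst M g)" for g :: "'a \<times> 'a \<times> 'a \<times> 'a \<Rightarrow> real"
  have f: "f (quart (A' \<union> M) H) = (quart A' H, quart M H)" for H
    unfolding f_def by (simp add: rst_quart)
  have "bij_betw f (fib (A' \<union> M) (R' \<union> RM)) (fib A' R' \<times> fib M RM)"
  proof (rule bij_betw_imageI)
    show "inj_on f (fib (A' \<union> M) (R' \<union> RM))"
    proof (rule inj_onI)
      fix g g' assume "g \<in> fib (A' \<union> M) (R' \<union> RM)" "g' \<in> fib (A' \<union> M) (R' \<union> RM)" and e: "f g = f g'"
      then obtain H H' where H: "sol (A' \<union> M) (R' \<union> RM) H" "g = quart (A' \<union> M) H"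
        and H': "sol (A' \<union> M) (R' \<union> RM) H'" "g' = quart (A' \<union> M) H'" unfolding fib_sol by blast
      have "quart A' H = quart A' H'" "quart M H = quart M H'" using e f H H' by auto
      hence "amalgam A' M H H H'" using H'(1) unfolding amalgam_def sol_def by simp
      thus "g = g'" using rigid(1)[OF H(1)] H H' by blast
    qed
    show "f ` fib (A' \<union> M) (R' \<union> RM) = fib A' R' \<times> fib M RM"
    proof (intro Set.set_eqI iffI)
      fix z assume "z \<in> f ` fib (A' \<union> M) (R' \<union> RM)"
      then obtain H where "sol (A' \<union> M) (R' \<union> RM) H" "z = (quart A' H, quart M H)" unfolding fib_sol using f by auto
      thus "z \<in> fib A' R' \<times> fib M RM" using sol_restrict(1,2)[of H] unfolding fib_sol by blast
    next
      fix z assume "z \<in> fib A' R' \<times> fib M RM"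
      then obtain H1 H2 where z: "z = (quart A' H1, quart M H2)" and s: "sol A' R' H1" "sol M RM H2" unfolding fib_sol by blast
      obtain H where H: "amalgam A' M H1 H2 H" using ex_amalgam[OF s] by blast
      have "z = f (quart (A' \<union> M) H)" using H z f unfolding amalgam_def by simp
      thus "z \<in> f ` fib (A' \<union> M) (R' \<union> RM)" using sol_amalgam[OF s H] unfolding fib_sol by blast
    qed
  qed
  thus ?thesis using bij_betw_same_card card_cartesian_product by metis
qed

end

end

section \<open>Six markings\<close>

text \<open>Half distances on \<open>{p, q, x, y, r, s}\<close> normalised to vanish on pairs containing \<open>p\<close> are given by
  the ten values on the pairs \<open>qx, qy, qr, qs, xy, xr, xs, yr, ys, rs\<close>, in this order.\<close>

lemma nrm_sym:
  assumes "\<And>a b. a \<in> A \<Longrightarrow> b \<in> A \<Longrightarrow> H a b = H b a" "a \<in> A" "b \<in> A"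
  shows "nrm p H a b = nrm p H b a"
  using assms(1)[OF assms(2,3)] by (simp add: nrm_def)

type_synonym t10 = "real \<times> real \<times> real \<times> real \<times> real \<times> real \<times> real \<times> real \<times> real \<times> real"

definition tup :: "'a \<Rightarrow> 'a \<Rightarrow> 'a \<Rightarrow> 'a \<Rightarrow> 'a \<Rightarrow> 'a \<Rightarrow> ('a \<Rightarrow> 'a \<Rightarrow> real) \<Rightarrow> t10" where
  "tup p q x y r s H = (let n = nrm p H in (n q x, n q y, n q r, n q s, n x y, n x r, n x s, n y r, n y s, n r s))"

fun h6 :: "'a \<Rightarrow> 'a \<Rightarrow> 'a \<Rightarrow> 'a \<Rightarrow> 'a \<Rightarrow> t10 \<Rightarrow> 'a \<Rightarrow> 'a \<Rightarrow> real" where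
  "h6 q x y r s (qx, qy, qr, qs, xy, xr, xs, yr, ys, rs) a b =
    (if {a, b} = {q, x} then qx else if {a, b} = {q, y} then qy else if {a, b} = {q, r} then qr
     else if {a, b} = {q, s} then qs else if {a, b} = {x, y} then xy else if {a, b} = {x, r} then xr
     else if {a, b} = {x, s} then xs else if {a, b} = {y, r} then yr else if {a, b} = {y, s} then ys
     else if {a, b} = {r, s} then rs else 0)"

declare h6.simps [simp del]

text \<open>The ultrametric inequality of a triple: the maximum is attained twice.\<close>

definition tri3 :: "real \<Rightarrow> real \<Rightarrow> real \<Rightarrow> bool" where
  "tri3 a b c \<longleftrightarrow> (a = b \<and> c \<le> a) \<or> (a = c \<and> b \<le> a) \<or> (b = c \<and> a \<le> b)"

fun U10 :: "t10 \<Rightarrow> bool" where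
  "U10 (qx, qy, qr, qs, xy, xr, xs, yr, ys, rs) \<longleftrightarrow>
    tri3 qx qy xy \<and> tri3 qx qr xr \<and> tri3 qx qs xs \<and> tri3 qy qr yr \<and> tri3 qy qs ys \<and> tri3 qr qs rs \<and>
    tri3 xy xr yr \<and> tri3 xy xs ys \<and> tri3 xr xs rs \<and> tri3 yr ys rs"

text \<open>The three triples that form a star with \<open>p\<close> when a strict inequality
  between the lengths degenerates to an equality, one for each explicit family of solutions with
  such a condition.\<close>

fun bad10 :: "t10 \<Rightarrow> bool" where
  "bad10 (qx, qy, qr, qs, xy, xr, xs, yr, ys, rs) \<longleftrightarrow> qx = qr \<and> qr = xr \<or> qy = qs \<and> qs = ys \<or> xy = xs \<and> xs = ys"

text \<open>The condition \<open>tlike\<close> for \<open>p\<close> and three further markings: if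
  one unprimed value is smaller than another, the two primed values other than its own
  coincide.\<close>

definition tl3 :: "real \<Rightarrow> real \<Rightarrow> real \<Rightarrow> real \<Rightarrow> real \<Rightarrow> real \<Rightarrow> bool" where
  "tl3 a b c a' b' c' \<longleftrightarrow> (c < a \<longrightarrow> a' = b') \<and> (c < b \<longrightarrow> a' = b') \<and> (b < a \<longrightarrow> a' = c') \<and> (b < c \<longrightarrow> a' = c') \<and>
     (a < b \<longrightarrow> b' = c') \<and> (a < c \<longrightarrow> b' = c')"

fun TL10 :: "t10 \<Rightarrow> t10 \<Rightarrow> bool" where
  "TL10 (qx, qy, qr, qs, xy, xr, xs, yr, ys, rs) (qx', qy', qr', qs', xy', xr', xs', yr', ys', rs') \<longleftrightarrow>
    tl3 qx qy xy qx' qy' xy' \<and> tl3 qx qr xr qx' qr' xr' \<and> tl3 qx qs xs qx' qs' xs' \<and> tl3 qy qr yr qy' qr' yr' \<and>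
    tl3 qy qs ys qy' qs' ys' \<and> tl3 qr qs rs qr' qs' rs' \<and> tl3 xy xr yr xy' xr' yr' \<and> tl3 xy xs ys xy' xs' ys' \<and>
    tl3 xr xs rs xr' xs' rs' \<and> tl3 yr ys rs yr' ys' rs'"

text \<open>A common shift of all ten values does not change the quartets, so normalised solutions
  are only determined up to it.\<close>

fun add10 :: "real \<Rightarrow> t10 \<Rightarrow> t10" where
  "add10 k (qx, qy, qr, qs, xy, xr, xs, yr, ys, rs) =
    (qx + k, qy + k, qr + k, qs + k, xy + k, xr + k, xs + k, yr + k, ys + k, rs + k)"

fun int10 :: "t10 \<Rightarrow> bool" where
  "int10 (qx, qy, qr, qs, xy, xr, xs, yr, ys, rs) \<longleftrightarrow> qx \<in> \<int> \<and> qy \<in> \<int> \<and> qr \<in> \<int> \<and> qs \<in> \<int> \<and> xy \<in> \<int> \<and>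
    xr \<in> \<int> \<and> xs \<in> \<int> \<and> yr \<in> \<int> \<and> ys \<in> \<int> \<and> rs \<in> \<int>"

text \<open>Lets the same splitting be imposed with another value, as needed for other points of the
  cone, also with lengths of any sign.\<close>

fun setl :: "real \<Rightarrow> 'a row \<Rightarrow> 'a row" where "setl v (l, a, b, c, d) = (v, a, b, c, d)"

lemma fst_setl [simp]: "fst (setl v C) = v" "setl (fst C) C = C" by (cases C; simp)+

text \<open>What an inner triangle without the factor 2 has to provide: two solutions, and at each
  of them integrality of all quartets from integrality of the three conditions.\<close>

definition hexQ :: "'a set \<Rightarrow> 'a row set \<Rightarrow> bool" where
  "hexQ M R \<longleftrightarrow> fib M R \<noteq> {} \<and> (gp M R \<longrightarrow> card (fib M R) = 2 \<and>
    (\<forall>H K. sol M R H \<longrightarrow> tlike M H K \<longrightarrow> (\<forall>C\<in>R. \<exists>v\<in>\<int>. fulr K (setl v C)) \<longrightarrow> gen_on \<int> M K))"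

text \<open>The pairs \<open>p\<close>, \<open>q\<close> and \<open>x\<close>, \<open>y\<close> and
  \<open>r\<close>, \<open>s\<close> are the polygon edges meeting at the three corners of an inner
  triangle; each side uses two of the pairs.\<close>

locale six =
  fixes p q x y r s :: 'a
  assumes dist: "distinct [p, q, x, y, r, s]"
begin

abbreviation "M \<equiv> {p, q, x, y, r, s}"
abbreviation "B \<equiv> {q, x, y, r, s}"
abbreviation "tp \<equiv> tup p q x y r s"
abbreviation "h \<equiv> h6 q x y r s"

lemma ne: "p \<noteq> q" "p \<noteq> x" "p \<noteq> y" "p \<noteq> r" "p \<noteq> s" "q \<noteq> x" "q \<noteq> y" "q \<noteq> r" "q \<noteq> s" "x \<noteq> y" "x \<noteq> r" "x \<noteq> s"
  "y \<noteq> r" "y \<noteq> s" "r \<noteq> s"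
  "q \<noteq> p" "x \<noteq> p" "y \<noteq> p" "r \<noteq> p" "s \<noteq> p" "x \<noteq> q" "y \<noteq> q" "r \<noteq> q" "s \<noteq> q" "y \<noteq> x" "r \<noteq> x" "s \<noteq> x" "r \<noteq> y" "s \<noteq> y" "s \<noteq> r"
  using dist by auto

lemma h_simps:
  assumes "t = (qx, qy, qr, qs, xy, xr, xs, yr, ys, rs)"
  shows "h t q x = qx" "h t q y = qy" "h t q r = qr" "h t q s = qs" "h t x y = xy" "h t x r = xr" "h t x s = xs"
    "h t y r = yr" "h t y s = ys" "h t r s = rs"
    "h t x q = qx" "h t y q = qy" "h t r q = qr" "h t s q = qs" "h t y x = xy" "h t r x = xr" "h t s x = xs"
    "h t r y = yr" "h t s y = ys" "h t s r = rs"
  using ne unfolding assms by (auto simp: doubleton_eq_iff h6.simps)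

lemma h_p: "h t p a = 0" "h t a p = 0"
  using ne by (cases t; auto simp: doubleton_eq_iff h6.simps)+

lemma h_sym: "h t a b = h t b a"
proof -
  obtain qx qy qr qs xy xr xs yr ys rs where t: "t = (qx, qy, qr, qs, xy, xr, xs, yr, ys, rs)" by (cases t) auto
  show ?thesis unfolding t h6.simps insert_commute[of a b "{}"] ..
qed

lemma tri3_iff: "tri3 a b c \<longleftrightarrow> a \<le> max b c \<and> b \<le> max a c \<and> c \<le> max a b"
  unfolding tri3_def by (auto simp: max_def)

lemma tm_h: assumes "U10 t" shows "tm M (h t)"
proof -
  obtain qx qy qr qs xy xr xs yr ys rs where t: "t = (qx, qy, qr, qs, xy, xr, xs, yr, ys, rs)" by (cases t) auto
  have "ultra B (h t)" unfolding ultra_def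
  proof (intro conjI ballI impI h_sym)
    fix a b c assume "a \<in> B" "b \<in> B" "c \<in> B" "distinct [a, b, c]"
    thus "h t a b \<le> max (h t a c) (h t c b)"
      using assms unfolding t U10.simps tri3_iff
      by (elim insertE emptyE; simp only: h_simps[OF HOL.refl]; simp add: max.commute)
  qed
  moreover have "p \<notin> B" using ne by simp
  ultimately show ?thesis by (rule tm_if_ultra) (simp_all add: h_p)
qed

lemma U10_tup: assumes "tm M H" shows "U10 (tp H)"
proof -
  have M: "M - {p} = B" using ne by auto
  have u: "ultra B (nrm p H)" using tm_nrm[OF assms, of p] unfolding M by simp
  have T: "tri3 (nrm p H a b) (nrm p H a c) (nrm p H b c)" if "a \<in> B" "b \<in> B" "c \<in> B" "distinct [a, b, c]" for a b c
    using ultraD[OF u, of a b c] ultraD[OF u, of a c b] ultraD[OF u, of b c a] that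
      ultra_sym[OF u, of c b] ultra_sym[OF u, of b a] unfolding tri3_iff by (auto simp: max.commute)
  show ?thesis unfolding tup_def Let_def U10.simps
    using ne by (intro conjI T) auto
qed

lemma quart_h_tup:
  assumes "\<And>a b. a \<in> M \<Longrightarrow> b \<in> M \<Longrightarrow> H a b = H b a"
  shows "quart M (h (tp H)) = quart M H"
proof -
  have e: "tp H = (nrm p H q x, nrm p H q y, nrm p H q r, nrm p H q s, nrm p H x y, nrm p H x r, nrm p H x s, nrm p H y r, nrm p H y s, nrm p H r s)"
    by (simp add: tup_def Let_def)
  have n: "nrm p H a b = nrm p H b a" if "a \<in> M" "b \<in> M" for a b using assms that by (rule nrm_sym)
  have q: "quart M (nrm p H) = quart M H" by (rule quart_nrm) (use assms in auto)
  have "qd (h (tp H)) a b c d = qd (nrm p H) a b c d" if "distinct [a, b, c, d]" "{a, b, c, d} \<subseteq> M" for a b c d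
  proof -
    have "h (tp H) a b = nrm p H a b" if "a \<in> M" "b \<in> M" "a \<noteq> b" for a b
    proof -
      have "a \<in> B \<Longrightarrow> b \<in> B \<Longrightarrow> h (tp H) a b = nrm p H a b"
        using that(3) n by (elim insertE emptyE; simp only: h_simps[OF e]; simp)
      moreover have "a = p \<or> b = p \<Longrightarrow> h (tp H) a b = nrm p H a b"
        by (elim disjE; simp only: h_p nrm_def HOL.simp_thms if_True)
      ultimately show ?thesis using that by blast
    qed
    thus ?thesis using that unfolding qd_def by simp
  qed
  hence "quart M (h (tp H)) = quart M (nrm p H)" by (rule quartI)
  thus ?thesis using q by simp
qed

lemma quart_add10: "quart M (h (add10 k t)) = quart M (h t)"
proof -
  obtain qx qy qr qs xy xr xs yr ys rs where t: "t = (qx, qy, qr, qs, xy, xr, xs, yr, ys, rs)" by (cases t) auto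
  have a: "add10 k t = (qx + k, qy + k, qr + k, qs + k, xy + k, xr + k, xs + k, yr + k, ys + k, rs + k)" using t by simp
  have e: "h (add10 k t) a b = h t a b + k" if "a \<in> B" "b \<in> B" "a \<noteq> b" for a b
    using that by (elim insertE emptyE; simp only: h_simps[OF a] h_simps[OF t]; simp)
  show ?thesis
  proof (rule quart_eqI_root[where \<rho> = p])
    fix a b c assume "{a, b, c} \<subseteq> M - {p}" "distinct [a, b, c]"
    hence "a \<in> B" "b \<in> B" "c \<in> B" "a \<noteq> b" "a \<noteq> c" by auto
    thus "qd (h (add10 k t)) a b c p = qd (h t) a b c p" unfolding qd_def h_p using e[of a b] e[of a c] by linarith
  qed (use h_sym in auto)
qed

lemma eq_add10_if_quart:
  assumes "quart M (h t) = quart M (h t')" shows "\<exists>k. t = add10 k t'"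
proof -
  obtain qx qy qr qs xy xr xs yr ys rs where t: "t = (qx, qy, qr, qs, xy, xr, xs, yr, ys, rs)" by (cases t) auto
  obtain qx' qy' qr' qs' xy' xr' xs' yr' ys' rs' where t': "t' = (qx', qy', qr', qs', xy', xr', xs', yr', ys', rs')" by (cases t') auto
  have "quart M (h t) = quart M (h t') \<longleftrightarrow> gen_on {0} M (\<lambda>a b. h t a b - h t' a b)"
    by (rule quart_eq_iff_gen) (rule h_sym)+
  hence g: "gen_on {0} M (\<lambda>a b. h t a b - h t' a b)" using assms by blast
  have nz: "nrm p (\<lambda>a b. h t a b - h t' a b) a b - nrm p (\<lambda>a b. h t a b - h t' a b) q x \<in> {0}" if "a \<in> B" "b \<in> B" "a \<noteq> b" for a b
  proof (rule gen_on_pairs[OF _ _ g])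
    show "h t a b - h t' a b = h t b a - h t' b a" for a b using h_sym[of t a b] h_sym[of t' a b] by simp
  qed (use that ne in \<open>auto simp: subgrp_def\<close>)
  hence e: "h t a b = h t' a b + (qx - qx')" if "a \<in> B" "b \<in> B" "a \<noteq> b" for a b
  proof -
    have "nrm p (\<lambda>a b. h t a b - h t' a b) a b - nrm p (\<lambda>a b. h t a b - h t' a b) q x = 0" using nz[OF that] by simp
    moreover have "a \<noteq> p" "b \<noteq> p" using that ne by auto
    ultimately show ?thesis using ne(16,17) by (simp only: nrm_def h_p h_simps(1)[OF t] h_simps(1)[OF t'] if_False HOL.simp_thms)
  qed
  have "t = add10 (qx - qx') t'"
    using e[of q y] e[of q r] e[of q s] e[of x y] e[of x r] e[of x s] e[of y r] e[of y s] e[of r s] ne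
    unfolding h_simps[OF t] h_simps[OF t'] unfolding t t' by simp
  thus ?thesis by blast
qed

lemma bad10_unresolved: assumes "bad10 t" shows "\<not> resolved M (h t)"
proof
  assume res: "resolved M (h t)"
  obtain qx qy qr qs xy xr xs yr ys rs where t: "t = (qx, qy, qr, qs, xy, xr, xs, yr, ys, rs)" by (cases t) auto
  have R: "\<not> (h t a b = h t a c \<and> h t a c = h t b c)" if "a \<in> B" "b \<in> B" "c \<in> B" "distinct [a, b, c]" for a b c
  proof -
    have "distinct [p, a, b, c]" "p \<in> M" "a \<in> M" "b \<in> M" "c \<in> M" using that ne by auto
    hence "\<not> (h t p a + h t b c = h t p b + h t a c \<and> h t p b + h t a c = h t p c + h t a b)"
      using res unfolding resolved_def by blast
    thus ?thesis unfolding h_p by argo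
  qed
  show False using assms R[of q x r] R[of q y s] R[of x y s] ne unfolding h_simps[OF t] unfolding t by auto
qed

lemma TL10_tup: assumes "tm M H" "tlike M H K" shows "TL10 (tp H) (tp K)"
proof -
  have T: "tl3 (nrm p H a b) (nrm p H a c) (nrm p H b c) (nrm p K a b) (nrm p K a c) (nrm p K b c)"
    if "a \<in> B" "b \<in> B" "c \<in> B" "distinct [a, b, c]" for a b c
  proof -
    have m: "p \<in> M" "a \<in> M" "b \<in> M" "c \<in> M" "a \<noteq> p" "b \<noteq> p" "c \<noteq> p" using that ne by auto
    have sub: "{p, a, b, c} \<subseteq> M" using m(1-4) by (intro insert_subsetI empty_subsetI)
    have D: "distinct [p, u, v, w]" "{p, u, v, w} \<subseteq> M" if "{u, v, w} \<subseteq> {a, b, c}" "distinct [u, v, w]" for u v w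
    proof -
      show "distinct [p, u, v, w]" using that m(5-7) by auto
      have "{p, u, v, w} \<subseteq> {p, a, b, c}" using that(1) by blast
      thus "{p, u, v, w} \<subseteq> M" using sub by (rule subset_trans)
    qed
    have S: "H u v = H v u" "K u v = K v u" if "{u, v} \<subseteq> {p, a, b, c}" for u v
    proof -
      have "u \<in> {p, a, b, c}" "v \<in> {p, a, b, c}" using that by auto
      hence uv: "u \<in> M" "v \<in> M" using subsetD[OF sub] by simp_all
      show "H u v = H v u" "K u v = K v u" using tm_sym[OF assms(1) uv] tlike_sym[OF assms(2) uv] .
    qed
    have L: "H p u + H v w < H p v + H u w \<longrightarrow> K p v + K u w = K p w + K u v"
      if "{u, v, w} \<subseteq> {a, b, c}" "distinct [u, v, w]" for u v w
      using tlikeD[OF assms(2) D(2,1)[OF that]] by blast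
    have d: "a \<noteq> b" "a \<noteq> c" "b \<noteq> c" using that(4) by auto
    show ?thesis unfolding tl3_def nrm_def
      using L[of a b c] L[of a c b] L[of b a c] L[of b c a] L[of c a b] L[of c b a]
        S[of b a] S[of c a] S[of c b] m d by (simp; argo)
  qed
  show ?thesis unfolding tup_def Let_def TL10.simps
    using ne by (intro conjI T) auto
qed

lemma gen_on_int10:
  assumes sym: "\<And>a b. a \<in> M \<Longrightarrow> b \<in> M \<Longrightarrow> K a b = K b a" and i: "int10 (add10 k (tp K))"
  shows "gen_on \<int> M K"
proof (rule gen_on_if_pairs[where p = p and k = "- k"])
  show "subgrp \<int>" by (simp add: subgrp_def)
next
  have n: "nrm p K a b = nrm p K b a" if "a \<in> B" "b \<in> B" for a b
  proof -
    have "a \<in> M" "b \<in> M" using that by auto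
    thus ?thesis using sym[of a b] by (simp add: nrm_def)
  qed
  fix a b assume ab: "{a, b} \<subseteq> M - {p}" "a \<noteq> b"
  hence "a \<in> B" "b \<in> B" by auto
  thus "nrm p K a b - - k \<in> \<int>"
    using ab(2) i n unfolding tup_def Let_def add10.simps int10.simps
    by (elim insertE emptyE; simp)
qed (use sym in auto)

text \<open>The argument common to all explicit cases. \<open>S\<close> and \<open>S'\<close> are
  candidate solutions, possibly equal, and \<open>gen\<close> is the strict inequality describing
  the open chamber. Off the chamber one candidate has a star, and a condition of length zero also
  produces one; so general position implies positive lengths and \<open>gen\<close>, after which
  \<open>uniq\<close> leaves no further solution.\<close>

lemma six_core:
  assumes R: "R = {c1, c2, c3}" and v: "vrow M c1" "vrow M c2" "vrow M c3"
    and cond: "\<And>t v1 v2 v3. fulr (h t) (setl v1 c1) \<and> fulr (h t) (setl v2 c2) \<and> fulr (h t) (setl v3 c3) \<longleftrightarrow> cond v1 v2 v3 t"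
    and SA: "U10 S" "cond (fst c1) (fst c2) (fst c3) S" and SB: "U10 S'" "cond (fst c1) (fst c2) (fst c3) S'"
    and nongen: "\<not> gen \<Longrightarrow> bad10 S \<or> bad10 S'"
    and uniq: "\<And>t. 0 < fst c1 \<Longrightarrow> 0 < fst c2 \<Longrightarrow> 0 < fst c3 \<Longrightarrow> gen \<Longrightarrow> U10 t \<Longrightarrow> cond (fst c1) (fst c2) (fst c3) t \<Longrightarrow>
       \<exists>k. t = add10 k S \<or> t = add10 k S'"
  shows "fib M R \<noteq> {}"
    and "gp M R \<Longrightarrow> 0 < fst c1 \<and> 0 < fst c2 \<and> 0 < fst c3 \<and> gen"
    and "gp M R \<Longrightarrow> fib M R = {quart M (h S), quart M (h S')}"
    and "\<And>H K v1 v2 v3. gp M R \<Longrightarrow> sol M R H \<Longrightarrow> tlike M H K \<Longrightarrow>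
      fulr K (setl v1 c1) \<Longrightarrow> fulr K (setl v2 c2) \<Longrightarrow> fulr K (setl v3 c3) \<Longrightarrow>
      cond v1 v2 v3 (tp K) \<and> (\<exists>k. TL10 (add10 k S) (tp K) \<or> TL10 (add10 k S') (tp K))"
proof -
  have fu: "fulr H (setl w c) \<longleftrightarrow> fulr (h (tp H)) (setl w c)"
    if H: "\<And>a b. a \<in> M \<Longrightarrow> b \<in> M \<Longrightarrow> H a b = H b a" and c: "vrow M c" for H w c
  proof -
    obtain l a b d e where c': "c = (l, a, b, d, e)" by (cases c) auto
    have D: "distinct [a, b, d, e]" "{a, b, d, e} \<subseteq> M" "distinct [a, b, e, d]" "{a, b, e, d} \<subseteq> M" "{d, e} \<subseteq> M" using c c' by auto
    note qq = quart_h_tup[OF H]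
    have "fulr H (w, a, b, d, e) \<longleftrightarrow> qd H a b d e = w \<and> qd H a b e d = w" using H D(5) by (rule fulr_qd)
    moreover have "fulr (h (tp H)) (w, a, b, d, e) \<longleftrightarrow> qd (h (tp H)) a b d e = w \<and> qd (h (tp H)) a b e d = w"
      using h_sym D(5) by (rule fulr_qd)
    moreover have "qd (h (tp H)) a b d e = qd H a b d e" "qd (h (tp H)) a b e d = qd H a b e d"
      using quartD[OF qq D(1,2)] quartD[OF qq D(3,4)] by auto
    ultimately show ?thesis unfolding c' by simp
  qed
  have cnd: "fulr H (setl v1 c1) \<and> fulr H (setl v2 c2) \<and> fulr H (setl v3 c3) \<longleftrightarrow> cond v1 v2 v3 (tp H)"
    if "\<And>a b. a \<in> M \<Longrightarrow> b \<in> M \<Longrightarrow> H a b = H b a" for H v1 v2 v3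
    using fu[OF that v(1), where w=v1] fu[OF that v(2), where w=v2] fu[OF that v(3), where w=v3] cond by simp
  have cnd': "(\<forall>C\<in>R. fulr H C) \<longleftrightarrow> cond (fst c1) (fst c2) (fst c3) (tp H)"
    if s: "\<And>a b. a \<in> M \<Longrightarrow> b \<in> M \<Longrightarrow> H a b = H b a" for H
    using cnd[of H "fst c1" "fst c2" "fst c3", OF s] unfolding R by simp
  have solh: "sol M R (h t)" if u: "U10 t" and c: "cond (fst c1) (fst c2) (fst c3) t" for t
    using tm_h[OF u] cond[of t "fst c1" "fst c2" "fst c3"] c unfolding sol_def R by simp
  have soltp: "U10 (tp H)" "cond (fst c1) (fst c2) (fst c3) (tp H)" "quart M (h (tp H)) = quart M H" if hs: "sol M R H" for H
  proof -
    have t: "tm M H" and f: "\<forall>C\<in>R. fulr H C" using hs unfolding sol_def by blast+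
    show "U10 (tp H)" by (rule U10_tup[OF t])
    show "cond (fst c1) (fst c2) (fst c3) (tp H)" using cnd'[of H, OF tm_sym[OF t]] f by blast
    show "quart M (h (tp H)) = quart M H" using tm_sym[OF t] by (rule quart_h_tup)
  qed
  show "fib M R \<noteq> {}" unfolding fib_sol using solh[OF SA] by blast
  assume gp: "gp M R"
  have pos: "0 < fst c" if c: "c \<in> R" for c
  proof (rule ccontr)
    assume n: "\<not> 0 < fst c"
    obtain l a b d e where c': "c = (l, a, b, d, e)" by (cases c) auto
    have vc: "vrow M c" using v c unfolding R by blast
    hence c0: "c = (0, a, b, d, e)" using c' n by simp
    hence f: "fulr (h S) (0, a, b, d, e)" using solh[OF SA] c unfolding sol_def by metis
    have "resolved M (h S)" by (rule gp[unfolded gp_sol, rule_format, OF solh[OF SA]])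
    moreover have "{a, b, d, e} \<subseteq> M" using vc c' by simp
    ultimately have r: "resolved {a, b, d, e} (h S)" by (rule resolved_mono)
    have "distinct [a, b, d, e]" using vc c' by simp
    hence "\<not> (h S a b + h S d e = h S a d + h S b e \<and> h S a d + h S b e = h S a e + h S b d)"
      using r unfolding resolved_def by blast
    thus False using f by auto
  qed
  have p: "0 < fst c1" "0 < fst c2" "0 < fst c3" using pos unfolding R by auto
  have gen
  proof (rule ccontr)
    assume "\<not> gen"
    hence "bad10 S \<or> bad10 S'" by (rule nongen)
    thus False
      using bad10_unresolved gp[unfolded gp_sol, rule_format, OF solh[OF SA]] gp[unfolded gp_sol, rule_format, OF solh[OF SB]] by metis
  qed
  thus "0 < fst c1 \<and> 0 < fst c2 \<and> 0 < fst c3 \<and> gen" using p by blast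
  show "fib M R = {quart M (h S), quart M (h S')}"
  proof (intro Set.set_eqI iffI)
    fix g assume "g \<in> fib M R"
    then obtain H where H: "sol M R H" "g = quart M H" unfolding fib_sol by blast
    obtain k where "tp H = add10 k S \<or> tp H = add10 k S'" using uniq[OF p \<open>gen\<close> soltp(1,2)[OF H(1)]] by blast
    hence "quart M (h (tp H)) = quart M (h S) \<or> quart M (h (tp H)) = quart M (h S')" using quart_add10 by metis
    thus "g \<in> {quart M (h S), quart M (h S')}" using soltp(3)[OF H(1)] H(2) by simp
  next
    fix g assume "g \<in> {quart M (h S), quart M (h S')}"
    thus "g \<in> fib M R" unfolding fib_sol using solh[OF SA] solh[OF SB] by blast
  qed
  fix H K v1 v2 v3
  assume s: "sol M R H" and l: "tlike M H K" and f: "fulr K (setl v1 c1)" "fulr K (setl v2 c2)" "fulr K (setl v3 c3)"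
  have c: "cond v1 v2 v3 (tp K)" using cnd[of K v1 v2 v3, OF tlike_sym[OF l]] f by blast
  have t: "tm M H" using s unfolding sol_def by blast
  obtain k where "tp H = add10 k S \<or> tp H = add10 k S'" using uniq[OF p \<open>gen\<close> soltp(1,2)[OF s]] by blast
  moreover have "TL10 (tp H) (tp K)" by (rule TL10_tup[OF t l])
  ultimately have "TL10 (add10 k S) (tp K) \<or> TL10 (add10 k S') (tp K)" by metis
  thus "cond v1 v2 v3 (tp K) \<and> (\<exists>k. TL10 (add10 k S) (tp K) \<or> TL10 (add10 k S') (tp K))" using c by blast
qed

lemma hexQ_core:
  assumes R: "R = {c1, c2, c3}" and v: "vrow M c1" "vrow M c2" "vrow M c3"
    and cond: "\<And>t v1 v2 v3. fulr (h t) (setl v1 c1) \<and> fulr (h t) (setl v2 c2) \<and> fulr (h t) (setl v3 c3) \<longleftrightarrow> cond v1 v2 v3 t"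
    and SA: "U10 S" "cond (fst c1) (fst c2) (fst c3) S" and SB: "U10 S'" "cond (fst c1) (fst c2) (fst c3) S'"
    and nongen: "\<not> gen \<Longrightarrow> bad10 S \<or> bad10 S'"
    and uniq: "\<And>t. 0 < fst c1 \<Longrightarrow> 0 < fst c2 \<Longrightarrow> 0 < fst c3 \<Longrightarrow> gen \<Longrightarrow> U10 t \<Longrightarrow> cond (fst c1) (fst c2) (fst c3) t \<Longrightarrow>
       \<exists>k. t = add10 k S \<or> t = add10 k S'"
    and diff: "\<And>k. 0 < fst c1 \<Longrightarrow> 0 < fst c2 \<Longrightarrow> 0 < fst c3 \<Longrightarrow> gen \<Longrightarrow> S \<noteq> add10 k S'"
    and int: "\<And>k w v1 v2 v3. 0 < fst c1 \<Longrightarrow> 0 < fst c2 \<Longrightarrow> 0 < fst c3 \<Longrightarrow> gen \<Longrightarrow>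
       TL10 (add10 k S) w \<or> TL10 (add10 k S') w \<Longrightarrow> cond v1 v2 v3 w \<Longrightarrow> v1 \<in> \<int> \<Longrightarrow> v2 \<in> \<int> \<Longrightarrow> v3 \<in> \<int> \<Longrightarrow> \<exists>k. int10 (add10 k w)"
  shows "hexQ M R"
proof -
  have "card (fib M R) = 2 \<and>
    (\<forall>H K. sol M R H \<longrightarrow> tlike M H K \<longrightarrow> (\<forall>C\<in>R. \<exists>v\<in>\<int>. fulr K (setl v C)) \<longrightarrow> gen_on \<int> M K)" if gp: "gp M R"
  proof -
    have "0 < fst c1 \<and> 0 < fst c2 \<and> 0 < fst c3 \<and> gen" by (rule six_core(2)[OF R v cond SA SB nongen uniq gp])
    hence p: "0 < fst c1" "0 < fst c2" "0 < fst c3" gen by simp_all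
    have "quart M (h S) \<noteq> quart M (h S')" using eq_add10_if_quart[of S S'] diff[OF p] by metis
    moreover have "fib M R = {quart M (h S), quart M (h S')}" by (rule six_core(3)[OF R v cond SA SB nongen uniq gp])
    ultimately have "card (fib M R) = 2" by simp
    moreover have "gen_on \<int> M K" if s: "sol M R H" and l: "tlike M H K" and iv: "\<forall>C\<in>R. \<exists>v\<in>\<int>. fulr K (setl v C)" for H K
    proof -
      have "\<exists>v\<in>\<int>. fulr K (setl v c1)" "\<exists>v\<in>\<int>. fulr K (setl v c2)" "\<exists>v\<in>\<int>. fulr K (setl v c3)"
        using iv unfolding R by simp_all
      then obtain v1 v2 v3 where vv: "v1 \<in> \<int>" "v2 \<in> \<int>" "v3 \<in> \<int>" "fulr K (setl v1 c1)" "fulr K (setl v2 c2)" "fulr K (setl v3 c3)"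
        by (elim bexE)
      have "cond v1 v2 v3 (tp K) \<and> (\<exists>k. TL10 (add10 k S) (tp K) \<or> TL10 (add10 k S') (tp K))"
        by (rule six_core(4)[OF R v cond SA SB nongen uniq gp s l vv(4-6)])
      then obtain k where k: "TL10 (add10 k S) (tp K) \<or> TL10 (add10 k S') (tp K)" and c: "cond v1 v2 v3 (tp K)" by (elim conjE exE)
      obtain k where k10: "int10 (add10 k (tp K))" using int[OF p k c vv(1-3)] by (elim exE)
      show ?thesis by (rule gen_on_int10[OF _ k10]) (rule tlike_sym[OF l])
    qed
    ultimately show ?thesis by (intro conjI allI impI)
  qed
  moreover have "fib M R \<noteq> {}" by (rule six_core(1)[OF R v cond SA SB nongen uniq])
  ultimately show ?thesis unfolding hexQ_def by blast
qed

end

section \<open>Cross-ratios of a triangle\<close>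

fun krow :: "interpretation_kind \<Rightarrow> real \<Rightarrow> 'a \<Rightarrow> 'a \<Rightarrow> 'a \<Rightarrow> 'a \<Rightarrow> 'a row" where
  "krow Dual l k k' m m' = (l, k, m', k', m)"
| "krow Neighboring l k k' m m' = (l, k, k', m, m')"
| "krow Intersecting l k k' m m' = (l, k, m, k', m')"

lemma setl_krow [simp]: "setl v (krow \<kappa> l a b c d) = krow \<kappa> v a b c d" by (cases \<kappa>) (auto simp: setl_def)
lemma fst_krow [simp]: "fst (krow \<kappa> l a b c d) = l" by (cases \<kappa>) auto

lemma vrow_krow: "distinct [a, b, c, d] \<Longrightarrow> {a, b, c, d} \<subseteq> M \<Longrightarrow> 0 \<le> l \<Longrightarrow> vrow M (krow \<kappa> l a b c d)"
  by (cases \<kappa>) auto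

section \<open>Symmetries of the problem on six markings\<close>

fun flip :: "interpretation_kind \<Rightarrow> interpretation_kind" where
  "flip Dual = Intersecting" | "flip Intersecting = Dual" | "flip Neighboring = Neighboring"

definition symon :: "'a set \<Rightarrow> ('a \<Rightarrow> 'a \<Rightarrow> real) \<Rightarrow> bool" where
  "symon M H \<longleftrightarrow> (\<forall>a\<in>M. \<forall>b\<in>M. H a b = H b a)"

lemma symonD: "symon M H \<Longrightarrow> a \<in> M \<Longrightarrow> b \<in> M \<Longrightarrow> H a b = H b a" unfolding symon_def by blast

lemma symon_mono: "symon M H \<Longrightarrow> A \<subseteq> M \<Longrightarrow> symon A H" unfolding symon_def by blast

text \<open>Exchanging the two markings at one corner keeps the neighboring splitting and
  interchanges the two others. At a corner this affects both adjacent sides of the triangle.\<close>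

lemma krow_flip:
  assumes "symon {a, b, c, d} H"
  shows "fulr H (krow (flip \<kappa>) l b a c d) \<longleftrightarrow> fulr H (krow \<kappa> l a b c d)"
    and "fulr H (krow (flip \<kappa>) l a b d c) \<longleftrightarrow> fulr H (krow \<kappa> l a b c d)"
    and "fulr H (krow \<kappa> l c d a b) \<longleftrightarrow> fulr H (krow \<kappa> l a b c d)"
  using symonD[OF assms, of a b] symonD[OF assms, of a c] symonD[OF assms, of a d] symonD[OF assms, of b c]
    symonD[OF assms, of b d] symonD[OF assms, of c d]
  by (cases \<kappa>; simp; argo)+

lemma hexQ_cong:
  assumes e: "\<And>H v. symon M H \<Longrightarrow> fulr H (setl v c1) = fulr H (setl v d1) \<and>
      fulr H (setl v c2) = fulr H (setl v d2) \<and> fulr H (setl v c3) = fulr H (setl v d3)"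
    and l: "fst c1 = fst d1" "fst c2 = fst d2" "fst c3 = fst d3"
    and Q: "hexQ M {c1, c2, c3}"
  shows "hexQ M {d1, d2, d3}"
proof -
  have k: "setl (fst c1) d1 = d1" "setl (fst c2) d2 = d2" "setl (fst c3) d3 = d3" by (simp_all add: l)
  have f: "fulr H c1 = fulr H d1 \<and> fulr H c2 = fulr H d2 \<and> fulr H c3 = fulr H d3"
    if t: "symon M H" for H
  proof (intro conjI)
    show "fulr H c1 = fulr H d1" using e[of H "fst c1", OF t] unfolding k fst_setl by (elim conjE)
    show "fulr H c2 = fulr H d2" using e[of H "fst c2", OF t] unfolding k fst_setl by (elim conjE)
    show "fulr H c3 = fulr H d3" using e[of H "fst c3", OF t] unfolding k fst_setl by (elim conjE)
  qed
  have s: "sol M {c1, c2, c3} H = sol M {d1, d2, d3} H" for H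
  proof (cases "tm M H")
    case True
    hence "symon M H" unfolding symon_def by (intro ballI tm_sym)
    thus ?thesis using f[of H] unfolding sol_def by simp
  qed (simp add: sol_def)
  hence g: "fib M {c1, c2, c3} = fib M {d1, d2, d3}" "gp M {c1, c2, c3} = gp M {d1, d2, d3}"
    unfolding fib_sol gp_sol by simp_all
  have i: "(\<forall>C\<in>{c1, c2, c3}. \<exists>v\<in>\<int>. fulr K (setl v C)) = (\<forall>C\<in>{d1, d2, d3}. \<exists>v\<in>\<int>. fulr K (setl v C))" if "tlike M H K" for H K
  proof -
    have "symon M K" unfolding symon_def by (intro ballI tlike_sym[OF that])
    thus ?thesis using e[of K] by simp
  qed
  have a: "gp M {d1, d2, d3} \<longrightarrow> card (fib M {d1, d2, d3}) = 2 \<and>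
    (\<forall>H K. sol M {d1, d2, d3} H \<longrightarrow> tlike M H K \<longrightarrow> (\<forall>C\<in>{c1, c2, c3}. \<exists>v\<in>\<int>. fulr K (setl v C)) \<longrightarrow> gen_on \<int> M K)"
    using Q unfolding hexQ_def s g by (rule conjunct2)
  have b: "fib M {d1, d2, d3} \<noteq> {}" using Q unfolding hexQ_def s g by (rule conjunct1)
  show ?thesis unfolding hexQ_def
  proof (intro conjI impI allI)
    assume gp: "gp M {d1, d2, d3}"
    show "card (fib M {d1, d2, d3}) = 2" using a gp by simp
    fix H K assume h: "sol M {d1, d2, d3} H" "tlike M H K" "\<forall>C\<in>{d1, d2, d3}. \<exists>v\<in>\<int>. fulr K (setl v C)"
    show "gen_on \<int> M K"
      by (rule mp[OF mp[OF mp[OF spec[OF spec[OF conjunct2[OF mp[OF a gp]]]] h(1)] h(2)]])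
        (use h(3) i[OF h(2)] in simp)
  qed (rule b)
qed

definition hexP where
  "hexP p q x y r s \<kappa>1 l1 \<kappa>2 l2 \<kappa>3 l3 \<longleftrightarrow>
    hexQ {p, q, x, y, r, s} {krow \<kappa>1 l1 p q x y, krow \<kappa>2 l2 x y r s, krow \<kappa>3 l3 p q r s}"

lemma hexP_flip_xy:
  assumes "hexP p q x y r s \<kappa>1 l1 \<kappa>2 l2 \<kappa>3 l3"
  shows "hexP p q y x r s (flip \<kappa>1) l1 (flip \<kappa>2) l2 \<kappa>3 l3"
proof -
  have M: "{p, q, y, x, r, s} = {p, q, x, y, r, s}" by auto
  show ?thesis unfolding hexP_def M
  proof (rule hexQ_cong[OF _ _ _ _ assms[unfolded hexP_def]], goal_cases)
    case (1 H v)
    hence S: "symon {p, q, x, y} H" "symon {x, y, r, s} H" "symon {p, q, r, s} H" by (rule symon_mono, blast)+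
    show ?case unfolding setl_krow krow_flip[OF S(1)] krow_flip[OF S(2)] krow_flip[OF S(3)] by (intro conjI HOL.refl)
  qed simp_all
qed

lemma hexP_flip_rs:
  assumes "hexP p q x y r s \<kappa>1 l1 \<kappa>2 l2 \<kappa>3 l3"
  shows "hexP p q x y s r \<kappa>1 l1 (flip \<kappa>2) l2 (flip \<kappa>3) l3"
proof -
  have M: "{p, q, x, y, s, r} = {p, q, x, y, r, s}" by auto
  show ?thesis unfolding hexP_def M
  proof (rule hexQ_cong[OF _ _ _ _ assms[unfolded hexP_def]], goal_cases)
    case (1 H v)
    hence S: "symon {p, q, x, y} H" "symon {x, y, r, s} H" "symon {p, q, r, s} H" by (rule symon_mono, blast)+
    show ?case unfolding setl_krow krow_flip[OF S(1)] krow_flip[OF S(2)] krow_flip[OF S(3)] by (intro conjI HOL.refl)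
  qed simp_all
qed

lemma hexP_flip_pq:
  assumes "hexP p q x y r s \<kappa>1 l1 \<kappa>2 l2 \<kappa>3 l3"
  shows "hexP q p x y r s (flip \<kappa>1) l1 \<kappa>2 l2 (flip \<kappa>3) l3"
proof -
  have M: "{q, p, x, y, r, s} = {p, q, x, y, r, s}" by auto
  show ?thesis unfolding hexP_def M
  proof (rule hexQ_cong[OF _ _ _ _ assms[unfolded hexP_def]], goal_cases)
    case (1 H v)
    hence S: "symon {p, q, x, y} H" "symon {x, y, r, s} H" "symon {p, q, r, s} H" by (rule symon_mono, blast)+
    show ?case unfolding setl_krow krow_flip[OF S(1)] krow_flip[OF S(2)] krow_flip[OF S(3)] by (intro conjI HOL.refl)
  qed simp_all
qed

lemma hexP_rotate:
  assumes "hexP r s p q x y \<kappa>3 l3 \<kappa>1 l1 \<kappa>2 l2"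
  shows "hexP p q x y r s \<kappa>1 l1 \<kappa>2 l2 \<kappa>3 l3"
proof -
  have M: "{p, q, x, y, r, s} = {r, s, p, q, x, y}" by auto
  have R: "{krow \<kappa>1 l1 p q x y, krow \<kappa>2 l2 x y r s, krow \<kappa>3 l3 p q r s} =
    {krow \<kappa>3 l3 p q r s, krow \<kappa>1 l1 p q x y, krow \<kappa>2 l2 x y r s}" by auto
  show ?thesis unfolding hexP_def M R
  proof (rule hexQ_cong[OF _ _ _ _ assms[unfolded hexP_def]], goal_cases)
    case (1 H v)
    hence S: "symon {p, q, x, y} H" "symon {x, y, r, s} H" "symon {p, q, r, s} H" by (rule symon_mono, blast)+
    show ?case unfolding setl_krow krow_flip[OF S(1)] krow_flip[OF S(2)] krow_flip[OF S(3)] by (intro conjI HOL.refl)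
  qed simp_all
qed

lemma hexP_swap:
  assumes "hexP p q r s x y \<kappa>3 l3 \<kappa>2 l2 \<kappa>1 l1"
  shows "hexP p q x y r s \<kappa>1 l1 \<kappa>2 l2 \<kappa>3 l3"
proof -
  have M: "{p, q, x, y, r, s} = {p, q, r, s, x, y}" by auto
  have R: "{krow \<kappa>1 l1 p q x y, krow \<kappa>2 l2 x y r s, krow \<kappa>3 l3 p q r s} =
    {krow \<kappa>3 l3 p q r s, krow \<kappa>2 l2 x y r s, krow \<kappa>1 l1 p q x y}" by auto
  show ?thesis unfolding hexP_def M R
  proof (rule hexQ_cong[OF _ _ _ _ assms[unfolded hexP_def]], goal_cases)
    case (1 H v)
    hence S: "symon {p, q, x, y} H" "symon {x, y, r, s} H" "symon {p, q, r, s} H" by (rule symon_mono, blast)+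
    show ?case unfolding setl_krow krow_flip[OF S(1)] krow_flip[OF S(2)] krow_flip[OF S(3)] by (intro conjI HOL.refl)
  qed simp_all
qed

lemma add10_minus [simp]: "add10 (- k) (add10 k t) = t"
proof -
  obtain qx qy qr qs xy xr xs yr ys rs where t: "t = (qx, qy, qr, qs, xy, xr, xs, yr, ys, rs)" by (cases t) auto
  show ?thesis unfolding t by simp
qed

section \<open>The explicit solutions\<close>

context six
begin

fun cond10 :: "interpretation_kind \<Rightarrow> interpretation_kind \<Rightarrow> interpretation_kind \<Rightarrow> real \<Rightarrow> real \<Rightarrow> real \<Rightarrow> t10 \<Rightarrow> bool" where
  "cond10 \<kappa>1 \<kappa>2 \<kappa>3 v1 v2 v3 (qx, qy, qr, qs, xy, xr, xs, yr, ys, rs) \<longleftrightarrow>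
    (case \<kappa>1 of Neighboring \<Rightarrow> qy = qx \<and> qx = xy + v1 | Intersecting \<Rightarrow> xy = qx \<and> qx = qy + v1 | Dual \<Rightarrow> xy = qy \<and> qy = qx + v1) \<and>
    (case \<kappa>2 of Neighboring \<Rightarrow> xr + ys = xs + yr \<and> xs + yr = xy + rs + v2
      | Intersecting \<Rightarrow> xy + rs = xs + yr \<and> xs + yr = xr + ys + v2 | Dual \<Rightarrow> xy + rs = xr + ys \<and> xr + ys = xs + yr + v2) \<and>
    (case \<kappa>3 of Neighboring \<Rightarrow> qs = qr \<and> qr = rs + v3 | Intersecting \<Rightarrow> rs = qr \<and> qr = qs + v3 | Dual \<Rightarrow> rs = qs \<and> qs = qr + v3)"

lemma cond10_iff:
  "fulr (h t) (setl v1 (krow \<kappa>1 l1 p q x y)) \<and> fulr (h t) (setl v2 (krow \<kappa>2 l2 x y r s)) \<and>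
   fulr (h t) (setl v3 (krow \<kappa>3 l3 p q r s)) \<longleftrightarrow> cond10 \<kappa>1 \<kappa>2 \<kappa>3 v1 v2 v3 t"
proof -
  obtain qx qy qr qs xy xr xs yr ys rs where t: "t = (qx, qy, qr, qs, xy, xr, xs, yr, ys, rs)" by (cases t) auto
  show ?thesis unfolding setl_krow
    by (cases \<kappa>1; cases \<kappa>2; cases \<kappa>3; simp only: krow.simps fulr.simps h_p h_simps[OF t]; simp add: t; argo)
qed

lemma krow_valid:
  assumes "0 \<le> l1" "0 \<le> l2" "0 \<le> l3"
  shows "vrow M (krow \<kappa>1 l1 p q x y)" "vrow M (krow \<kappa>2 l2 x y r s)" "vrow M (krow \<kappa>3 l3 p q r s)"
  using assms ne by (auto intro!: vrow_krow)

text \<open>\<open>S\<close> and \<open>S'\<close> are the two solutions, rooted at \<open>p\<close>. They are linear in the lengths on the chamber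
  considered, so they also describe the half distances \<open>w\<close> of the same combinatorial type.\<close>

lemma hexP_core:
  assumes l: "0 \<le> l1" "0 \<le> l2" "0 \<le> l3"
    and SA: "U10 (S l1 l2 l3)" "cond10 \<kappa>1 \<kappa>2 \<kappa>3 l1 l2 l3 (S l1 l2 l3)" and SB: "U10 (S' l1 l2 l3)" "cond10 \<kappa>1 \<kappa>2 \<kappa>3 l1 l2 l3 (S' l1 l2 l3)"
    and nongen: "\<not> gen \<Longrightarrow> bad10 (S l1 l2 l3) \<or> bad10 (S' l1 l2 l3)"
    and uniq: "\<And>qx qy qr qs xy xr xs yr ys rs. 0 < l1 \<Longrightarrow> 0 < l2 \<Longrightarrow> 0 < l3 \<Longrightarrow> gen \<Longrightarrow> U10 (qx, qy, qr, qs, xy, xr, xs, yr, ys, rs) \<Longrightarrow>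
      cond10 \<kappa>1 \<kappa>2 \<kappa>3 l1 l2 l3 (qx, qy, qr, qs, xy, xr, xs, yr, ys, rs) \<Longrightarrow>
      (qx, qy, qr, qs, xy, xr, xs, yr, ys, rs) = add10 qr (S l1 l2 l3) \<or> (qx, qy, qr, qs, xy, xr, xs, yr, ys, rs) = add10 qr (S' l1 l2 l3)"
    and diff: "\<And>k. 0 < l1 \<Longrightarrow> 0 < l2 \<Longrightarrow> 0 < l3 \<Longrightarrow> gen \<Longrightarrow> S l1 l2 l3 \<noteq> add10 k (S' l1 l2 l3)"
    and lin: "\<And>k qx qy qr qs xy xr xs yr ys rs v1 v2 v3. 0 < l1 \<Longrightarrow> 0 < l2 \<Longrightarrow> 0 < l3 \<Longrightarrow> gen \<Longrightarrow>
      TL10 (add10 k (S l1 l2 l3)) (qx, qy, qr, qs, xy, xr, xs, yr, ys, rs) \<Longrightarrow> cond10 \<kappa>1 \<kappa>2 \<kappa>3 v1 v2 v3 (qx, qy, qr, qs, xy, xr, xs, yr, ys, rs) \<Longrightarrow>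
      (qx, qy, qr, qs, xy, xr, xs, yr, ys, rs) = add10 qr (S v1 v2 v3)"
    and lin': "\<And>k qx qy qr qs xy xr xs yr ys rs v1 v2 v3. 0 < l1 \<Longrightarrow> 0 < l2 \<Longrightarrow> 0 < l3 \<Longrightarrow> gen \<Longrightarrow>
      TL10 (add10 k (S' l1 l2 l3)) (qx, qy, qr, qs, xy, xr, xs, yr, ys, rs) \<Longrightarrow> cond10 \<kappa>1 \<kappa>2 \<kappa>3 v1 v2 v3 (qx, qy, qr, qs, xy, xr, xs, yr, ys, rs) \<Longrightarrow>
      (qx, qy, qr, qs, xy, xr, xs, yr, ys, rs) = add10 qr (S' v1 v2 v3)"
    and int: "\<And>v1 v2 v3. v1 \<in> \<int> \<Longrightarrow> v2 \<in> \<int> \<Longrightarrow> v3 \<in> \<int> \<Longrightarrow> int10 (S v1 v2 v3) \<and> int10 (S' v1 v2 v3)"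
  shows "hexP p q x y r s \<kappa>1 l1 \<kappa>2 l2 \<kappa>3 l3"
  unfolding hexP_def
proof (rule hexQ_core[OF HOL.refl krow_valid[OF l] cond10_iff], unfold fst_krow)
  show "U10 (S l1 l2 l3)" "cond10 \<kappa>1 \<kappa>2 \<kappa>3 l1 l2 l3 (S l1 l2 l3)" "U10 (S' l1 l2 l3)" "cond10 \<kappa>1 \<kappa>2 \<kappa>3 l1 l2 l3 (S' l1 l2 l3)"
    by fact+
next
  assume "\<not> gen" thus "bad10 (S l1 l2 l3) \<or> bad10 (S' l1 l2 l3)" by (rule nongen)
next
  fix t assume a: "0 < l1" "0 < l2" "0 < l3" gen "U10 t" "cond10 \<kappa>1 \<kappa>2 \<kappa>3 l1 l2 l3 t"
  obtain qx qy qr qs xy xr xs yr ys rs where t: "t = (qx, qy, qr, qs, xy, xr, xs, yr, ys, rs)" by (cases t) auto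
  show "\<exists>k. t = add10 k (S l1 l2 l3) \<or> t = add10 k (S' l1 l2 l3)" using uniq[OF a(1-4)] a(5,6) unfolding t by blast
next
  fix k assume a: "0 < l1" "0 < l2" "0 < l3" gen
  show "S l1 l2 l3 \<noteq> add10 k (S' l1 l2 l3)" by (rule diff[OF a])
next
  fix k w v1 v2 v3
  assume a: "0 < l1" "0 < l2" "0 < l3" gen and T: "TL10 (add10 k (S l1 l2 l3)) w \<or> TL10 (add10 k (S' l1 l2 l3)) w"
    and c: "cond10 \<kappa>1 \<kappa>2 \<kappa>3 v1 v2 v3 w" and v: "v1 \<in> \<int>" "v2 \<in> \<int>" "v3 \<in> \<int>"
  obtain qx qy qr qs xy xr xs yr ys rs where w: "w = (qx, qy, qr, qs, xy, xr, xs, yr, ys, rs)" by (cases w) auto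
  have "w = add10 qr (S v1 v2 v3) \<or> w = add10 qr (S' v1 v2 v3)"
    using T
  proof
    assume "TL10 (add10 k (S l1 l2 l3)) w" thus ?thesis using lin[OF a _ c[unfolded w], of k] unfolding w by blast
  next
    assume "TL10 (add10 k (S' l1 l2 l3)) w" thus ?thesis using lin'[OF a _ c[unfolded w], of k] unfolding w by blast
  qed
  hence "int10 (add10 (- qr) w)" using int[OF v] add10_minus by metis
  thus "\<exists>k. int10 (add10 k w)" by blast
qed

text \<open>The path between the cherries \<open>xy\<close> and \<open>rs\<close> has length
  \<open>l2\<close>. One of \<open>p\<close>, \<open>q\<close> attaches at distance
  \<open>l1\<close> from the first cherry, the other at distance \<open>l3\<close> from the second,
  with a segment of length \<open>l2 - l1 - l3\<close> between them; the two solutions differ by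
  exchanging \<open>p\<close> and \<open>q\<close>.\<close>

lemma hexP_NNN:
  assumes "0 \<le> l1" "0 \<le> l2" "0 \<le> l3" "l1 + l3 \<le> l2"
  shows "hexP p q x y r s Neighboring l1 Neighboring l2 Neighboring l3"
  by (rule hexP_core[where gen = "l1 + l3 < l2"
    and S = "\<lambda>l1 l2 l3. let t = l2 - l1 - l3 in (t, t, 0, 0, t - l1, t, t, t, t, - l3)"
    and S' = "\<lambda>l1 l2 l3. let t = l1 + l3 - l2 in (t, t, 0, 0, t - l1, 0, 0, 0, 0, - l3)"];
    use assms in \<open>simp add: tri3_def tl3_def Let_def; (smt (verit))?\<close>)

text \<open>Both trees are caterpillars starting with the cherry \<open>pq\<close>. The edge of
  length \<open>l2\<close>, which realises \<open>xr|ys\<close>, cuts off \<open>x\<close>,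
  \<open>r\<close> in one solution and \<open>y\<close>, \<open>s\<close> in the other.\<close>

lemma hexP_NIN:
  assumes "0 \<le> l1" "0 \<le> l2" "0 \<le> l3" "l1 \<le> l3"
  shows "hexP p q x y r s Neighboring l1 Intersecting l2 Neighboring l3"
  by (rule hexP_core[where gen = "l1 < l3"
    and S = "\<lambda>l1 l2 l3. (0, 0, 0, 0, - l1, - l3 - l2, - l3, - l1, - l1, - l3)"
    and S' = "\<lambda>l1 l2 l3. (0, 0, 0, 0, - l1, - l1, - l1, - l3, - l3 - l2, - l3)"];
    use assms in \<open>simp add: tri3_def tl3_def Let_def; (smt (verit))?\<close>)

text \<open>Two caterpillars in which each bounded edge realises one condition alone:
  \<open>px\<close> and \<open>qs\<close> are the final cherries of one, with \<open>y\<close>,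
  \<open>r\<close> in between, and \<open>pr\<close> and \<open>qy\<close> those of the other, with
  \<open>s\<close>, \<open>x\<close> in between.\<close>

lemma hexP_INI:
  assumes "0 \<le> l1" "0 \<le> l2" "0 \<le> l3"
  shows "hexP p q x y r s Intersecting l1 Neighboring l2 Intersecting l3"
  by (rule hexP_core[where gen = True
    and S = "\<lambda>l1 l2 l3. (l1 + l2, l2, 0, - l3, l1 + l2, l1 + l2, l1 + l2, l2, l2, 0)"
    and S' = "\<lambda>l1 l2 l3. (- l3 - l2, - l3 - l2 - l1, 0, - l3, - l3 - l2, 0, - l3, 0, - l3, 0)"];
    use assms in \<open>simp add: tri3_def tl3_def Let_def; (smt (verit))?\<close>)

text \<open>Both solutions are caterpillars with edge lengths \<open>l1\<close>,
  \<open>l3 - l1\<close> and \<open>l2 - l1\<close>. One has the cherries \<open>qs\<close> and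
  \<open>xr\<close> at its ends, the other \<open>pr\<close> and \<open>ys\<close>; for
  \<open>l1 = l3\<close> an edge contracts in both.\<close>

lemma hexP_III:
  assumes "0 \<le> l1" "0 \<le> l2" "0 \<le> l3" "l1 \<le> l3" "l3 \<le> l2"
  shows "hexP p q x y r s Intersecting l1 Intersecting l2 Intersecting l3"
  by (rule hexP_core[where gen = "l1 < l3"
    and S = "\<lambda>l1 l2 l3. (0, - l1, 0, - l3, 0, l1 - l2, 0, 0, - l1, 0)"
    and S' = "\<lambda>l1 l2 l3. (l1 - l3, - l3, 0, - l3, l1 - l3, 0, l1 - l3, 0, - l3 - l2 + l1, 0)"];
    use assms in \<open>simp add: tri3_def tl3_def Let_def; (smt (verit))?\<close>)

text \<open>Both solutions have three cherries joined at one vertex: \<open>pr\<close>,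
  \<open>qy\<close>, \<open>xs\<close> in the first, \<open>px\<close>, \<open>qs\<close>,
  \<open>yr\<close> in the second. Each edge realises exactly one condition.\<close>

lemma hexP_IDI:
  assumes "0 \<le> l1" "0 \<le> l2" "0 \<le> l3"
  shows "hexP p q x y r s Intersecting l1 Dual l2 Intersecting l3"
  by (rule hexP_core[where gen = True
    and S = "\<lambda>l1 l2 l3. (- l3, - l3 - l1, 0, - l3, - l3, 0, - l3 - l2, 0, - l3, 0)"
    and S' = "\<lambda>l1 l2 l3. (l1, 0, 0, - l3, l1, l1, l1, - l2, 0, 0)"];
    use assms in \<open>simp add: tri3_def tl3_def Let_def; (smt (verit))?\<close>)

text \<open>The only tree has the cherries \<open>pq\<close>, \<open>xy\<close>, \<open>rs\<close>
  joined at one vertex, and each condition is the sum of two of its edges. The quartet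
  \<open>qd K p q x r\<close> is the edge of the cherry \<open>pq\<close>, half of
  \<open>v1 + v3 - v2\<close>; it replaces the first condition as integral coordinate.\<close>

lemma snow:
  assumes l: "l1 < l2 + l3" "l2 < l1 + l3" "l3 < l1 + l2" and
    R: "R = {krow Neighboring l1 p q x y, krow Neighboring l2 x y r s, krow Neighboring l3 p q r s}"
  shows "fib M R \<noteq> {}" and "gp M R \<Longrightarrow> card (fib M R) = 1"
    and "\<And>H K v1 v2 v3. gp M R \<Longrightarrow> sol M R H \<Longrightarrow> tlike M H K \<Longrightarrow> fulr K (krow Neighboring v1 p q x y) \<Longrightarrow>
      fulr K (krow Neighboring v2 x y r s) \<Longrightarrow> fulr K (krow Neighboring v3 p q r s) \<Longrightarrow>
      v1 = 2 * qd K p q x r + v2 - v3 \<and> (v2 \<in> \<int> \<longrightarrow> v3 \<in> \<int> \<longrightarrow> qd K p q x r \<in> \<int> \<longrightarrow> gen_on \<int> M K)"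
proof -
  have nn: "0 \<le> l1" "0 \<le> l2" "0 \<le> l3" using l by linarith+
  \<comment> \<open>The height at which \<open>xy\<close> and \<open>rs\<close> join when
    \<open>p\<close> is the root; the three edges have lengths \<open>- c\<close>,
    \<open>c + l1\<close> and \<open>c + l3\<close>, positive by the triangle inequalities.\<close>
  define c where "c = (l2 - l1 - l3) / 2"
  define S where "S = (0 :: real, 0 :: real, 0 :: real, 0 :: real, - l1, c, c, c, c, - l3)"
  have S: "U10 S" "cond10 Neighboring Neighboring Neighboring l1 l2 l3 S"
    using l nn unfolding S_def c_def by (simp_all add: tri3_def)
  have u: "\<exists>k. t = add10 k S \<or> t = add10 k S" if U: "U10 t" and C: "cond10 Neighboring Neighboring Neighboring l1 l2 l3 t" for t
  proof -
    obtain qx qy qr qs xy xr xs yr ys rs where t: "t = (qx, qy, qr, qs, xy, xr, xs, yr, ys, rs)" by (cases t) auto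
    have "2 * c = l2 - l1 - l3" unfolding c_def by simp
    hence "t = add10 qr S" using U C l unfolding t S_def by (simp add: tri3_def; smt (verit))
    thus ?thesis by blast
  qed
  note core = six_core[OF R krow_valid[OF nn] cond10_iff, unfolded fst_krow, OF S S, where gen = True]
  have core1: "fib M R \<noteq> {}" by (rule core(1)) (use u in blast)+
  thus "fib M R \<noteq> {}" .
  assume gp: "gp M R"
  have "fib M R = {quart M (h S), quart M (h S)}" by (rule core(3)) (use u gp in blast)+
  thus "card (fib M R) = 1" by simp
  fix H K v1 v2 v3 assume s: "sol M R H" and tl: "tlike M H K" and f: "fulr K (krow Neighboring v1 p q x y)"
    "fulr K (krow Neighboring v2 x y r s)" "fulr K (krow Neighboring v3 p q r s)"
  have "cond10 Neighboring Neighboring Neighboring v1 v2 v3 (tp K) \<and> (\<exists>k. TL10 (add10 k S) (tp K) \<or> TL10 (add10 k S) (tp K))"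
  proof (rule core(4)[OF _ _ gp s tl])
    show "fulr K (setl v1 (krow Neighboring l1 p q x y))" "fulr K (setl v2 (krow Neighboring l2 x y r s))"
      "fulr K (setl v3 (krow Neighboring l3 p q r s))" using f by simp_all
  qed (simp, rule u)
  then obtain k where k: "TL10 (add10 k S) (tp K)" and C: "cond10 Neighboring Neighboring Neighboring v1 v2 v3 (tp K)" by (elim conjE exE disjE)
  obtain qx qy qr qs xy xr xs yr ys rs where t: "tp K = (qx, qy, qr, qs, xy, xr, xs, yr, ys, rs)" by (cases "tp K") auto
  have g: "qd K p q x r = qr - xr"
    using t ne tlike_sym[OF tl, of r q] tlike_sym[OF tl, of p r] unfolding tup_def Let_def nrm_def qd_def by simp
  have c: "c < 0" "- l1 < c" "- l3 < c" using l unfolding c_def by (simp_all add: field_simps)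
  have w: "qx = qr \<and> qy = qr \<and> qs = qr \<and> xy = qr - v1 \<and> rs = qr - v3 \<and> xs = xr \<and> yr = xr \<and> ys = xr"
    using k C c unfolding t S_def by (simp add: tl3_def)
  have v: "v1 = 2 * qd K p q x r + v2 - v3" using w C unfolding g t by simp
  have "gen_on \<int> M K" if i: "v2 \<in> \<int>" "v3 \<in> \<int>" "qd K p q x r \<in> \<int>"
  proof -
    have "v1 \<in> \<int>" unfolding v using i by simp
    moreover have "xr - qr \<in> \<int>" using Ints_minus[OF i(3)] unfolding g by simp
    ultimately have "int10 (add10 (- qr) (tp K))" using w i unfolding t by simp
    thus ?thesis by (rule gen_on_int10[rotated]) (rule tlike_sym[OF tl])
  qed
  thus "v1 = 2 * qd K p q x r + v2 - v3 \<and> (v2 \<in> \<int> \<longrightarrow> v3 \<in> \<int> \<longrightarrow> qd K p q x r \<in> \<int> \<longrightarrow> gen_on \<int> M K)"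
    using v by blast
qed

end

section \<open>Reduction of all interpretations to the explicit cases\<close>

lemma hexP_NXN:
  assumes "distinct [p, q, x, y, r, s]" "\<kappa> \<noteq> Neighboring" "0 \<le> l1" "0 \<le> l2" "0 \<le> l3"
  shows "hexP p q x y r s Neighboring l1 \<kappa> l2 Neighboring l3"
proof -
  have I: "hexP p q x y r s Neighboring l1 Intersecting l2 Neighboring l3" if "distinct [p, q, x, y, r, s]" for x y
  proof (cases "l1 \<le> l3")
    case True thus ?thesis using six.hexP_NIN[OF six.intro, of p q x y r s] that assms by simp
  next
    case False
    hence "hexP p q r s x y Neighboring l3 Intersecting l2 Neighboring l1"
      using six.hexP_NIN[OF six.intro, of p q r s x y] that assms by auto
    thus ?thesis by (rule hexP_swap)
  qed
  show ?thesis
  proof (cases \<kappa>)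
    case Dual thus ?thesis using hexP_flip_xy[OF I[of y x]] assms by auto
  qed (use I assms in auto)
qed

lemma hexP_XNX:
  assumes "distinct [p, q, x, y, r, s]" "\<kappa>1 \<noteq> Neighboring" "\<kappa>3 \<noteq> Neighboring" "0 \<le> l1" "0 \<le> l2" "0 \<le> l3"
  shows "hexP p q x y r s \<kappa>1 l1 Neighboring l2 \<kappa>3 l3"
proof -
  have I: "hexP p q x y r s Intersecting l1 Neighboring l2 Intersecting l3" if "distinct [p, q, x, y, r, s]" for x y r s
    using six.hexP_INI[OF six.intro, of p q x y r s] that assms by simp
  have J: "hexP p q x y r s \<kappa>1 l1 Neighboring l2 Intersecting l3" if "distinct [p, q, x, y, r, s]" for x y r s
  proof (cases \<kappa>1)
    case Dual thus ?thesis using hexP_flip_xy[OF I[of y x r s]] that by auto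
  qed (use I that assms in auto)
  show ?thesis
  proof (cases \<kappa>3)
    case Dual thus ?thesis using hexP_flip_rs[OF J[of x y s r]] assms by auto
  qed (use J assms in auto)
qed

text \<open>Flipping a corner changes two of the three kinds at once, so the parity of the number of
  \<open>Dual\<close> is invariant. The even case reduces to three times
  \<open>Intersecting\<close>, where a rotation makes the middle length the largest, the odd case to
  \<open>hexP_IDI\<close>.\<close>

lemma hexP_XXX:
  assumes "distinct [p, q, x, y, r, s]" "\<kappa>1 \<noteq> Neighboring" "\<kappa>2 \<noteq> Neighboring" "\<kappa>3 \<noteq> Neighboring" "0 \<le> l1" "0 \<le> l2" "0 \<le> l3"
  shows "hexP p q x y r s \<kappa>1 l1 \<kappa>2 l2 \<kappa>3 l3"
proof -
  have mid: "hexP p q x y r s Intersecting l1 Intersecting l2 Intersecting l3"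
    if "distinct [p, q, x, y, r, s]" "0 \<le> l1" "0 \<le> l2" "0 \<le> l3" "l1 \<le> l2" "l3 \<le> l2" for p q x y r s :: 'a and l1 l2 l3
  proof (cases "l1 \<le> l3")
    case True thus ?thesis using six.hexP_III[OF six.intro, of p q x y r s] that by simp
  next
    case False
    hence "hexP p q r s x y Intersecting l3 Intersecting l2 Intersecting l1"
      using six.hexP_III[OF six.intro, of p q r s x y] that by auto
    thus ?thesis by (rule hexP_swap)
  qed
  have I: "hexP p q x y r s Intersecting l1 Intersecting l2 Intersecting l3" if d: "distinct [p, q, x, y, r, s]" for p q x y r s :: 'a
  proof -
    have d': "distinct [r, s, p, q, x, y]" "distinct [x, y, r, s, p, q]" using d by auto
    consider "l1 \<le> l2" "l3 \<le> l2" | "l3 \<le> l1" "l2 \<le> l1" | "l1 \<le> l3" "l2 \<le> l3" by linarith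
    thus ?thesis
    proof cases
      case 1 thus ?thesis using mid d assms by blast
    next
      case 2 show ?thesis by (rule hexP_rotate, rule mid) (use 2 d' assms in blast)+
    next
      case 3 show ?thesis by (rule hexP_rotate, rule hexP_rotate, rule mid) (use 3 d' assms in blast)+
    qed
  qed
  have J: "hexP p q x y r s Intersecting l1 Dual l2 Intersecting l3" if "distinct [p, q, x, y, r, s]" for p q x y r s :: 'a
    using six.hexP_IDI[OF six.intro, of p q x y r s] that assms by simp
  have d: "distinct [p, q, y, x, r, s]" "distinct [p, q, x, y, s, r]" "distinct [q, p, x, y, r, s]" using assms by auto
  show ?thesis
    using assms I[OF assms(1)] J[OF assms(1)] hexP_flip_xy[OF I[OF d(1)]] hexP_flip_rs[OF I[OF d(2)]] hexP_flip_pq[OF I[OF d(3)]]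
      hexP_flip_xy[OF J[OF d(1)]] hexP_flip_rs[OF J[OF d(2)]] hexP_flip_pq[OF J[OF d(3)]]
    by (cases \<kappa>1; cases \<kappa>2; cases \<kappa>3; simp)
qed

lemma hexP_all:
  assumes d: "distinct [p, q, x, y, r, s]" and l: "0 \<le> l1" "0 \<le> l2" "0 \<le> l3"
    and ns: "\<not> (\<kappa>1 = Neighboring \<and> \<kappa>2 = Neighboring \<and> \<kappa>3 = Neighboring \<and> l1 < l2 + l3 \<and> l2 < l1 + l3 \<and> l3 < l1 + l2)"
  shows "hexP p q x y r s \<kappa>1 l1 \<kappa>2 l2 \<kappa>3 l3"
proof -
  have d': "distinct [r, s, p, q, x, y]" "distinct [x, y, r, s, p, q]" using d by auto
  let ?N = Neighboring
  note six = six.hexP_NNN[OF six.intro]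
  consider "\<kappa>1 = ?N" "\<kappa>2 = ?N" "\<kappa>3 = ?N" "l1 + l3 \<le> l2" | "\<kappa>1 = ?N" "\<kappa>2 = ?N" "\<kappa>3 = ?N" "l3 + l2 \<le> l1"
    | "\<kappa>1 = ?N" "\<kappa>2 = ?N" "\<kappa>3 = ?N" "l2 + l1 \<le> l3"
    | "\<kappa>1 = ?N" "\<kappa>2 \<noteq> ?N" "\<kappa>3 = ?N" | "\<kappa>1 \<noteq> ?N" "\<kappa>2 = ?N" "\<kappa>3 = ?N" | "\<kappa>1 = ?N" "\<kappa>2 = ?N" "\<kappa>3 \<noteq> ?N"
    | "\<kappa>1 \<noteq> ?N" "\<kappa>2 = ?N" "\<kappa>3 \<noteq> ?N" | "\<kappa>1 = ?N" "\<kappa>2 \<noteq> ?N" "\<kappa>3 \<noteq> ?N" | "\<kappa>1 \<noteq> ?N" "\<kappa>2 \<noteq> ?N" "\<kappa>3 = ?N"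
    | "\<kappa>1 \<noteq> ?N" "\<kappa>2 \<noteq> ?N" "\<kappa>3 \<noteq> ?N" using ns by argo
  thus ?thesis
  proof cases
    case 1 thus ?thesis using six[OF d] l by simp
  next
    case 2 show ?thesis by (rule hexP_rotate) (use 2 six[OF d'(1)] l in simp)
  next
    case 3 show ?thesis by (rule hexP_rotate, rule hexP_rotate) (use 3 six[OF d'(2)] l in simp)
  next
    case 4 show ?thesis unfolding 4 by (rule hexP_NXN) (use 4 d l in simp_all)
  next
    case 5 show ?thesis by (rule hexP_rotate) (use 5 hexP_NXN[OF d'(1), of \<kappa>1 l3 l1 l2] l in simp)
  next
    case 6 show ?thesis by (rule hexP_rotate, rule hexP_rotate) (use 6 hexP_NXN[OF d'(2), of \<kappa>3 l2 l3 l1] l in simp)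
  next
    case 7 thus ?thesis using hexP_XNX[OF d, of \<kappa>1 \<kappa>3 l1 l2 l3] l by simp
  next
    case 8 show ?thesis by (rule hexP_rotate) (use 8 hexP_XNX[OF d'(1), of \<kappa>3 \<kappa>2 l3 l1 l2] l in simp)
  next
    case 9 show ?thesis by (rule hexP_rotate, rule hexP_rotate) (use 9 hexP_XNX[OF d'(2), of \<kappa>2 \<kappa>1 l2 l3 l1] l in simp)
  next
    case 10 thus ?thesis using hexP_XXX[OF d, of \<kappa>1 \<kappa>2 \<kappa>3 l1 l2 l3] l by simp
  qed
qed

section \<open>A single cross-ratio on four markings\<close>

lemma fulr_subgrp:
  assumes K: "symon M K" and M: "M = {a, b, c, d}" "distinct [a, b, c, d]"
    and f: "fulr K (v, a, b, c, d)" and G: "subgrp G" "v \<in> G"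
  shows "gen_on G M K"
proof (rule gen_on_if_pairs[where p = a and k = "nrm a K c d"])
  have s: "K b a = K a b" "K c a = K a c" "K d a = K a d" "K c b = K b c" "K d b = K b d" "K d c = K c d"
    by (rule symonD[OF K]; simp add: M)+
  have ne: "b \<noteq> a" "c \<noteq> a" "d \<noteq> a" "a \<noteq> b" "a \<noteq> c" "a \<noteq> d" using M(2) by auto
  fix u w assume uw: "{u, w} \<subseteq> M - {a}" "u \<noteq> w"
  have n: "nrm a K b d - nrm a K c d = v" "nrm a K d b - nrm a K c d = v" "nrm a K b c - nrm a K c d = v" "nrm a K c b - nrm a K c d = v"
    "nrm a K d c - nrm a K c d = 0" "nrm a K c d - nrm a K c d = 0"
    using f ne s by (simp_all add: nrm_def)
  have "u \<in> {b, c, d}" "w \<in> {b, c, d}" using uw M by auto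
  thus "nrm a K u w - nrm a K c d \<in> G"
    using uw(2) by (elim insertE emptyE; simp add: n G subgrpD[OF G(1)] del: diff_self)
next
  show "subgrp G" by (rule G)
  show "a \<in> M" unfolding M by simp
  show "\<And>u w. u \<in> M \<Longrightarrow> w \<in> M \<Longrightarrow> K u w = K w u" by (rule symonD[OF K])
qed

lemma fib_four:
  assumes M: "rmarks C = M" "vrow M C"
  shows "fib M {C} \<noteq> {}" "card (fib M {C}) = 1"
    "\<And>K v. symon M K \<Longrightarrow> fulr K (setl v C) \<Longrightarrow> v \<in> \<int> \<Longrightarrow> gen_on \<int> M K"
proof -
  obtain l a b c d where C: "C = (l, a, b, c, d)" by (cases C) auto
  have d: "distinct [a, b, c, d]" and Me: "M = {a, b, c, d}" and l: "0 \<le> l" using M unfolding C by auto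
  \<comment> \<open>After halving, the two pairs of the splitting get \<open>- l / 2\<close> and all
    other pairs zero, which makes the pair sums differ by \<open>l\<close>.\<close>
  define H where "H u w = (if {u, w} = {a, b} \<or> {u, w} = {c, d} then - l else (0 :: real))" for u w
  have s: "H u w = H w u" for u w unfolding H_def by (simp add: insert_commute)
  have v: "H a b = - l" "H c d = - l" "H a c = 0" "H b d = 0" "H a d = 0" "H b c = 0"
    using d unfolding H_def by (auto simp: doubleton_eq_iff)
  have "(l, a, b, c, d) = C" using C by simp
  define H' where "H' u w = H u w / 2" for u w
  have f: "fulr H' C" using v unfolding C H'_def by simp
  have "tm M H'"
    unfolding tm_def
  proof (intro conjI ballI impI)
    fix u w show "H' u w = H' w u" using s unfolding H'_def by simp
  next
    fix x y z t assume xyz: "x \<in> M" "y \<in> M" "z \<in> M" "t \<in> M" "distinct [x, y, z, t]"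
    have v': "H b a = - l" "H d c = - l" "H c a = 0" "H d b = 0" "H d a = 0" "H c b = 0" using v s by metis+
    show "H' x y + H' z t \<le> max (H' x z + H' y t) (H' x t + H' y z)"
      using xyz(1-4) xyz(5) l v v' unfolding H'_def Me by (elim insertE emptyE; simp)
  qed
  hence "sol M {C} H'" using f unfolding sol_def by simp
  hence ne: "quart M H' \<in> fib M {C}" unfolding fib_sol by blast
  thus "fib M {C} \<noteq> {}" by blast
  have "g = quart M H'" if g: "g \<in> fib M {C}" for g
  proof -
    obtain K where K: "tm M K" "fulr K C" "g = quart M K" using g unfolding fib_sol sol_def by auto
    show ?thesis using quart_eq_if_fulr[of M K H', OF tm_sym[OF K(1)] _ M(2) K(2) f] s K(3) M(1) unfolding H'_def by simp
  qed
  hence "fib M {C} = {quart M H'}" using ne by blast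
  thus "card (fib M {C}) = 1" by simp
  fix K and v :: real assume "symon M K" "fulr K (setl v C)" "v \<in> \<int>"
  thus "gen_on \<int> M K" using fulr_subgrp[of M K a b c d v \<int>] Me d unfolding C setl_def by (simp add: subgrp_def)
qed

section \<open>Building up a triangulation\<close>

text \<open>A triangulation built up by its triangles, with \<open>d\<close> counting the inner ones
  and \<open>k\<close> those of them contributing a factor 2. In an inner step the third side is
  already in the list, and \<open>krow \<kappa>1 l1 p q x y\<close> is appended last because
  \<open>snow\<close> expresses it through the other two rows, as a triangular transformation
  requires.\<close>

inductive tri :: "'a set \<Rightarrow> 'a row list \<Rightarrow> nat \<Rightarrow> nat \<Rightarrow> bool" where
  base: "distinct [a, b, c] \<Longrightarrow> tri {a, b, c} [] 0 0"
| outer: "tri A R d k \<Longrightarrow> x \<notin> A \<Longrightarrow> vrow (insert x A) C \<Longrightarrow> x \<in> rmarks C \<Longrightarrow> tri (insert x A) (R @ [C]) d k"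
| inner: "tri A R d k \<Longrightarrow> krow \<kappa>3 l3 p q r s \<in> set R \<Longrightarrow> distinct [p, q, x, y, r, s] \<Longrightarrow> x \<notin> A \<Longrightarrow> y \<notin> A \<Longrightarrow>
    0 \<le> l1 \<Longrightarrow> 0 \<le> l2 \<Longrightarrow>
    b \<longleftrightarrow> \<kappa>1 = Neighboring \<and> \<kappa>2 = Neighboring \<and> \<kappa>3 = Neighboring \<and> l1 < l2 + l3 \<and> l2 < l1 + l3 \<and> l3 < l1 + l2 \<Longrightarrow>
    tri (insert x (insert y A)) (R @ [krow \<kappa>2 l2 x y r s, krow \<kappa>1 l1 p q x y]) (Suc d) (if b then Suc k else k)"

fun rv :: "('a \<Rightarrow> 'a \<Rightarrow> real) \<Rightarrow> 'a row \<Rightarrow> real" where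
  "rv K (l, a, b, c, d) = qd K a b c d"

lemma rv_fulr: "fulr K (setl v C) \<Longrightarrow> rv K C = v"
  by (cases C) (auto simp: setl_def qd_def)

lemma rmarks_krow: "rmarks (krow \<kappa> l a b c d) = {a, b, c, d}"
  by (cases \<kappa>) auto

lemma vrow_mono: "vrow A C \<Longrightarrow> A \<subseteq> B \<Longrightarrow> vrow B C" by (cases C) auto

lemma vrow_rmarks: "vrow A C \<Longrightarrow> rmarks C \<subseteq> A" "vrow A C \<Longrightarrow> card (rmarks C) = 4" "vrow A C \<Longrightarrow> vrow (rmarks C) C"
  by (cases C; auto)+

lemma pos_if_gp:
  assumes gp: "gp A R" and C: "C \<in> R" "vrow A C" and s: "sol A R H"
  shows "0 < fst C"
proof (rule ccontr)
  assume n: "\<not> 0 < fst C"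
  obtain l a b c d where c: "C = (l, a, b, c, d)" by (cases C) auto
  have f: "fulr H (0, a, b, c, d)" "distinct [a, b, c, d]" "a \<in> A" "b \<in> A" "c \<in> A" "d \<in> A" using s C n unfolding c sol_def by auto
  have "resolved A H" using gp s unfolding gp_sol by simp
  hence "\<not> (H a b + H c d = H a c + H b d \<and> H a c + H b d = H a d + H b c)" using f(2-6) unfolding resolved_def by blast
  thus False using f(1) by simp
qed

text \<open>Since the length is positive, \<open>H a b + H c d\<close> is strictly the smallest pair
  sum, so equality of the two others belongs to the combinatorial type; only the value may
  change.\<close>

lemma fulr_tlike:
  assumes C: "vrow A C" "fulr H C" "0 < fst C" and t: "tlike A H K" shows "fulr K (setl (rv K C) C)"
proof -
  obtain l a b c d where c: "C = (l, a, b, c, d)" by (cases C) auto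
  have d: "{a, b, c, d} \<subseteq> A" "distinct [a, b, c, d]" "H a b + H c d < H a c + H b d" using C unfolding c by auto
  have "K a c + K b d = K a d + K b c" using tlikeD[OF t d(1,2)] d(3) by simp
  thus ?thesis unfolding c setl_def qd_def by (simp add: qd_def)
qed

text \<open>Up to a unitriangular transformation, the conditions \<open>R\<close> are the multiples by \<open>c\<close> of functionals \<open>G\<close>
  whose integrality forces that of all quartets; the product of the \<open>c i\<close> is the multiplicity.\<close>

definition frame_at where
  "frame_at A R k H (G :: nat \<Rightarrow> 'a row) c a \<longleftrightarrow> (\<Prod>i<length R. c i :: real) = 2 ^ k \<and> (\<forall>i<length R. rmarks (G i) \<subseteq> A) \<and>
     (\<forall>K. tlike A H K \<longrightarrow> (\<forall>i<length R. c i * rv K (G i) = rv K (R ! i) + (\<Sum>j<i. a i j * rv K (R ! j)))) \<and>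
     (\<forall>K. tlike A H K \<longrightarrow> (\<forall>i<length R. rv K (G i) \<in> \<int>) \<longrightarrow> gen_on \<int> A K)"

definition frame :: "'a set \<Rightarrow> 'a row list \<Rightarrow> nat \<Rightarrow> ('a \<Rightarrow> 'a \<Rightarrow> real) \<Rightarrow> bool" where
  "frame A R k H \<longleftrightarrow> (\<exists>G c a. frame_at A R k H G c a)"

lemma frame_atD:
  assumes "frame_at A R k H G c a"
  shows "(\<Prod>i<length R. c i) = 2 ^ k" "\<And>i. i < length R \<Longrightarrow> rmarks (G i) \<subseteq> A"
    "\<And>K i. tlike A H K \<Longrightarrow> i < length R \<Longrightarrow> c i * rv K (G i) = rv K (R ! i) + (\<Sum>j<i. a i j * rv K (R ! j))"
    "\<And>K. tlike A H K \<Longrightarrow> (\<And>i. i < length R \<Longrightarrow> rv K (G i) \<in> \<int>) \<Longrightarrow> gen_on \<int> A K"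
  using assms unfolding frame_at_def by simp_all

lemma frame_snoc:
  assumes f: "frame A R k H" and AB: "A \<subseteq> B"
    and G: "rmarks g \<subseteq> B" "(c :: real) = 1 \<and> k' = k \<or> c = 2 \<and> k' = Suc k"
    and e: "\<And>K. tlike B H K \<Longrightarrow> c * rv K g = rv K C + (\<Sum>j<length R. a j * rv K (R ! j))"
    and i: "\<And>K. tlike B H K \<Longrightarrow> (\<forall>i<length R. rv K (R ! i) \<in> \<int>) \<Longrightarrow> gen_on \<int> A K \<Longrightarrow> rv K g \<in> \<int> \<Longrightarrow> gen_on \<int> B K"
    and R: "\<And>K i. i < length R \<Longrightarrow> gen_on \<int> A K \<Longrightarrow> rv K (R ! i) \<in> \<int>"
  shows "frame B (R @ [C]) k' H"
proof -
  obtain G0 c0 a0 where "frame_at A R k H G0 c0 a0" using f unfolding frame_def by (elim exE)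
  note F = frame_atD[OF this]
  let ?n = "length R"
  show ?thesis unfolding frame_def frame_at_def
  proof (intro exI[of _ "G0(?n := g)"] exI[of _ "c0(?n := c)"] exI[of _ "a0(?n := a)"] conjI allI impI)
    have "(\<Prod>i<?n. (c0(?n := c)) i) = (\<Prod>i<?n. c0 i)" by (rule prod.cong) auto
    thus "(\<Prod>i<length (R @ [C]). (c0(?n := c)) i) = 2 ^ k'" using F(1) G(2) by auto
  next
    fix i assume "i < length (R @ [C])"
    hence "i = ?n \<or> i < ?n \<and> rmarks (G0 i) \<subseteq> B" using order_trans[OF F(2)[of i] AB] by auto
    thus "rmarks ((G0(?n := g)) i) \<subseteq> B" using G(1) by auto
  next
    fix K i assume t: "tlike B H K" and l: "i < length (R @ [C])"
    have "(\<Sum>j<i. (a0(?n := a)) i j * rv K ((R @ [C]) ! j)) = (\<Sum>j<i. (a0(?n := a)) i j * rv K (R ! j))"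
      by (rule sum.cong) (use l in \<open>auto simp: nth_append\<close>)
    thus "(c0(?n := c)) i * rv K ((G0(?n := g)) i) = rv K ((R @ [C]) ! i) + (\<Sum>j<i. (a0(?n := a)) i j * rv K ((R @ [C]) ! j))"
      using F(3)[OF tlike_mono[OF t AB], of i] e[OF t] l by (cases "i = ?n") (auto simp: nth_append)
  next
    fix K assume t: "tlike B H K" and l: "\<forall>i<length (R @ [C]). rv K ((G0(?n := g)) i) \<in> \<int>"
    have "rv K (G0 i) \<in> \<int>" if "i < ?n" for i using l[rule_format, of i] that by simp
    hence g: "gen_on \<int> A K" by (rule F(4)[OF tlike_mono[OF t AB]])
    show "gen_on \<int> B K" by (rule i[OF t _ g]) (use R g l[rule_format, of ?n] in auto)
  qed
qed

text \<open>The induction invariant. Count and frames are claimed in general position only, which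
  the smaller problem inherits from the larger one by \<open>gp_left\<close>; as this inheritance
  needs solutions, nonemptiness is claimed without it.\<close>

definition tri_ok :: "'a set \<Rightarrow> 'a row list \<Rightarrow> nat \<Rightarrow> nat \<Rightarrow> bool" where
  "tri_ok A R d k \<longleftrightarrow> finite A \<and> card A = length R + 3 \<and> (\<forall>C\<in>set R. vrow A C) \<and> k \<le> d \<and> fib A (set R) \<noteq> {} \<and>
     (gp A (set R) \<longrightarrow> card (fib A (set R)) = 2 ^ (d - k) \<and> (\<forall>H. sol A (set R) H \<longrightarrow> frame A R k H))"

lemma tri_ok_base:
  assumes "distinct [a, b, c]" shows "tri_ok {a, b, c} [] 0 0"
proof -
  have "tm {a, b, c} (\<lambda>_ _. 0)" unfolding tm_def by simp
  moreover have q: "quart {a, b, c} H = (\<lambda>_. 0)" for H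
  proof
    fix z show "quart {a, b, c} H z = 0"
      by (cases z) (auto simp: quart_def)
  qed
  ultimately have "fib {a, b, c} (set []) = {\<lambda>_. 0}" unfolding fib_sol sol_def by auto
  moreover have "gen_on \<int> {a, b, c} K" for K unfolding gen_on_def by auto
  hence "frame {a, b, c} [] 0 H" for H unfolding frame_def frame_at_def by simp
  ultimately show ?thesis using assms unfolding tri_ok_def by simp
qed

lemma rv_Ints:
  assumes "gen_on \<int> A K" "vrow A C" shows "rv K C \<in> \<int>"
  using assms by (cases C) (auto simp: gen_on_def)

lemma subgrp_Ints: "subgrp \<int>" by (simp add: subgrp_def)

text \<open>The four markings of the new condition meet the old ones in three, where there is no
  quartet to compare. On four markings a cross-ratio has one solution, so neither the count nor the
  multiplicity changes.\<close>

lemma tri_ok_outer: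
  assumes IH: "tri_ok A R d k" and x: "x \<notin> A" and C: "vrow (insert x A) C" "x \<in> rmarks C"
  shows "tri_ok (insert x A) (R @ [C]) d k"
proof -
  have fin: "finite A" and len: "card A = length R + 3" and v: "\<And>C. C \<in> set R \<Longrightarrow> vrow A C" and kd: "k \<le> d" and ne: "fib A (set R) \<noteq> {}"
    using IH unfolding tri_ok_def by auto
  define M where "M = rmarks C"
  have M: "M \<subseteq> insert x A" "card M = 4" "vrow M C" "x \<in> M" using vrow_rmarks[OF C(1)] C(2) unfolding M_def by auto
  have fM: "finite M" using M(2) by (simp add: card_ge_0_finite)
  have AM: "A \<inter> M = M - {x}" "A \<union> M = insert x A" using M(1,4) x by auto
  have c3: "card (A \<inter> M) = 3" using M(2,4) fM unfolding AM by simp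
  have q0: "quart (A \<inter> M) H = (\<lambda>_. 0)" for H
  proof
    fix z :: "'a \<times> 'a \<times> 'a \<times> 'a"
    obtain u1 u2 u3 u4 where z: "z = (u1, u2, u3, u4)" by (cases z) auto
    have "\<not> (distinct [u1, u2, u3, u4] \<and> {u1, u2, u3, u4} \<subseteq> A \<inter> M)"
    proof
      assume h: "distinct [u1, u2, u3, u4] \<and> {u1, u2, u3, u4} \<subseteq> A \<inter> M"
      have "card {u1, u2, u3, u4} = 4" using h by auto
      moreover have "card {u1, u2, u3, u4} \<le> card (A \<inter> M)" using h fM by (intro card_mono) auto
      ultimately show False using c3 by simp
    qed
    thus "quart (A \<inter> M) H z = 0" unfolding quart_def z by auto
  qed
  note four = fib_four[OF M_def[symmetric] M(3)]
  interpret amalgamation A M "set R" "{C}"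
    by unfold_locales (use fM c3 v M(3) q0 ne four(1) in auto)
  have U: "set R \<union> {C} = set (R @ [C])" by simp
  have vA: "vrow (insert x A) C'" if "C' \<in> set (R @ [C])" for C'
    using that vrow_mono[OF v, of C' "insert x A"] C(1) by auto
  have "card (fib (insert x A) (set (R @ [C]))) = 2 ^ (d - k) \<and> (\<forall>H. sol (insert x A) (set (R @ [C])) H \<longrightarrow> frame (insert x A) (R @ [C]) k H)"
    if gp: "gp (insert x A) (set (R @ [C]))"
  proof (intro conjI allI impI)
    have gp': "gp (A \<union> M) (set R \<union> {C})" using gp unfolding AM U .
    have IH': "card (fib A (set R)) = 2 ^ (d - k)" "\<And>H. sol A (set R) H \<Longrightarrow> frame A R k H"
      using IH gp_left[OF gp'] unfolding tri_ok_def by simp_all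
    show "card (fib (insert x A) (set (R @ [C]))) = 2 ^ (d - k)"
      using card_fib[OF gp'] IH'(1) four(2) unfolding AM U by simp
    fix H assume s: "sol (insert x A) (set (R @ [C])) H"
    have s': "sol (A \<union> M) (set R \<union> {C}) H" using s unfolding AM U .
    have fC: "fulr H C" "0 < fst C" using s pos_if_gp[OF gp _ C(1) s] unfolding sol_def by auto
    show "frame (insert x A) (R @ [C]) k H"
    proof (rule frame_snoc[where g = C and c = 1 and a = "\<lambda>_. 0"])
      show "frame A R k H" by (rule IH'(2)[OF sol_restrict(1)[OF s']])
      show "rmarks C \<subseteq> insert x A" by (rule vrow_rmarks(1)[OF C(1)])
      fix K i assume i: "i < length R" and g: "gen_on \<int> A K"
      show "rv K (R ! i) \<in> \<int>" by (rule rv_Ints[OF g v[OF nth_mem[OF i]]])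
    next
      fix K assume t: "tlike (insert x A) H K" and g: "gen_on \<int> A K" and i: "rv K C \<in> \<int>"
      have "symon M K" using tlike_sym[OF tlike_mono[OF t M(1)]] unfolding symon_def by (intro ballI)
      hence "gen_on \<int> M K" using four(3)[OF _ fulr_tlike[OF C(1) fC t] i] by simp
      thus "gen_on \<int> (insert x A) K" using rigid(2)[OF gp' s' subgrp_Ints _ g, unfolded AM, OF t] by simp
    qed auto
  qed
  thus ?thesis using fin len x kd fib_nonempty vA unfolding tri_ok_def AM U by simp
qed

text \<open>The six markings of the triangle meet the old ones in the four markings of the common
  side. Its condition \<open>c3\<close> belongs to both problems and fixes all quartets there, so
  their solutions agree on the overlap.\<close>

lemma tri_ok_inner:
  assumes IH: "tri_ok A R d k" and C3: "krow \<kappa>3 l3 p q r s \<in> set R" and D: "distinct [p, q, x, y, r, s]" and xy: "x \<notin> A" "y \<notin> A"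
    and l: "0 \<le> l1" "0 \<le> l2"
    and b: "b \<longleftrightarrow> \<kappa>1 = Neighboring \<and> \<kappa>2 = Neighboring \<and> \<kappa>3 = Neighboring \<and> l1 < l2 + l3 \<and> l2 < l1 + l3 \<and> l3 < l1 + l2"
  shows "tri_ok (insert x (insert y A)) (R @ [krow \<kappa>2 l2 x y r s, krow \<kappa>1 l1 p q x y]) (Suc d) (if b then Suc k else k)"
proof -
  have fin: "finite A" and len: "card A = length R + 3" and v: "\<And>C. C \<in> set R \<Longrightarrow> vrow A C" and kd: "k \<le> d" and fne: "fib A (set R) \<noteq> {}"
    using IH unfolding tri_ok_def by auto
  interpret six p q x y r s by (rule six.intro[OF D])
  define c1 c2 c3 where c: "c1 = krow \<kappa>1 l1 p q x y" "c2 = krow \<kappa>2 l2 x y r s" "c3 = krow \<kappa>3 l3 p q r s"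
  define A2 R2 where A2: "A2 = insert x (insert y A)" and R2: "R2 = R @ [c2, c1]"
  have v3: "vrow A c3" "c3 \<in> set R" using v C3 unfolding c by auto
  have l3: "0 \<le> l3" and Q: "{p, q, r, s} \<subseteq> A" using v3(1) unfolding c by (cases \<kappa>3; auto)+
  have vM0: "vrow M c1" "vrow M c2" "vrow M c3" unfolding c by (rule krow_valid[OF l l3])+
  have AM: "A \<inter> M = {p, q, r, s}" "A \<union> M = A2" using Q xy unfolding A2 by auto
  have U: "set R \<union> {c1, c2, c3} = set R2" using v3 unfolding R2 by auto
  have MA: "M \<subseteq> A2" using AM by blast
  have ns: "hexQ M {c1, c2, c3}" if "\<not> b" using hexP_all[OF D l l3, of \<kappa>1 \<kappa>2 \<kappa>3] that b unfolding hexP_def c by blast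
  have b': "l1 < l2 + l3" "l2 < l1 + l3" "l3 < l1 + l2"
    "{c1, c2, c3} = {krow Neighboring l1 p q x y, krow Neighboring l2 x y r s, krow Neighboring l3 p q r s}" if b
    using that b unfolding c by auto
  note sn = snow[OF b']
  have neM: "fib M {c1, c2, c3} \<noteq> {}"
  proof (cases b)
    case False thus ?thesis using conjunct1[OF ns[OF False, unfolded hexQ_def]] by simp
  next
    case True show ?thesis by (rule sn(1)[OF True True True True])
  qed
  interpret amalgamation A M "set R" "{c1, c2, c3}"
  proof
    fix H1 H2 assume s: "sol A (set R) H1" "sol M {c1, c2, c3} H2"
    have "rmarks c3 = A \<inter> M" unfolding AM c by (rule rmarks_krow)
    moreover have "quart (rmarks c3) H1 = quart (rmarks c3) H2"
    proof (rule quart_eq_if_fulr[where A = "A \<inter> M"])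
      show "vrow (A \<inter> M) c3" using vrow_rmarks(3)[OF v3(1)] calculation by simp
      show "fulr H1 c3" "fulr H2 c3" using s v3 unfolding sol_def by auto
      have "tm A H1" "tm M H2" using s unfolding sol_def by blast+
      thus "H1 a b = H1 b a" "H2 a b = H2 b a" if "a \<in> A \<inter> M" "b \<in> A \<inter> M" for a b
        using tm_sym[of A H1 a b] tm_sym[of M H2 a b] that by blast+
    qed
    ultimately show "quart (A \<inter> M) H1 = quart (A \<inter> M) H2" by simp
  next
    show "3 \<le> card (A \<inter> M)" using D unfolding AM by simp
    show "vrow M C" if "C \<in> {c1, c2, c3}" for C using that vM0 by auto
  next
    show "finite M" by simp
    show "vrow A C" if "C \<in> set R" for C by (rule v[OF that])
    show "fib A (set R) \<noteq> {}" "fib M {c1, c2, c3} \<noteq> {}" by (rule fne neM)+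
  qed
  have v2: "vrow A2 C" if "C \<in> set R2" for C
    using that vrow_mono[OF v, of C A2] vrow_mono[OF vM0(1) MA] vrow_mono[OF vM0(2) MA] unfolding R2 A2 by auto
  define k' where "k' = (if b then Suc k else k)"
  have "card (fib A2 (set R2)) = 2 ^ (Suc d - k') \<and> (\<forall>H. sol A2 (set R2) H \<longrightarrow> frame A2 R2 k' H)"
    if gp: "gp A2 (set R2)"
  proof (intro conjI allI impI)
    have gp': "gp (A \<union> M) (set R \<union> {c1, c2, c3})" using gp unfolding AM U .
    have IH': "card (fib A (set R)) = 2 ^ (d - k)" "\<And>H. sol A (set R) H \<Longrightarrow> frame A R k H"
      using IH gp_left[OF gp'] unfolding tri_ok_def by simp_all
    note gr = gp_right[OF gp']
    have cM: "card (fib M {c1, c2, c3}) = (if b then 1 else 2)" (is ?cM)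
    proof (cases b)
      case True thus ?cM using sn(2)[OF True True True True gr] by simp
    next
      case False thus ?cM using conjunct2[OF ns[OF False, unfolded hexQ_def]] gr by simp
    qed
    show "card (fib A2 (set R2)) = 2 ^ (Suc d - k')"
      using card_fib[OF gp'] IH'(1) cM kd unfolding AM U k'_def by (simp add: Suc_diff_le)
    fix H assume s: "sol A2 (set R2) H"
    have s': "sol (A \<union> M) (set R \<union> {c1, c2, c3}) H" using s unfolding AM U .
    note sM = sol_restrict(2)[OF s']
    have fu: "fulr K (setl (rv K c1) c1)" "fulr K (setl (rv K c2) c2)" "fulr K (setl (rv K c3) c3)" if t: "tlike A2 H K" for K
    proof -
      have "fulr K (setl (rv K C) C)" if "C \<in> set R2" for C
        using fulr_tlike[OF v2[OF that] _ pos_if_gp[OF gp that v2[OF that] s] t] s that unfolding sol_def by blast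
      thus "fulr K (setl (rv K c1) c1)" "fulr K (setl (rv K c2) c2)" "fulr K (setl (rv K c3) c3)" using v3 unfolding R2 by auto
    qed
    note rg = rigid(2)[OF gp' s' subgrp_Ints, unfolded AM]
    show "frame A2 R2 k' H"
    proof -
      have f0: "frame A R k H" by (rule IH'(2)[OF sol_restrict(1)[OF s']])
      obtain G0 c0 a0 where "frame_at A R k H G0 c0 a0" using f0 unfolding frame_def by (elim exE)
      note F = frame_atD[OF this]
      obtain j3 where j3: "j3 < length R" "R ! j3 = c3" using v3(2) unfolding in_set_conv_nth by blast
      let ?n = "length R"
      \<comment> \<open>In the case of a factor 2 the last functional is the edge of the cherry
        \<open>pq\<close>; the length 0 in this row is a dummy, as \<open>rv\<close> reads only the
        markings.\<close>
      define G where "G = G0(?n := c2, Suc ?n := (if b then (0, p, q, x, r) else c1))"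
      define cc where "cc = c0(?n := 1, Suc ?n := (if b then 2 else 1 :: real))"
      \<comment> \<open>By \<open>snow\<close>, twice this edge is \<open>c1 + c3 - c2\<close>; here
        \<open>c3\<close> stands at position \<open>j3\<close> of the old rows and \<open>c2\<close>
        at position \<open>?n\<close>.\<close>
      define aa where "aa = a0(?n := (\<lambda>_. 0), Suc ?n := (\<lambda>j. if b then (if j = j3 then 1 else if j = ?n then - 1 else 0) else 0 :: real))"
      have AA: "A \<subseteq> A2" unfolding A2 by blast
      have nn: "length R2 = Suc (Suc ?n)" "R2 ! ?n = c2" "R2 ! Suc ?n = c1" "\<And>i. i < ?n \<Longrightarrow> R2 ! i = R ! i"
        unfolding R2 by (simp_all add: nth_append)
      have sn3: "rv K c1 = 2 * qd K p q x r + rv K c2 - rv K c3 \<and> (rv K c2 \<in> \<int> \<longrightarrow> rv K c3 \<in> \<int> \<longrightarrow> qd K p q x r \<in> \<int> \<longrightarrow> gen_on \<int> M K)"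
        if t: "tlike A2 H K" and bb: b for K
      proof (rule sn(3)[OF bb bb bb bb gr sM tlike_mono[OF t MA]])
        show "fulr K (krow Neighboring (rv K c1) p q x y)" "fulr K (krow Neighboring (rv K c2) x y r s)"
          "fulr K (krow Neighboring (rv K c3) p q r s)" using fu[OF t] bb b unfolding c by simp_all
      qed
      show ?thesis unfolding frame_def frame_at_def
      proof (intro exI[of _ G] exI[of _ cc] exI[of _ aa] conjI allI impI)
        have "(\<Prod>i<?n. cc i) = (\<Prod>i<?n. c0 i)" by (rule prod.cong) (auto simp: cc_def)
        thus "(\<Prod>i<length R2. cc i) = 2 ^ k'" using F(1) unfolding nn k'_def by (simp add: cc_def)
      next
        fix i assume "i < length R2"
        hence "i < ?n \<or> i = ?n \<or> i = Suc ?n" unfolding nn by auto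
        moreover have "rmarks c2 \<subseteq> A2" "rmarks c1 \<subseteq> A2" "{p, q, x, r} \<subseteq> A2" using MA unfolding c rmarks_krow by auto
        ultimately show "rmarks (G i) \<subseteq> A2" using F(2)[of i] AA unfolding G_def by auto
      next
        fix K i assume t: "tlike A2 H K" and "i < length R2"
        hence "i < ?n \<or> i = ?n \<or> i = Suc ?n" unfolding nn by auto
        moreover have "cc i * rv K (G i) = rv K (R2 ! i) + (\<Sum>j<i. aa i j * rv K (R2 ! j))" if i: "i < ?n"
        proof -
          have "(\<Sum>j<i. aa i j * rv K (R2 ! j)) = (\<Sum>j<i. a0 i j * rv K (R ! j))"
            by (rule sum.cong) (use i nn(4) in \<open>auto simp: aa_def\<close>)
          thus ?thesis using F(3)[OF tlike_mono[OF t AA] i] i nn(4)[OF i] by (simp add: cc_def G_def)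
        qed
        moreover have "cc ?n * rv K (G ?n) = rv K (R2 ! ?n) + (\<Sum>j<?n. aa ?n j * rv K (R2 ! j))"
          unfolding nn(2) by (simp add: cc_def G_def aa_def)
        moreover have "cc (Suc ?n) * rv K (G (Suc ?n)) = rv K (R2 ! Suc ?n) + (\<Sum>j<Suc ?n. aa (Suc ?n) j * rv K (R2 ! j))"
        proof (cases b)
          case True
          have "(\<Sum>j<?n. aa (Suc ?n) j * rv K (R2 ! j)) = (\<Sum>j<?n. if j = j3 then rv K (R2 ! j) else 0)"
            by (rule sum.cong) (use True in \<open>auto simp: aa_def\<close>)
          also have "\<dots> = rv K c3" using j3 nn(4) by simp
          finally show ?thesis using sn3[OF t True] True j3 unfolding nn(3) by (simp add: cc_def G_def aa_def nn(2))
        qed (simp add: cc_def G_def aa_def nn(3))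
        ultimately show "cc i * rv K (G i) = rv K (R2 ! i) + (\<Sum>j<i. aa i j * rv K (R2 ! j))" by blast
      next
        fix K assume t: "tlike A2 H K" and i: "\<forall>i<length R2. rv K (G i) \<in> \<int>"
        have "rv K (G0 i) \<in> \<int>" if "i < ?n" for i using i[rule_format, of i] that unfolding nn(1) by (simp add: G_def)
        hence g: "gen_on \<int> A K" using F(4)[OF tlike_mono[OF t AA]] by blast
        have i2: "rv K c2 \<in> \<int>" using i[rule_format, of ?n] unfolding nn(1) by (simp add: G_def)
        have i3: "rv K c3 \<in> \<int>" by (rule rv_Ints[OF g v3(1)])
        have "gen_on \<int> M K"
        proof (cases b)
          case True
          have "qd K p q x r \<in> \<int>" using i[rule_format, of "Suc ?n"] True unfolding nn(1) by (simp add: G_def)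
          thus ?thesis using sn3[OF t True] i2 i3 by blast
        next
          case False
          have i1: "rv K c1 \<in> \<int>" using i[rule_format, of "Suc ?n"] False unfolding nn(1) by (simp add: G_def)
          have "\<forall>C\<in>{c1, c2, c3}. \<exists>v\<in>\<int>. fulr K (setl v C)" using fu[OF t] i1 i2 i3 by blast
          thus ?thesis
            using conjunct2[OF mp[OF conjunct2[OF ns[OF False, unfolded hexQ_def]] gr]] sM tlike_mono[OF t MA] by blast
        qed
        thus "gen_on \<int> A2 K" by (rule rg[OF t g])
      qed
    qed
  qed
  moreover have "card A2 = length R2 + 3" using fin len xy D unfolding A2 R2 by simp
  moreover have "fib A2 (set R2) \<noteq> {}" using fib_nonempty unfolding AM U .
  moreover have "finite A2" "k' \<le> Suc d" using fin kd unfolding A2 k'_def by auto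
  ultimately have "tri_ok A2 R2 (Suc d) k'" using v2 unfolding tri_ok_def by blast
  thus ?thesis unfolding A2 R2 k'_def c .
qed

theorem tri_ok: "tri A R d k \<Longrightarrow> tri_ok A R d k"
proof (induction rule: tri.induct)
  case (base a b c) thus ?case by (rule tri_ok_base)
next
  case (outer A R d k x C) thus ?case by (intro tri_ok_outer)
next
  case (inner A R d k \<kappa>3 l3 p q r s x y l1 l2 b \<kappa>1 \<kappa>2)
  show ?case by (rule tri_ok_inner[OF inner.IH inner.hyps(2-)])
qed

section \<open>Multiplicities\<close>

lemma det_Ints:
  fixes A :: "real mat" assumes A: "A \<in> carrier_mat n n" and i: "\<And>i j. i < n \<Longrightarrow> j < n \<Longrightarrow> A $$ (i, j) \<in> \<int>"
  shows "det A \<in> \<int>"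
  unfolding det_def'[OF A]
proof (intro Ints_sum Ints_mult Ints_prod)
  fix p i assume p: "p \<in> {p. p permutes {0..<n}}" and i: "i \<in> {0..<n}"
  hence "p i < n" using permutes_in_image[of p "{0..<n}" i] by simp
  thus "A $$ (i, p i) \<in> \<int>" using assms(2) i by simp
qed (simp add: sign_def)

lemma abs_eq_1_if_Ints: assumes "x \<in> \<int>" "y \<in> \<int>" "x * y = (1 :: real)" shows "\<bar>x\<bar> = 1"
proof -
  obtain a b :: int where ab: "x = of_int a" "y = of_int b" using assms(1,2) by (auto elim!: Ints_cases)
  have "real_of_int (a * b) = 1" using assms(3) unfolding ab by simp
  hence "a * b = 1" by linarith
  hence "\<bar>a\<bar> = 1" using zmult_eq_1_iff[of a b] by auto
  thus ?thesis unfolding ab by (metis of_int_1 of_int_abs)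
qed

text \<open>If integral values force integral arguments, the kernel is trivial, and applying
  \<open>int\<close> to the columns of the inverse matrix shows that it is integral too. Then two
  integers with product one are determinants.\<close>

lemma abs_det_unimodular:
  fixes g :: "nat \<Rightarrow> nat \<Rightarrow> real"
  assumes g: "\<And>i j. i < n \<Longrightarrow> j < n \<Longrightarrow> g i j \<in> \<int>"
    and int: "\<And>l. (\<And>i. i < n \<Longrightarrow> (\<Sum>j<n. g i j * l j) \<in> \<int>) \<Longrightarrow> \<forall>j<n. l j \<in> \<int>"
  shows "\<bar>det (mat n n (\<lambda>(i, j). g i j))\<bar> = 1"
proof -
  define G where "G = mat n n (\<lambda>(i, j). g i j)"
  have G: "G \<in> carrier_mat n n" unfolding G_def by simp
  have d: "det G \<noteq> 0"
  proof
    assume "det G = 0"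
    then obtain v where v: "v \<in> carrier_vec n" "v \<noteq> 0\<^sub>v n" "G *\<^sub>v v = 0\<^sub>v n"
      using det_0_iff_vec_prod_zero_field[OF G] by blast
    obtain j where j: "j < n" "v $ j \<noteq> 0" using v(1,2) by (metis eq_vecI carrier_vecD index_zero_vec(1,2))
    \<comment> \<open>A kernel vector rescaled to have the coordinate 1/2 at \<open>j\<close>, which
      contradicts integrality.\<close>
    define l where "l t = v $ t / (2 * v $ j)" for t
    have "(\<Sum>t<n. g i t * l t) = 0" if i: "i < n" for i
    proof -
      have "(\<Sum>t<n. g i t * v $ t) = (G *\<^sub>v v) $ i" using i v(1)
        by (simp add: G_def scalar_prod_def lessThan_atLeast0)
      hence "(\<Sum>t<n. g i t * v $ t) = 0" using v(3) i by simp
      moreover have "(\<Sum>t<n. g i t * l t) = (\<Sum>t<n. g i t * v $ t) / (2 * v $ j)" unfolding l_def by (simp add: sum_divide_distrib)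
      ultimately show ?thesis by simp
    qed
    hence "\<forall>t<n. l t \<in> \<int>" by (intro int) simp
    hence "(1/2 :: real) \<in> \<int>" using j unfolding l_def by (auto dest!: spec[of _ j])
    then obtain m :: int where "1 / 2 = real_of_int m" by (auto elim: Ints_cases)
    hence "real_of_int (2 * m) = 1" by simp
    hence "2 * m = 1" by linarith
    thus False by presburger
  qed
  define B where "B = mat n n (\<lambda>(j, i). adj_mat G $$ (j, i) / det G)"
  have B: "B \<in> carrier_mat n n" unfolding B_def by simp
  have aj: "adj_mat G \<in> carrier_mat n n" "G * adj_mat G = det G \<cdot>\<^sub>m 1\<^sub>m n" using adj_mat[OF G] by auto
  have s: "(\<Sum>t<n. g k t * (adj_mat G $$ (t, i) / det G)) = (if k = i then 1 else 0)" if ki: "k < n" "i < n" for k i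
  proof -
    have "(\<Sum>t<n. g k t * adj_mat G $$ (t, i)) = (G * adj_mat G) $$ (k, i)"
      using ki aj(1) by (simp add: G_def scalar_prod_def lessThan_atLeast0)
    hence e: "(\<Sum>t<n. g k t * adj_mat G $$ (t, i)) = (if k = i then det G else 0)" using ki unfolding aj(2) by simp
    have "(\<Sum>t<n. g k t * (adj_mat G $$ (t, i) / det G)) = (\<Sum>t<n. g k t * adj_mat G $$ (t, i)) / det G"
      by (simp add: sum_divide_distrib)
    thus ?thesis using e d by simp
  qed
  have "G * B = 1\<^sub>m n"
    by (rule eq_matI) (use s in \<open>simp_all add: G_def B_def scalar_prod_def lessThan_atLeast0\<close>)
  hence GB: "det G * det B = 1" using det_mult[OF G B] by simp
  have dG: "det G \<in> \<int>" by (rule det_Ints[OF G]) (simp add: G_def g)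
  have dB: "det B \<in> \<int>"
  proof (rule det_Ints[OF B])
    fix j i assume ji: "j < n" "i < n"
    have "\<forall>t<n. adj_mat G $$ (t, i) / det G \<in> \<int>"
    proof (rule int)
      fix k assume "k < n"
      thus "(\<Sum>t<n. g k t * (adj_mat G $$ (t, i) / det G)) \<in> \<int>" using s[OF _ ji(2), of k] by simp
    qed
    thus "B $$ (j, i) \<in> \<int>" using ji by (simp add: B_def)
  qed
  show ?thesis using abs_eq_1_if_Ints[OF dG dB GB] unfolding G_def .
qed

text \<open>A lower triangular matrix with unit diagonal carries the rows \<open>f\<close> to the
  rows \<open>c i * g i\<close>, so the determinants differ by the product of the
  \<open>c i\<close>.\<close>

lemma det_triangular_factor:
  fixes f g a :: "nat \<Rightarrow> nat \<Rightarrow> real"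
  assumes e: "\<And>i j. i < n \<Longrightarrow> j < n \<Longrightarrow> c i * g i j = f i j + (\<Sum>t<i. a i t * f t j)"
  shows "det (mat n n (\<lambda>(i, j). f i j)) = (\<Prod>i<n. c i) * det (mat n n (\<lambda>(i, j). g i j))"
proof -
  define U where "U = mat n n (\<lambda>(i, t). if i = t then 1 else if t < i then a i t else 0)"
  define D where "D = mat n n (\<lambda>(i, t). if i = t then c i else 0)"
  let ?F = "mat n n (\<lambda>(i, j). f i j)" let ?G = "mat n n (\<lambda>(i, j). g i j)"
  have C: "U \<in> carrier_mat n n" "D \<in> carrier_mat n n" "?F \<in> carrier_mat n n" "?G \<in> carrier_mat n n" unfolding U_def D_def by auto
  have "det U = prod_list (diag_mat U)" by (rule det_lower_triangular[OF _ C(1)]) (simp add: U_def)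
  also have "\<dots> = 1" unfolding prod_list_diag_prod by (simp add: U_def)
  finally have U: "det U = 1" .
  have "det D = prod_list (diag_mat D)" by (rule det_lower_triangular[OF _ C(2)]) (simp add: D_def)
  also have "\<dots> = (\<Prod>i<n. c i)" unfolding prod_list_diag_prod by (simp add: D_def lessThan_atLeast0)
  finally have D: "det D = (\<Prod>i<n. c i)" .
  have "U * ?F = D * ?G"
  proof (rule eq_matI)
    fix i j assume "i < dim_row (D * ?G)" "j < dim_col (D * ?G)"
    hence ij: "i < n" "j < n" by (auto simp: D_def)
    have "(U * ?F) $$ (i, j) = (\<Sum>t<n. (if i = t then 1 else if t < i then a i t else 0) * f t j)"
      using ij by (simp add: U_def scalar_prod_def lessThan_atLeast0)
    also have "\<dots> = (\<Sum>t<n. (if t = i then f t j else 0) + (if t < i then a i t * f t j else 0))"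
      by (rule sum.cong) auto
    also have "\<dots> = f i j + (\<Sum>t<n. if t < i then a i t * f t j else 0)" using ij by (simp add: sum.distrib)
    also have "(\<Sum>t<n. if t < i then a i t * f t j else 0) = (\<Sum>t<i. a i t * f t j)"
      by (rule sum.mono_neutral_cong_right) (use ij in auto)
    also have "f i j + \<dots> = (\<Sum>t<n. if t = i then c i * g t j else 0)" using e[OF ij] ij by simp
    also have "\<dots> = (\<Sum>t<n. (if i = t then c i else 0) * g t j)" by (rule sum.cong) auto
    also have "\<dots> = (D * ?G) $$ (i, j)" using ij by (simp add: D_def scalar_prod_def lessThan_atLeast0)
    finally show "(U * ?F) $$ (i, j) = (D * ?G) $$ (i, j)" .
  qed (auto simp: U_def D_def)
  hence "det U * det ?F = det D * det ?G" using det_mult[OF C(1,3)] det_mult[OF C(2,4)] by simp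
  thus ?thesis unfolding U D by simp
qed

section \<open>The multiplicity matrix of a curve\<close>

context marked_tree
begin

text \<open>The coordinate vectors of the space of edge lengths. The conditions evaluated at them
  are the entries of the multiplicity matrix, see \<open>rv_unit\<close>.\<close>

definition unit_len :: "nat set \<Rightarrow> nat set \<Rightarrow> real" where "unit_len e f = (if f = e then 1 else 0)"

lemma hd_len_unit: "hd_len \<Gamma> l a b = (\<Sum>e\<in>bounded_edges \<Gamma>. l e * hd_len \<Gamma> (unit_len e) a b)"
proof -
  have "hd_len \<Gamma> (unit_len e) a b = (if sep \<Gamma> e a b then 1 else 0) / 2" if e: "e \<in> bounded_edges \<Gamma>" for e
  proof -
    have "(\<Sum>f\<in>bounded_edges \<Gamma>. if sep \<Gamma> f a b then unit_len e f else 0) = (\<Sum>f\<in>bounded_edges \<Gamma>. if f = e then (if sep \<Gamma> e a b then 1 else 0) else 0)"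
      by (rule sum.cong) (auto simp: unit_len_def)
    thus ?thesis unfolding hd_len_def using e finite_bounded by simp
  qed
  note u = this
  have S: "(\<Sum>e\<in>bounded_edges \<Gamma>. l e * hd_len \<Gamma> (unit_len e) a b) = (\<Sum>e\<in>bounded_edges \<Gamma>. (if sep \<Gamma> e a b then l e else 0) / 2)"
  proof (rule sum.cong[OF HOL.refl])
    fix e assume "e \<in> bounded_edges \<Gamma>"
    thus "l e * hd_len \<Gamma> (unit_len e) a b = (if sep \<Gamma> e a b then l e else 0) / 2" using u[of e] by (cases "sep \<Gamma> e a b") simp_all
  qed
  show ?thesis unfolding S unfolding hd_len_def by (simp add: sum_divide_distrib)
qed

lemma rv_hd_len: "rv (hd_len \<Gamma> l) C = (\<Sum>e\<in>bounded_edges \<Gamma>. l e * rv (hd_len \<Gamma> (unit_len e)) C)"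
proof -
  obtain v a b c d where C: "C = (v, a, b, c, d)" by (cases C) auto
  show ?thesis unfolding C rv.simps qd_def
    unfolding hd_len_unit[of l a c] hd_len_unit[of l b d] hd_len_unit[of l a b] hd_len_unit[of l c d]
    by (simp add: algebra_simps sum.distrib sum_subtractf)
qed

lemma lamf_unit: "lamf \<Gamma> (unit_len e) a b c d = (if e \<in> bounded_edges \<Gamma> \<and> seps \<Gamma> e a b c d then 1 else 0)"
proof -
  have "lamf \<Gamma> (unit_len e) a b c d = (\<Sum>f\<in>{f \<in> bounded_edges \<Gamma>. seps \<Gamma> f a b c d}. if f = e then 1 else 0)"
    unfolding lamf_def unit_len_def by (rule sum.cong) auto
  thus ?thesis using finite_bounded by simp
qed

lemma rv_unit_Ints: assumes "rmarks C \<subseteq> A" shows "rv (hd_len \<Gamma> (unit_len e)) C \<in> \<int>"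
proof -
  obtain v a b c d where C: "C = (v, a, b, c, d)" by (cases C) auto
  show ?thesis using qd_hd_len[of a b c d] assms unfolding C by (simp add: lamf_unit)
qed

lemma rv_unit:
  assumes C: "vrow A C" "fulr (hdist \<Gamma>) C" "0 < fst C" and e: "e \<in> bounded_edges \<Gamma>"
  shows "rv (hd_len \<Gamma> (unit_len e)) C = (if contributes \<Gamma> e (crow C) then 1 else 0)"
proof -
  obtain l a b c d where c: "C = (l, a, b, c, d)" by (cases C) auto
  have A: "a \<in> A" "b \<in> A" "c \<in> A" "d \<in> A" "{a, b, c, d} \<subseteq> A" and l: "l > 0" using C unfolding c by auto
  have "lamf \<Gamma> (len \<Gamma>) a b c d = l" using fulr_iff_lamf[OF A(5) l] C(2) unfolding c by blast
  hence ex: "\<exists>e\<in>bounded_edges \<Gamma>. seps \<Gamma> e a b c d" using l lamf_pos_iff(2)[of "len \<Gamma>", OF len_pos] by metis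
  have "\<not> seps \<Gamma> e a c b d" using ex seps_compat[OF _ e A(1-4)] by blast
  thus ?thesis using contributes_iff[OF C(1)[unfolded c] C(2)[unfolded c] l e] qd_hd_len[OF A(5), of "unit_len e"] e
    unfolding c by (simp add: lamf_unit)
qed

text \<open>By \<open>edge_witness\<close> some quartet has no other contribution than the given
  edge.\<close>

lemma hd_len_witness:
  assumes e: "e \<in> bounded_edges \<Gamma>" and g: "gen_on G A (hd_len \<Gamma> l)" shows "l e \<in> G"
proof -
  obtain a b c d where w: "distinct [a, b, c, d]" "{a, b, c, d} \<subseteq> A" "\<forall>e'\<in>bounded_edges \<Gamma>. seps \<Gamma> e' a b c d \<longleftrightarrow> e' = e"
    by (rule edge_witness[OF e])
  have A: "a \<in> A" "b \<in> A" "c \<in> A" "d \<in> A" using w(2) by auto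
  have ex: "\<exists>e\<in>bounded_edges \<Gamma>. seps \<Gamma> e a b c d" using w(3) e by blast
  have X: "{f \<in> bounded_edges \<Gamma>. seps \<Gamma> f a b c d} = {e}" using w(3) e by blast
  have Y: "{f \<in> bounded_edges \<Gamma>. seps \<Gamma> f a c b d} = {}" using ex seps_compat[OF _ _ A] by blast
  have "qd (hd_len \<Gamma> l) a b c d = l e" unfolding qd_hd_len[OF w(2)] lamf_def X Y by simp
  moreover have "qd (hd_len \<Gamma> l) a b c d \<in> G" by (rule g[unfolded gen_on_def, rule_format, OF A w(1)])
  ultimately show ?thesis by simp
qed

text \<open>The conditions are, up to a unitriangular transformation, the functionals
  \<open>G i\<close> of the frame times \<open>c i\<close>. The matrix of the \<open>G i\<close> is
  unimodular: integral values of the \<open>G i\<close> make all quartets integral, and edge lengths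
  are quartets.\<close>

lemma abs_det_rows:
  assumes f: "frame A R k (hdist \<Gamma>)" and es: "distinct es" "set es = bounded_edges \<Gamma>" and len: "length es = length R"
  shows "\<bar>det (mat (length R) (length R) (\<lambda>(i, j). rv (hd_len \<Gamma> (unit_len (es ! j))) (R ! i)))\<bar> = 2 ^ k"
proof -
  let ?n = "length R"
  obtain G c a where "frame_at A R k (hdist \<Gamma>) G c a" using f unfolding frame_def by (elim exE)
  note F = frame_atD[OF this]
  define u where "u j = hd_len \<Gamma> (unit_len (es ! j))" for j
  have "det (mat ?n ?n (\<lambda>(i, j). rv (u j) (R ! i))) = (\<Prod>i<?n. c i) * det (mat ?n ?n (\<lambda>(i, j). rv (u j) (G i)))"
    by (rule det_triangular_factor[where a = a]) (unfold u_def, rule F(3)[OF tlike_hd_len])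
  moreover have "\<bar>det (mat ?n ?n (\<lambda>(i, j). rv (u j) (G i)))\<bar> = 1"
  proof (rule abs_det_unimodular)
    fix i j assume "i < ?n" "j < ?n" thus "rv (u j) (G i) \<in> \<int>" unfolding u_def using rv_unit_Ints[OF F(2)] by blast
  next
    fix l :: "nat \<Rightarrow> real" assume i: "\<And>i. i < ?n \<Longrightarrow> (\<Sum>j<?n. rv (u j) (G i) * l j) \<in> \<int>"
    define l' where "l' e = l (THE j. j < ?n \<and> es ! j = e)" for e
    have l': "l' (es ! j) = l j" if j: "j < ?n" for j
    proof -
      have "(THE t. t < ?n \<and> es ! t = es ! j) = j" using j es(1) len by (intro the_equality) (auto simp: nth_eq_iff_index_eq)
      thus ?thesis unfolding l'_def by simp
    qed
    have "rv (hd_len \<Gamma> l') C = (\<Sum>j<?n. rv (u j) C * l j)" for C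
    proof -
      have b: "bij_betw (\<lambda>j. es ! j) {..<?n} (bounded_edges \<Gamma>)" using bij_betw_nth[OF es(1) HOL.refl] es(2) len by simp
      have "rv (hd_len \<Gamma> l') C = (\<Sum>j<?n. l' (es ! j) * rv (u j) C)"
        unfolding rv_hd_len[of l'] u_def by (rule sum.reindex_bij_betw[OF b, symmetric])
      also have "\<dots> = (\<Sum>j<?n. rv (u j) C * l j)" by (rule sum.cong) (simp_all add: l')
      finally show ?thesis .
    qed
    hence g: "gen_on \<int> A (hd_len \<Gamma> l')" using i by (intro F(4)[OF tlike_hd_len]) simp
    show "\<forall>j<?n. l j \<in> \<int>"
    proof (intro allI impI)
      fix j assume j: "j < ?n"
      hence "es ! j \<in> bounded_edges \<Gamma>" using es(2) len nth_mem[of j es] by simp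
      hence "l' (es ! j) \<in> \<int>" by (rule hd_len_witness[OF _ g])
      thus "l j \<in> \<int>" unfolding l'[OF j] .
    qed
  qed
  ultimately show ?thesis using F(1) unfolding u_def by (simp add: abs_mult)
qed

end

text \<open>Extracts injectivity from integrality: if all conditions vanish on \<open>K\<close>,
  they vanish on every real multiple of \<open>K\<close>, so every real multiple of a quartet of
  \<open>K\<close> is an integer.\<close>

lemma frame_zero:
  assumes f: "frame A R k H" and t: "tlike A H K" and z: "\<And>C. C \<in> set R \<Longrightarrow> rv K C = 0"
  shows "gen_on {0} A K"
proof -
  obtain G c' a' where "frame_at A R k H G c' a'" using f unfolding frame_def by (elim exE)
  note F = frame_atD[OF this]
  have c: "c' i \<noteq> 0" if i: "i < length R" for i
  proof
    assume "c' i = 0"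
    hence "(\<Prod>i<length R. c' i) = 0" using i by auto
    thus False using F(1) by simp
  qed
  have g0: "rv K (G i) = 0" if "i < length R" for i
  proof -
    have "(\<Sum>j<i. a' i j * rv K (R ! j)) = 0" by (rule sum.neutral) (use z that in auto)
    hence "c' i * rv K (G i) = 0" using F(3)[OF t that] z[OF nth_mem[OF that]] by simp
    thus ?thesis using c[OF that] by simp
  qed
  have s: "gen_on \<int> A (\<lambda>a b. w * K a b)" for w
  proof (rule F(4))
    show "tlike A H (\<lambda>a b. w * K a b)" unfolding tlike_def
    proof (intro conjI ballI impI)
      fix a b assume "a \<in> A" "b \<in> A"
      thus "w * K a b = w * K b a" using tlike_sym[OF t, of a b] by simp
    next
      fix a b c d assume h: "a \<in> A" "b \<in> A" "c \<in> A" "d \<in> A" "distinct [a, b, c, d]" "H a b + H c d < H a c + H b d"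
      hence "{a, b, c, d} \<subseteq> A" by simp
      hence "K a c + K b d = K a d + K b c" using tlikeD[OF t] h(5,6) by blast
      thus "w * K a c + w * K b d = w * K a d + w * K b c" unfolding distrib_left[symmetric] by simp
    qed
    fix i assume i: "i < length R"
    have "rv (\<lambda>a b. w * K a b) C = w * rv K C" for C by (cases C) (simp add: qd_def algebra_simps)
    thus "rv (\<lambda>a b. w * K a b) (G i) \<in> \<int>" using g0[OF i] by simp
  qed
  have qs: "qd (\<lambda>a b. w * K a b) a b c d = w * qd K a b c d" for w a b c d by (simp add: qd_def algebra_simps)
  show ?thesis unfolding gen_on_def
  proof (intro ballI impI)
    fix a b c d assume A: "a \<in> A" "b \<in> A" "c \<in> A" "d \<in> A" "distinct [a, b, c, d]"
    show "qd K a b c d \<in> {0}"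
    proof (rule ccontr)
      let ?q = "qd K a b c d"
      assume "?q \<notin> {0}"
      hence n: "?q \<noteq> 0" by simp
      \<comment> \<open>The multiple for which a nonzero quartet would become 1/2.\<close>
      have "qd (\<lambda>a b. (1 / (2 * ?q)) * K a b) a b c d \<in> \<int>" by (rule s[unfolded gen_on_def, rule_format, OF A])
      hence "(1/2 :: real) \<in> \<int>" unfolding qs using n by simp
      then obtain m :: int where "1 / 2 = real_of_int m" by (auto elim: Ints_cases)
      hence "real_of_int (2 * m) = 1" by simp
      hence "2 * m = 1" by linarith
      thus False by presburger
    qed
  qed
qed

text \<open>The cross-ratios come in an arbitrary order, the frame in the order of construction;
  permuting rows changes the determinant only by a sign. The enumeration of the bounded edges is
  arbitrary in \<open>abs_det_rows\<close>.\<close>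

lemma curve_mult_eq:
  assumes ok: "tri_ok A R d k" and gp: "gp A (set R)" and trop: "tropical_curve A \<Gamma>"
    and f: "\<And>C. C \<in> set R \<Longrightarrow> fulr (hdist \<Gamma>) C" and p: "mset R' = mset R"
  shows "curve_mult (map crow R') \<Gamma> = 2 ^ k"
proof -
  have ok': "finite A" "card A = length R + 3" "\<And>C. C \<in> set R \<Longrightarrow> vrow A C" "\<And>H. sol A (set R) H \<Longrightarrow> frame A R k H"
    using ok gp unfolding tri_ok_def by blast+
  obtain \<rho> where "\<rho> \<in> A" using ok'(2) by fastforce
  then interpret marked_tree A \<Gamma> \<rho> using trop by unfold_locales
  have s: "sol A (set R) (hdist \<Gamma>)" unfolding sol_def using tm_hdist f by blast
  have "resolved A (hdist \<Gamma>)" using gp s unfolding gp_sol by blast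
  hence t: "\<forall>v\<in>inner_verts \<Gamma>. valence \<Gamma> v = 3" using resolved_iff_trivalent[OF trop] by blast
  define es where "es = (SOME es. distinct es \<and> set es = bounded_edges \<Gamma>)"
  have "\<exists>es. distinct es \<and> set es = bounded_edges \<Gamma>" using finite_distinct_list[OF finite_bounded] by blast
  hence es: "distinct es" "set es = bounded_edges \<Gamma>" unfolding es_def by (metis (mono_tags, lifting) someI_ex)+
  let ?n = "length R"
  have len: "length es = ?n" using distinct_card[OF es(1)] es(2) card_bounded_trivalent[OF t] ok'(2) by simp
  have lR: "length R' = ?n" using p by (metis size_mset)
  obtain \<sigma> where sg: "\<sigma> permutes {..<?n}" "permute_list \<sigma> R = R'" using mset_eq_permutation[OF p] .
  have sg': "\<sigma> permutes {0..<?n}" using sg(1) by (simp add: lessThan_atLeast0)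
  have R': "R' ! i = R ! (\<sigma> i)" "\<sigma> i < ?n" if "i < ?n" for i
    using permute_list_nth[OF sg(1) that] sg(2) permutes_in_image[OF sg(1), of i] that by auto
  define V where "V = mat ?n ?n (\<lambda>(i, j). rv (hd_len \<Gamma> (unit_len (es ! j))) (R ! i))"
  define N where "N = mat ?n ?n (\<lambda>(i, j). if contributes \<Gamma> (es ! j) (map crow R' ! i) then 1 else 0 :: int)"
  have V: "V \<in> carrier_mat ?n ?n" unfolding V_def by simp
  have "map_mat real_of_int N = mat ?n ?n (\<lambda>(i, j). V $$ (\<sigma> i, j))"
  proof (rule eq_matI)
    fix i j assume "i < dim_row (mat ?n ?n (\<lambda>(i, j). V $$ (\<sigma> i, j)))" "j < dim_col (mat ?n ?n (\<lambda>(i, j). V $$ (\<sigma> i, j)))"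
    hence ij: "i < ?n" "j < ?n" by auto
    have m: "R ! \<sigma> i \<in> set R" using R'(2)[OF ij(1)] by simp
    have e: "es ! j \<in> bounded_edges \<Gamma>" using es(2) len nth_mem[of j es] ij by simp
    show "map_mat real_of_int N $$ (i, j) = mat ?n ?n (\<lambda>(i, j). V $$ (\<sigma> i, j)) $$ (i, j)"
      using rv_unit[OF ok'(3)[OF m] f[OF m] pos_if_gp[OF gp m ok'(3)[OF m] s] e] ij R'[OF ij(1)] lR
      by (simp add: N_def V_def)
  qed (simp_all add: N_def)
  hence "real_of_int (det N) = signof \<sigma> * det V" using det_permute_rows[OF V sg'] of_int_hom.hom_det[of N, where 'a = real] by simp
  hence "\<bar>real_of_int (det N)\<bar> = \<bar>det V\<bar>" by (simp add: abs_mult sign_def)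
  also have "\<dots> = 2 ^ k" unfolding V_def by (rule abs_det_rows[OF ok'(4)[OF s] es len])
  finally have "real_of_int \<bar>det N\<bar> = real_of_int (2 ^ k)" by simp
  hence "\<bar>det N\<bar> = 2 ^ k" by (simp only: of_int_eq_iff)
  thus ?thesis unfolding curve_mult_def Let_def es_def[symmetric] len length_map lR N_def by simp
qed

section \<open>Triangulations of a polygon\<close>

locale triangulated =
  fixes n :: nat and T :: "(nat \<times> nat) set" and lam :: "nat \<times> nat \<Rightarrow> real" and kind :: "nat \<times> nat \<Rightarrow> interpretation_kind"
  assumes n4: "n \<ge> 4" and tr: "triangulation n T" and lam0: "\<And>e. e \<in> T \<Longrightarrow> 0 \<le> lam e"
begin

lemma nxt_less [simp]: "k < n \<Longrightarrow> nxt n k = Suc k" and nxt_n [simp]: "nxt n n = 1"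
  by (auto simp: nxt_def)

lemma T_bounds: "(a, b) \<in> T \<Longrightarrow> 1 \<le> a \<and> a + 2 \<le> b \<and> b \<le> n \<and> (a, b) \<noteq> (1, n)"
proof -
  assume "(a, b) \<in> T"
  hence d: "1 \<le> a" "a < b" "b \<le> n" "b \<noteq> nxt n a" "a \<noteq> nxt n b"
    using tr unfolding triangulation_def diagonals_def segments_def polygon_edges_def by auto
  thus ?thesis by auto
qed

lemma no_cross: "(a, b) \<in> T \<Longrightarrow> (c, d) \<in> T \<Longrightarrow> a < c \<Longrightarrow> c < b \<Longrightarrow> b < d \<Longrightarrow> False"
  using tr unfolding triangulation_def by fastforce

lemma finT: "finite T"
  using tr n4 unfolding triangulation_def by (intro card_ge_0_finite) auto

section \<open>Subpolygons of a triangulated polygon\<close>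

definition E where "E i j = {e \<in> T. i \<le> fst e \<and> snd e \<le> j}"
definition D where "D i j = E i j - {(i, j)}"

lemma fin_ED: "finite (E i j)" "finite (D i j)" using finT unfolding D_def E_def by auto

text \<open>The farthest neighbour \<open>m\<close> of \<open>i\<close> before \<open>j\<close>
  splits the subpolygon with vertices \<open>i, ..., j\<close>: a diagonal passing over
  \<open>m\<close> would either start at \<open>i\<close> and reach farther, or cross the diagonal
  from \<open>i\<close> to \<open>m\<close>.\<close>

lemma split_apex:
  assumes "i + 2 \<le> j"
  obtains m where "i < m" "m < j" "D i j = E i m \<union> E m j" "E i m \<inter> E m j = {}"
proof -
  \<comment> \<open>The vertex \<open>i + 1\<close> stands for the polygon edge starting at
    \<open>i\<close>, so that a neighbour always exists.\<close>
  define B where "B = insert (i + 1) {b. (i, b) \<in> T \<and> b < j}"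
  have fB: "finite B" unfolding B_def using finite_subset[of "{b. (i, b) \<in> T \<and> b < j}" "{..<j}"] by auto
  define m where "m = Max B"
  have mB: "m \<in> B" unfolding m_def using fB by (intro Max_in) (auto simp: B_def)
  have mx: "b \<le> m" if "b \<in> B" for b unfolding m_def using fB that by simp
  have m: "i < m" "m < j" using mB T_bounds[of i m] assms unfolding B_def by auto
  have "D i j \<subseteq> E i m \<union> E m j"
  proof
    fix e assume e: "e \<in> D i j"
    obtain a b where ab: "e = (a, b)" by (cases e)
    have h: "(a, b) \<in> T" "i \<le> a" "b \<le> j" "(a, b) \<noteq> (i, j)" using e unfolding ab D_def E_def by auto
    have "\<not> (a < m \<and> m < b)"
    proof
      assume x: "a < m \<and> m < b"
      show False
      proof (cases "a = i")
        case True
        hence "b \<in> B" using h unfolding B_def by auto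
        thus False using mx x by fastforce
      next
        case False
        hence "(i, m) \<in> T" using mB h(2) x unfolding B_def by auto
        thus False using no_cross[of i m a b] h False x by auto
      qed
    qed
    thus "e \<in> E i m \<union> E m j" using h unfolding ab E_def by auto
  qed
  moreover have "E i m \<union> E m j \<subseteq> D i j" using m unfolding D_def E_def by auto
  moreover have "E i m \<inter> E m j = {}"
  proof -
    have False if "e \<in> E i m" "e \<in> E m j" for e using that T_bounds[of "fst e" "snd e"] unfolding E_def by auto
    thus ?thesis by blast
  qed
  ultimately show ?thesis using that m by blast
qed

lemma E_Suc: "E i (Suc i) = {}"
proof -
  have False if "e \<in> E i (Suc i)" for e using that T_bounds[of "fst e" "snd e"] unfolding E_def by auto
  thus ?thesis by blast
qed

lemma E_D: "E i j = D i j \<union> ({(i, j)} \<inter> T)" unfolding D_def E_def by auto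

lemma card_E: "card (E i j) = card (D i j) + (if (i, j) \<in> T then 1 else 0)"
proof (cases "(i, j) \<in> T")
  case True
  hence "E i j = insert (i, j) (D i j)" unfolding D_def E_def by auto
  moreover have "(i, j) \<notin> D i j" unfolding D_def by simp
  ultimately show ?thesis using True fin_ED(2) by simp
next
  case False
  thus ?thesis using E_D[of i j] by simp
qed

text \<open>The subpolygon has \<open>j - i + 1\<close> sides, hence at most
  \<open>j - i - 2\<close> diagonals; \<open>E i j\<close> may in addition contain its closing side
  \<open>(i, j)\<close>.\<close>

lemma card_bounds: "i < j \<Longrightarrow> card (E i j) \<le> j - i - 1 \<and> card (D i j) \<le> j - i - 2"
proof (induction "j - i" arbitrary: i j rule: less_induct)
  case less
  show ?case
  proof (cases "j = Suc i")
    case True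
    thus ?thesis using E_Suc unfolding D_def by simp
  next
    case False
    hence ij: "i + 2 \<le> j" using less.prems by simp
    obtain m where m: "i < m" "m < j" "D i j = E i m \<union> E m j" "E i m \<inter> E m j = {}" by (rule split_apex[OF ij])
    have "card (E i m) \<le> m - i - 1" "card (E m j) \<le> j - m - 1" using less.hyps[of m i] less.hyps[of j m] m by auto
    hence "card (D i j) \<le> j - i - 2" using m(1,2) card_Un_disjoint[OF fin_ED(1) fin_ED(1) m(4)] unfolding m(3) by simp
    thus ?thesis using card_E[of i j] ij by (auto split: if_splits)
  qed
qed

text \<open>The subpolygon is completely triangulated and closed by a diagonal or a polygon edge.
  Phrased as equality in \<open>card_bounds\<close>, fullness passes to both subpolygons at the apex
  by counting alone.\<close>

definition full where "full i j \<longleftrightarrow> i < j \<and> card (E i j) = j - i - 1"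

lemma fullD: "full i j \<Longrightarrow> i < j \<and> ((i, j) \<in> T \<or> j = Suc i) \<and> card (D i j) = j - i - 2"
proof (cases "j = Suc i")
  case True
  assume "full i j"
  thus ?thesis using True E_Suc[of i] unfolding full_def D_def by simp
next
  case False
  assume f: "full i j"
  thus ?thesis using False card_bounds[of i j] card_E[of i j] unfolding full_def by (auto split: if_splits)
qed

lemma full_apex:
  assumes "i + 2 \<le> j" "card (D i j) = j - i - 2"
  obtains m where "i < m" "m < j" "D i j = E i m \<union> E m j" "full i m" "full m j"
proof -
  obtain m where m: "i < m" "m < j" "D i j = E i m \<union> E m j" "E i m \<inter> E m j = {}" using assms(1) by (rule split_apex)
  have "card (E i m) \<le> m - i - 1" "card (E m j) \<le> j - m - 1" using card_bounds m by auto
  moreover have "card (E i m) + card (E m j) = j - i - 2"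
    using assms(2) card_Un_disjoint[OF fin_ED(1) fin_ED(1) m(4)] unfolding m(3) by simp
  ultimately have "full i m" "full m j" using m(1,2) unfolding full_def by auto
  thus ?thesis by (rule that[OF m(1-3)])
qed

section \<open>Counting inner triangles of a subpolygon\<close>

definition IT where "IT i j = {(a, b, c). a < b \<and> b < c \<and> {(a, b), (b, c), (a, c)} \<subseteq> T \<and> i \<le> a \<and> c \<le> j}"

definition snowy where "snowy t \<longleftrightarrow> (\<forall>e\<in>sides t. kind e = Neighboring) \<and> triangle_ineqs lam t"

definition ST where "ST i j = {t \<in> IT i j. snowy t}"

lemma fin_IT: "finite (IT i j)" "finite (ST i j)"
proof -
  have "IT i j \<subseteq> {..n} \<times> {..n} \<times> {..n}"
  proof
    fix t assume "t \<in> IT i j"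
    moreover obtain a b c where t: "t = (a, b, c)" by (cases t)
    ultimately have "a < b" "b < c" "(a, c) \<in> T" unfolding IT_def by auto
    thus "t \<in> {..n} \<times> {..n} \<times> {..n}" using T_bounds[of a c] unfolding t by simp
  qed
  thus "finite (IT i j)" by (rule finite_subset) simp
  thus "finite (ST i j)" unfolding ST_def by simp
qed

lemma IT_split:
  assumes m: "i < m" "m < j" "D i j = E i m \<union> E m j"
  shows "IT i j = (IT i m \<union> IT m j) \<union> (if (i, m) \<in> T \<and> (m, j) \<in> T \<and> (i, j) \<in> T then {(i, m, j)} else {})"
proof (intro Set.set_eqI iffI)
  fix t assume t: "t \<in> IT i j"
  obtain a b c where abc: "t = (a, b, c)" by (cases t)
  have h: "a < b" "b < c" "(a, b) \<in> T" "(b, c) \<in> T" "(a, c) \<in> T" "i \<le> a" "c \<le> j" using t unfolding abc IT_def by auto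
  show "t \<in> (IT i m \<union> IT m j) \<union> (if (i, m) \<in> T \<and> (m, j) \<in> T \<and> (i, j) \<in> T then {(i, m, j)} else {})"
  proof (cases "a = i \<and> c = j")
    case True
    have "(i, b) \<in> D i j" "(b, j) \<in> D i j" using h True unfolding D_def E_def by auto
    hence "b = m" using m unfolding m(3) E_def by auto
    thus ?thesis using h True unfolding abc by auto
  next
    case False
    hence "(a, c) \<in> D i j" using h unfolding D_def E_def by auto
    thus ?thesis using h unfolding m(3) abc IT_def E_def by auto
  qed
next
  fix t assume "t \<in> (IT i m \<union> IT m j) \<union> (if (i, m) \<in> T \<and> (m, j) \<in> T \<and> (i, j) \<in> T then {(i, m, j)} else {})"
  thus "t \<in> IT i j" using m(1,2) unfolding IT_def by (auto split: if_splits)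
qed

lemma card_IT_split:
  assumes m: "i < m" "m < j" "D i j = E i m \<union> E m j"
  defines "b \<equiv> (i, m) \<in> T \<and> (m, j) \<in> T \<and> (i, j) \<in> T"
  shows "card (IT i j) = (if b then 1 else 0) + card (IT i m) + card (IT m j)"
    and "card (ST i j) = (if b \<and> snowy (i, m, j) then 1 else 0) + card (ST i m) + card (ST m j)"
proof -
  have d: "IT i m \<inter> IT m j = {}" "(i, m, j) \<notin> IT i m \<union> IT m j" using m(1,2) unfolding IT_def by auto
  have s: "IT i j = (if b then insert (i, m, j) (IT i m \<union> IT m j) else IT i m \<union> IT m j)"
    using IT_split[OF m] unfolding b_def by auto
  show "card (IT i j) = (if b then 1 else 0) + card (IT i m) + card (IT m j)"
    using d fin_IT(1) unfolding s by (simp add: card_Un_disjoint)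
  have s': "ST i j = (if b \<and> snowy (i, m, j) then insert (i, m, j) (ST i m \<union> ST m j) else ST i m \<union> ST m j)"
    using s unfolding ST_def by (auto split: if_splits)
  have d': "ST i m \<inter> ST m j = {}" "(i, m, j) \<notin> ST i m \<union> ST m j" using d unfolding ST_def by auto
  show "card (ST i j) = (if b \<and> snowy (i, m, j) then 1 else 0) + card (ST i m) + card (ST m j)"
    using d' fin_IT(2) unfolding s' by (simp add: card_Un_disjoint)
qed

section \<open>Building up the triangulation from its triangles\<close>

fun rw where "rw (a, b) = krow (kind (a, b)) (lam (a, b)) a (nxt n a) b (nxt n b)"

declare rw.simps [simp del]

lemma rw_valid:
  assumes "(a, b) \<in> T" "{a, nxt n a, b, nxt n b} \<subseteq> A" shows "vrow A (rw (a, b))"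
proof -
  note t = T_bounds[OF assms(1)]
  have "distinct [a, nxt n a, b, nxt n b]" using t by (cases "b = n") auto
  thus ?thesis using assms lam0[OF assms(1)] by (simp only: rw.simps) (intro vrow_krow)
qed

lemma tri_rmarks: "tri A R d k \<Longrightarrow> C \<in> set R \<Longrightarrow> rmarks C \<subseteq> A"
  using tri_ok[of A R d k] vrow_rmarks(1) unfolding tri_ok_def by blast

text \<open>Attaches the triangle \<open>i, m, j\<close> along its treated side
  \<open>(i, j)\<close>. If \<open>m = i + 1\<close> or \<open>j = m + 1\<close>, one of the
  markings \<open>m\<close>, \<open>m + 1\<close> is already present, which the intersection with
  \<open>{i + 2..<j}\<close> accounts for; border, outer and inner triangles thus add no, one or two
  conditions.\<close>

lemma step:
  assumes t: "tri A (map rw es) d k" and ij: "(i, j) \<in> T" "(i, j) \<in> set es" and m: "i < m" "m < j"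
    and f: "(i, m) \<in> T \<or> m = Suc i" "(m, j) \<in> T \<or> j = Suc m" and A: "A \<inter> {i + 2..<j} = {}"
  defines "b \<equiv> (i, m) \<in> T \<and> (m, j) \<in> T"
  shows "\<exists>es1. tri (A \<union> ({m, m + 1} \<inter> {i + 2..<j})) (map rw (es @ es1)) (d + (if b then 1 else 0)) (k + (if b \<and> snowy (i, m, j) then 1 else 0)) \<and>
    distinct es1 \<and> set es1 = {(i, m), (m, j)} \<inter> T"
proof -
  have bd: "1 \<le> i" "j \<le> n" "(i, j) \<noteq> (1, n)" using T_bounds[OF ij(1)] by auto
  have nx: "nxt n i = Suc i" "nxt n m = Suc m" using m bd by auto
  have "rw (i, j) \<in> set (map rw es)" unfolding set_map using ij(2) by (rule imageI)
  hence "rmarks (rw (i, j)) \<subseteq> A" by (rule tri_rmarks[OF t])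
  hence mk: "i \<in> A" "Suc i \<in> A" "j \<in> A" "nxt n j \<in> A" unfolding rw.simps rmarks_krow nx by auto
  consider "(i, m) \<notin> T" "(m, j) \<notin> T" | "(i, m) \<notin> T" "(m, j) \<in> T" | "(i, m) \<in> T" "(m, j) \<notin> T" | "(i, m) \<in> T" "(m, j) \<in> T" by blast
  thus ?thesis
  proof cases
    case 1
    hence "{m, m + 1} \<inter> {i + 2..<j} = {}" using f by auto
    thus ?thesis using t 1 unfolding b_def by (intro exI[of _ "[]"]) auto
  next
    case 2
    hence e: "m = Suc i" using f by auto
    have mj: "m + 2 \<le> j" using T_bounds[OF 2(2)] by auto
    have s: "A \<union> ({m, m + 1} \<inter> {i + 2..<j}) = insert (Suc m) A" using e mj by auto
    have "tri (insert (Suc m) A) (map rw es @ [rw (m, j)]) d k"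
    proof (rule tri.outer[OF t])
      show "Suc m \<notin> A" using A e mj by auto
      show "vrow (insert (Suc m) A) (rw (m, j))" by (rule rw_valid[OF 2(2)]) (use mk e nx in auto)
      show "Suc m \<in> rmarks (rw (m, j))" by (simp add: rw.simps rmarks_krow nx)
    qed
    thus ?thesis unfolding s using 2 by (intro exI[of _ "[(m, j)]"]) (auto simp: b_def)
  next
    case 3
    hence e: "j = Suc m" using f by auto
    have im: "i + 2 \<le> m" using T_bounds[OF 3(1)] by auto
    have s: "A \<union> ({m, m + 1} \<inter> {i + 2..<j}) = insert m A" using e im by auto
    have "tri (insert m A) (map rw es @ [rw (i, m)]) d k"
    proof (rule tri.outer[OF t])
      show "m \<notin> A" using A e im by auto
      show "vrow (insert m A) (rw (i, m))" by (rule rw_valid[OF 3(1)]) (use mk e nx in auto)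
      show "m \<in> rmarks (rw (i, m))" by (simp add: rw.simps rmarks_krow nx)
    qed
    thus ?thesis unfolding s using 3 by (intro exI[of _ "[(i, m)]"]) (auto simp: b_def)
  next
    case 4
    have im: "i + 2 \<le> m" and mj: "m + 2 \<le> j" using T_bounds[OF 4(1)] T_bounds[OF 4(2)] by auto
    have s: "A \<union> ({m, m + 1} \<inter> {i + 2..<j}) = insert m (insert (Suc m) A)" using im mj by auto
    have r: "rw (i, j) = krow (kind (i, j)) (lam (i, j)) i (Suc i) j (nxt n j)" "rw (i, m) = krow (kind (i, m)) (lam (i, m)) i (Suc i) m (Suc m)"
      "rw (m, j) = krow (kind (m, j)) (lam (m, j)) m (Suc m) j (nxt n j)" using nx by (simp_all add: rw.simps)
    have "tri (insert m (insert (Suc m) A)) (map rw es @ [rw (m, j), rw (i, m)]) (Suc d) (if snowy (i, m, j) then Suc k else k)"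
      unfolding r(2,3)
    proof (rule tri.inner[OF t])
      show "krow (kind (i, j)) (lam (i, j)) i (Suc i) j (nxt n j) \<in> set (map rw es)"
        unfolding set_map r(1)[symmetric] using ij(2) by (rule imageI)
      show "distinct [i, Suc i, m, Suc m, j, nxt n j]" using im mj bd by (cases "j = n") auto
      show "m \<notin> A" "Suc m \<notin> A" using A im mj by auto
      show "0 \<le> lam (i, m)" "0 \<le> lam (m, j)" using lam0 4 by auto
      show "snowy (i, m, j) \<longleftrightarrow> kind (i, m) = Neighboring \<and> kind (m, j) = Neighboring \<and> kind (i, j) = Neighboring \<and>
        lam (i, m) < lam (m, j) + lam (i, j) \<and> lam (m, j) < lam (i, m) + lam (i, j) \<and> lam (i, j) < lam (i, m) + lam (m, j)"
        unfolding snowy_def by auto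
    qed
    moreover have "(m, j) \<noteq> (i, m)" using m by auto
    ultimately show ?thesis unfolding s using 4
      by (intro exI[of _ "[(m, j), (i, m)]"]) (auto simp: b_def)
  qed
qed

lemma both:
  assumes rec: "\<And>A es d k. tri A (map rw es) d k \<Longrightarrow> (i, m) \<in> set es \<or> m = Suc i \<Longrightarrow> A \<inter> {i + 2..<m} = {} \<Longrightarrow>
      \<exists>es'. tri (A \<union> {i + 2..<m}) (map rw (es @ es')) (d + card (IT i m)) (k + card (ST i m)) \<and> distinct es' \<and> set es' = D i m"
    and rec': "\<And>A es d k. tri A (map rw es) d k \<Longrightarrow> (m, j) \<in> set es \<or> j = Suc m \<Longrightarrow> A \<inter> {m + 2..<j} = {} \<Longrightarrow>
      \<exists>es'. tri (A \<union> {m + 2..<j}) (map rw (es @ es')) (d + card (IT m j)) (k + card (ST m j)) \<and> distinct es' \<and> set es' = D m j"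
    and m: "i < m" "m < j" and f: "full i m" "full m j"
    and t: "tri A1 (map rw (es @ es1)) d1 k1" "distinct es1" "set es1 = {(i, m), (m, j)} \<inter> T"
    and A: "A1 \<inter> {i + 2..<m} = {}" "A1 \<inter> {m + 2..<j} = {}"
  shows "\<exists>es'. tri (A1 \<union> {i + 2..<m} \<union> {m + 2..<j}) (map rw (es @ es')) (d1 + card (IT i m) + card (IT m j)) (k1 + card (ST i m) + card (ST m j)) \<and>
      distinct es' \<and> set es' = E i m \<union> E m j"
proof -
  have im: "(i, m) \<in> set (es @ es1) \<or> m = Suc i" using fullD[OF f(1)] t(3) by auto
  obtain es2 where 2: "tri (A1 \<union> {i + 2..<m}) (map rw ((es @ es1) @ es2)) (d1 + card (IT i m)) (k1 + card (ST i m))" "distinct es2" "set es2 = D i m"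
    using rec[OF t(1) im A(1)] by blast
  have mj: "(m, j) \<in> set ((es @ es1) @ es2) \<or> j = Suc m" using fullD[OF f(2)] t(3) by auto
  have "(A1 \<union> {i + 2..<m}) \<inter> {m + 2..<j} = {}" using A(2) by auto
  from rec'[OF 2(1) mj this] obtain es3 where 3: "tri (A1 \<union> {i + 2..<m} \<union> {m + 2..<j}) (map rw (((es @ es1) @ es2) @ es3))
      (d1 + card (IT i m) + card (IT m j)) (k1 + card (ST i m) + card (ST m j))" "distinct es3" "set es3 = D m j" by blast
  have "set (es1 @ es2 @ es3) = E i m \<union> E m j" using t(3) 2(3) 3(3) E_D[of i m] E_D[of m j] by auto
  moreover have "distinct (es1 @ es2 @ es3)"
  proof -
    have "False" if "e \<in> D i m" "e \<in> D m j" for e using that T_bounds[of "fst e" "snd e"] unfolding D_def E_def by auto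
    hence "D i m \<inter> D m j = {}" by blast
    moreover have "({(i, m), (m, j)}) \<inter> (D i m \<union> D m j) = {}" using m unfolding D_def E_def by auto
    ultimately show ?thesis using t(2,3) 2(2,3) 3(2,3) by auto
  qed
  moreover have "map rw (((es @ es1) @ es2) @ es3) = map rw (es @ (es1 @ es2 @ es3))" by simp
  ultimately show ?thesis using 3(1) by metis
qed

text \<open>The markings strictly inside a subpolygon are new and disjoint from those of the other
  part, so the triangle at the closing side is attached first and the two subpolygons follow
  independently. The polygon edge \<open>(1, n)\<close> is excluded because it carries no condition
  to attach to; \<open>start\<close> replaces it.\<close>

lemma tri_rec:
  assumes "full i j" "(i, j) \<noteq> (1, n)" "tri A (map rw es) d k" "(i, j) \<in> set es \<or> j = Suc i" "A \<inter> {i + 2..<j} = {}"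
  shows "\<exists>es'. tri (A \<union> {i + 2..<j}) (map rw (es @ es')) (d + card (IT i j)) (k + card (ST i j)) \<and> distinct es' \<and> set es' = D i j"
  using assms
proof (induction "j - i" arbitrary: i j A es d k rule: less_induct)
  case less
  note fD = fullD[OF less.prems(1)]
  show ?case
  proof (cases "j = Suc i")
    case True
    have "IT i j = {}" "ST i j = {}" "D i j = {}" using True E_Suc[of i] unfolding ST_def IT_def D_def by auto
    thus ?thesis using less.prems(3) True by (intro exI[of _ "[]"]) auto
  next
    case False
    hence ij: "(i, j) \<in> T" "(i, j) \<in> set es" "i + 2 \<le> j" using fD less.prems(4) by auto
    obtain m where m: "i < m" "m < j" "D i j = E i m \<union> E m j" "full i m" "full m j" by (rule full_apex[OF ij(3)]) (use fD in blast)
    have jn: "j \<le> n" using T_bounds[OF ij(1)] by simp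
    have f: "(i, m) \<in> T \<or> m = Suc i" "(m, j) \<in> T \<or> j = Suc m" using fullD[OF m(4)] fullD[OF m(5)] by auto
    define b where "b \<longleftrightarrow> (i, m) \<in> T \<and> (m, j) \<in> T"
    obtain es1 where 1: "tri (A \<union> ({m, m + 1} \<inter> {i + 2..<j})) (map rw (es @ es1)) (d + (if b then 1 else 0)) (k + (if b \<and> snowy (i, m, j) then 1 else 0))"
      "distinct es1" "set es1 = {(i, m), (m, j)} \<inter> T"
      using step[OF less.prems(3) ij(1,2) m(1,2) f less.prems(5)] unfolding b_def by blast
    have r: "m - i < j - i" "j - m < j - i" "(i, m) \<noteq> (1, n)" "(m, j) \<noteq> (1, n)" using m jn T_bounds[OF ij(1)] by auto
    have A: "(A \<union> ({m, m + 1} \<inter> {i + 2..<j})) \<inter> {i + 2..<m} = {}" "(A \<union> ({m, m + 1} \<inter> {i + 2..<j})) \<inter> {m + 2..<j} = {}"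
      using less.prems(5) m by auto
    have S: "A \<union> ({m, m + 1} \<inter> {i + 2..<j}) \<union> {i + 2..<m} \<union> {m + 2..<j} = A \<union> {i + 2..<j}" using m by auto
    have "\<exists>es'. tri (A \<union> ({m, m + 1} \<inter> {i + 2..<j}) \<union> {i + 2..<m} \<union> {m + 2..<j}) (map rw (es @ es'))
      (d + (if b then 1 else 0) + card (IT i m) + card (IT m j)) (k + (if b \<and> snowy (i, m, j) then 1 else 0) + card (ST i m) + card (ST m j)) \<and>
      distinct es' \<and> set es' = E i m \<union> E m j"
      by (rule both[OF less.hyps[OF r(1) m(4) r(3)] less.hyps[OF r(2) m(5) r(4)] m(1,2,4,5) 1 A])
    thus ?thesis unfolding S using card_IT_split[OF m(1-3)] ij(1) m(3) unfolding b_def by (simp add: add.assoc)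
  qed
qed

text \<open>The triangle at the polygon edge from vertex 1 to vertex \<open>n\<close> is no inner
  one, so its conditions can be added by outer steps alone. If both other sides are diagonals, they
  share the three markings \<open>1\<close>, \<open>m\<close>, \<open>Suc m\<close>, from which the
  construction starts.\<close>

lemma start:
  assumes m: "1 < m" "m < n" and f: "(1, m) \<in> T \<or> m = 2" "(m, n) \<in> T \<or> n = Suc m"
  shows "\<exists>es1. tri {1, 2, n, m, Suc m} (map rw es1) 0 0 \<and> distinct es1 \<and> set es1 = {(1, m), (m, n)} \<inter> T"
proof -
  have nx: "nxt n 1 = 2" "nxt n m = Suc m" "nxt n n = 1" using m n4 by auto
  have r: "rmarks (rw (1, m)) = {1, 2, m, Suc m}" "rmarks (rw (m, n)) = {m, Suc m, n, 1}" unfolding rw.simps rmarks_krow nx by auto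
  consider "(1, m) \<notin> T" "(m, n) \<in> T" | "(1, m) \<in> T" "(m, n) \<notin> T" | "(1, m) \<in> T" "(m, n) \<in> T" using f n4 by fastforce
  thus ?thesis
  proof cases
    case 1
    hence e: "m = 2" using f by auto
    have "tri (insert 3 {1, 2, n}) ([] @ [rw (2, n)]) 0 0"
    proof (rule tri.outer[OF tri.base])
      show "vrow (insert 3 {1, 2, n}) (rw (2, n))" by (rule rw_valid) (use 1 e nx in auto)
    qed (use n4 r(2) e in auto)
    moreover have "insert 3 {1, 2, n} = {1, 2, n, m, Suc m}" using e by auto
    ultimately show ?thesis using 1 e by (intro exI[of _ "[(m, n)]"]) auto
  next
    case 2
    hence e: "n = Suc m" using f by auto
    have "tri (insert m {1, 2, n}) ([] @ [rw (1, m)]) 0 0"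
    proof (rule tri.outer[OF tri.base])
      show "vrow (insert m {1, 2, n}) (rw (1, m))" by (rule rw_valid) (use 2 e nx in auto)
    qed (use n4 r(1) e in auto)
    moreover have "insert m {1, 2, n} = {1, 2, n, m, Suc m}" using e by auto
    ultimately show ?thesis using 2 by (intro exI[of _ "[(1, m)]"]) auto
  next
    case 3
    have mb: "3 \<le> m" "m + 2 \<le> n" using T_bounds[OF 3(1)] T_bounds[OF 3(2)] by auto
    have "tri (insert 2 {1, m, Suc m}) ([] @ [rw (1, m)]) 0 0"
    proof (rule tri.outer[OF tri.base])
      show "vrow (insert 2 {1, m, Suc m}) (rw (1, m))" by (rule rw_valid) (use 3 nx in auto)
    qed (use mb r(1) in auto)
    hence "tri (insert n (insert 2 {1, m, Suc m})) (([] @ [rw (1, m)]) @ [rw (m, n)]) 0 0"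
    proof (rule tri.outer)
      show "vrow (insert n (insert 2 {1, m, Suc m})) (rw (m, n))" by (rule rw_valid) (use 3 nx in auto)
    qed (use mb r(2) in auto)
    moreover have "insert n (insert 2 {1, m, Suc m}) = {1, 2, n, m, Suc m}" by auto
    ultimately show ?thesis using 3 mb by (intro exI[of _ "[(1, m), (m, n)]"]) auto
  qed
qed

theorem ex_tri:
  "\<exists>es. tri {1..n} (map rw es) (card (inner_triangles n T)) (card {t \<in> inner_triangles n T. snowy t}) \<and> distinct es \<and> set es = T"
proof -
  have D: "D 1 n = T"
  proof -
    have "e \<in> D 1 n" if "e \<in> T" for e using T_bounds[of "fst e" "snd e"] that unfolding D_def E_def by auto
    thus ?thesis unfolding D_def E_def by blast
  qed
  have n1: "1 + 2 \<le> n" using n4 by simp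
  have cd: "card (D 1 n) = n - 1 - 2" using tr unfolding D triangulation_def by simp
  obtain m where m: "1 < m" "m < n" "D 1 n = E 1 m \<union> E m n" "full 1 m" "full m n" by (rule full_apex[OF n1 cd])
  have f: "(1, m) \<in> T \<or> m = 2" "(m, n) \<in> T \<or> n = Suc m" using fullD[OF m(4)] fullD[OF m(5)] by auto
  obtain es1 where 1: "tri {1, 2, n, m, Suc m} (map rw ([] @ es1)) 0 0" "distinct es1" "set es1 = {(1, m), (m, n)} \<inter> T"
    using start[OF m(1,2) f] by auto
  have r: "(1, m) \<noteq> (1, n)" "(m, n) \<noteq> (1, n)" using m by auto
  have A: "{1, 2, n, m, Suc m} \<inter> {1 + 2..<m} = {}" "{1, 2, n, m, Suc m} \<inter> {m + 2..<n} = {}" using m by auto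
  have S: "{1, 2, n, m, Suc m} \<union> {1 + 2..<m} \<union> {m + 2..<n} = {1..n}" using m n4 by auto
  have "\<exists>es'. tri ({1, 2, n, m, Suc m} \<union> {1 + 2..<m} \<union> {m + 2..<n}) (map rw ([] @ es'))
      (0 + card (IT 1 m) + card (IT m n)) (0 + card (ST 1 m) + card (ST m n)) \<and> distinct es' \<and> set es' = E 1 m \<union> E m n"
    by (rule both[OF tri_rec[OF m(4) r(1)] tri_rec[OF m(5) r(2)] m(1,2,4,5) 1 A])
  moreover have "(1, n) \<notin> T" using T_bounds[of 1 n] by auto
  moreover have I: "inner_triangles n T = IT 1 n"
  proof -
    have "T \<inter> polygon_edges n = {}" using tr unfolding triangulation_def diagonals_def by blast
    hence "inner_triangles n T = {(a, b, c). a < b \<and> b < c \<and> {(a, b), (b, c), (a, c)} \<subseteq> T}"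
      unfolding inner_triangles_def triangles_def by auto
    moreover have "1 \<le> a \<and> c \<le> n" if "(a, c) \<in> T" for a c using T_bounds[OF that] by simp
    hence "{(a, b, c). a < b \<and> b < c \<and> {(a, b), (b, c), (a, c)} \<subseteq> T} = IT 1 n" unfolding IT_def by auto
    ultimately show ?thesis by simp
  qed
  moreover have "{t \<in> inner_triangles n T. snowy t} = ST 1 n" unfolding I ST_def ..
  ultimately show ?thesis unfolding S using card_IT_split[OF m(1-3)] D m(3) by simp
qed

lemma crow_rw: "crow (rw e) = diagonal_cr n (kind e) (lam e) e"
  by (cases e; cases "kind e") (auto simp: rw.simps)

lemma rmarks_rw: "rmarks (rw e) = diagonal_marks n e"
  by (cases e) (simp add: rw.simps rmarks_krow)

text \<open>A diagonal is recovered from its markings except in the quadrilateral, whose two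
  diagonals use the same four markings; but these cross.\<close>

lemma inj_marks: "inj_on (diagonal_marks n) T"
proof (rule inj_onI)
  fix e f assume h: "e \<in> T" "f \<in> T" "diagonal_marks n e = diagonal_marks n f"
  obtain a b c d where ef: "e = (a, b)" "f = (c, d)" by (cases e; cases f)
  have t: "1 \<le> a" "a + 2 \<le> b" "b \<le> n" "1 \<le> c" "c + 2 \<le> d" "d \<le> n" "a = 1 \<Longrightarrow> b < n" "c = 1 \<Longrightarrow> d < n"
    using T_bounds[of a b] T_bounds[of c d] h unfolding ef by auto
  have q: "{a, Suc a, b, nxt n b} = {c, Suc c, d, nxt n d}" using h(3) t unfolding ef by simp
  have nb: "nxt n b = (if b = n then 1 else Suc b)" "nxt n d = (if d = n then 1 else Suc d)" using t by auto
  have m: "x = a \<or> x = Suc a \<or> x = b \<or> x = nxt n b \<longleftrightarrow> x = c \<or> x = Suc c \<or> x = d \<or> x = nxt n d" for x using q by blast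
  have no: False if "a = 2" "b = 4" "c = 1" "d = 3" using no_cross[of c d a b] h(1,2) that unfolding ef by simp
  have no': False if "c = 2" "d = 4" "a = 1" "b = 3" using no_cross[of a b c d] h(1,2) that unfolding ef by simp
  consider "b < n" "d < n" | "b = n" "d = n" | "b = n" "d < n" | "b < n" "d = n" using t by linarith
  thus "e = f"
  proof cases
    case 1
    have "c \<le> a" "a \<le> c" "b \<le> d" "d \<le> b" using m[of a] m[of c] m[of "Suc b"] m[of "Suc d"] t 1 unfolding nb by auto
    thus ?thesis unfolding ef by simp
  next
    case 2
    have "a \<noteq> 1" "c \<noteq> 1" using t 2 by auto
    hence "c \<le> a" "a \<le> c" using m[of a] m[of c] t 2 unfolding nb by auto
    thus ?thesis using 2 unfolding ef by simp
  next
    case 3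
    have a: "a \<noteq> 1" using t 3 by auto
    have c: "c = 1" using m[of 1] t 3 unfolding nb by auto
    have a2: "a = 2" using m[of 2] a c t 3 unfolding nb by auto
    have "n = Suc d" using m[of n] c t 3 unfolding nb by auto
    moreover have "d = 3" using m[of 3] a2 c t 3 calculation unfolding nb by auto
    ultimately show ?thesis using no a2 c 3 by simp
  next
    case 4
    have c: "c \<noteq> 1" using t 4 by auto
    have a: "a = 1" using m[of 1] t 4 unfolding nb by auto
    have c2: "c = 2" using m[of 2] a c t 4 unfolding nb by auto
    have "n = Suc b" using m[of n] a t 4 unfolding nb by auto
    moreover have "b = 3" using m[of 3] c2 a t 4 calculation unfolding nb by auto
    ultimately show ?thesis using no' c2 a 4 by simp
  qed
qed

end

section \<open>The fibre\<close>

lemma iso_class: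
  assumes "tropical_curve A \<Gamma>"
  shows "iso_rel A `` {\<Gamma>} = {\<Delta>. tropical_curve A \<Delta> \<and> quart A (hdist \<Delta>) = quart A (hdist \<Gamma>)}"
  using assms unfolding iso_rel_iff Image_def by auto

lemma M0_class:
  assumes "X \<in> M0_trop A" "\<Gamma> \<in> X" shows "tropical_curve A \<Gamma>" "X = iso_rel A `` {\<Gamma>}"
proof -
  obtain \<Delta> where D: "tropical_curve A \<Delta>" "X = iso_rel A `` {\<Delta>}" using assms(1) unfolding M0_trop_def by (auto elim!: quotientE)
  have G: "tropical_curve A \<Gamma>" "quart A (hdist \<Gamma>) = quart A (hdist \<Delta>)" using assms(2) unfolding D(2) iso_class[OF D(1)] by auto
  show "tropical_curve A \<Gamma>" by (rule G(1))
  show "X = iso_rel A `` {\<Gamma>}" unfolding D(2) iso_class[OF D(1)] iso_class[OF G(1)] G(2) ..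
qed

lemma M0_nonempty: assumes "X \<in> M0_trop A" obtains \<Gamma> where "\<Gamma> \<in> X"
proof -
  obtain \<Delta> where D: "tropical_curve A \<Delta>" "X = iso_rel A `` {\<Delta>}" using assms unfolding M0_trop_def by (auto elim!: quotientE)
  thus ?thesis using that[of \<Delta>] iso_class by auto
qed

lemma in_comb_type: "tropical_curve A \<Gamma> \<Longrightarrow> \<Gamma> \<in> X \<Longrightarrow> \<Gamma> \<in> comb_type A X"
  unfolding comb_type_def by (rule UN_I, assumption) (simp add: type_rel_refl)

lemma in_M0: "tropical_curve A \<Gamma> \<Longrightarrow> iso_rel A `` {\<Gamma>} \<in> M0_trop A"
  unfolding M0_trop_def by (rule quotientI) simp

lemma self_class: "tropical_curve A \<Gamma> \<Longrightarrow> \<Gamma> \<in> iso_rel A `` {\<Gamma>}"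
  using iso_class by auto

lemma hdist_tm: assumes "tropical_curve A \<Gamma>" shows "tm A (hdist \<Gamma>)"
proof -
  have "card A \<ge> 3" using assms unfolding tropical_curve_def by blast
  then obtain \<rho> where "\<rho> \<in> A" by fastforce
  then interpret marked_tree A \<Gamma> \<rho> using assms by unfold_locales
  show ?thesis by (rule tm_hdist)
qed

lemma hd_len_tlike: assumes "tropical_curve A \<Gamma>" shows "tlike A (hdist \<Gamma>) (hd_len \<Gamma> l)"
proof -
  have "card A \<ge> 3" using assms unfolding tropical_curve_def by blast
  then obtain \<rho> where "\<rho> \<in> A" by fastforce
  then interpret marked_tree A \<Gamma> \<rho> using assms by unfold_locales
  show ?thesis by (rule tlike_hd_len)
qed

lemma tlike_if_type: assumes "(\<Delta>, \<Gamma>) \<in> type_rel A" shows "tlike A (hdist \<Gamma>) (hdist \<Delta>)"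
proof -
  have G: "tropical_curve A \<Gamma>" using assms unfolding type_rel_def by blast
  obtain l where l: "\<And>a b. a \<in> A \<Longrightarrow> b \<in> A \<Longrightarrow> hdist \<Delta> a b = hd_len \<Gamma> l a b" using type_rel_lengths[OF assms] by blast
  note t = hd_len_tlike[OF G, of l]
  show ?thesis unfolding tlike_def
  proof (intro conjI ballI impI)
    fix a b assume "a \<in> A" "b \<in> A" thus "hdist \<Delta> a b = hdist \<Delta> b a" using tlike_sym[OF t, of a b] l by simp
  next
    fix a b c d assume h: "a \<in> A" "b \<in> A" "c \<in> A" "d \<in> A" "distinct [a, b, c, d]"
      "hdist \<Gamma> a b + hdist \<Gamma> c d < hdist \<Gamma> a c + hdist \<Gamma> b d"
    hence "{a, b, c, d} \<subseteq> A" by simp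
    hence "hd_len \<Gamma> l a c + hd_len \<Gamma> l b d = hd_len \<Gamma> l a d + hd_len \<Gamma> l b c" using tlikeD[OF t] h(5,6) by blast
    thus "hdist \<Delta> a c + hdist \<Delta> b d = hdist \<Delta> a d + hdist \<Delta> b c" using l h by simp
  qed
qed

text \<open>Both curves lie on the tree of \<Gamma>, so their difference is given by real edge
  lengths on this tree. All conditions vanish on it, and \<open>frame_zero\<close> makes all
  quartets vanish.\<close>

lemma quart_eq_if_rows:
  assumes f: "frame A R k (hdist \<Gamma>)" and t: "(\<Delta>, \<Gamma>) \<in> type_rel A" "(\<Delta>', \<Gamma>) \<in> type_rel A"
    and R: "\<And>C. C \<in> set R \<Longrightarrow> vrow A C" "\<And>C. C \<in> set R \<Longrightarrow> rv (hdist \<Delta>) C = rv (hdist \<Delta>') C"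
  shows "quart A (hdist \<Delta>) = quart A (hdist \<Delta>')"
proof -
  have T: "tropical_curve A \<Gamma>" "tropical_curve A \<Delta>" "tropical_curve A \<Delta>'" using t unfolding type_rel_def by auto
  obtain l where l: "\<And>a b. a \<in> A \<Longrightarrow> b \<in> A \<Longrightarrow> hdist \<Delta> a b = hd_len \<Gamma> l a b" using type_rel_lengths[OF t(1)] by blast
  obtain l' where l': "\<And>a b. a \<in> A \<Longrightarrow> b \<in> A \<Longrightarrow> hdist \<Delta>' a b = hd_len \<Gamma> l' a b" using type_rel_lengths[OF t(2)] by blast
  let ?K = "hd_len \<Gamma> (\<lambda>e. l e - l' e)"
  have "(\<Sum>e\<in>bounded_edges \<Gamma>. if sep \<Gamma> e a b then l e - l' e else 0) =
      (\<Sum>e\<in>bounded_edges \<Gamma>. (if sep \<Gamma> e a b then l e else 0) - (if sep \<Gamma> e a b then l' e else 0))" for a b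
    by (rule sum.cong) auto
  hence K: "?K a b = hdist \<Delta> a b - hdist \<Delta>' a b" if "a \<in> A" "b \<in> A" for a b
    unfolding l[OF that] l'[OF that] unfolding hd_len_def by (simp add: sum_subtractf diff_divide_distrib)
  have "gen_on {0} A ?K"
  proof (rule frame_zero[OF f hd_len_tlike[OF T(1)]])
    fix C assume C: "C \<in> set R"
    obtain v a b c d where c: "C = (v, a, b, c, d)" by (cases C) auto
    have "a \<in> A" "b \<in> A" "c \<in> A" "d \<in> A" using R(1)[OF C] unfolding c by auto
    thus "rv ?K C = 0" using R(2)[OF C] unfolding c by (simp add: qd_def K)
  qed
  hence "gen_on {0} A (\<lambda>a b. hdist \<Delta> a b - hdist \<Delta>' a b)" unfolding gen_on_def by (simp add: qd_def K)
  moreover have "quart A (hdist \<Delta>) = quart A (hdist \<Delta>') \<longleftrightarrow> gen_on {0} A (\<lambda>a b. hdist \<Delta> a b - hdist \<Delta>' a b)"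
    by (rule quart_eq_iff_gen) (rule tm_sym[OF hdist_tm[OF T(2)]] tm_sym[OF hdist_tm[OF T(3)]], assumption+)+
  ultimately show ?thesis by blast
qed

lemma rv_nonneg:
  assumes C: "vrow A C" "fulr K (setl (rv K C) C)" and t: "tm A K" shows "0 \<le> rv K C"
proof -
  obtain l a b c d where c: "C = (l, a, b, c, d)" by (cases C) auto
  have "K a b + K c d \<le> max (K a c + K b d) (K a d + K b c)" using t C(1) unfolding c tm_def by simp
  thus ?thesis using C(2) unfolding c setl_def by simp
qed

lemma crow_setl: "rmarks (setl v C) = rmarks C" by (cases C) (simp add: setl_def)

lemma vrow_setl: "vrow A C \<Longrightarrow> 0 \<le> v \<Longrightarrow> vrow A (setl v C)" by (cases C) (simp add: setl_def)

section \<open>The curves fulfilling all cross-ratios\<close>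

context
  fixes A :: "'a set" and R R' :: "'a row list" and d k :: nat and Cs :: "'a cross_ratio list"
  assumes ok: "tri_ok A R d k" and p: "mset R' = mset R" and Cs: "Cs = map crow R'" and gpos: "general_position A Cs"
begin

lemma okD: "finite A" "card A \<ge> 3" "\<And>C. C \<in> set R \<Longrightarrow> vrow A C" "k \<le> d" "fib A (set R) \<noteq> {}"
  using ok unfolding tri_ok_def by auto

lemma set_R': "set R' = set R" using p by (metis set_mset_mset)

lemma fibre_iff: assumes "tropical_curve A \<Gamma>"
  shows "iso_rel A `` {\<Gamma>} \<in> fibre A Cs \<longleftrightarrow> sol A (set R) (hdist \<Gamma>)"
  using fulfills_iff[OF assms okD(3)] in_M0[OF assms] hdist_tm[OF assms]
  unfolding fibre_def sol_def Cs by (simp add: set_R')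

text \<open>General position speaks about curves only, but every tree metric is realised by a curve
  (\<open>ex_curve_if_tm\<close>).\<close>

lemma gp: "gp A (set R)"
  unfolding gp_sol
proof (intro allI impI)
  fix H assume s: "sol A (set R) H"
  hence t: "tm A H" unfolding sol_def by blast
  obtain \<Gamma> where G: "tropical_curve A \<Gamma>" "quart A (hdist \<Gamma>) = quart A H" using ex_curve_if_tm[OF t okD(1,2)] by blast
  have "fulr (hdist \<Gamma>) C" if C: "C \<in> set R" for C
    by (rule fulr_cong_tm[OF hdist_tm[OF G(1)] t _ _ G(2) okD(3)[OF C]]) (use s C in \<open>auto simp: sol_def\<close>)
  hence "iso_rel A `` {\<Gamma>} \<in> fibre A Cs" unfolding fibre_iff[OF G(1)] sol_def using hdist_tm[OF G(1)] by blast
  hence "trivalent (iso_rel A `` {\<Gamma>})" using gpos unfolding general_position_def by blast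
  hence "\<forall>v\<in>inner_verts \<Gamma>. valence \<Gamma> v = 3" using self_class[OF G(1)] unfolding trivalent_def by blast
  hence "resolved A (hdist \<Gamma>)" using resolved_iff_trivalent[OF G(1)] by blast
  thus "resolved A H" by (rule resolved_cong_tm[OF hdist_tm[OF G(1)] t order_refl order_refl G(2)])
qed

lemma frame: "sol A (set R) H \<Longrightarrow> frame A R k H" using ok gp unfolding tri_ok_def by blast

lemma card_fibre: "card (fibre A Cs) = 2 ^ (d - k)"
proof -
  define \<psi> where "\<psi> g = {\<Delta>. tropical_curve A \<Delta> \<and> quart A (hdist \<Delta>) = g}" for g
  have ne: "\<exists>\<Gamma>. tropical_curve A \<Gamma> \<and> quart A (hdist \<Gamma>) = g \<and> sol A (set R) (hdist \<Gamma>)" if gf: "g \<in> fib A (set R)" for g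
  proof -
    obtain H where H: "sol A (set R) H" "g = quart A H" using gf unfolding fib_sol by blast
    hence t: "tm A H" unfolding sol_def by blast
    obtain \<Gamma> where G: "tropical_curve A \<Gamma>" "quart A (hdist \<Gamma>) = quart A H" using ex_curve_if_tm[OF t okD(1,2)] by blast
    have "fulr (hdist \<Gamma>) C" if C: "C \<in> set R" for C
      by (rule fulr_cong_tm[OF hdist_tm[OF G(1)] t _ _ G(2) okD(3)[OF C]]) (use H(1) C in \<open>auto simp: sol_def\<close>)
    thus ?thesis using G H(2) hdist_tm[OF G(1)] unfolding sol_def by blast
  qed
  have img: "fibre A Cs = \<psi> ` fib A (set R)"
  proof (intro Set.set_eqI iffI)
    fix X assume X: "X \<in> fibre A Cs"
    hence M: "X \<in> M0_trop A" unfolding fibre_def by blast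
    obtain \<Gamma> where G: "\<Gamma> \<in> X" using M0_nonempty[OF M] .
    note c = M0_class[OF M G]
    have "sol A (set R) (hdist \<Gamma>)" using X fibre_iff[OF c(1)] c(2) by simp
    moreover have "X = \<psi> (quart A (hdist \<Gamma>))" using c(2) unfolding iso_class[OF c(1)] \<psi>_def by simp
    ultimately show "X \<in> \<psi> ` fib A (set R)" unfolding fib_sol by blast
  next
    fix X assume "X \<in> \<psi> ` fib A (set R)"
    then obtain g where g: "g \<in> fib A (set R)" "X = \<psi> g" by blast
    obtain \<Gamma> where G: "tropical_curve A \<Gamma>" "quart A (hdist \<Gamma>) = g" "sol A (set R) (hdist \<Gamma>)" using ne[OF g(1)] by blast
    have "X = iso_rel A `` {\<Gamma>}" unfolding iso_class[OF G(1)] g(2) \<psi>_def G(2) ..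
    thus "X \<in> fibre A Cs" using fibre_iff[OF G(1)] G(3) by simp
  qed
  have inj: "inj_on \<psi> (fib A (set R))"
  proof (rule inj_onI)
    fix g g' assume h: "g \<in> fib A (set R)" "\<psi> g = \<psi> g'"
    obtain \<Gamma> where G: "tropical_curve A \<Gamma>" "quart A (hdist \<Gamma>) = g" using ne[OF h(1)] by blast
    have "\<Gamma> \<in> \<psi> g'" unfolding h(2)[symmetric] using G unfolding \<psi>_def by simp
    thus "g = g'" using G(2) unfolding \<psi>_def by simp
  qed
  have "card (fib A (set R)) = 2 ^ (d - k)" using ok gp unfolding tri_ok_def by blast
  thus ?thesis unfolding img card_image[OF inj] .
qed

lemma fibre_sol: assumes "X \<in> fibre A Cs" "\<Gamma> \<in> X"
  shows "tropical_curve A \<Gamma>" "X = iso_rel A `` {\<Gamma>}" "sol A (set R) (hdist \<Gamma>)" "X \<in> M0_trop A"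
proof -
  have M: "X \<in> M0_trop A" using assms(1) unfolding fibre_def by blast
  note c = M0_class[OF M assms(2)]
  show "tropical_curve A \<Gamma>" "X = iso_rel A `` {\<Gamma>}" "X \<in> M0_trop A" by (rule c M)+
  show "sol A (set R) (hdist \<Gamma>)" using assms(1) fibre_iff[OF c(1)] c(2) by simp
qed

lemma fibre_rep: assumes "X \<in> fibre A Cs" shows "\<exists>\<Gamma>. \<Gamma> \<in> X"
proof -
  have "X \<in> M0_trop A" using assms unfolding fibre_def by blast
  from M0_nonempty[OF this] show ?thesis by blast
qed

text \<open>Two curves of the same type in the fibre have the same values of all conditions, so
  \<open>quart_eq_if_rows\<close> applies.\<close>

lemma inj_comb_type: "inj_on (comb_type A) (fibre A Cs)"
proof (rule inj_onI)
  fix X Y assume X: "X \<in> fibre A Cs" and Y: "Y \<in> fibre A Cs" and e: "comb_type A X = comb_type A Y"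
  obtain \<Gamma> where G: "\<Gamma> \<in> X" using fibre_rep[OF X] by (elim exE)
  note x = fibre_sol[OF X G]
  have "\<Gamma> \<in> comb_type A Y" using in_comb_type[OF x(1) G] unfolding e .
  then obtain \<Delta> where D: "\<Delta> \<in> Y" "(\<Delta>, \<Gamma>) \<in> type_rel A" unfolding comb_type_def by (elim UN_E ImageE singletonE) simp
  note y = fibre_sol[OF Y D(1)]
  have "quart A (hdist \<Delta>) = quart A (hdist \<Gamma>)"
  proof (rule quart_eq_if_rows[OF frame[OF x(3)] D(2) type_rel_refl[OF x(1)] okD(3)])
    fix C assume C: "C \<in> set R"
    have "fulr (hdist \<Delta>) (setl (fst C) C)" "fulr (hdist \<Gamma>) (setl (fst C) C)" using x(3) y(3) C unfolding sol_def by simp_all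
    thus "rv (hdist \<Delta>) C = rv (hdist \<Gamma>) C" using rv_fulr by metis
  qed
  thus "X = Y" unfolding x(2) y(2) iso_class[OF x(1)] iso_class[OF y(1)] by simp
qed

lemma mult: assumes X: "X \<in> fibre A Cs" shows "tropical_multiplicity Cs X = 2 ^ k"
proof -
  obtain \<Gamma> where G: "\<Gamma> \<in> X" using fibre_rep[OF X] by (elim exE)
  have "curve_mult Cs \<Delta> = 2 ^ k" if D: "\<Delta> \<in> X" for \<Delta>
    unfolding Cs by (rule curve_mult_eq[OF ok gp fibre_sol(1)[OF X D] _ p]) (use fibre_sol(3)[OF X D] in \<open>auto simp: sol_def\<close>)
  hence "curve_mult Cs ` X = {2 ^ k}" using G by auto
  thus ?thesis unfolding tropical_multiplicity_def by simp
qed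

lemma sum_mult: "(\<Sum>X\<in>fibre A Cs. tropical_multiplicity Cs X) = 2 ^ d"
proof -
  have "(\<Sum>X\<in>fibre A Cs. tropical_multiplicity Cs X) = (\<Sum>X\<in>fibre A Cs. 2 ^ k)" by (rule sum.cong) (simp_all add: mult)
  also have "\<dots> = 2 ^ (d - k) * 2 ^ k" using card_fibre by simp
  also have "\<dots> = (2 :: int) ^ d" using okD(4) by (simp add: power_add[symmetric])
  finally show ?thesis .
qed

text \<open>The degree is defined by the count only if some maximal cone is mapped injectively. The
  cone of any curve in the fibre is one, as there a frame is available.\<close>

lemma ex_inj_cone: "\<exists>K\<in>maximal_cones A. inj_on (pi_map (rmarks ` set R)) K"
proof -
  have "fibre A Cs \<noteq> {}" using card_fibre by (metis card.empty power_not_zero zero_neq_numeral)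
  then obtain X where X: "X \<in> fibre A Cs" by blast
  obtain \<Gamma> where G: "\<Gamma> \<in> X" using fibre_rep[OF X] by (elim exE)
  note x = fibre_sol[OF X G]
  define K where "K = {Y \<in> M0_trop A. comb_type A Y = comb_type A X}"
  have "trivalent X" using gpos X unfolding general_position_def by blast
  hence "K \<in> maximal_cones A" unfolding maximal_cones_def K_def using x(4) by blast
  moreover have "inj_on (pi_map (rmarks ` set R)) K"
  proof (rule inj_onI)
    have rep: "\<exists>\<Delta>\<in>Y. (\<Delta>, \<Gamma>) \<in> type_rel A" if "Y \<in> K" for Y
    proof -
      have "\<Gamma> \<in> comb_type A X" by (rule in_comb_type[OF x(1) G])
      hence "\<Gamma> \<in> comb_type A Y" using that unfolding K_def by simp
      thus ?thesis unfolding comb_type_def by blast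
    qed
    fix Y Y' assume Y: "Y \<in> K" and Y': "Y' \<in> K" and e: "pi_map (rmarks ` set R) Y = pi_map (rmarks ` set R) Y'"
    obtain \<Delta> where D: "\<Delta> \<in> Y" "(\<Delta>, \<Gamma>) \<in> type_rel A" using rep[OF Y] by blast
    obtain \<Delta>' where D': "\<Delta>' \<in> Y'" "(\<Delta>', \<Gamma>) \<in> type_rel A" using rep[OF Y'] by blast
    have M: "Y \<in> M0_trop A" "Y' \<in> M0_trop A" using Y Y' unfolding K_def by auto
    note y = M0_class[OF M(1) D(1)] and y' = M0_class[OF M(2) D'(1)]
    have "quart A (hdist \<Delta>) = quart A (hdist \<Delta>')"
    proof (rule quart_eq_if_rows[OF frame[OF x(3)] D(2) D'(2) okD(3)])
      fix C assume C: "C \<in> set R"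
      note v = okD(3)[OF C]
      \<comment> \<open>The common image of the two curves under the forgetful map is the point of
        length \<open>w\<close> with the splitting of \<open>C\<close>: the splitting is fixed by
        the type, so equality of images becomes equality of lengths.\<close>
      define w where "w = rv (hdist \<Delta>) C"
      have fC: "fulr (hdist \<Gamma>) C" using x(3) C unfolding sol_def by blast
      have f: "fulr (hdist \<Delta>) (setl w C)"
        unfolding w_def by (rule fulr_tlike[OF v fC pos_if_gp[OF gp C v x(3)] tlike_if_type[OF D(2)]])
      have "0 \<le> w" unfolding w_def by (rule rv_nonneg[OF v f[unfolded w_def] hdist_tm[OF y(1)]])
      hence vs: "vrow A (setl w C)" by (rule vrow_setl[OF v])
      have "fulfills Y (crow (setl w C))" unfolding y(2) fulfills_iff[OF y(1) vs] by (rule f)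
      moreover have "ft_map (rmarks C) Y = ft_map (rmarks C) Y'"
        using fun_cong[OF e, of "rmarks C"] C unfolding pi_map_def by simp
      ultimately have "fulfills Y' (crow (setl w C))" unfolding fulfills_def cr_marks_crow crow_setl by simp
      hence "fulr (hdist \<Delta>') (setl w C)" unfolding y'(2) fulfills_iff[OF y'(1) vs] .
      thus "rv (hdist \<Delta>) C = rv (hdist \<Delta>') C" unfolding rv_fulr[OF f] by (simp add: rv_fulr)
    qed
    thus "Y = Y'" unfolding y(2) y'(2) iso_class[OF y(1)] iso_class[OF y'(1)] by simp
  qed
  ultimately show ?thesis by blast
qed

end

section \<open>The theorem\<close>

text \<open>The three interpretations of a diagonal are all the splittings of its four markings into
  two pairs.\<close>

lemma ex_interpretation:
  assumes d: "distinct [a, b, c, d]" "distinct [k, k', m, m']" and e: "{a, b, c, d} = {k, k', m, m'}"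
  shows "\<exists>\<kappa>. CR l a b c d = crow (krow \<kappa> l k k' m m')"
proof -
  have ex: "(\<exists>\<kappa>. P \<kappa>) \<longleftrightarrow> P Dual \<or> P Neighboring \<or> P Intersecting" for P by (metis interpretation_kind.exhaust)
  have "a \<in> {k, k', m, m'}" "b \<in> {k, k', m, m'}" "c \<in> {k, k', m, m'}" "d \<in> {k, k', m, m'}" using e by blast+
  thus ?thesis unfolding ex using d by (elim insertE emptyE; simp add: CR_def doubleton_eq_iff)
qed

text \<open>The degree quantifies over all cross-ratios with the given sets of markings. By
  \<open>inj_marks\<close> each of them belongs to one diagonal and by
  \<open>ex_interpretation\<close> it is one of its interpretations, so the count for a
  triangulation applies to all of them.\<close>

lemma ex_lengths:
  assumes T: "triangulated n T lam" and u: "uses_markings {1..n} (diagonal_marks n ` T) Cs"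
  obtains lam' kind' ds where "\<And>e. e \<in> T \<Longrightarrow> 0 \<le> lam' e" "distinct ds" "set ds = T"
    "Cs = map (\<lambda>e. diagonal_cr n (kind' e) (lam' e) e) ds"
proof -
  interpret triangulated n T lam "\<lambda>_. Dual" by (rule T)
  have U: "\<And>C. C \<in> set Cs \<Longrightarrow> is_cross_ratio {1..n} C" "distinct (map cr_marks Cs)" "cr_marks ` set Cs = diagonal_marks n ` T"
    using u unfolding uses_markings_def by auto
  have "\<forall>C\<in>set Cs. \<exists>e. e \<in> T \<and> diagonal_marks n e = cr_marks C"
  proof
    fix C assume "C \<in> set Cs"
    hence "cr_marks C \<in> diagonal_marks n ` T" unfolding U(3)[symmetric] by (rule imageI)
    thus "\<exists>e. e \<in> T \<and> diagonal_marks n e = cr_marks C" by (elim imageE) (intro exI conjI, assumption, simp)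
  qed
  from bchoice[OF this] obtain f where f': "\<forall>C\<in>set Cs. f C \<in> T \<and> diagonal_marks n (f C) = cr_marks C" by (elim exE)
  hence f: "f C \<in> T \<and> diagonal_marks n (f C) = cr_marks C" if "C \<in> set Cs" for C using that by simp
  define ds where "ds = map f Cs"
  have "map (diagonal_marks n) ds = map cr_marks Cs" unfolding ds_def using f by simp
  hence dd: "distinct ds" using U(2) distinct_map by metis
  hence inj: "inj_on f (set Cs)" unfolding ds_def distinct_map by blast
  have sd: "set ds = T"
  proof
    show "set ds \<subseteq> T" unfolding ds_def using f by auto
    show "T \<subseteq> set ds"
    proof
      fix e assume e: "e \<in> T"
      then obtain C where C: "C \<in> set Cs" "cr_marks C = diagonal_marks n e" using U(3) by (metis image_iff)
      hence "f C = e" using f[OF C(1)] inj_onD[OF inj_marks _ _ e, of "f C"] by simp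
      thus "e \<in> set ds" using C(1) unfolding ds_def by auto
    qed
  qed
  have "\<exists>\<kappa> x. 0 \<le> x \<and> C = diagonal_cr n \<kappa> x (f C)" if C: "C \<in> set Cs" for C
  proof -
    obtain l a b c d where c: "C = CR l a b c d" "0 \<le> l" "distinct [a, b, c, d]" using U(1)[OF C] unfolding is_cross_ratio_def by blast
    obtain k m where km: "f C = (k, m)" by (cases "f C")
    have "cr_marks C = {a, b, c, d}" using cr_marks_crow[of "(l, a, b, c, d)"] unfolding c(1) by simp
    moreover have "(k, m) \<in> T" "diagonal_marks n (k, m) = cr_marks C" using f[OF C] unfolding km by blast+
    ultimately have fC: "(k, m) \<in> T" "{k, nxt n k, m, nxt n m} = {a, b, c, d}" by simp_all
    have "vrow {a, b, c, d} (rw (k, m))" by (rule rw_valid[OF fC(1)]) (simp add: fC(2))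
    hence "distinct [k, nxt n k, m, nxt n m]" unfolding rw.simps by auto
    from ex_interpretation[OF c(3) this fC(2)[symmetric], of l]
    obtain \<kappa> where "C = crow (krow \<kappa> l k (nxt n k) m (nxt n m))" unfolding c(1) by (elim exE)
    moreover have "crow (krow \<kappa> l k (nxt n k) m (nxt n m)) = diagonal_cr n \<kappa> l (k, m)" by (cases \<kappa>) auto
    ultimately show ?thesis using c(2) unfolding km by metis
  qed
  hence "\<forall>C\<in>set Cs. \<exists>y. 0 \<le> snd y \<and> C = diagonal_cr n (fst y) (snd y) (f C)" by simp
  from bchoice[OF this] obtain y where y': "\<forall>C\<in>set Cs. 0 \<le> snd (y C) \<and> C = diagonal_cr n (fst (y C)) (snd (y C)) (f C)" by (elim exE)
  hence y: "0 \<le> snd (y C)" "diagonal_cr n (fst (y C)) (snd (y C)) (f C) = C" if "C \<in> set Cs" for C using that by auto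
  define g where "g = inv_into (set Cs) f"
  have g: "g (f C) = C" if "C \<in> set Cs" for C unfolding g_def using inv_into_f_f[OF inj that] .
  show ?thesis
  proof (rule that[of "\<lambda>e. snd (y (g e))" ds "\<lambda>e. fst (y (g e))"])
    show "0 \<le> snd (y (g e))" if e: "e \<in> T" for e
    proof -
      obtain C where "C \<in> set Cs" "e = f C" using e sd unfolding ds_def by auto
      thus ?thesis using y g by simp
    qed
    have "map (\<lambda>e. diagonal_cr n (fst (y (g e))) (snd (y (g e))) e) ds = map (\<lambda>C. C) Cs"
      unfolding ds_def map_map by (rule map_cong[OF HOL.refl]) (use y g in simp)
    thus "Cs = map (\<lambda>e. diagonal_cr n (fst (y (g e))) (snd (y (g e))) e) ds" by simp
  qed (rule dd sd)+
qed

lemma (in triangulated) ex_rows: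
  assumes "distinct ds" "set ds = T"
  obtains R R' where "tri_ok {1..n} R (card (inner_triangles n T)) (card {t \<in> inner_triangles n T. snowy t})" "mset R' = mset R"
    "map (\<lambda>e. diagonal_cr n (kind e) (lam e) e) ds = map crow R'" "rmarks ` set R = diagonal_marks n ` T"
proof -
  obtain es where es: "tri {1..n} (map rw es) (card (inner_triangles n T)) (card {t \<in> inner_triangles n T. snowy t})" "distinct es" "set es = T"
    using ex_tri by blast
  show ?thesis
  proof (rule that[OF tri_ok[OF es(1)]])
    show "mset (map rw ds) = mset (map rw es)" using set_eq_iff_mset_eq_distinct[OF assms(1) es(2)] assms(2) es(3) by simp
    show "map (\<lambda>e. diagonal_cr n (kind e) (lam e) e) ds = map crow (map rw ds)" by (simp add: crow_rw)
    show "rmarks ` set (map rw es) = diagonal_marks n ` T" using es(3) by (simp add: image_image rmarks_rw)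
  qed
qed

lemma (in triangulated) sum_degree:
  assumes "distinct ds" "set ds = T" "general_position {1..n} (map (\<lambda>e. diagonal_cr n (kind e) (lam e) e) ds)"
  shows "(\<Sum>X\<in>fibre {1..n} (map (\<lambda>e. diagonal_cr n (kind e) (lam e) e) ds).
    tropical_multiplicity (map (\<lambda>e. diagonal_cr n (kind e) (lam e) e) ds) X) = 2 ^ card (inner_triangles n T)"
proof -
  obtain R R' where R: "tri_ok {1..n} R (card (inner_triangles n T)) (card {t \<in> inner_triangles n T. snowy t})" "mset R' = mset R"
    "map (\<lambda>e. diagonal_cr n (kind e) (lam e) e) ds = map crow R'" "rmarks ` set R = diagonal_marks n ` T"
    by (rule ex_rows[OF assms(1,2)])
  show ?thesis by (rule sum_mult[OF R(1-3) assms(3)])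
qed

theorem theorem1p1:
  fixes n d k :: nat
    and T :: "(nat \<times> nat) set"
    and lam :: "nat \<times> nat \<Rightarrow> real"
    and kind :: "nat \<times> nat \<Rightarrow> interpretation_kind"
    and ds :: "(nat \<times> nat) list"
    and Cs :: "nat cross_ratio list"
  assumes "n \<ge> 4"
    and "triangulation n T"
    and "\<forall>e\<in>T. lam e \<ge> 0"
    and "distinct ds" and "set ds = T"
    and "Cs = map (\<lambda>e. diagonal_cr n (kind e) (lam e) e) ds"
    and "general_position {1..n} Cs"
    and "d = card (inner_triangles n T)"
    and "k = card {t \<in> inner_triangles n T.
               (\<forall>e\<in>sides t. kind e = Neighboring) \<and> triangle_ineqs lam t}"
  shows "card (fibre {1..n} Cs) = 2 ^ (d - k)
    \<and> inj_on (comb_type {1..n}) (fibre {1..n} Cs)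
    \<and> (\<forall>X\<in>fibre {1..n} Cs. tropical_multiplicity Cs X = 2 ^ k)
    \<and> tropical_degree {1..n} (diagonal_marks n ` T) = 2 ^ d"
proof -
  let ?A = "{1..n}" let ?U = "diagonal_marks n ` T"
  have tri: "triangulated n T lam'" if "\<And>e. e \<in> T \<Longrightarrow> 0 \<le> lam' e" for lam'
    using assms(1,2) that by unfold_locales
  interpret triangulated n T lam kind using assms(3) by (intro tri) simp
  obtain R R' where R0: "tri_ok ?A R (card (inner_triangles n T)) (card {t \<in> inner_triangles n T. snowy t})" "mset R' = mset R"
    "map (\<lambda>e. diagonal_cr n (kind e) (lam e) e) ds = map crow R'" "rmarks ` set R = ?U"
    by (rule ex_rows[OF assms(4,5)])
  have R: "tri_ok ?A R d (card {t \<in> inner_triangles n T. snowy t})" "mset R' = mset R" "Cs = map crow R'" "rmarks ` set R = ?U"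
    unfolding assms(6,8) by (rule R0)+
  have k: "k = card {t \<in> inner_triangles n T. snowy t}" unfolding assms(9) snowy_def ..
  note main = card_fibre[OF R(1-3) assms(7)] inj_comb_type[OF R(1-3) assms(7)] mult[OF R(1-3) assms(7)]
    sum_mult[OF R(1-3) assms(7)] ex_inj_cone[OF R(1-3) assms(7)]
  have uses: "uses_markings ?A ?U Cs"
  proof -
    have "is_cross_ratio ?A C" if "C \<in> set Cs" for C
    proof -
      have "C \<in> crow ` set R'" using that unfolding R(3) by simp
      then obtain C' where C': "C = crow C'" "C' \<in> set R'" by (elim imageE)
      hence "C' \<in> set R" using arg_cong[OF R(2), of set_mset] by simp
      moreover have "\<forall>C\<in>set R. vrow ?A C" using R(1) unfolding tri_ok_def by (elim conjE)
      ultimately have v: "vrow ?A C'" by simp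
      obtain l a b c e where cc: "C' = (l, a, b, c, e)" by (cases C') auto
      have v': "distinct [a, b, c, e] \<and> {a, b, c, e} \<subseteq> ?A \<and> 0 \<le> l" using v unfolding cc vrow.simps .
      have e0: "C = CR l a b c e" unfolding C'(1) cc by simp
      have d1: "distinct [a, b, c, e]" using v' by (elim conjE)
      have d2: "{a, b, c, e} \<subseteq> ?A" using v' by (elim conjE)
      have d3: "l \<ge> 0" using v' by (elim conjE)
      show ?thesis unfolding is_cross_ratio_def
        by (rule exI[of _ l], rule exI[of _ a], rule exI[of _ b], rule exI[of _ c], rule exI[of _ e]) (intro conjI e0 d3 d1 d2)
    qed
    moreover have "map cr_marks Cs = map (diagonal_marks n) ds"
      unfolding assms(6) by (simp add: crow_rw[symmetric] rmarks_rw)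
    ultimately show ?thesis using inj_marks assms(4,5) unfolding uses_markings_def by (simp add: distinct_map)
  qed
  have "(THE D. \<forall>Cs. uses_markings ?A ?U Cs \<and> general_position ?A Cs \<longrightarrow>
             (\<Sum>X\<in>fibre ?A Cs. tropical_multiplicity Cs X) = D) = 2 ^ d"
  proof (rule the_equality)
    show "\<forall>Cs. uses_markings ?A ?U Cs \<and> general_position ?A Cs \<longrightarrow> (\<Sum>X\<in>fibre ?A Cs. tropical_multiplicity Cs X) = 2 ^ d"
    proof (intro allI impI)
      fix Cs' assume u: "uses_markings ?A ?U Cs' \<and> general_position ?A Cs'"
      show "(\<Sum>X\<in>fibre ?A Cs'. tropical_multiplicity Cs' X) = 2 ^ d"
      proof (rule ex_lengths[OF triangulated_axioms conjunct1[OF u]])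
        fix lam' kind' ds'
        assume c: "\<And>e. e \<in> T \<Longrightarrow> 0 \<le> lam' e" "distinct ds'" "set ds' = T" "Cs' = map (\<lambda>e. diagonal_cr n (kind' e) (lam' e) e) ds'"
        show "(\<Sum>X\<in>fibre ?A Cs'. tropical_multiplicity Cs' X) = 2 ^ d"
          unfolding c(4) assms(8) by (rule triangulated.sum_degree[OF tri[OF c(1)] c(2,3) conjunct2[OF u, unfolded c(4)]])
      qed
    qed
    fix w assume h: "\<forall>Cs. uses_markings ?A ?U Cs \<and> general_position ?A Cs \<longrightarrow> (\<Sum>X\<in>fibre ?A Cs. tropical_multiplicity Cs X) = w"
    show "w = 2 ^ d" using h[rule_format, OF conjI[OF uses assms(7)]] main(4) by simp
  qed
  hence "tropical_degree ?A ?U = 2 ^ d" using main(5) unfolding tropical_degree_def R(4) by simp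
  thus ?thesis using main(1-3) unfolding k by blast
qed

end
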